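(* (Existence of pairings.) Every cubic-homogeneous map can be paired to a cubic-linear map, and vice versa every cubic-linear map $F(X)=X-(AX)^{*3}$ (with $A$ singular) can be paired to a cubic-homogeneous map. (Transfer of properties.) Moreover, if $f$ (cubic-homogeneous) and $F$ (cubic-linear) are paired, each of the following properties for one of the two mappings implies the same property for the other, for a given $\lambda\in\mathbb{C}\setminus\{0\}$, $|\lambda|\neq1$: 1. one-to-one; 2. onto; 3. invertible with polynomial inverse; 4. constant Jacobian determinant; 5. existence of a global pre-conjugation; 6. the global pre-conjugation is onto; 7. the global pre-conjugation is one-to-one; 8. the global pre-conjugation is a polynomial map; 9. the conjugation has a polynomial inverse. The existence of global pre-conjugations is guaranteed when $|\lambda|>1$, and also when $f$ and $F$ are invertible.
   Context: For $x,y\in\mathbb{C}^m$, $x*y$ denotes the componentwise product, and $x^{*3}=x*x*x$. $I_m$ is the identity map (or matrix) of $\mathbb{C}^m$. A map $f\colon\mathbb{C}^n\to\mathbb{C}^n$ is cubic-homogeneous if there is a symmetric trilinear $g\colon\mathbb{C}^n\times\mathbb{C}^n\times\mathbb{C}^n\to\mathbb{C}^n$ with $f(x)=x-g(x,x,x)$ for all $x$. A map $F\colon\mathbb{C}^N\to\mathbb{C}^N$ is cubic-linear if there is an $N\times N$ complex matrix $A$ with $F(X)=X-(AX)^{*3}$ for all $X$. Given a cubic-homogeneous $f\colon\mathbb{C}^n\to\mathbb{C}^n$ and a cubic-linear $F\colon\mathbb{C}^N\to\mathbb{C}^N$, $F(X)=X-(AX)^{*3}$, with $N>n$, $f$ and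 $F$ are paired through the matrices $B$ (of size $n\times N$) and $C$ (of size $N\times n$) if $\ker A=\ker B$, $BC=I_n$, and $f(x)=BF(Cx)$ for all $x\in\mathbb{C}^n$. They are paired if this holds for some $B,C$. For $\lambda\in\mathbb{C}\setminus\{0\}$, $|\lambda|\ne1$, and a polynomial map $h\colon\mathbb{C}^m\to\mathbb{C}^m$ with $h(0)=0$, $h'(0)=I_m$, a global pre-conjugation of $h$ is an analytic map $k_\lambda\colon\mathbb{C}^m\to\mathbb{C}^m$ with $k_\lambda(0)=0$, $k_\lambda'(0)=I_m$ and $\lambda h(k_\lambda(y))=k_\lambda(\lambda y)$ for all $y\in\mathbb{C}^m$. A conjugation is a global pre-conjugation that is invertible. *)

theory Defs
  imports
    "HOL-Library.FuncSet"
    "HOL-Analysis.Derivative"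
    "HOL-Analysis.Infinite_Sum"
    "Jordan_Normal_Form.Determinant"
    "Jordan_Normal_Form.Matrix_Kernel"
begin

text \<open>
  \<open>\<complex>\<^sup>m\<close> is \<open>carrier_vec m\<close>, so that dimensions are natural numbers that can be quantified
  over. A map \<open>\<complex>\<^sup>m \<rightarrow> \<complex>\<^sup>m\<close> is a function on \<open>complex vec\<close> of which only the values on
  \<open>carrier_vec m\<close> matter.
\<close>

definition cwise_mult :: "complex vec \<Rightarrow> complex vec \<Rightarrow> complex vec" where
  "cwise_mult x y = vec (dim_vec x) (\<lambda>i. x $ i * y $ i)"

definition cwise_cube :: "complex vec \<Rightarrow> complex vec" where
  "cwise_cube x = cwise_mult (cwise_mult x x) x"

definition symmetric_trilinear ::
    "nat \<Rightarrow> (complex vec \<Rightarrow> complex vec \<Rightarrow> complex vec \<Rightarrow> complex vec) \<Rightarrow> bool" where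
  "symmetric_trilinear n g \<longleftrightarrow>
     (\<forall>x\<in>carrier_vec n. \<forall>y\<in>carrier_vec n. \<forall>z\<in>carrier_vec n.
        g x y z \<in> carrier_vec n \<and>
        g x y z = g y x z \<and> g x y z = g x z y) \<and>
     (\<forall>a b. \<forall>x\<in>carrier_vec n. \<forall>x'\<in>carrier_vec n. \<forall>y\<in>carrier_vec n. \<forall>z\<in>carrier_vec n.
        g (a \<cdot>\<^sub>v x + b \<cdot>\<^sub>v x') y z = a \<cdot>\<^sub>v g x y z + b \<cdot>\<^sub>v g x' y z \<and>
        g y (a \<cdot>\<^sub>v x + b \<cdot>\<^sub>v x') z = a \<cdot>\<^sub>v g y x z + b \<cdot>\<^sub>v g y x' z \<and>
        g y z (a \<cdot>\<^sub>v x + b \<cdot>\<^sub>v x') = a \<cdot>\<^sub>v g y z x + b \<cdot>\<^sub>v g y z x')"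

definition cubic_homogeneous :: "nat \<Rightarrow> (complex vec \<Rightarrow> complex vec) \<Rightarrow> bool" where
  "cubic_homogeneous n f \<longleftrightarrow>
     (\<exists>g. symmetric_trilinear n g \<and> (\<forall>x\<in>carrier_vec n. f x = x - g x x x))"

text \<open>The matrix \<open>A\<close> is kept as a parameter, since the pairing relation refers to it.\<close>

definition cubic_linear ::
    "nat \<Rightarrow> complex mat \<Rightarrow> (complex vec \<Rightarrow> complex vec) \<Rightarrow> bool" where
  "cubic_linear N A F \<longleftrightarrow>
     A \<in> carrier_mat N N \<and> (\<forall>X\<in>carrier_vec N. F X = X - cwise_cube (A *\<^sub>v X))"

definition paired_through ::
    "nat \<Rightarrow> nat \<Rightarrow> (complex vec \<Rightarrow> complex vec) \<Rightarrow> complex mat \<Rightarrow> (complex vec \<Rightarrow> complex vec)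
      \<Rightarrow> complex mat \<Rightarrow> complex mat \<Rightarrow> bool" where
  "paired_through n N f A F B C \<longleftrightarrow>
     cubic_homogeneous n f \<and> cubic_linear N A F \<and> n < N \<and>
     B \<in> carrier_mat n N \<and> C \<in> carrier_mat N n \<and>
     mat_kernel A = mat_kernel B \<and> B * C = 1\<^sub>m n \<and>
     (\<forall>x\<in>carrier_vec n. f x = B *\<^sub>v F (C *\<^sub>v x))"

definition paired ::
    "nat \<Rightarrow> nat \<Rightarrow> (complex vec \<Rightarrow> complex vec) \<Rightarrow> complex mat \<Rightarrow> (complex vec \<Rightarrow> complex vec)
      \<Rightarrow> bool" where
  "paired n N f A F \<longleftrightarrow> (\<exists>B C. paired_through n N f A F B C)"

definition multi_indices :: "nat \<Rightarrow> (nat \<Rightarrow> nat) set" where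
  "multi_indices m = {..<m} \<rightarrow>\<^sub>E UNIV"

definition vec_monomial :: "nat \<Rightarrow> (nat \<Rightarrow> nat) \<Rightarrow> complex vec \<Rightarrow> complex" where
  "vec_monomial m \<alpha> x = (\<Prod>j<m. (x $ j) ^ \<alpha> j)"

definition polynomial_map :: "nat \<Rightarrow> (complex vec \<Rightarrow> complex vec) \<Rightarrow> bool" where
  "polynomial_map m h \<longleftrightarrow>
     (\<forall>x\<in>carrier_vec m. h x \<in> carrier_vec m) \<and>
     (\<forall>i<m. \<exists>S c. finite S \<and> S \<subseteq> multi_indices m \<and>
        (\<forall>x\<in>carrier_vec m. h x $ i = (\<Sum>\<alpha>\<in>S. c \<alpha> * vec_monomial m \<alpha> x)))"

text \<open>
  Around every point of \<open>\<complex>\<^sup>m\<close>, each component is the sum of a power series in \<open>m\<close> variables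
  that converges on some polydisc.
\<close>

definition analytic_map :: "nat \<Rightarrow> (complex vec \<Rightarrow> complex vec) \<Rightarrow> bool" where
  "analytic_map m h \<longleftrightarrow>
     (\<forall>x\<in>carrier_vec m. h x \<in> carrier_vec m) \<and>
     (\<forall>a\<in>carrier_vec m. \<forall>i<m. \<exists>r>0. \<exists>c. \<forall>y\<in>carrier_vec m.
        (\<forall>j<m. cmod (y $ j) < r) \<longrightarrow>
        ((\<lambda>\<alpha>. c \<alpha> * vec_monomial m \<alpha> y) has_sum (h (a + y) $ i)) (multi_indices m))"

text \<open>
  The matrix of partial derivatives; it is only used for polynomial and analytic maps, for which
  all partial derivatives exist.
\<close>

definition jacobian_mat ::
    "nat \<Rightarrow> (complex vec \<Rightarrow> complex vec) \<Rightarrow> complex vec \<Rightarrow> complex mat" where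
  "jacobian_mat m h x =
     mat m m (\<lambda>(i, j). deriv (\<lambda>t. h (x + t \<cdot>\<^sub>v unit_vec m j) $ i) 0)"

definition constant_jacobian_det :: "nat \<Rightarrow> (complex vec \<Rightarrow> complex vec) \<Rightarrow> bool" where
  "constant_jacobian_det m h \<longleftrightarrow>
     (\<exists>c. \<forall>x\<in>carrier_vec m. det (jacobian_mat m h x) = c)"

definition one_to_one :: "nat \<Rightarrow> (complex vec \<Rightarrow> complex vec) \<Rightarrow> bool" where
  "one_to_one m h \<longleftrightarrow> inj_on h (carrier_vec m)"

definition onto :: "nat \<Rightarrow> (complex vec \<Rightarrow> complex vec) \<Rightarrow> bool" where
  "onto m h \<longleftrightarrow> h ` carrier_vec m = carrier_vec m"

definition invertible_map :: "nat \<Rightarrow> (complex vec \<Rightarrow> complex vec) \<Rightarrow> bool" where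
  "invertible_map m h \<longleftrightarrow> bij_betw h (carrier_vec m) (carrier_vec m)"

definition has_polynomial_inverse :: "nat \<Rightarrow> (complex vec \<Rightarrow> complex vec) \<Rightarrow> bool" where
  "has_polynomial_inverse m h \<longleftrightarrow>
     invertible_map m h \<and> polynomial_map m (inv_into (carrier_vec m) h)"

text \<open>
  The requirements that \<open>h\<close> be polynomial with \<open>h(0) = 0\<close>, \<open>h'(0) = I\<close>, and that \<open>\<mu> \<noteq> 0\<close>,
  \<open>|\<mu>| \<noteq> 1\<close>, are left to the context of use: the former hold for every cubic-homogeneous and
  every cubic-linear map.
\<close>

definition global_pre_conjugation ::
    "nat \<Rightarrow> complex \<Rightarrow> (complex vec \<Rightarrow> complex vec) \<Rightarrow> (complex vec \<Rightarrow> complex vec) \<Rightarrow> bool" where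
  "global_pre_conjugation m \<mu> h k \<longleftrightarrow>
     analytic_map m k \<and> k (0\<^sub>v m) = 0\<^sub>v m \<and> jacobian_mat m k (0\<^sub>v m) = 1\<^sub>m m \<and>
     (\<forall>y\<in>carrier_vec m. \<mu> \<cdot>\<^sub>v h (k y) = k (\<mu> \<cdot>\<^sub>v y))"

definition conjugation ::
    "nat \<Rightarrow> complex \<Rightarrow> (complex vec \<Rightarrow> complex vec) \<Rightarrow> (complex vec \<Rightarrow> complex vec) \<Rightarrow> bool" where
  "conjugation m \<mu> h k \<longleftrightarrow> global_pre_conjugation m \<mu> h k \<and> invertible_map m k"

end

theory Submission
  imports
    "HOL-Complex_Analysis.Complex_Analysis"
    "HOL-Homology.Invariance_of_Domain"
    "HOL-Computational_Algebra.Fundamental_Theorem_Algebra"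
    Defs
begin

text \<open>
  Let \<open>H y = (ACy)\<^sup>*\<^sup>3\<close>. Since \<open>X - CBX\<close> lies in \<open>ker B = ker A\<close>, one has \<open>F X = X - H(BX)\<close> and
  \<open>B \<circ> F = f \<circ> B\<close>, so that in the coordinates \<open>(BX, X - CBX)\<close> the map \<open>F\<close> is the triangular extension
  \<open>(y, w) \<mapsto> (f y, w + \<psi> y)\<close> of \<open>f\<close>. Injectivity, surjectivity and polynomial inverses pass between a
  map and a triangular extension of it. A global pre-conjugation is unique because two of them
  agree near the origin; hence that of \<open>F\<close> is again triangular, and extending one of \<open>f\<close> to one of \<open>F\<close>
  means solving a linear equation \<open>\<phi>(y) - \<phi>(\<mu>y)/\<mu> = h(y)\<close> with \<open>h\<close> of order three: by a
  geometrically convergent series, or by comparing coefficients when \<open>h\<close> is a polynomial.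

  For \<open>|\<mu>| > 1\<close> the pre-conjugation is obtained by Poincare's iteration. For \<open>|\<mu>| < 1\<close> and \<open>f\<close> bijective,
  one applies this to \<open>f\<^sup>-\<^sup>1\<close> and \<open>1/\<mu>\<close>, for which \<open>f\<^sup>-\<^sup>1\<close> has to be known to be polynomial.
\<close>

unbundle no vec_syntax
hide_const (open) Finite_Cartesian_Product.vec Determinants.det Finite_Cartesian_Product.mat
  Finite_Cartesian_Product.row Finite_Cartesian_Product.column Infinite_Set_Sum.abs_summable_on
hide_type (open) Finite_Cartesian_Product.vec
unbundle no fps_syntax
no_notation fps_nth (infixl \<open>$\<close> 75)
hide_const (open) up_ring.coeff up_ring.monom module.smult

section \<open>Polynomial functions\<close>

text \<open>For |\<mu>| > 1 the equation k(y) = \<mu> f(k(y/\<mu>)) continues \<open>k\<close>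
  outwards from a ball around the origin. For |\<mu>| < 1 the corresponding step is k(y) =
  f^-1(k(\<mu>y)/\<mu>), which calls for an inverse that is holomorphic on the whole space; hence
  the detour through polynomial inverses. A pre-conjugation \<open>K\<close> of \<open>F\<close> is
  not triangular by definition. It is compared with the extension of its own restriction y -> B K(C
  y), and uniqueness identifies the two. The shift in the extension of \<open>k\<close> solves a
  linear equation whose right-hand side contains \<open>k\<close>. To transfer a polynomial inverse
  of a conjugation, \<open>k\<close> itself is therefore shown to be a polynomial map: it is the
  inverse of the bijective polynomial map k^-1. Jacobian determinants are compared directly: that of
  \<open>F\<close> at \<open>X\<close> equals that of \<open>f\<close> at
  \<open>B *\<^sub>v X\<close>, because det(1 - UV) = det(1 - VU).\<close>

definition vnorm :: "complex vec \<Rightarrow> real" where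
  "vnorm x = Max (insert 0 ((\<lambda>i. cmod (x $ i)) ` {..<dim_vec x}))"

text \<open>The conjunct \<open>0 \<le> r\<close> accounts for dimension 0, where only the inserted
  0 is left in the maximum. The maximum norm is chosen because its balls are the polydiscs in
  \<open>analytic_map\<close>.\<close>

lemma vnorm_le_iff: "x \<in> carrier_vec m \<Longrightarrow> vnorm x \<le> r \<longleftrightarrow> 0 \<le> r \<and> (\<forall>i<m. cmod (x $ i) \<le> r)"
  unfolding vnorm_def by (subst Max_le_iff) auto

lemma vnorm_less_iff: "x \<in> carrier_vec m \<Longrightarrow> vnorm x < r \<longleftrightarrow> 0 < r \<and> (\<forall>i<m. cmod (x $ i) < r)"
  unfolding vnorm_def by (subst Max_less_iff) auto

lemma vnorm_nonneg [simp]: "0 \<le> vnorm x"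
  unfolding vnorm_def by (intro Max_ge) auto

lemma cmod_index_le_vnorm: "i < dim_vec x \<Longrightarrow> cmod (x $ i) \<le> vnorm x"
  unfolding vnorm_def by (intro Max_ge) auto

lemma cmod_index_le_vnorm': "x \<in> carrier_vec m \<Longrightarrow> i < m \<Longrightarrow> cmod (x $ i) \<le> vnorm x"
  using cmod_index_le_vnorm by auto

lemma vnorm_zero [simp]: "vnorm (0\<^sub>v m) = 0"
  using vnorm_le_iff[of "0\<^sub>v m" m 0] vnorm_nonneg[of "0\<^sub>v m"] by (auto intro: antisym)

lemma vnorm_smult:
  assumes "x \<in> carrier_vec m" shows "vnorm (c \<cdot>\<^sub>v x) = cmod c * vnorm x"
proof (rule antisym)
  show "vnorm (c \<cdot>\<^sub>v x) \<le> cmod c * vnorm x"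
    using assms cmod_index_le_vnorm'[OF assms]
    by (subst vnorm_le_iff[of _ m]) (auto simp: norm_mult intro!: mult_left_mono)
  show "cmod c * vnorm x \<le> vnorm (c \<cdot>\<^sub>v x)"
  proof (cases "c = 0")
    case False
    have "vnorm x \<le> vnorm (c \<cdot>\<^sub>v x) / cmod c"
    proof (subst vnorm_le_iff[OF assms], intro conjI allI impI)
      fix i assume "i < m"
      then show "cmod (x $ i) \<le> vnorm (c \<cdot>\<^sub>v x) / cmod c"
        using assms cmod_index_le_vnorm'[of "c \<cdot>\<^sub>v x" m i] False
        by (auto simp: norm_mult field_simps)
    qed auto
    with False show ?thesis by (simp add: field_simps)
  qed auto
qed

lemma vnorm_triangle:
  assumes "x \<in> carrier_vec m" "y \<in> carrier_vec m"
  shows "vnorm (x + y) \<le> vnorm x + vnorm y"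
proof (subst vnorm_le_iff[of _ m], use assms in simp, intro conjI allI impI)
  fix i assume "i < m"
  with assms have "cmod ((x + y) $ i) \<le> cmod (x $ i) + cmod (y $ i)"
    using norm_triangle_ineq by auto
  also have "\<dots> \<le> vnorm x + vnorm y"
    using assms \<open>i < m\<close> by (intro add_mono cmod_index_le_vnorm'[of _ m]) auto
  finally show "cmod ((x + y) $ i) \<le> vnorm x + vnorm y" .
qed auto

lemma vnorm_minus_commute:
  assumes "x \<in> carrier_vec m" "y \<in> carrier_vec m"
  shows "vnorm (x - y) = vnorm (y - x)"
proof -
  have "x - y = (-1) \<cdot>\<^sub>v (y - x)" using assms by auto
  then show ?thesis using assms vnorm_smult[of "y - x" m "-1"] by simp
qed

lemma vnorm_triangle_sub:
  assumes "x \<in> carrier_vec m" "y \<in> carrier_vec m"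
  shows "vnorm x \<le> vnorm y + vnorm (x - y)"
proof -
  have "x = y + (x - y)" using assms by auto
  then show ?thesis using vnorm_triangle[of y m "x - y"] assms by auto
qed

lemma vnorm_eq_0_iff:
  assumes "x \<in> carrier_vec m" shows "vnorm x = 0 \<longleftrightarrow> x = 0\<^sub>v m"
proof
  assume "vnorm x = 0"
  then have "vnorm x \<le> 0" by simp
  then show "x = 0\<^sub>v m" using assms by (auto simp: vnorm_le_iff[OF assms])
qed simp

section \<open>Closure properties of polynomial functions\<close>

definition polyfun :: "nat \<Rightarrow> (complex vec \<Rightarrow> complex) \<Rightarrow> bool" where
  "polyfun m \<phi> \<longleftrightarrow> (\<exists>S c. finite S \<and> S \<subseteq> multi_indices m \<and>
     (\<forall>x\<in>carrier_vec m. \<phi> x = (\<Sum>\<alpha>\<in>S. c \<alpha> * vec_monomial m \<alpha> x)))"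

lemma polynomial_map_iff_polyfun:
  "polynomial_map m h \<longleftrightarrow>
     (\<forall>x\<in>carrier_vec m. h x \<in> carrier_vec m) \<and> (\<forall>i<m. polyfun m (\<lambda>x. h x $ i))"
  unfolding polynomial_map_def polyfun_def by simp

lemma polyfun_cong:
  assumes "polyfun m \<phi>" "\<And>x. x \<in> carrier_vec m \<Longrightarrow> \<psi> x = \<phi> x"
  shows "polyfun m \<psi>"
  using assms unfolding polyfun_def by metis

lemma polyfun_monomial:
  assumes "\<alpha> \<in> multi_indices m" shows "polyfun m (\<lambda>x. c * vec_monomial m \<alpha> x)"
  unfolding polyfun_def by (rule exI[of _ "{\<alpha>}"], rule exI[of _ "\<lambda>_. c"]) (use assms in auto)

lemma polyfun_add:
  assumes "polyfun m \<phi>" "polyfun m \<psi>" shows "polyfun m (\<lambda>x. \<phi> x + \<psi> x)"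
proof -
  obtain S c where S: "finite S" "S \<subseteq> multi_indices m"
    "\<And>x. x \<in> carrier_vec m \<Longrightarrow> \<phi> x = (\<Sum>\<alpha>\<in>S. c \<alpha> * vec_monomial m \<alpha> x)"
    using assms(1) unfolding polyfun_def by auto
  obtain T d where T: "finite T" "T \<subseteq> multi_indices m"
    "\<And>x. x \<in> carrier_vec m \<Longrightarrow> \<psi> x = (\<Sum>\<alpha>\<in>T. d \<alpha> * vec_monomial m \<alpha> x)"
    using assms(2) unfolding polyfun_def by auto
  let ?e = "\<lambda>\<alpha>. (if \<alpha> \<in> S then c \<alpha> else 0) + (if \<alpha> \<in> T then d \<alpha> else 0)"
  have "\<phi> x + \<psi> x = (\<Sum>\<alpha>\<in>S \<union> T. ?e \<alpha> * vec_monomial m \<alpha> x)" if "x \<in> carrier_vec m" for x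
  proof -
    have "(\<Sum>\<alpha>\<in>S \<union> T. ?e \<alpha> * vec_monomial m \<alpha> x) =
      (\<Sum>\<alpha>\<in>S \<union> T. if \<alpha> \<in> S then c \<alpha> * vec_monomial m \<alpha> x else 0) +
      (\<Sum>\<alpha>\<in>S \<union> T. if \<alpha> \<in> T then d \<alpha> * vec_monomial m \<alpha> x else 0)"
      unfolding sum.distrib[symmetric] by (intro sum.cong refl) (simp add: distrib_right)
    also have "\<dots> = \<phi> x + \<psi> x"
      using S(1) T(1) that by (simp add: S(3) T(3) sum.If_cases Int_absorb1 Int_absorb2)
    finally show ?thesis by simp
  qed
  then show ?thesis
    unfolding polyfun_def using S(1,2) T(1,2) by (intro exI[of _ "S \<union> T"] exI[of _ ?e]) auto
qed

lemma zero_multi_index: "(\<lambda>j\<in>{..<m}. 0) \<in> multi_indices m"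
  unfolding multi_indices_def by auto

lemma polyfun_const: "polyfun m (\<lambda>x. c)"
  by (rule polyfun_cong[OF polyfun_monomial[OF zero_multi_index, of m c]])
     (auto simp: vec_monomial_def)

lemma polyfun_sum:
  assumes "\<And>i. i \<in> I \<Longrightarrow> polyfun m (\<phi> i)" shows "polyfun m (\<lambda>x. \<Sum>i\<in>I. \<phi> i x)"
  using assms by (induction I rule: infinite_finite_induct) (auto intro: polyfun_add polyfun_const)

lemma polyfun_mult:
  assumes "polyfun m \<phi>" "polyfun m \<psi>" shows "polyfun m (\<lambda>x. \<phi> x * \<psi> x)"
proof -
  obtain S c where S: "finite S" "S \<subseteq> multi_indices m"
    "\<And>x. x \<in> carrier_vec m \<Longrightarrow> \<phi> x = (\<Sum>\<alpha>\<in>S. c \<alpha> * vec_monomial m \<alpha> x)"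
    using assms(1) unfolding polyfun_def by auto
  obtain T d where T: "finite T" "T \<subseteq> multi_indices m"
    "\<And>x. x \<in> carrier_vec m \<Longrightarrow> \<psi> x = (\<Sum>\<alpha>\<in>T. d \<alpha> * vec_monomial m \<alpha> x)"
    using assms(2) unfolding polyfun_def by auto
  have "polyfun m (\<lambda>x. \<Sum>\<alpha>\<in>S. \<Sum>\<beta>\<in>T. (c \<alpha> * d \<beta>) * vec_monomial m (\<lambda>j\<in>{..<m}. \<alpha> j + \<beta> j) x)"
    by (intro polyfun_sum polyfun_monomial) (auto simp: multi_indices_def)
  then show ?thesis
    by (rule polyfun_cong)
       (auto simp: S(3) T(3) sum_product vec_monomial_def power_add prod.distrib mult_ac intro!: sum.cong)
qed

lemma polyfun_prod:
  assumes "\<And>i. i \<in> I \<Longrightarrow> polyfun m (\<phi> i)" shows "polyfun m (\<lambda>x. \<Prod>i\<in>I. \<phi> i x)"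
  using assms by (induction I rule: infinite_finite_induct) (auto intro: polyfun_mult polyfun_const)

lemma polyfun_power:
  assumes "polyfun m \<phi>" shows "polyfun m (\<lambda>x. \<phi> x ^ k)"
  using assms by (induction k) (auto intro: polyfun_mult polyfun_const)

lemma polyfun_diff:
  assumes "polyfun m \<phi>" "polyfun m \<psi>" shows "polyfun m (\<lambda>x. \<phi> x - \<psi> x)"
  using polyfun_add[OF assms(1) polyfun_mult[OF polyfun_const[of m "-1"] assms(2)]] by simp

lemma polyfun_index:
  assumes "j < m" shows "polyfun m (\<lambda>x. x $ j)"
proof -
  have *: "(\<lambda>i\<in>{..<m}. if i = j then 1 else 0) \<in> multi_indices m"
    unfolding multi_indices_def by auto
  have "vec_monomial m (\<lambda>i\<in>{..<m}. if i = j then 1 else 0) x = x $ j" for x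
  proof -
    have "vec_monomial m (\<lambda>i\<in>{..<m}. if i = j then 1 else 0) x = (\<Prod>i<m. if i = j then x $ i else 1)"
      unfolding vec_monomial_def by (intro prod.cong) auto
    then show ?thesis using assms by (simp add: prod.delta)
  qed
  then show ?thesis using polyfun_monomial[OF *, of 1] by simp
qed

text \<open>Polynomial functions are generated by constants and coordinates under sums and products.
  The case \<open>cong\<close> is there because \<open>polyfun\<close> sees a function only on
  \<open>carrier_vec m\<close>, while \<open>P\<close> may see more.\<close>

lemma polyfun_induct [consumes 1, case_names const index add mult cong]:
  assumes "polyfun m \<phi>"
    and const: "\<And>c. P (\<lambda>x. c)" and index: "\<And>j. j < m \<Longrightarrow> P (\<lambda>x. x $ j)"
    and add: "\<And>\<phi> \<psi>. polyfun m \<phi> \<Longrightarrow> polyfun m \<psi> \<Longrightarrow> P \<phi> \<Longrightarrow> P \<psi> \<Longrightarrow> P (\<lambda>x. \<phi> x + \<psi> x)"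
    and mult: "\<And>\<phi> \<psi>. polyfun m \<phi> \<Longrightarrow> polyfun m \<psi> \<Longrightarrow> P \<phi> \<Longrightarrow> P \<psi> \<Longrightarrow> P (\<lambda>x. \<phi> x * \<psi> x)"
    and cong: "\<And>\<phi> \<psi>. P \<phi> \<Longrightarrow> (\<And>x. x \<in> carrier_vec m \<Longrightarrow> \<psi> x = \<phi> x) \<Longrightarrow> P \<psi>"
  shows "P \<phi>"
proof -
  \<comment> \<open>\<open>polyfun\<close> is carried along in \<open>Q\<close>, since the cases
    \<open>add\<close> and \<open>mult\<close> ask for it on both operands.\<close>
  define Q where "Q \<phi> \<longleftrightarrow> polyfun m \<phi> \<and> P \<phi>" for \<phi>
  have Q: "Q (\<lambda>x. c)" "j < m \<Longrightarrow> Q (\<lambda>x. x $ j)" "Q \<phi> \<Longrightarrow> Q \<psi> \<Longrightarrow> Q (\<lambda>x. \<phi> x + \<psi> x)"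
    "Q \<phi> \<Longrightarrow> Q \<psi> \<Longrightarrow> Q (\<lambda>x. \<phi> x * \<psi> x)" for c j \<phi> \<psi>
    unfolding Q_def by (auto intro: polyfun_const polyfun_index polyfun_add polyfun_mult assms)
  obtain S c where S: "finite S"
    "\<And>x. x \<in> carrier_vec m \<Longrightarrow> \<phi> x = (\<Sum>\<alpha>\<in>S. c \<alpha> * vec_monomial m \<alpha> x)"
    using assms(1) unfolding polyfun_def by auto
  have pow: "Q (\<lambda>x. x $ j ^ k)" if "j < m" for j k
    by (induction k) (use Q(1)[of 1] Q(2,4) that in auto)
  have prd: "finite J \<Longrightarrow> J \<subseteq> {..<m} \<Longrightarrow> Q (\<lambda>x. \<Prod>j\<in>J. x $ j ^ \<alpha> j)" for \<alpha> :: "nat \<Rightarrow> nat" and J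
    by (induction J rule: finite_induct) (use Q(1)[of 1] Q(4) pow in auto)
  have mon: "Q (\<lambda>x. c \<alpha> * vec_monomial m \<alpha> x)" for \<alpha>
    unfolding vec_monomial_def by (intro Q prd) auto
  have "Q (\<lambda>x. \<Sum>\<alpha>\<in>S. c \<alpha> * vec_monomial m \<alpha> x)"
    using S(1) by (induction S rule: finite_induct) (use Q(1)[of 0] Q(3) mon in auto)
  then have "P (\<lambda>x. \<Sum>\<alpha>\<in>S. c \<alpha> * vec_monomial m \<alpha> x)" unfolding Q_def by simp
  then show ?thesis by (rule cong) (use S(2) in auto)
qed

lemma polyfun_compose:
  assumes "polyfun n \<phi>" "\<And>x. x \<in> carrier_vec m \<Longrightarrow> h x \<in> carrier_vec n"
    "\<And>i. i < n \<Longrightarrow> polyfun m (\<lambda>x. h x $ i)"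
  shows "polyfun m (\<lambda>x. \<phi> (h x))"
  using assms(1)
proof (induction rule: polyfun_induct)
  case (cong \<phi> \<psi>)
  then show ?case using assms(2) by (auto intro: polyfun_cong)
qed (auto intro: polyfun_const polyfun_add polyfun_mult assms)

lemma polyfun_mult_mat_vec:
  assumes "A \<in> carrier_mat p n" "i < p" "\<And>x. x \<in> carrier_vec m \<Longrightarrow> h x \<in> carrier_vec n"
    "\<And>i. i < n \<Longrightarrow> polyfun m (\<lambda>x. h x $ i)"
  shows "polyfun m (\<lambda>x. (A *\<^sub>v h x) $ i)"
proof -
  have "polyfun m (\<lambda>x. \<Sum>j<n. A $$ (i,j) * h x $ j)"
    by (intro polyfun_sum polyfun_mult polyfun_const assms) auto
  then show ?thesis
    by (rule polyfun_cong)
       (use assms in \<open>force simp: scalar_prod_def atLeast0LessThan intro!: sum.cong\<close>)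
qed

lemma polyfun_det:
  assumes "\<And>i j. i < m \<Longrightarrow> j < m \<Longrightarrow> polyfun n (\<lambda>x. J i j x)"
  shows "polyfun n (\<lambda>x. det (mat m m (\<lambda>(i, j). J i j x)))"
proof -
  have "polyfun n (\<lambda>x. \<Sum>p\<in>{p. p permutes {0..<m}}. signof p * (\<Prod>i\<in>{0..<m}. J i (p i) x))"
  proof (intro polyfun_sum polyfun_mult polyfun_const polyfun_prod assms)
    fix p i assume "p \<in> {p. p permutes {0..<m}}" "i \<in> {0..<m}"
    then show "i < m" "p i < m" by (auto dest: permutes_in_image[of p "{0..<m}" i])
  qed
  then show ?thesis
    by (rule polyfun_cong)
       (auto simp: Determinant.det_def permutes_in_image[of _ "{0..<m}", simplified]
             intro!: sum.cong prod.cong)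
qed

text \<open>The degree bound \<open>D\<close> does not depend on the line. This uniformity is what
  later allows interpolation at the same nodes on every line.\<close>

lemma polyfun_line:
  assumes "polyfun m \<phi>"
  shows "\<exists>D. \<forall>a\<in>carrier_vec m. \<forall>b\<in>carrier_vec m. \<exists>p. degree p \<le> D \<and> (\<forall>t. \<phi> (a + t \<cdot>\<^sub>v b) = poly p t)"
  using assms
proof (induction rule: polyfun_induct)
  case (const c)
  show ?case by (intro exI[of _ 0] ballI exI[of _ "[:c:]"]) auto
next
  case (index j)
  then show ?case by (intro exI[of _ 1] ballI exI[of _ "[:_ $ j, _ $ j:]"]) (auto simp: field_simps)
next
  case (add \<phi> \<psi>)
  obtain D where D: "\<And>a b. a \<in> carrier_vec m \<Longrightarrow> b \<in> carrier_vec m \<Longrightarrow>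
    \<exists>p. degree p \<le> D \<and> (\<forall>t. \<phi> (a + t \<cdot>\<^sub>v b) = poly p t)" using add by metis
  obtain E where E: "\<And>a b. a \<in> carrier_vec m \<Longrightarrow> b \<in> carrier_vec m \<Longrightarrow>
    \<exists>p. degree p \<le> E \<and> (\<forall>t. \<psi> (a + t \<cdot>\<^sub>v b) = poly p t)" using add by metis
  show ?case
  proof (intro exI[of _ "max D E"] ballI)
    fix a b :: "complex vec" assume ab: "a \<in> carrier_vec m" "b \<in> carrier_vec m"
    obtain p where "degree p \<le> D" "\<forall>t. \<phi> (a + t \<cdot>\<^sub>v b) = poly p t" using D[OF ab] by auto
    moreover obtain q where "degree q \<le> E" "\<forall>t. \<psi> (a + t \<cdot>\<^sub>v b) = poly q t" using E[OF ab] by auto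
    ultimately show "\<exists>p. degree p \<le> max D E \<and> (\<forall>t. \<phi> (a + t \<cdot>\<^sub>v b) + \<psi> (a + t \<cdot>\<^sub>v b) = poly p t)"
      by (intro exI[of _ "p + q"]) (auto intro: degree_add_le)
  qed
next
  case (mult \<phi> \<psi>)
  obtain D where D: "\<And>a b. a \<in> carrier_vec m \<Longrightarrow> b \<in> carrier_vec m \<Longrightarrow>
    \<exists>p. degree p \<le> D \<and> (\<forall>t. \<phi> (a + t \<cdot>\<^sub>v b) = poly p t)" using mult by metis
  obtain E where E: "\<And>a b. a \<in> carrier_vec m \<Longrightarrow> b \<in> carrier_vec m \<Longrightarrow>
    \<exists>p. degree p \<le> E \<and> (\<forall>t. \<psi> (a + t \<cdot>\<^sub>v b) = poly p t)" using mult by metis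
  show ?case
  proof (intro exI[of _ "D + E"] ballI)
    fix a b :: "complex vec" assume ab: "a \<in> carrier_vec m" "b \<in> carrier_vec m"
    obtain p where "degree p \<le> D" "\<forall>t. \<phi> (a + t \<cdot>\<^sub>v b) = poly p t" using D[OF ab] by auto
    moreover obtain q where "degree q \<le> E" "\<forall>t. \<psi> (a + t \<cdot>\<^sub>v b) = poly q t" using E[OF ab] by auto
    ultimately show "\<exists>p. degree p \<le> D + E \<and> (\<forall>t. \<phi> (a + t \<cdot>\<^sub>v b) * \<psi> (a + t \<cdot>\<^sub>v b) = poly p t)"
      by (intro exI[of _ "p * q"]) (auto intro: order_trans[OF degree_mult_le])
  qed
next
  case (cong \<phi> \<psi>)
  have "\<psi> (a + t \<cdot>\<^sub>v b) = \<phi> (a + t \<cdot>\<^sub>v b)" if "a \<in> carrier_vec m" "b \<in> carrier_vec m" for a b t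
    using that by (intro cong) simp
  with cong(1) show ?case by simp
qed

section \<open>Bounds, Lipschitz estimates and the Taylor formula\<close>

lemma polyfun_bounded:
  assumes "polyfun m \<phi>"
  shows "\<exists>C. \<forall>x\<in>carrier_vec m. vnorm x \<le> R \<longrightarrow> cmod (\<phi> x) \<le> C"
  using assms
proof (induction rule: polyfun_induct)
  case (index j)
  then show ?case using cmod_index_le_vnorm'[of _ m j] order_trans by blast
next
  case (add \<phi> \<psi>)
  obtain C where C: "\<And>x. x \<in> carrier_vec m \<Longrightarrow> vnorm x \<le> R \<Longrightarrow> cmod (\<phi> x) \<le> C" using add by metis
  obtain D where D: "\<And>x. x \<in> carrier_vec m \<Longrightarrow> vnorm x \<le> R \<Longrightarrow> cmod (\<psi> x) \<le> D" using add by metis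
  show ?case using norm_triangle_le[OF add_mono[OF C D]] by blast
next
  case (mult \<phi> \<psi>)
  obtain C where C: "\<And>x. x \<in> carrier_vec m \<Longrightarrow> vnorm x \<le> R \<Longrightarrow> cmod (\<phi> x) \<le> C" using mult by metis
  obtain D where D: "\<And>x. x \<in> carrier_vec m \<Longrightarrow> vnorm x \<le> R \<Longrightarrow> cmod (\<psi> x) \<le> D" using mult by metis
  have "cmod (\<phi> x * \<psi> x) \<le> C * D" if "x \<in> carrier_vec m" "vnorm x \<le> R" for x
    unfolding norm_mult using C[OF that] D[OF that] order_trans[OF norm_ge_zero C[OF that]]
    by (intro mult_mono) auto
  then show ?case by blast
qed auto

text \<open>On the ball of radius \<open>R\<close> one has |x - y| \<le> 2R, so one factor of the
  quadratic remainder turns into a constant. Separated from \<open>polyfun_taylor\<close> because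
  the product case there uses the Lipschitz bounds of both factors.\<close>

lemma taylor_imp_lipschitz:
  assumes "\<forall>j<m. polyfun m (L j)"
    and taylor: "\<And>x y. x \<in> carrier_vec m \<Longrightarrow> y \<in> carrier_vec m \<Longrightarrow> vnorm x \<le> R \<Longrightarrow> vnorm y \<le> R \<Longrightarrow>
      cmod (\<phi> x - \<phi> y - (\<Sum>j<m. L j y * (x $ j - y $ j))) \<le> C * (vnorm (x - y))\<^sup>2"
  shows "\<exists>D\<ge>0. \<forall>x\<in>carrier_vec m. \<forall>y\<in>carrier_vec m. vnorm x \<le> R \<longrightarrow> vnorm y \<le> R \<longrightarrow>
    cmod (\<phi> x - \<phi> y) \<le> D * vnorm (x - y)"
proof -
  have "\<forall>j. \<exists>b. j < m \<longrightarrow> (\<forall>x\<in>carrier_vec m. vnorm x \<le> R \<longrightarrow> cmod (L j x) \<le> b)"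
    using assms(1) polyfun_bounded[of m _ R] by blast
  then obtain B where B: "\<And>j x. j < m \<Longrightarrow> x \<in> carrier_vec m \<Longrightarrow> vnorm x \<le> R \<Longrightarrow> cmod (L j x) \<le> B j"
    by metis
  let ?D = "\<bar>C\<bar> * (2 * \<bar>R\<bar>) + (\<Sum>j<m. \<bar>B j\<bar>)"
  have "cmod (\<phi> x - \<phi> y) \<le> ?D * vnorm (x - y)"
    if xy: "x \<in> carrier_vec m" "y \<in> carrier_vec m" "vnorm x \<le> R" "vnorm y \<le> R" for x y
  proof -
    have R: "R \<ge> 0" using vnorm_nonneg[of x] xy by linarith
    have d: "x - y \<in> carrier_vec m" using xy by simp
    have "vnorm (x - y) \<le> vnorm x + vnorm y"
      using vnorm_triangle[of x m "- y"] vnorm_smult[of y m "-1"] xy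
      by (simp add: minus_add_uminus_vec[OF xy(1,2)] uminus_vec_def smult_vec_def)
    with xy have n2: "vnorm (x - y) \<le> 2 * R" by linarith
    have "C * (vnorm (x - y))\<^sup>2 \<le> \<bar>C\<bar> * ((2 * R) * vnorm (x - y))"
      unfolding power2_eq_square using n2 R by (intro mult_mono) auto
    moreover have "cmod (\<Sum>j<m. L j y * (x $ j - y $ j)) \<le> (\<Sum>j<m. \<bar>B j\<bar> * vnorm (x - y))"
    proof (rule sum_norm_le)
      fix j assume "j \<in> {..<m}"
      then show "cmod (L j y * (x $ j - y $ j)) \<le> \<bar>B j\<bar> * vnorm (x - y)"
        unfolding norm_mult using B[of j y] cmod_index_le_vnorm'[OF d, of j] xy
        by (intro mult_mono) auto
    qed
    moreover have "cmod (\<phi> x - \<phi> y) \<le>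
      cmod (\<phi> x - \<phi> y - (\<Sum>j<m. L j y * (x $ j - y $ j))) + cmod (\<Sum>j<m. L j y * (x $ j - y $ j))"
      using norm_triangle_sub[of "\<phi> x - \<phi> y"] by (simp add: add.commute)
    moreover have "?D * vnorm (x - y) = \<bar>C\<bar> * ((2 * R) * vnorm (x - y)) + (\<Sum>j<m. \<bar>B j\<bar> * vnorm (x - y))"
      using R by (simp add: distrib_right sum_distrib_right)
    ultimately show ?thesis using taylor[OF xy] by linarith
  qed
  moreover have "?D \<ge> 0" by (intro add_nonneg_nonneg sum_nonneg) auto
  ultimately show ?thesis by blast
qed

text \<open>The first-order Taylor formula with both points varying, so that it yields Lipschitz
  bounds as well as derivatives.\<close>

lemma polyfun_taylor:
  assumes "polyfun m \<phi>"
  shows "\<exists>L. (\<forall>j<m. polyfun m (L j)) \<and> (\<forall>R. \<exists>C. \<forall>x\<in>carrier_vec m. \<forall>y\<in>carrier_vec m.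
    vnorm x \<le> R \<longrightarrow> vnorm y \<le> R \<longrightarrow>
    cmod (\<phi> x - \<phi> y - (\<Sum>j<m. L j y * (x $ j - y $ j))) \<le> C * (vnorm (x - y))\<^sup>2)"
  using assms
proof (induction rule: polyfun_induct)
  case (const c)
  show ?case by (rule exI[of _ "\<lambda>_ _. 0"]) (auto intro!: polyfun_const exI[of _ 0])
next
  case (index i)
  have "(\<Sum>j<m. (if j = i then 1 else 0) * (x $ j - y $ j)) = x $ i - y $ i" for x y :: "complex vec"
  proof -
    have "(\<Sum>j<m. (if j = i then 1 else 0) * (x $ j - y $ j)) = (\<Sum>j<m. if j = i then x $ j - y $ j else 0)"
      by (intro sum.cong) auto
    then show ?thesis using index by simp
  qed
  then show ?case
    by (intro exI[of _ "\<lambda>j x. if j = i then 1 else 0"]) (auto intro!: polyfun_const exI[of _ 0])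
next
  case (add \<phi> \<psi>)
  obtain L where L: "\<forall>j<m. polyfun m (L j)" "\<And>R. \<exists>C. \<forall>x\<in>carrier_vec m. \<forall>y\<in>carrier_vec m.
    vnorm x \<le> R \<longrightarrow> vnorm y \<le> R \<longrightarrow>
    cmod (\<phi> x - \<phi> y - (\<Sum>j<m. L j y * (x $ j - y $ j))) \<le> C * (vnorm (x - y))\<^sup>2" using add by auto
  obtain K where K: "\<forall>j<m. polyfun m (K j)" "\<And>R. \<exists>C. \<forall>x\<in>carrier_vec m. \<forall>y\<in>carrier_vec m.
    vnorm x \<le> R \<longrightarrow> vnorm y \<le> R \<longrightarrow>
    cmod (\<psi> x - \<psi> y - (\<Sum>j<m. K j y * (x $ j - y $ j))) \<le> C * (vnorm (x - y))\<^sup>2" using add by auto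
  show ?case
  proof (intro exI[of _ "\<lambda>j x. L j x + K j x"] conjI allI impI)
    fix R
    obtain C where C: "\<And>x y. x \<in> carrier_vec m \<Longrightarrow> y \<in> carrier_vec m \<Longrightarrow> vnorm x \<le> R \<Longrightarrow> vnorm y \<le> R \<Longrightarrow>
      cmod (\<phi> x - \<phi> y - (\<Sum>j<m. L j y * (x $ j - y $ j))) \<le> C * (vnorm (x - y))\<^sup>2" using L(2)[of R] by auto
    obtain D where D: "\<And>x y. x \<in> carrier_vec m \<Longrightarrow> y \<in> carrier_vec m \<Longrightarrow> vnorm x \<le> R \<Longrightarrow> vnorm y \<le> R \<Longrightarrow>
      cmod (\<psi> x - \<psi> y - (\<Sum>j<m. K j y * (x $ j - y $ j))) \<le> D * (vnorm (x - y))\<^sup>2" using K(2)[of R] by auto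
    have "cmod (\<phi> x + \<psi> x - (\<phi> y + \<psi> y) - (\<Sum>j<m. (L j y + K j y) * (x $ j - y $ j)))
      \<le> (C + D) * (vnorm (x - y))\<^sup>2"
      if "x \<in> carrier_vec m" "y \<in> carrier_vec m" "vnorm x \<le> R" "vnorm y \<le> R" for x y
    proof -
      have eq: "\<phi> x + \<psi> x - (\<phi> y + \<psi> y) - (\<Sum>j<m. (L j y + K j y) * (x $ j - y $ j)) =
        (\<phi> x - \<phi> y - (\<Sum>j<m. L j y * (x $ j - y $ j))) + (\<psi> x - \<psi> y - (\<Sum>j<m. K j y * (x $ j - y $ j)))"
        by (simp add: distrib_right sum.distrib)
      show ?thesis unfolding eq using norm_triangle_le[OF add_mono[OF C[OF that] D[OF that]]]
        by (simp add: distrib_right)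
    qed
    then show "\<exists>C. \<forall>x\<in>carrier_vec m. \<forall>y\<in>carrier_vec m. vnorm x \<le> R \<longrightarrow> vnorm y \<le> R \<longrightarrow>
      cmod (\<phi> x + \<psi> x - (\<phi> y + \<psi> y) - (\<Sum>j<m. (L j y + K j y) * (x $ j - y $ j))) \<le> C * (vnorm (x - y))\<^sup>2"
      by blast
  qed (use L(1) K(1) in \<open>auto intro: polyfun_add\<close>)
next
  case (cong \<phi> \<psi>)
  then show ?case by simp
next
  case (mult \<phi> \<psi>)
  obtain L where L: "\<forall>j<m. polyfun m (L j)" "\<And>R. \<exists>C. \<forall>x\<in>carrier_vec m. \<forall>y\<in>carrier_vec m.
    vnorm x \<le> R \<longrightarrow> vnorm y \<le> R \<longrightarrow>
    cmod (\<phi> x - \<phi> y - (\<Sum>j<m. L j y * (x $ j - y $ j))) \<le> C * (vnorm (x - y))\<^sup>2" using mult by auto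
  obtain K where K: "\<forall>j<m. polyfun m (K j)" "\<And>R. \<exists>C. \<forall>x\<in>carrier_vec m. \<forall>y\<in>carrier_vec m.
    vnorm x \<le> R \<longrightarrow> vnorm y \<le> R \<longrightarrow>
    cmod (\<psi> x - \<psi> y - (\<Sum>j<m. K j y * (x $ j - y $ j))) \<le> C * (vnorm (x - y))\<^sup>2" using mult by auto
  have poly: "polyfun m \<phi>" "polyfun m \<psi>" using mult by auto
  show ?case
  proof (intro exI[of _ "\<lambda>j x. \<phi> x * K j x + \<psi> x * L j x"] conjI allI impI)
    fix R
    obtain C where C: "\<And>x y. x \<in> carrier_vec m \<Longrightarrow> y \<in> carrier_vec m \<Longrightarrow> vnorm x \<le> R \<Longrightarrow> vnorm y \<le> R \<Longrightarrow>
      cmod (\<phi> x - \<phi> y - (\<Sum>j<m. L j y * (x $ j - y $ j))) \<le> C * (vnorm (x - y))\<^sup>2" using L(2)[of R] by auto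
    obtain D where D: "\<And>x y. x \<in> carrier_vec m \<Longrightarrow> y \<in> carrier_vec m \<Longrightarrow> vnorm x \<le> R \<Longrightarrow> vnorm y \<le> R \<Longrightarrow>
      cmod (\<psi> x - \<psi> y - (\<Sum>j<m. K j y * (x $ j - y $ j))) \<le> D * (vnorm (x - y))\<^sup>2" using K(2)[of R] by auto
    obtain C' where C': "C' \<ge> 0" "\<And>x y. x \<in> carrier_vec m \<Longrightarrow> y \<in> carrier_vec m \<Longrightarrow> vnorm x \<le> R \<Longrightarrow> vnorm y \<le> R \<Longrightarrow>
      cmod (\<phi> x - \<phi> y) \<le> C' * vnorm (x - y)" using taylor_imp_lipschitz[OF L(1), of R \<phi> C] C by blast
    obtain D' where D': "D' \<ge> 0" "\<And>x y. x \<in> carrier_vec m \<Longrightarrow> y \<in> carrier_vec m \<Longrightarrow> vnorm x \<le> R \<Longrightarrow> vnorm y \<le> R \<Longrightarrow>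
      cmod (\<psi> x - \<psi> y) \<le> D' * vnorm (x - y)" using taylor_imp_lipschitz[OF K(1), of R \<psi> D] D by blast
    obtain E where E: "\<And>x. x \<in> carrier_vec m \<Longrightarrow> vnorm x \<le> R \<Longrightarrow> cmod (\<phi> x) \<le> E"
      using polyfun_bounded[OF poly(1), of R] by blast
    obtain F where F: "\<And>x. x \<in> carrier_vec m \<Longrightarrow> vnorm x \<le> R \<Longrightarrow> cmod (\<psi> x) \<le> F"
      using polyfun_bounded[OF poly(2), of R] by blast
    have "cmod (\<phi> x * \<psi> x - \<phi> y * \<psi> y - (\<Sum>j<m. (\<phi> y * K j y + \<psi> y * L j y) * (x $ j - y $ j)))
      \<le> (E * D + F * C + C' * D') * (vnorm (x - y))\<^sup>2"
      if xy: "x \<in> carrier_vec m" "y \<in> carrier_vec m" "vnorm x \<le> R" "vnorm y \<le> R" for x y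
    proof -
      let ?A = "\<phi> x - \<phi> y - (\<Sum>j<m. L j y * (x $ j - y $ j))"
      let ?B = "\<psi> x - \<psi> y - (\<Sum>j<m. K j y * (x $ j - y $ j))"
      have s: "(\<Sum>j<m. (\<phi> y * K j y + \<psi> y * L j y) * (x $ j - y $ j)) =
        \<phi> y * (\<Sum>j<m. K j y * (x $ j - y $ j)) + \<psi> y * (\<Sum>j<m. L j y * (x $ j - y $ j))"
        unfolding sum_distrib_left sum.distrib[symmetric]
        by (intro sum.cong refl) (simp add: algebra_simps)
      \<comment> \<open>Leibniz rule: besides the two weighted remainders there is the product of
        the increments, which is quadratic by the Lipschitz bounds.\<close>
      have "\<phi> x * \<psi> x - \<phi> y * \<psi> y - (\<Sum>j<m. (\<phi> y * K j y + \<psi> y * L j y) * (x $ j - y $ j)) =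
        \<phi> y * ?B + \<psi> y * ?A + (\<phi> x - \<phi> y) * (\<psi> x - \<psi> y)"
        unfolding s by (simp add: algebra_simps)
      moreover have b1: "cmod (\<phi> y * ?B) \<le> E * (D * (vnorm (x - y))\<^sup>2)"
        unfolding norm_mult using E[OF xy(2,4)] D[OF xy] order_trans[OF norm_ge_zero E[OF xy(2,4)]]
        by (intro mult_mono) auto
      moreover have b2: "cmod (\<psi> y * ?A) \<le> F * (C * (vnorm (x - y))\<^sup>2)"
        unfolding norm_mult using F[OF xy(2,4)] C[OF xy] order_trans[OF norm_ge_zero F[OF xy(2,4)]]
        by (intro mult_mono) auto
      moreover have b3: "cmod ((\<phi> x - \<phi> y) * (\<psi> x - \<psi> y)) \<le> (C' * vnorm (x - y)) * (D' * vnorm (x - y))"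
        unfolding norm_mult using C'(1) C'(2)[OF xy] D'(2)[OF xy] by (intro mult_mono) auto
      ultimately have "cmod (\<phi> x * \<psi> x - \<phi> y * \<psi> y - (\<Sum>j<m. (\<phi> y * K j y + \<psi> y * L j y) * (x $ j - y $ j)))
        \<le> E * (D * (vnorm (x - y))\<^sup>2) + F * (C * (vnorm (x - y))\<^sup>2) + (C' * vnorm (x - y)) * (D' * vnorm (x - y))"
        using norm_triangle_le[OF add_mono[OF norm_triangle_le[OF add_mono[OF b1 b2]] b3]] by metis
      then show ?thesis by (simp add: algebra_simps power2_eq_square)
    qed
    then show "\<exists>C. \<forall>x\<in>carrier_vec m. \<forall>y\<in>carrier_vec m. vnorm x \<le> R \<longrightarrow> vnorm y \<le> R \<longrightarrow>
      cmod (\<phi> x * \<psi> x - \<phi> y * \<psi> y - (\<Sum>j<m. (\<phi> y * K j y + \<psi> y * L j y) * (x $ j - y $ j))) \<le> C * (vnorm (x - y))\<^sup>2"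
      by blast
    show "polyfun m (\<lambda>x. \<phi> x * K j x + \<psi> x * L j x)" if "j < m" for j
      by (rule polyfun_add[OF polyfun_mult[OF poly(1) K(1)[rule_format, OF that]]
            polyfun_mult[OF poly(2) L(1)[rule_format, OF that]]])
  qed
qed

lemma polyfun_lipschitz:
  assumes "polyfun m \<phi>"
  shows "\<exists>D\<ge>0. \<forall>x\<in>carrier_vec m. \<forall>y\<in>carrier_vec m. vnorm x \<le> R \<longrightarrow> vnorm y \<le> R \<longrightarrow>
    cmod (\<phi> x - \<phi> y) \<le> D * vnorm (x - y)"
proof -
  obtain L where L: "\<forall>j<m. polyfun m (L j)" "\<forall>R. \<exists>C. \<forall>x\<in>carrier_vec m. \<forall>y\<in>carrier_vec m.
    vnorm x \<le> R \<longrightarrow> vnorm y \<le> R \<longrightarrow>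
    cmod (\<phi> x - \<phi> y - (\<Sum>j<m. L j y * (x $ j - y $ j))) \<le> C * (vnorm (x - y))\<^sup>2"
    using polyfun_taylor[OF assms] by (elim exE conjE)
  from L(2)[THEN spec, of R] obtain C where C: "\<forall>x\<in>carrier_vec m. \<forall>y\<in>carrier_vec m.
    vnorm x \<le> R \<longrightarrow> vnorm y \<le> R \<longrightarrow>
    cmod (\<phi> x - \<phi> y - (\<Sum>j<m. L j y * (x $ j - y $ j))) \<le> C * (vnorm (x - y))\<^sup>2" ..
  show ?thesis
    by (rule taylor_imp_lipschitz[OF L(1), where C = C]) (use C in blast)
qed

section \<open>Holomorphic functions of several variables\<close>

text \<open>Cauchy's inequality on circles of radius s < r, whose closed discs lie in the domain,
  followed by s -> r.\<close>

lemma taylor_coeff_bound: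
  assumes "u holomorphic_on ball 0 r" "0 < r" and M: "\<And>w. cmod w < r \<Longrightarrow> cmod (u w) \<le> M"
  shows "cmod ((deriv ^^ j) u 0 / fact j) \<le> M / r ^ j"
proof -
  let ?a = "cmod ((deriv ^^ j) u 0 / fact j)"
  have *: "?a * s ^ j \<le> M" if s: "0 < s" "s < r" for s
  proof -
    have "cball 0 s \<subseteq> ball (0::complex) r" using s by auto
    then have "cmod ((deriv ^^ j) u 0) \<le> fact j * M / s ^ j"
      using assms(1) s by (intro Cauchy_inequality)
        (auto intro: holomorphic_on_subset holomorphic_on_imp_continuous_on M)
    then show ?thesis using s by (simp add: norm_divide field_simps)
  qed
  have "((\<lambda>s. ?a * s ^ j) \<longlongrightarrow> ?a * r ^ j) (at_left r)" by (intro tendsto_intros)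
  then have "?a * r ^ j \<le> M"
    by (rule tendsto_upperbound)
       (use assms(2) * in \<open>auto simp: eventually_at_left intro!: exI[of _ 0]\<close>)
  then show ?thesis using assms(2) by (simp add: field_simps)
qed

text \<open>The tail of the Taylor series is dominated by a geometric series of ratio at most 1/2,
  whence the factor 2.\<close>

lemma taylor_remainder_bound:
  assumes "u holomorphic_on ball 0 r" "0 < r" and M: "\<And>w. cmod w < r \<Longrightarrow> cmod (u w) \<le> M"
    and w: "cmod w \<le> r / 2"
  shows "cmod (u w - (\<Sum>j<k. (deriv ^^ j) u 0 / fact j * w ^ j)) \<le> 2 * M * (cmod w / r) ^ k"
proof -
  let ?a = "\<lambda>j. (deriv ^^ j) u 0 / fact j"
  have "(\<lambda>j. ?a j * (w - 0) ^ j) sums u w"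
    by (rule holomorphic_power_series[OF assms(1)]) (use assms(2) w in auto)
  then have "(\<lambda>j. ?a (j + k) * w ^ (j + k)) sums (u w - (\<Sum>j<k. ?a j * w ^ j))"
    by (intro sums_split_initial_segment) simp
  moreover have "(\<lambda>j. M * (cmod w / r) ^ k * (cmod w / r) ^ j) sums (M * (cmod w / r) ^ k * (1 / (1 - cmod w / r)))"
    using w assms(2) by (intro sums_mult geometric_sums) (auto simp: field_simps)
  moreover have "cmod (?a (j + k) * w ^ (j + k)) \<le> M * (cmod w / r) ^ k * (cmod w / r) ^ j" for j
  proof -
    have "cmod (?a (j + k) * w ^ (j + k)) = cmod (?a (j + k)) * cmod w ^ (j + k)"
      by (simp only: norm_mult norm_power)
    also have "\<dots> \<le> M / r ^ (j + k) * cmod w ^ (j + k)"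
      by (intro mult_right_mono taylor_coeff_bound assms) auto
    also have "\<dots> = M * (cmod w / r) ^ k * (cmod w / r) ^ j"
      by (simp add: power_divide power_add mult_ac)
    finally show ?thesis .
  qed
  ultimately have "cmod (u w - (\<Sum>j<k. ?a j * w ^ j)) \<le> M * (cmod w / r) ^ k * (1 / (1 - cmod w / r))"
    using norm_sums_le by blast
  also have "\<dots> \<le> M * (cmod w / r) ^ k * 2"
  proof (rule mult_left_mono)
    show "1 / (1 - cmod w / r) \<le> 2" using w assms(2) by (simp add: field_simps)
    have "0 \<le> M" using order_trans[OF norm_ge_zero M[of 0]] assms(2) by simp
    then show "0 \<le> M * (cmod w / r) ^ k" using assms(2) by simp
  qed
  finally show ?thesis by (simp add: mult_ac)
qed

text \<open>Each coefficient is a limit of difference quotients of the function and the lower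
  coefficients, uniformly in the parameter because of the common bound.\<close>

lemma holomorphic_taylor_coeff:
  assumes "0 < r" "open S"
    and M: "\<And>t s. cmod t < r \<Longrightarrow> s \<in> S \<Longrightarrow> cmod (\<psi> t s) \<le> M"
    and h1: "\<And>s. s \<in> S \<Longrightarrow> (\<lambda>t. \<psi> t s) holomorphic_on ball 0 r"
    and h2: "\<And>t. cmod t < r \<Longrightarrow> \<psi> t holomorphic_on S"
  shows "(\<lambda>s. (deriv ^^ j) (\<lambda>t. \<psi> t s) 0 / fact j) holomorphic_on S"
proof (induction j rule: less_induct)
  case (less k)
  let ?a = "\<lambda>j s. (deriv ^^ j) (\<lambda>t. \<psi> t s) 0 / fact j"
  \<comment> \<open>Sample points tending to 0, at most \<open>r / 2\<close> so that
    \<open>taylor_remainder_bound\<close> applies to each of them.\<close>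
  define w :: "nat \<Rightarrow> real" where "w n = r / 2 * inverse (real (Suc n))" for n
  have w: "0 < w n" "w n \<le> r / 2" for n using assms(1) by (auto simp: w_def field_simps)
  have wr: "cmod (of_real (w n)) < r" for n using w[of n] assms(1) by simp
  let ?q = "\<lambda>n s. (\<psi> (of_real (w n)) s - (\<Sum>j<k. ?a j s * of_real (w n) ^ j)) / of_real (w n) ^ k"
  have bound: "cmod (?q n s - ?a k s) \<le> 2 * \<bar>M\<bar> / r ^ Suc k * w n" if "s \<in> S" for n s
  proof -
    have "cmod (\<psi> (of_real (w n)) s - (\<Sum>j<Suc k. ?a j s * of_real (w n) ^ j)) \<le> 2 * M * (cmod (of_real (w n)) / r) ^ Suc k"
      by (rule taylor_remainder_bound[OF h1]) (use that assms(1) w M in \<open>auto simp: abs_of_pos\<close>)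
    also have "cmod (complex_of_real (w n)) = w n" using w(1)[of n] by simp
    also have "2 * M * (w n / r) ^ Suc k \<le> 2 * \<bar>M\<bar> * (w n / r) ^ Suc k"
      using w(1)[of n] assms(1) by (intro mult_right_mono) auto
    finally have "cmod (\<psi> (of_real (w n)) s - (\<Sum>j<Suc k. ?a j s * of_real (w n) ^ j)) / w n ^ k
      \<le> 2 * \<bar>M\<bar> * (w n / r) ^ Suc k / w n ^ k"
      using w(1)[of n] by (intro divide_right_mono) auto
    moreover have "?q n s - ?a k s = (\<psi> (of_real (w n)) s - (\<Sum>j<Suc k. ?a j s * of_real (w n) ^ j)) / of_real (w n) ^ k"
      using w(1)[of n] by (simp add: field_simps)
    ultimately show ?thesis
      using w(1)[of n] assms(1) by (simp add: norm_divide norm_power power_divide)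
  qed
  have "uniform_limit S ?q (?a k) sequentially"
  proof (rule uniform_limitI)
    fix e :: real assume "e > 0"
    have "w \<longlonglongrightarrow> 0" unfolding w_def
      using tendsto_mult_right_zero[OF LIMSEQ_inverse_real_of_nat, of "r / 2"] by simp
    then have "(\<lambda>n. 2 * \<bar>M\<bar> / r ^ Suc k * w n) \<longlonglongrightarrow> 2 * \<bar>M\<bar> / r ^ Suc k * 0" by (intro tendsto_intros)
    then have "\<forall>\<^sub>F n in sequentially. 2 * \<bar>M\<bar> / r ^ Suc k * w n < e"
      using \<open>e > 0\<close> by (intro order_tendstoD(2)) auto
    then show "\<forall>\<^sub>F n in sequentially. \<forall>s\<in>S. dist (?q n s) (?a k s) < e"
      by eventually_elim (use bound in \<open>auto simp: dist_norm intro: le_less_trans\<close>)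
  qed
  show ?case
  proof (rule holomorphic_uniform_sequence[OF assms(2)])
    show "?q n holomorphic_on S" for n
      using w(1)[of n] wr[of n] by (intro holomorphic_intros h2 less.IH) auto
    show "\<exists>d>0. cball x d \<subseteq> S \<and> uniform_limit (cball x d) ?q (?a k) sequentially" if "x \<in> S" for x
      using open_contains_cball_eq[OF assms(2)] that \<open>uniform_limit S ?q (?a k) sequentially\<close>
      by (meson uniform_limit_on_subset)
  qed
qed

section \<open>Multi-indices and power series in several variables\<close>

lemma multi_indices_0: "multi_indices 0 = {\<lambda>_. undefined}"
  unfolding multi_indices_def by simp

text \<open>Splits off the exponent of the last variable. The inverse resets it to
  \<open>undefined\<close>, because the elements of \<open>multi_indices m\<close> are
  extensional.\<close>

lemma multi_indices_Suc_bij: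
  "bij_betw (\<lambda>(j, \<alpha>). \<alpha>(m := j)) (UNIV \<times> multi_indices m) (multi_indices (Suc m))"
  by (rule bij_betw_byWitness[where f' = "\<lambda>\<beta>. (\<beta> m, \<beta>(m := undefined))"])
     (auto simp: multi_indices_def PiE_def extensional_def fun_eq_iff)

lemma monomial_fun_upd:
  fixes x :: "nat \<Rightarrow> 'a :: comm_monoid_mult"
  shows "(\<Prod>i<Suc m. x i ^ (\<alpha>(m := j)) i) = (\<Prod>i<m. x i ^ \<alpha> i) * x m ^ j"
  by (auto intro!: arg_cong2[of _ _ _ _ "(*)"] prod.cong)

text \<open>The sum is a product of \<open>m\<close> geometric series. Scaled by a Cauchy bound it
  majorizes a power series inside the polydisc.\<close>

lemma summable_on_monomials:
  fixes x :: "nat \<Rightarrow> real"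
  assumes "\<And>j. j < m \<Longrightarrow> 0 \<le> x j \<and> x j < 1"
  shows "(\<lambda>\<alpha>. \<Prod>j<m. x j ^ \<alpha> j) summable_on multi_indices m"
  using assms
proof (induction m)
  case 0
  then show ?case by (simp add: multi_indices_0)
next
  case (Suc m)
  let ?f = "\<lambda>\<alpha>. \<Prod>j<m. x j ^ \<alpha> j"
  have IH: "?f summable_on multi_indices m" using Suc by auto
  have "(\<lambda>(j, \<alpha>). ?f \<alpha> * x m ^ j) summable_on UNIV \<times> multi_indices m"
  proof (rule summable_on_SigmaI)
    show "((\<lambda>\<alpha>. case (j, \<alpha>) of (j, \<alpha>) \<Rightarrow> ?f \<alpha> * x m ^ j) has_sum (infsum ?f (multi_indices m) * x m ^ j)) (multi_indices m)" for j
      using has_sum_cmult_left[OF has_sum_infsum[OF IH]] by simp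
    have "summable (\<lambda>j. x m ^ j)" using Suc.prems[of m] by (intro summable_geometric) auto
    then have "(\<lambda>j. x m ^ j) summable_on UNIV"
      using Suc.prems[of m] by (intro norm_summable_imp_summable_on) auto
    then show "(\<lambda>j. infsum ?f (multi_indices m) * x m ^ j) summable_on UNIV"
      by (rule summable_on_cmult_right)
    show "0 \<le> (case (j, \<alpha>) of (j, \<alpha>) \<Rightarrow> ?f \<alpha> * x m ^ j)" for j \<alpha>
      using Suc.prems by (auto intro!: mult_nonneg_nonneg prod_nonneg)
  qed
  also have "(\<lambda>(j, \<alpha>). ?f \<alpha> * x m ^ j) = (\<lambda>p. (\<lambda>\<alpha>. \<Prod>j<Suc m. x j ^ \<alpha> j) ((\<lambda>(j, \<alpha>). \<alpha>(m := j)) p))"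
    using monomial_fun_upd[of x] by (auto simp: fun_eq_iff simp del: prod.lessThan_Suc)
  finally show ?case
    by (subst (asm) summable_on_reindex_bij_betw[OF multi_indices_Suc_bij])
qed

text \<open>Osgood's lemma by induction on the number of variables: expand in the last variable and
  apply the induction hypothesis to its Taylor coefficients.\<close>

lemma bounded_separately_holomorphic_power_series:
  assumes r: "0 < r"
    and bound: "\<And>y. (\<forall>j<m. cmod (y j) < r) \<Longrightarrow> cmod (\<phi> y) \<le> M"
    and hol: "\<And>y j. (\<forall>j<m. cmod (y j) < r) \<Longrightarrow> j < m \<Longrightarrow> (\<lambda>t. \<phi> (y(j := t))) holomorphic_on ball 0 r"
    and dep: "\<And>y y'. (\<forall>j<m. y j = y' j) \<Longrightarrow> \<phi> y = \<phi> y'"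
  shows "\<exists>c. (\<forall>\<alpha>\<in>multi_indices m. cmod (c \<alpha>) \<le> M / r ^ (\<Sum>j<m. \<alpha> j)) \<and>
    (\<forall>y. (\<forall>j<m. cmod (y j) < r) \<longrightarrow>
      ((\<lambda>\<alpha>. c \<alpha> * (\<Prod>j<m. y j ^ \<alpha> j)) has_sum \<phi> y) (multi_indices m))"
  using bound hol dep
proof (induction m arbitrary: \<phi> M)
  case 0
  have "\<phi> y = \<phi> (\<lambda>_. 0)" for y using 0(3) by auto
  then show ?case
    using 0(1) by (intro exI[of _ "\<lambda>_. \<phi> (\<lambda>_. 0)"]) (auto simp: multi_indices_0 has_sum_finite_iff)
next
  case (Suc m)
  define a where "a j y = (deriv ^^ j) (\<lambda>t. \<phi> (y(m := t))) 0 / fact j" for j y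
  have IH: "\<exists>c. (\<forall>\<alpha>\<in>multi_indices m. cmod (c \<alpha>) \<le> M / r ^ j / r ^ (\<Sum>j<m. \<alpha> j)) \<and>
    (\<forall>y. (\<forall>j<m. cmod (y j) < r) \<longrightarrow>
      ((\<lambda>\<alpha>. c \<alpha> * (\<Prod>j<m. y j ^ \<alpha> j)) has_sum a j y) (multi_indices m))" for j
  proof (rule Suc.IH)
    fix y :: "nat \<Rightarrow> complex" assume y: "\<forall>j<m. cmod (y j) < r"
    have h: "(\<lambda>t. \<phi> (y(m := t))) holomorphic_on ball 0 r"
    proof -
      have "\<forall>j<Suc m. cmod ((y(m := 0)) j) < r" using y r by (auto simp: less_Suc_eq)
      from Suc.prems(2)[OF this, of m] show ?thesis unfolding fun_upd_upd by blast
    qed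
    show "cmod (a j y) \<le> M / r ^ j"
      unfolding a_def using y by (intro taylor_coeff_bound[OF h r] Suc.prems) (auto simp: less_Suc_eq)
    fix i assume i: "i < m"
    have *: "(y(i := s, m := t)) = (y(m := t, i := s))" for s t using i by (auto simp: fun_upd_twist)
    have "(\<lambda>s. (deriv ^^ j) (\<lambda>t. \<phi> (y(i := s, m := t))) 0 / fact j) holomorphic_on ball 0 r"
    proof (rule holomorphic_taylor_coeff[OF r, where M = M])
      show "cmod (\<phi> (y(i := s, m := t))) \<le> M" if "cmod t < r" "s \<in> ball 0 r" for t s
        using y that by (intro Suc.prems) (auto simp: less_Suc_eq)
      show "(\<lambda>t. \<phi> (y(i := s, m := t))) holomorphic_on ball 0 r" if "s \<in> ball 0 r" for s
      proof -
        have "\<forall>j<Suc m. cmod ((y(i := s, m := 0)) j) < r" using y r that by (auto simp: less_Suc_eq)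
        from Suc.prems(2)[OF this, of m] show ?thesis unfolding fun_upd_upd by blast
      qed
      show "(\<lambda>s. \<phi> (y(i := s, m := t))) holomorphic_on ball 0 r" if "cmod t < r" for t
        unfolding * using i y that by (intro Suc.prems) (auto simp: less_Suc_eq)
    qed auto
    then show "(\<lambda>s. a j (y(i := s))) holomorphic_on ball 0 r" by (simp add: a_def)
  next
    fix y y' :: "nat \<Rightarrow> complex" assume "\<forall>j<m. y j = y' j"
    then have "\<phi> (y(m := t)) = \<phi> (y'(m := t))" for t
      by (intro Suc.prems) (auto simp: less_Suc_eq)
    then show "a j y = a j y'" by (simp add: a_def)
  qed
  have "\<exists>C. \<forall>j. (\<forall>\<alpha>\<in>multi_indices m. cmod (C j \<alpha>) \<le> M / r ^ j / r ^ (\<Sum>j<m. \<alpha> j)) \<and>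
    (\<forall>y. (\<forall>j<m. cmod (y j) < r) \<longrightarrow>
      ((\<lambda>\<alpha>. C j \<alpha> * (\<Prod>j<m. y j ^ \<alpha> j)) has_sum a j y) (multi_indices m))"
    by (intro choice allI IH)
  then obtain C where C: "\<And>j \<alpha>. \<alpha> \<in> multi_indices m \<Longrightarrow> cmod (C j \<alpha>) \<le> M / r ^ j / r ^ (\<Sum>j<m. \<alpha> j)"
    "\<And>j y. (\<forall>j<m. cmod (y j) < r) \<Longrightarrow>
      ((\<lambda>\<alpha>. C j \<alpha> * (\<Prod>j<m. y j ^ \<alpha> j)) has_sum a j y) (multi_indices m)"
    by blast
  define c where "c \<beta> = C (\<beta> m) (\<beta>(m := undefined))" for \<beta> :: "nat \<Rightarrow> nat"
  have c_upd: "c (\<alpha>(m := j)) = C j \<alpha>" if "\<alpha> \<in> multi_indices m" for \<alpha> j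
  proof -
    have "\<alpha>(m := undefined) = \<alpha>" using that by (auto simp: multi_indices_def PiE_def extensional_def)
    then show ?thesis by (simp add: c_def)
  qed
  have c_bound: "cmod (c \<beta>) \<le> M / r ^ (\<Sum>j<Suc m. \<beta> j)" if \<beta>: "\<beta> \<in> multi_indices (Suc m)" for \<beta>
  proof -
    obtain p where "p \<in> UNIV \<times> multi_indices m" "\<beta> = (\<lambda>(j, \<alpha>). \<alpha>(m := j)) p"
      using \<beta> unfolding bij_betw_imp_surj_on[OF multi_indices_Suc_bij[of m], symmetric] by blast
    then obtain j \<alpha> where j: "\<alpha> \<in> multi_indices m" "\<beta> = \<alpha>(m := j)"
      by (cases p) auto
    then have "(\<Sum>i<Suc m. \<beta> i) = (\<Sum>i<m. \<alpha> i) + j" by simp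
    then show ?thesis using C(1)[OF j(1), of j] c_upd[OF j(1)] r j(2)
      by (simp add: power_add field_simps)
  qed
  have "((\<lambda>\<beta>. c \<beta> * (\<Prod>j<Suc m. y j ^ \<beta> j)) has_sum \<phi> y) (multi_indices (Suc m))"
    if y: "\<forall>j<Suc m. cmod (y j) < r" for y
  proof -
    let ?g = "\<lambda>\<beta>. c \<beta> * (\<Prod>j<Suc m. y j ^ \<beta> j)"
    \<comment> \<open>Absolute convergence over all multi-indices, from the Cauchy bounds. It
      licenses the evaluation of the sum by iterated summation, over \<open>\<alpha>\<close> and
      then over the last exponent.\<close>
    have "(\<lambda>\<beta>. M * (\<Prod>j<Suc m. (cmod (y j) / r) ^ \<beta> j)) summable_on multi_indices (Suc m)"
      using y r by (intro summable_on_cmult_right summable_on_monomials) auto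
    then have "(\<lambda>\<beta>. norm (?g \<beta>)) summable_on multi_indices (Suc m)"
    proof (rule summable_on_comparison_test)
      fix \<beta> assume "\<beta> \<in> multi_indices (Suc m)"
      then have "cmod (c \<beta>) * (\<Prod>j<Suc m. cmod (y j) ^ \<beta> j) \<le>
        M / r ^ (\<Sum>j<Suc m. \<beta> j) * (\<Prod>j<Suc m. cmod (y j) ^ \<beta> j)"
        by (intro mult_right_mono c_bound prod_nonneg) auto
      also have "\<dots> = M * (\<Prod>j<Suc m. (cmod (y j) / r) ^ \<beta> j)"
        unfolding power_sum power_divide prod_dividef by simp
      finally show "norm (?g \<beta>) \<le> M * (\<Prod>j<Suc m. (cmod (y j) / r) ^ \<beta> j)"
        by (simp add: norm_mult norm_power prod_norm[symmetric] del: prod.lessThan_Suc)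
    qed auto
    then have "?g summable_on multi_indices (Suc m)" by (rule abs_summable_summable)
    then have "(\<lambda>p. ?g ((\<lambda>(j, \<alpha>). \<alpha>(m := j)) p)) summable_on UNIV \<times> multi_indices m"
      by (subst summable_on_reindex_bij_betw[OF multi_indices_Suc_bij])
    moreover have "((\<lambda>\<alpha>. ?g ((\<lambda>(j, \<alpha>). \<alpha>(m := j)) (j, \<alpha>))) has_sum (a j y * y m ^ j)) (multi_indices m)" for j
    proof -
      have "((\<lambda>\<alpha>. C j \<alpha> * (\<Prod>j<m. y j ^ \<alpha> j) * y m ^ j) has_sum (a j y * y m ^ j)) (multi_indices m)"
        using y by (intro has_sum_cmult_left C) auto
      then show ?thesis
        by (rule has_sum_cong[THEN iffD1, rotated])
           (use monomial_fun_upd[of y] c_upd in \<open>auto simp: mult_ac simp del: prod.lessThan_Suc\<close>)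
    qed
    moreover have "((\<lambda>j. a j y * y m ^ j) has_sum \<phi> y) UNIV"
    proof -
      have h: "(\<lambda>t. \<phi> (y(m := t))) holomorphic_on ball 0 r" using y by (intro Suc.prems) auto
      have s: "(\<lambda>j. a j y * (y m - 0) ^ j) sums \<phi> (y(m := y m))"
        unfolding a_def using y by (intro holomorphic_power_series[OF h]) auto
      have "summable (\<lambda>j. cmod (a j y * y m ^ j))"
      proof (rule summable_comparison_test)
        show "summable (\<lambda>j. M * (cmod (y m) / r) ^ j)"
          using y r by (intro summable_mult summable_geometric) auto
        have "cmod (a j y) \<le> M / r ^ j" for j
          unfolding a_def using y by (intro taylor_coeff_bound[OF h r] Suc.prems) (auto simp: less_Suc_eq)
        then have "cmod (a j y) * cmod (y m) ^ j \<le> M / r ^ j * cmod (y m) ^ j" for j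
          by (intro mult_right_mono) auto
        then show "\<exists>N. \<forall>j\<ge>N. norm (cmod (a j y * y m ^ j)) \<le> M * (cmod (y m) / r) ^ j"
          by (auto simp: norm_mult norm_power power_divide)
      qed
      with s show ?thesis by (intro norm_summable_imp_has_sum) auto
    qed
    ultimately have "((\<lambda>p. ?g ((\<lambda>(j, \<alpha>). \<alpha>(m := j)) p)) has_sum \<phi> y) (UNIV \<times> multi_indices m)"
      by (intro has_sum_SigmaI) auto
    then show ?thesis by (subst (asm) has_sum_reindex_bij_betw[OF multi_indices_Suc_bij])
  qed
  with c_bound show ?case by (intro exI[of _ c]) auto
qed

text \<open>Holomorphic functions on \<open>\<complex>\<^sup>m\<close>: this description, equivalent to the existence of local
  power series by Osgood's lemma, is visibly stable under composition and under limits.\<close>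

definition entire_fun :: "nat \<Rightarrow> (complex vec \<Rightarrow> complex) \<Rightarrow> bool" where
  "entire_fun m \<phi> \<longleftrightarrow>
     (\<forall>a\<in>carrier_vec m. \<exists>r>0. \<exists>M. \<forall>z\<in>carrier_vec m. vnorm z < r \<longrightarrow> cmod (\<phi> (a + z)) \<le> M) \<and>
     (\<forall>a\<in>carrier_vec m. \<forall>b\<in>carrier_vec m. (\<lambda>t. \<phi> (a + t \<cdot>\<^sub>v b)) holomorphic_on UNIV)"

lemma entire_fun_bounded:
  assumes "entire_fun m \<phi>" "a \<in> carrier_vec m"
  obtains r M where "r > 0" "\<And>z. z \<in> carrier_vec m \<Longrightarrow> vnorm z < r \<Longrightarrow> cmod (\<phi> (a + z)) \<le> M"
  using assms unfolding entire_fun_def by metis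

lemma entire_fun_line:
  assumes "entire_fun m \<phi>" "a \<in> carrier_vec m" "b \<in> carrier_vec m"
  shows "(\<lambda>t. \<phi> (a + t \<cdot>\<^sub>v b)) holomorphic_on UNIV"
  using assms unfolding entire_fun_def by metis

lemma entire_fun_power_series:
  assumes e: "entire_fun m \<phi>" and a: "a \<in> carrier_vec m"
  shows "\<exists>r>0. \<exists>c. \<forall>y\<in>carrier_vec m. (\<forall>j<m. cmod (y $ j) < r) \<longrightarrow>
        ((\<lambda>\<alpha>. c \<alpha> * vec_monomial m \<alpha> y) has_sum (\<phi> (a + y))) (multi_indices m)"
proof -
  obtain r M where r: "r > 0" and M: "\<And>z. z \<in> carrier_vec m \<Longrightarrow> vnorm z < r \<Longrightarrow> cmod (\<phi> (a + z)) \<le> M"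
    using entire_fun_bounded[OF e a] by blast
  have "\<exists>c. (\<forall>\<alpha>\<in>multi_indices m. cmod (c \<alpha>) \<le> M / r ^ (\<Sum>j<m. \<alpha> j)) \<and>
    (\<forall>y. (\<forall>j<m. cmod (y j) < r) \<longrightarrow>
      ((\<lambda>\<alpha>. c \<alpha> * (\<Prod>j<m. y j ^ \<alpha> j)) has_sum \<phi> (a + vec m y)) (multi_indices m))"
  proof (rule bounded_separately_holomorphic_power_series[OF r])
    fix y :: "nat \<Rightarrow> complex"
    assume "\<forall>j<m. cmod (y j) < r"
    with r show "cmod (\<phi> (a + vec m y)) \<le> M" by (intro M) (auto simp: vnorm_less_iff[of _ m])
  next
    fix y :: "nat \<Rightarrow> complex" and j assume j: "j < m"
    have *: "a + vec m (y(j := t)) = (a + vec m (y(j := 0))) + t \<cdot>\<^sub>v unit_vec m j" for t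
      using a j by (intro eq_vecI) auto
    show "(\<lambda>t. \<phi> (a + vec m (y(j := t)))) holomorphic_on ball 0 r"
      by (rule holomorphic_transform[OF holomorphic_on_subset[OF entire_fun_line[OF e,
            of "a + vec m (y(j := 0))" "unit_vec m j"]]])
         (use a *[symmetric] in auto)
  next
    fix y y' :: "nat \<Rightarrow> complex" assume "\<forall>j<m. y j = y' j"
    then have "vec m y = vec m y'" by (intro eq_vecI) auto
    then show "\<phi> (a + vec m y) = \<phi> (a + vec m y')" by simp
  qed
  then obtain c where c: "\<And>y. (\<forall>j<m. cmod (y j) < r) \<Longrightarrow>
      ((\<lambda>\<alpha>. c \<alpha> * (\<Prod>j<m. y j ^ \<alpha> j)) has_sum \<phi> (a + vec m y)) (multi_indices m)"
    by blast
  have "((\<lambda>\<alpha>. c \<alpha> * vec_monomial m \<alpha> y) has_sum (\<phi> (a + y))) (multi_indices m)"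
    if "y \<in> carrier_vec m" "\<forall>j<m. cmod (y $ j) < r" for y
  proof -
    have "vec m (\<lambda>j. y $ j) = y" using that by (intro eq_vecI) auto
    then show ?thesis using c[of "\<lambda>j. y $ j"] that by (simp add: vec_monomial_def)
  qed
  with r show ?thesis by blast
qed

lemma norm_vec_monomial_le:
  assumes "y \<in> carrier_vec m" "vnorm y \<le> s"
  shows "cmod (vec_monomial m \<alpha> y) \<le> s ^ (\<Sum>j<m. \<alpha> j)"
proof -
  have "cmod (vec_monomial m \<alpha> y) = (\<Prod>j<m. cmod (y $ j) ^ \<alpha> j)"
    by (simp add: vec_monomial_def prod_norm[symmetric] norm_power)
  also have "\<dots> \<le> (\<Prod>j<m. s ^ \<alpha> j)"
    using assms cmod_index_le_vnorm'[OF assms(1)]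
    by (intro prod_mono) (auto intro!: power_mono intro: order_trans)
  finally show ?thesis by (simp add: power_sum)
qed

lemma vec_monomial_const:
  "vec_monomial m \<alpha> (vec m (\<lambda>_. s)) = s ^ (\<Sum>j<m. \<alpha> j)"
  unfolding vec_monomial_def power_sum by (intro prod.cong) auto

text \<open>At the point with all coordinates \<open>r / 2\<close> every monomial becomes a power of
  \<open>r / 2\<close>, and unordered summability of complex numbers is absolute.\<close>

lemma power_series_majorant:
  assumes r: "r > 0" and s: "\<And>y. y \<in> carrier_vec m \<Longrightarrow> (\<forall>j<m. cmod (y $ j) < r) \<Longrightarrow>
        ((\<lambda>\<alpha>. c \<alpha> * vec_monomial m \<alpha> y) has_sum \<psi> y) (multi_indices m)"
  shows "(\<lambda>\<alpha>. cmod (c \<alpha>) * (r / 2) ^ (\<Sum>j<m. \<alpha> j)) summable_on multi_indices m"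
proof -
  have "(\<lambda>\<alpha>. c \<alpha> * vec_monomial m \<alpha> (vec m (\<lambda>_. of_real (r / 2)))) summable_on multi_indices m"
    using r by (intro has_sum_imp_summable[OF s]) auto
  then have "(\<lambda>\<alpha>. norm (c \<alpha> * vec_monomial m \<alpha> (vec m (\<lambda>_. of_real (r / 2))))) summable_on multi_indices m"
    by (simp only: summable_on_iff_abs_summable_on_complex)
  then show ?thesis
    using r unfolding vec_monomial_const by (simp add: norm_mult norm_power norm_divide)
qed

lemma vec_monomial_smult:
  assumes "b \<in> carrier_vec m"
  shows "vec_monomial m \<alpha> (t \<cdot>\<^sub>v b) = t ^ (\<Sum>j<m. \<alpha> j) * vec_monomial m \<alpha> b"
proof -
  have "vec_monomial m \<alpha> (t \<cdot>\<^sub>v b) = (\<Prod>j<m. t ^ \<alpha> j * b $ j ^ \<alpha> j)"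
    unfolding vec_monomial_def using assms by (intro prod.cong) (auto simp: power_mult_distrib)
  then show ?thesis by (simp add: prod.distrib power_sum vec_monomial_def)
qed

text \<open>On half the polydisc the terms are dominated by a summable majorant. This bounds the sum
  near the center, and along a line it makes the partial sums, polynomials in the parameter,
  converge uniformly.\<close>

lemma power_series_imp_entire_fun:
  assumes s: "\<And>a. a \<in> carrier_vec m \<Longrightarrow> \<exists>r>0. \<exists>c. \<forall>y\<in>carrier_vec m. (\<forall>j<m. cmod (y $ j) < r) \<longrightarrow>
        ((\<lambda>\<alpha>. c \<alpha> * vec_monomial m \<alpha> y) has_sum (\<phi> (a + y))) (multi_indices m)"
  shows "entire_fun m \<phi>"
  unfolding entire_fun_def
proof (intro conjI ballI)
  fix a :: "complex vec" assume a: "a \<in> carrier_vec m"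
  obtain r c where r: "r > 0" and rc: "\<And>y. y \<in> carrier_vec m \<Longrightarrow> (\<forall>j<m. cmod (y $ j) < r) \<Longrightarrow>
        ((\<lambda>\<alpha>. c \<alpha> * vec_monomial m \<alpha> y) has_sum (\<phi> (a + y))) (multi_indices m)" using s[OF a] by blast
  let ?b = "\<lambda>\<alpha>. cmod (c \<alpha>) * (r / 2) ^ (\<Sum>j<m. \<alpha> j)"
  have b: "?b summable_on multi_indices m"
    by (rule power_series_majorant[OF r rc])
  have "cmod (\<phi> (a + z)) \<le> infsum ?b (multi_indices m)" if z: "z \<in> carrier_vec m" "vnorm z < r / 2" for z
  proof -
    have "((\<lambda>\<alpha>. c \<alpha> * vec_monomial m \<alpha> z) has_sum (\<phi> (a + z))) (multi_indices m)"
    proof (rule rc[OF z(1)])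
      have "vnorm z < r" using z r by simp
      then show "\<forall>j<m. cmod (z $ j) < r" using vnorm_less_iff[OF z(1)] by blast
    qed
    moreover have le: "cmod (c \<alpha> * vec_monomial m \<alpha> z) \<le> ?b \<alpha>" for \<alpha>
      unfolding norm_mult using z by (intro mult_left_mono norm_vec_monomial_le) auto
    moreover have n: "(\<lambda>\<alpha>. cmod (c \<alpha> * vec_monomial m \<alpha> z)) summable_on multi_indices m"
      by (rule summable_on_comparison_test[OF b]) (use le in auto)
    ultimately show ?thesis
      using norm_has_sum_bound[OF has_sum_infsum[OF n]] infsum_mono[OF n b] order_trans by blast
  qed
  then show "\<exists>r>0. \<exists>M. \<forall>z\<in>carrier_vec m. vnorm z < r \<longrightarrow> cmod (\<phi> (a + z)) \<le> M"
    using r by (intro exI[of _ "r / 2"]) auto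
next
  fix a b :: "complex vec" assume a: "a \<in> carrier_vec m" and b: "b \<in> carrier_vec m"
  show "(\<lambda>t. \<phi> (a + t \<cdot>\<^sub>v b)) holomorphic_on UNIV"
  proof (rule holomorphic_onI, rule field_differentiable_at_within)
    fix t
    have at: "a + t \<cdot>\<^sub>v b \<in> carrier_vec m" using a b by simp
    obtain r c where r: "r > 0" and rc: "\<And>y. y \<in> carrier_vec m \<Longrightarrow> (\<forall>j<m. cmod (y $ j) < r) \<Longrightarrow>
        ((\<lambda>\<alpha>. c \<alpha> * vec_monomial m \<alpha> y) has_sum (\<phi> (a + t \<cdot>\<^sub>v b + y))) (multi_indices m)" using s[OF at] by blast
    let ?b = "\<lambda>\<alpha>. cmod (c \<alpha>) * (r / 2) ^ (\<Sum>j<m. \<alpha> j)"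
    have bs: "?b summable_on multi_indices m" by (rule power_series_majorant[OF r rc])
    \<comment> \<open>For |w| \<le> d the point \<open>w \<cdot>\<^sub>v b\<close> stays within
      radius \<open>r / 2\<close>; the summand 1 covers the direction b = 0.\<close>
    define d where "d = r / (2 * (1 + vnorm b))"
    have d: "d > 0" using r by (simp add: d_def add_pos_nonneg)
    have db: "d * vnorm b \<le> r / 2"
    proof -
      have "d * vnorm b \<le> d * (1 + vnorm b)" using d by simp
      also have "\<dots> = r / 2" using vnorm_nonneg[of b] by (simp add: d_def field_simps add_nonneg_eq_0_iff)
      finally show ?thesis .
    qed
    let ?f = "\<lambda>\<alpha> w. c \<alpha> * (w ^ (\<Sum>j<m. \<alpha> j) * vec_monomial m \<alpha> b)"
    let ?g = "\<lambda>w. \<phi> (a + t \<cdot>\<^sub>v b + w \<cdot>\<^sub>v b)"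
    have n: "vnorm (w \<cdot>\<^sub>v b) \<le> r / 2" if "w \<in> cball 0 d" for w
    proof -
      have "vnorm (w \<cdot>\<^sub>v b) \<le> d * vnorm b"
        unfolding vnorm_smult[OF b] using that by (intro mult_right_mono) auto
      with db show ?thesis by simp
    qed
    have "uniform_limit (cball 0 d) (\<lambda>X w. \<Sum>\<alpha>\<in>X. ?f \<alpha> w) ?g (finite_subsets_at_top (multi_indices m))"
    proof (rule Weierstrass_m_test_general'[OF _ _ bs])
      fix \<alpha> w assume w: "w \<in> cball (0::complex) d"
      show "norm (?f \<alpha> w) \<le> ?b \<alpha>"
        unfolding norm_mult[of "c \<alpha>"] vec_monomial_smult[OF b, symmetric]
        using n[OF w] b by (intro mult_left_mono norm_vec_monomial_le) auto
    next
      fix w assume w: "w \<in> cball (0::complex) d"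
      have "vnorm (w \<cdot>\<^sub>v b) < r" using n[OF w] r by simp
      then show "((\<lambda>\<alpha>. ?f \<alpha> w) has_sum ?g w) (multi_indices m)"
        unfolding vec_monomial_smult[OF b, symmetric]
        using b by (intro rc) (auto simp: vnorm_less_iff[of _ m] simp del: index_smult_vec)
    qed
    then have "?g holomorphic_on ball 0 d"
      by (rule holomorphic_uniform_limit[rotated])
         (auto intro!: always_eventually holomorphic_intros continuous_intros)
    then have "?g field_differentiable at 0"
      using d by (intro holomorphic_on_imp_differentiable_at) auto
    then have "(?g \<circ> (\<lambda>w. w - t)) field_differentiable at t"
      by (intro field_differentiable_compose) (auto intro!: derivative_intros)
    moreover have "?g \<circ> (\<lambda>w. w - t) = (\<lambda>t. \<phi> (a + t \<cdot>\<^sub>v b))"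
    proof
      fix w
      have "a + t \<cdot>\<^sub>v b + (w - t) \<cdot>\<^sub>v b = a + w \<cdot>\<^sub>v b"
        using a b by (intro eq_vecI) (auto simp: algebra_simps)
      then show "(?g \<circ> (\<lambda>w. w - t)) w = \<phi> (a + w \<cdot>\<^sub>v b)" by simp
    qed
    ultimately show "(\<lambda>t. \<phi> (a + t \<cdot>\<^sub>v b)) field_differentiable at t" by simp
  qed
qed

lemma entire_fun_iff_power_series:
  "entire_fun m \<phi> \<longleftrightarrow> (\<forall>a\<in>carrier_vec m. \<exists>r>0. \<exists>c. \<forall>y\<in>carrier_vec m. (\<forall>j<m. cmod (y $ j) < r) \<longrightarrow>
        ((\<lambda>\<alpha>. c \<alpha> * vec_monomial m \<alpha> y) has_sum (\<phi> (a + y))) (multi_indices m))"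
  by (rule iffI, rule ballI, erule (1) entire_fun_power_series)
     (rule power_series_imp_entire_fun, erule (1) bspec)

lemma analytic_map_iff_entire_fun:
  "analytic_map m h \<longleftrightarrow>
     (\<forall>x\<in>carrier_vec m. h x \<in> carrier_vec m) \<and> (\<forall>i<m. entire_fun m (\<lambda>x. h x $ i))"
proof -
  have swap: "(\<forall>a\<in>S. \<forall>i<m. Q a i) \<longleftrightarrow> (\<forall>i<m. \<forall>a\<in>S. Q a i)" for S :: "complex vec set" and Q
    by blast
  show ?thesis unfolding analytic_map_def swap entire_fun_iff_power_series ..
qed

text \<open>The constant and linear terms of the local power series are split off. Each remaining
  monomial has degree at least 2, so on the ball of radius \<open>r / 2\<close> it is at most its
  value bound at that radius times (2|y|/r)^2.\<close>

lemma entire_fun_quadratic_approx: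
  assumes e: "entire_fun m \<phi>" and a: "a \<in> carrier_vec m"
  shows "\<exists>L C r. r > 0 \<and> (\<forall>y\<in>carrier_vec m. vnorm y \<le> r \<longrightarrow>
    cmod (\<phi> (a + y) - \<phi> a - (\<Sum>j<m. L j * y $ j)) \<le> C * (vnorm y)\<^sup>2)"
proof -
  obtain r c where r: "r > 0" and rc: "\<And>y. y \<in> carrier_vec m \<Longrightarrow> (\<forall>j<m. cmod (y $ j) < r) \<Longrightarrow>
        ((\<lambda>\<alpha>. c \<alpha> * vec_monomial m \<alpha> y) has_sum (\<phi> (a + y))) (multi_indices m)"
    using entire_fun_power_series[OF e a] by blast
  let ?b = "\<lambda>\<alpha>. cmod (c \<alpha>) * (r / 2) ^ (\<Sum>j<m. \<alpha> j)"
  have b: "?b summable_on multi_indices m" by (rule power_series_majorant[OF r rc])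
  \<comment> \<open>The multi-indices of degree 0 and 1; all others have degree at least 2 by
    \<open>deg\<close>.\<close>
  define z where "z = (\<lambda>j\<in>{..<m}. 0::nat)"
  define e where "e i = (\<lambda>j\<in>{..<m}. if j = i then 1 else 0::nat)" for i
  let ?T = "insert z (e ` {..<m})"
  have "z \<in> multi_indices m" "e i \<in> multi_indices m" for i
    unfolding z_def e_def multi_indices_def by (simp_all only: restrict_PiE_iff) simp_all
  then have T: "?T \<subseteq> multi_indices m" "finite ?T" by auto
  have inj: "inj_on e {..<m}"
  proof (rule inj_onI)
    fix i j assume "i \<in> {..<m}" "j \<in> {..<m}" "e i = e j"
    then have "e i i = e j i" by simp
    then show "i = j" using \<open>i \<in> {..<m}\<close> by (auto simp: e_def split: if_splits)
  qed
  have z_notin: "z \<notin> e ` {..<m}"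
  proof
    assume "z \<in> e ` {..<m}"
    then obtain i where i: "i < m" "z = e i" by auto
    then have "z i = e i i" by simp
    then show False using i by (simp add: z_def e_def)
  qed
  have deg: "2 \<le> (\<Sum>j<m. \<alpha> j)" if \<alpha>: "\<alpha> \<in> multi_indices m - ?T" for \<alpha>
  proof (rule ccontr)
    have ext: "\<alpha> j = undefined" if "\<not> j < m" for j
      using \<alpha> that by (auto simp: multi_indices_def PiE_def extensional_def)
    assume "\<not> 2 \<le> (\<Sum>j<m. \<alpha> j)"
    then consider "(\<Sum>j<m. \<alpha> j) = 0" | "(\<Sum>j<m. \<alpha> j) = 1" by linarith
    then show False
    proof cases
      case 1
      then have "\<alpha> = z" using ext by (auto simp: z_def fun_eq_iff)
      with \<alpha> show False by simp
    next
      case 2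
      then obtain i where "i < m" "\<alpha> i = 1" "\<forall>j\<in>{..<m}. i \<noteq> j \<longrightarrow> \<alpha> j = 0"
        using sum_eq_1_iff[of "{..<m}" \<alpha>] by auto
      then have "\<alpha> = e i" using ext by (auto simp: e_def fun_eq_iff)
      with \<alpha> \<open>i < m\<close> show False by simp
    qed
  qed
  have mono_z: "vec_monomial m z y = 1" for y by (simp add: vec_monomial_def z_def)
  have mono_e: "vec_monomial m (e i) y = y $ i" if "i < m" for i y
  proof -
    have "vec_monomial m (e i) y = (\<Prod>j<m. if j = i then y $ j else 1)"
      unfolding vec_monomial_def e_def by (intro prod.cong) auto
    with that show ?thesis by (simp add: prod.delta)
  qed
  let ?R = "multi_indices m - ?T"
  have bR: "?b summable_on ?R" by (rule summable_on_subset_banach[OF b]) auto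
  define C where "C = infsum ?b ?R * (2 / r)\<^sup>2"
  have main: "cmod (\<phi> (a + y) - c z - (\<Sum>j<m. c (e j) * y $ j)) \<le> C * (vnorm y)\<^sup>2"
    if y: "y \<in> carrier_vec m" "vnorm y \<le> r / 2" for y
  proof -
    let ?t = "\<lambda>\<alpha>. c \<alpha> * vec_monomial m \<alpha> y"
    have "(?t has_sum (\<phi> (a + y))) (multi_indices m)"
    proof (rule rc[OF y(1)])
      have "vnorm y < r" using y r by simp
      then show "\<forall>j<m. cmod (y $ j) < r" using vnorm_less_iff[OF y(1)] by blast
    qed
    then have "(?t has_sum (\<phi> (a + y) - sum ?t ?T)) ?R"
      using T by (intro has_sum_Diff has_sum_finite)
    moreover have "sum ?t ?T = c z + (\<Sum>j<m. c (e j) * y $ j)"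
      using z_notin by (simp add: mono_z sum.reindex[OF inj] mono_e)
    ultimately have hs: "(?t has_sum (\<phi> (a + y) - c z - (\<Sum>j<m. c (e j) * y $ j))) ?R"
      by (simp add: algebra_simps)
    have le: "cmod (?t \<alpha>) \<le> ?b \<alpha> * ((2 / r)\<^sup>2 * (vnorm y)\<^sup>2)" if \<alpha>: "\<alpha> \<in> ?R" for \<alpha>
    proof -
      let ?d = "\<Sum>j<m. \<alpha> j"
      obtain k where k: "?d = k + 2" using deg[OF \<alpha>] by (metis add.commute le_iff_add)
      have "cmod (vec_monomial m \<alpha> y) \<le> vnorm y ^ ?d" using y by (intro norm_vec_monomial_le) auto
      also have "\<dots> = vnorm y ^ k * (vnorm y)\<^sup>2" by (simp only: k power_add)
      also have "\<dots> \<le> (r / 2) ^ k * (vnorm y)\<^sup>2"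
        using y by (intro mult_right_mono power_mono) auto
      also have "\<dots> = (r / 2) ^ k * ((r / 2)\<^sup>2 * (2 / r)\<^sup>2) * (vnorm y)\<^sup>2"
        using r by (simp add: power_mult_distrib[symmetric])
      also have "\<dots> = (r / 2) ^ ?d * ((2 / r)\<^sup>2 * (vnorm y)\<^sup>2)"
        by (simp only: k power_add mult.assoc)
      finally have "cmod (c \<alpha>) * cmod (vec_monomial m \<alpha> y) \<le> cmod (c \<alpha>) * ((r / 2) ^ ?d * ((2 / r)\<^sup>2 * (vnorm y)\<^sup>2))"
        by (intro mult_left_mono) auto
      then show ?thesis by (simp add: norm_mult mult_ac)
    qed
    have b': "(\<lambda>\<alpha>. ?b \<alpha> * ((2 / r)\<^sup>2 * (vnorm y)\<^sup>2)) summable_on ?R"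
      by (rule summable_on_cmult_left[OF bR])
    have n: "(\<lambda>\<alpha>. cmod (?t \<alpha>)) summable_on ?R"
      by (rule summable_on_comparison_test[OF b']) (use le in auto)
    have "cmod (\<phi> (a + y) - c z - (\<Sum>j<m. c (e j) * y $ j)) \<le> infsum (\<lambda>\<alpha>. cmod (?t \<alpha>)) ?R"
      by (rule norm_has_sum_bound[OF has_sum_infsum[OF n] hs])
    also have "\<dots> \<le> infsum (\<lambda>\<alpha>. ?b \<alpha> * ((2 / r)\<^sup>2 * (vnorm y)\<^sup>2)) ?R"
      using n b' le by (intro infsum_mono)
    also have "\<dots> = C * (vnorm y)\<^sup>2"
      unfolding C_def using bR by (subst infsum_cmult_left) auto
    finally show ?thesis .
  qed
  have "\<phi> a = c z"
    using main[of "0\<^sub>v m"] r a by simp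
  with main r show ?thesis
    by (intro exI[of _ "\<lambda>j. c (e j)"] exI[of _ C] exI[of _ "r / 2"]) auto
qed

lemma vnorm_leI:
  "x \<in> carrier_vec m \<Longrightarrow> 0 \<le> r \<Longrightarrow> (\<And>i. i < m \<Longrightarrow> cmod (x $ i) \<le> r) \<Longrightarrow> vnorm x \<le> r"
  by (simp add: vnorm_le_iff)

section \<open>Closure properties of entire functions\<close>

lemma entire_fun_cong:
  assumes "entire_fun m \<phi>" "\<And>x. x \<in> carrier_vec m \<Longrightarrow> \<psi> x = \<phi> x" shows "entire_fun m \<psi>"
proof -
  have "\<psi> (a + b) = \<phi> (a + b)" if "a \<in> carrier_vec m" "b \<in> carrier_vec m" for a b
    using that by (intro assms(2)) simp
  moreover have "\<psi> (a + t \<cdot>\<^sub>v b) = \<phi> (a + t \<cdot>\<^sub>v b)" if "a \<in> carrier_vec m" "b \<in> carrier_vec m" for a b t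
    using that by (intro assms(2)) simp
  ultimately show ?thesis using assms(1) unfolding entire_fun_def by simp
qed

lemma entire_fun_const: "entire_fun m (\<lambda>x. c)"
  unfolding entire_fun_def by (auto intro: exI[of _ 1])

lemma entire_fun_index:
  assumes "j < m" shows "entire_fun m (\<lambda>x. x $ j)"
  unfolding entire_fun_def
proof (intro conjI ballI)
  fix a :: "complex vec" assume a: "a \<in> carrier_vec m"
  have "cmod ((a + z) $ j) \<le> vnorm a + 1" if z: "z \<in> carrier_vec m" "vnorm z < 1" for z
    using vnorm_triangle[OF a z(1)] cmod_index_le_vnorm'[of "a + z" m j] a z assms by fastforce
  then show "\<exists>r>0. \<exists>M. \<forall>z\<in>carrier_vec m. vnorm z < r \<longrightarrow> cmod ((a + z) $ j) \<le> M"
    by (intro exI[of _ 1]) auto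
next
  fix a b :: "complex vec" assume "a \<in> carrier_vec m" "b \<in> carrier_vec m"
  then have "(\<lambda>t. (a + t \<cdot>\<^sub>v b) $ j) = (\<lambda>t. a $ j + t * b $ j)" using assms by auto
  then show "(\<lambda>t. (a + t \<cdot>\<^sub>v b) $ j) holomorphic_on UNIV" by (auto intro!: holomorphic_intros)
qed

lemma entire_fun_add:
  assumes "entire_fun m \<phi>" "entire_fun m \<psi>" shows "entire_fun m (\<lambda>x. \<phi> x + \<psi> x)"
  unfolding entire_fun_def
proof (intro conjI ballI)
  fix a :: "complex vec" assume a: "a \<in> carrier_vec m"
  obtain r M where r: "r > 0" "\<And>z. z \<in> carrier_vec m \<Longrightarrow> vnorm z < r \<Longrightarrow> cmod (\<phi> (a + z)) \<le> M"
    using entire_fun_bounded[OF assms(1) a] by blast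
  obtain s N where s: "s > 0" "\<And>z. z \<in> carrier_vec m \<Longrightarrow> vnorm z < s \<Longrightarrow> cmod (\<psi> (a + z)) \<le> N"
    using entire_fun_bounded[OF assms(2) a] by blast
  show "\<exists>r>0. \<exists>M. \<forall>z\<in>carrier_vec m. vnorm z < r \<longrightarrow> cmod (\<phi> (a + z) + \<psi> (a + z)) \<le> M"
    using r s by (intro exI[of _ "min r s"] conjI exI[of _ "M + N"]) (auto intro!: norm_triangle_le add_mono)
qed (use assms in \<open>auto intro!: holomorphic_intros entire_fun_line\<close>)

lemma entire_fun_mult:
  assumes "entire_fun m \<phi>" "entire_fun m \<psi>" shows "entire_fun m (\<lambda>x. \<phi> x * \<psi> x)"
  unfolding entire_fun_def
proof (intro conjI ballI)
  fix a :: "complex vec" assume a: "a \<in> carrier_vec m"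
  obtain r M where r: "r > 0" "\<And>z. z \<in> carrier_vec m \<Longrightarrow> vnorm z < r \<Longrightarrow> cmod (\<phi> (a + z)) \<le> M"
    using entire_fun_bounded[OF assms(1) a] by blast
  obtain s N where s: "s > 0" "\<And>z. z \<in> carrier_vec m \<Longrightarrow> vnorm z < s \<Longrightarrow> cmod (\<psi> (a + z)) \<le> N"
    using entire_fun_bounded[OF assms(2) a] by blast
  have "cmod (\<phi> (a + z) * \<psi> (a + z)) \<le> M * N" if z: "z \<in> carrier_vec m" "vnorm z < min r s" for z
  proof -
    have "cmod (\<phi> (a + z)) \<le> M" "cmod (\<psi> (a + z)) \<le> N" using r s z by auto
    moreover from this have "0 \<le> M" using norm_ge_zero order_trans by blast
    ultimately show ?thesis unfolding norm_mult by (intro mult_mono) auto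
  qed
  then show "\<exists>r>0. \<exists>M. \<forall>z\<in>carrier_vec m. vnorm z < r \<longrightarrow> cmod (\<phi> (a + z) * \<psi> (a + z)) \<le> M"
    using r(1) s(1) by (intro exI[of _ "min r s"]) auto
qed (use assms in \<open>auto intro!: holomorphic_intros entire_fun_line\<close>)

lemma entire_fun_sum:
  assumes "\<And>i. i \<in> I \<Longrightarrow> entire_fun m (\<phi> i)" shows "entire_fun m (\<lambda>x. \<Sum>i\<in>I. \<phi> i x)"
  using assms by (induction I rule: infinite_finite_induct) (auto intro: entire_fun_add entire_fun_const)

lemma entire_fun_diff:
  assumes "entire_fun m \<phi>" "entire_fun m \<psi>" shows "entire_fun m (\<lambda>x. \<phi> x - \<psi> x)"
  using entire_fun_add[OF assms(1) entire_fun_mult[OF entire_fun_const[of m "-1"] assms(2)]] by simp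

lemma entire_fun_polyfun_compose:
  assumes "polyfun n \<phi>" "\<And>x. x \<in> carrier_vec m \<Longrightarrow> h x \<in> carrier_vec n"
    "\<And>i. i < n \<Longrightarrow> entire_fun m (\<lambda>x. h x $ i)"
  shows "entire_fun m (\<lambda>x. \<phi> (h x))"
  using assms(1)
proof (induction rule: polyfun_induct)
  case (cong \<phi> \<psi>)
  show ?case by (rule entire_fun_cong[OF cong(1)]) (rule cong(2)[OF assms(2)])
qed (auto intro: entire_fun_const entire_fun_add entire_fun_mult assms)

lemma polyfun_imp_entire_fun: "polyfun m \<phi> \<Longrightarrow> entire_fun m \<phi>"
  by (rule entire_fun_polyfun_compose[of m \<phi> m "\<lambda>x. x"]) (auto intro: entire_fun_index)

lemma vnorm_mult_mat_vec_le:
  assumes "B \<in> carrier_mat n m"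
  shows "\<exists>\<beta>\<ge>0. \<forall>z\<in>carrier_vec m. vnorm (B *\<^sub>v z) \<le> \<beta> * vnorm z"
proof -
  let ?\<beta> = "\<Sum>i<n. \<Sum>j<m. cmod (B $$ (i, j))"
  have "vnorm (B *\<^sub>v z) \<le> ?\<beta> * vnorm z" if z: "z \<in> carrier_vec m" for z
  proof (subst vnorm_le_iff[of _ n], use assms z in simp, intro conjI allI impI)
    fix i assume i: "i < n"
    have "(B *\<^sub>v z) $ i = (\<Sum>j<m. B $$ (i, j) * z $ j)"
      using assms z i by (auto simp: scalar_prod_def atLeast0LessThan intro!: sum.cong)
    also have "cmod \<dots> \<le> (\<Sum>j<m. cmod (B $$ (i, j)) * vnorm z)"
      using cmod_index_le_vnorm'[OF z] by (intro sum_norm_le) (auto simp: norm_mult intro!: mult_left_mono)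
    also have "\<dots> = (\<Sum>j<m. cmod (B $$ (i, j))) * vnorm z" by (simp add: sum_distrib_right)
    also have "\<dots> \<le> ?\<beta> * vnorm z"
      using i by (intro mult_right_mono member_le_sum[where f = "\<lambda>i. \<Sum>j<m. cmod (B $$ (i, j))"]) (auto intro!: sum_nonneg)
    finally show "cmod ((B *\<^sub>v z) $ i) \<le> ?\<beta> * vnorm z" .
  qed (auto intro!: mult_nonneg_nonneg sum_nonneg)
  moreover have "?\<beta> \<ge> 0" by (intro sum_nonneg) auto
  ultimately show ?thesis by blast
qed

lemma mult_mat_vec_line:
  fixes B :: "complex mat"
  assumes "B \<in> carrier_mat n m" "a \<in> carrier_vec m" "b \<in> carrier_vec m"
  shows "B *\<^sub>v (a + t \<cdot>\<^sub>v b) = B *\<^sub>v a + t \<cdot>\<^sub>v (B *\<^sub>v b)"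
  using assms by (simp add: mult_add_distrib_mat_vec[of B n m] mult_mat_vec[of B n m])

lemma entire_fun_linear_compose:
  assumes e: "entire_fun n \<phi>" and B: "B \<in> carrier_mat n m"
  shows "entire_fun m (\<lambda>y. \<phi> (B *\<^sub>v y))"
  unfolding entire_fun_def
proof (intro conjI ballI)
  fix a :: "complex vec" assume a: "a \<in> carrier_vec m"
  have Ba: "B *\<^sub>v a \<in> carrier_vec n" using a B by simp
  obtain r M where r: "r > 0" "\<And>z. z \<in> carrier_vec n \<Longrightarrow> vnorm z < r \<Longrightarrow> cmod (\<phi> (B *\<^sub>v a + z)) \<le> M"
    using entire_fun_bounded[OF e Ba] by blast
  obtain \<beta> where \<beta>: "\<beta> \<ge> 0" "\<And>z. z \<in> carrier_vec m \<Longrightarrow> vnorm (B *\<^sub>v z) \<le> \<beta> * vnorm z"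
    using vnorm_mult_mat_vec_le[OF B] by blast
  have "cmod (\<phi> (B *\<^sub>v (a + z))) \<le> M" if z: "z \<in> carrier_vec m" "vnorm z < r / (\<beta> + 1)" for z
  proof -
    have "vnorm (B *\<^sub>v z) \<le> (\<beta> + 1) * vnorm z" using \<beta>(2)[OF z(1)] by (simp add: distrib_right add_increasing2)
    also have "\<dots> < r" using z(2) \<beta>(1) r(1) by (simp add: field_simps)
    finally have "cmod (\<phi> (B *\<^sub>v a + B *\<^sub>v z)) \<le> M" using z B by (intro r) auto
    then show ?thesis using a z B by (simp add: mult_add_distrib_mat_vec[of B n m])
  qed
  then show "\<exists>r>0. \<exists>M. \<forall>z\<in>carrier_vec m. vnorm z < r \<longrightarrow> cmod (\<phi> (B *\<^sub>v (a + z))) \<le> M"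
    using r \<beta> by (intro exI[of _ "r / (\<beta> + 1)"]) auto
next
  fix a b :: "complex vec" assume "a \<in> carrier_vec m" "b \<in> carrier_vec m"
  then show "(\<lambda>t. \<phi> (B *\<^sub>v (a + t \<cdot>\<^sub>v b))) holomorphic_on UNIV"
    using entire_fun_line[OF e, of "B *\<^sub>v a" "B *\<^sub>v b"] B by (simp add: mult_mat_vec_line[OF B])
qed

lemma smult_mat_mult_vec:
  fixes A :: "complex mat"
  assumes "A \<in> carrier_mat n m" "y \<in> carrier_vec m"
  shows "(c \<cdot>\<^sub>m A) *\<^sub>v y = c \<cdot>\<^sub>v (A *\<^sub>v y)"
  using assms by (intro eq_vecI) (auto simp: scalar_prod_def sum_distrib_left mult.assoc intro!: sum.cong)

lemma entire_fun_smult_compose: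
  assumes "entire_fun m \<phi>" shows "entire_fun m (\<lambda>y. \<phi> (c \<cdot>\<^sub>v y))"
  by (rule entire_fun_cong[OF entire_fun_linear_compose[OF assms, of "c \<cdot>\<^sub>m 1\<^sub>m m" m]])
     (auto simp: smult_mat_mult_vec[of _ m m])

text \<open>The majorant may start at an index \<open>J\<close> depending on \<open>R\<close>,
  because a term such as P(\<nu>^j y)/\<nu>^j is controlled only once \<nu>^j y has entered a small
  ball. For local boundedness the first \<open>J\<close> terms are split off as a finite
  sum.\<close>

lemma entire_fun_suminf:
  assumes e: "\<And>j. entire_fun m (u j)"
    and b: "\<And>R. \<exists>J M. summable M \<and> (\<forall>j\<ge>J. \<forall>y\<in>carrier_vec m. vnorm y \<le> R \<longrightarrow> cmod (u j y) \<le> M j)"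
  shows "entire_fun m (\<lambda>y. suminf (\<lambda>j. u j y))" "y \<in> carrier_vec m \<Longrightarrow> summable (\<lambda>j. u j y)"
proof -
  show s: "summable (\<lambda>j. u j y)" if "y \<in> carrier_vec m" for y
  proof -
    obtain J M where M: "summable M" "\<forall>j\<ge>J. \<forall>y'\<in>carrier_vec m. vnorm y' \<le> vnorm y \<longrightarrow> cmod (u j y') \<le> M j"
      using b[of "vnorm y"] by blast
    then have "\<forall>j\<ge>J. cmod (u j y) \<le> M j" using that by blast
    with M(1) show ?thesis by (intro summable_comparison_test[of "\<lambda>j. u j y" M]) auto
  qed
  show "entire_fun m (\<lambda>y. suminf (\<lambda>j. u j y))"
    unfolding entire_fun_def
  proof (intro conjI ballI)
    fix a :: "complex vec" assume a: "a \<in> carrier_vec m"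
    obtain J M where M: "summable M" "\<And>j y. j \<ge> J \<Longrightarrow> y \<in> carrier_vec m \<Longrightarrow> vnorm y \<le> vnorm a + 1 \<Longrightarrow> cmod (u j y) \<le> M j"
      using b[of "vnorm a + 1"] by auto
    have eJ: "entire_fun m (\<lambda>x. \<Sum>j<J. u j x)" by (intro entire_fun_sum e)
    obtain r N where r: "r > 0" "\<And>z. z \<in> carrier_vec m \<Longrightarrow> vnorm z < r \<Longrightarrow> cmod (\<Sum>j<J. u j (a + z)) \<le> N"
      using entire_fun_bounded[OF eJ a] by blast
    have "cmod (suminf (\<lambda>j. u j (a + z))) \<le> (suminf (\<lambda>j. M (j + J))) + N" if z: "z \<in> carrier_vec m" "vnorm z < min r 1" for z
    proof -
      have az: "a + z \<in> carrier_vec m" using a z by simp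
      have n: "vnorm (a + z) \<le> vnorm a + 1" using vnorm_triangle[OF a z(1)] z by simp
      have "(suminf (\<lambda>j. u j (a + z))) = (suminf (\<lambda>j. u (j + J) (a + z))) + (\<Sum>j<J. u j (a + z))"
        by (rule suminf_split_initial_segment[OF s[OF az]])
      moreover have "cmod (suminf (\<lambda>j. u (j + J) (a + z))) \<le> (suminf (\<lambda>j. M (j + J)))"
        using M az n by (intro norm_suminf_le) auto
      moreover have "cmod (\<Sum>j<J. u j (a + z)) \<le> N" using z by (intro r) auto
      ultimately show ?thesis by (auto intro!: norm_triangle_le)
    qed
    then show "\<exists>r>0. \<exists>M. \<forall>z\<in>carrier_vec m. vnorm z < r \<longrightarrow> cmod (suminf (\<lambda>j. u j (a + z))) \<le> M"
      using r by (intro exI[of _ "min r 1"]) auto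
  next
    fix a b' :: "complex vec" assume a: "a \<in> carrier_vec m" and b': "b' \<in> carrier_vec m"
    show "(\<lambda>t. suminf (\<lambda>j. u j (a + t \<cdot>\<^sub>v b'))) holomorphic_on UNIV"
    proof (rule holomorphic_onI, rule field_differentiable_at_within)
      fix t :: complex
      define \<rho> where "\<rho> = cmod t + 1"
      obtain J M where M: "summable M" "\<And>j y. j \<ge> J \<Longrightarrow> y \<in> carrier_vec m \<Longrightarrow> vnorm y \<le> vnorm a + \<rho> * vnorm b' \<Longrightarrow> cmod (u j y) \<le> M j"
        using b[of "vnorm a + \<rho> * vnorm b'"] by auto
      have "uniform_limit (cball 0 \<rho>) (\<lambda>n w. \<Sum>j<n. u j (a + w \<cdot>\<^sub>v b')) (\<lambda>w. suminf (\<lambda>j. u j (a + w \<cdot>\<^sub>v b'))) sequentially"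
      proof (rule Weierstrass_m_test_ev[OF _ M(1)], rule eventually_sequentiallyI[of J], intro ballI)
        fix j and w :: complex assume j: "J \<le> j" and w: "w \<in> cball 0 \<rho>"
        have "vnorm (a + w \<cdot>\<^sub>v b') \<le> vnorm a + cmod w * vnorm b'"
          using vnorm_triangle[of a m "w \<cdot>\<^sub>v b'"] a b' by (simp add: vnorm_smult[OF b'])
        also have "\<dots> \<le> vnorm a + \<rho> * vnorm b'" using w by (intro add_mono mult_right_mono) auto
        finally show "cmod (u j (a + w \<cdot>\<^sub>v b')) \<le> M j" using a b' j by (intro M) auto
      qed
      then have "(\<lambda>w. suminf (\<lambda>j. u j (a + w \<cdot>\<^sub>v b'))) holomorphic_on ball 0 \<rho>"
        by (rule holomorphic_uniform_limit[rotated])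
           (auto intro!: always_eventually holomorphic_on_sum continuous_on_sum
             holomorphic_on_subset[OF entire_fun_line[OF e a b']] holomorphic_on_imp_continuous_on)
      then show "(\<lambda>t. suminf (\<lambda>j. u j (a + t \<cdot>\<^sub>v b'))) field_differentiable at t"
        by (intro holomorphic_on_imp_differentiable_at) (auto simp: \<rho>_def)
    qed
  qed
qed

text \<open>One estimate in place of the pair k(0) = 0, k'(0) = I; at y = 0 it forces the value 0.
  The quadratic order, stronger than o(|y|), is what makes the iterations and series below
  converge.\<close>

definition tangent_to_id :: "nat \<Rightarrow> (complex vec \<Rightarrow> complex vec) \<Rightarrow> bool" where
  "tangent_to_id m k \<longleftrightarrow> (\<exists>C r. r > 0 \<and> (\<forall>y\<in>carrier_vec m. vnorm y \<le> r \<longrightarrow> vnorm (k y - y) \<le> C * (vnorm y)\<^sup>2))"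

lemma deriv_eqI_quadratic:
  fixes u :: "complex \<Rightarrow> complex"
  assumes "r > 0" "\<And>t. cmod t \<le> r \<Longrightarrow> cmod (u t - u 0 - l * t) \<le> C * (cmod t)\<^sup>2"
  shows "deriv u 0 = l"
proof (rule DERIV_imp_deriv)
  have "((\<lambda>t. (u t - u 0) / t - l) \<longlongrightarrow> 0) (at 0)"
  proof (rule Lim_null_comparison)
    have "\<forall>\<^sub>F t in at 0. cmod t < r \<and> t \<noteq> (0::complex)"
      using assms(1) by (auto simp: eventually_at intro!: exI[of _ r])
    then show "\<forall>\<^sub>F t in at 0. norm ((u t - u 0) / t - l) \<le> \<bar>C\<bar> * cmod t"
    proof eventually_elim
      case (elim t)
      have "(u t - u 0) / t - l = (u t - u 0 - l * t) / t" using elim by (simp add: field_simps)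
      then have "norm ((u t - u 0) / t - l) = cmod (u t - u 0 - l * t) / cmod t" by (simp add: norm_divide)
      also have "\<dots> \<le> (C * (cmod t)\<^sup>2) / cmod t" using elim assms(2)[of t] by (intro divide_right_mono) auto
      also have "\<dots> = C * cmod t" using elim by (simp add: power2_eq_square)
      also have "\<dots> \<le> \<bar>C\<bar> * cmod t" by (intro mult_right_mono) auto
      finally show ?case .
    qed
    show "((\<lambda>t. \<bar>C\<bar> * cmod t) \<longlongrightarrow> 0) (at 0)"
      by (rule tendsto_eq_intros refl tendsto_ident_at | simp)+
  qed
  then show "(u has_field_derivative l) (at 0)"
    by (simp add: has_field_derivative_iff Lim_null[symmetric])
qed

text \<open>The form in which pre-conjugations are used throughout: entire components and one norm
  estimate, in place of local power series and a Jacobian matrix at the origin.\<close>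

lemma global_pre_conjugation_iff:
  "global_pre_conjugation m \<mu> h k \<longleftrightarrow>
    (\<forall>x\<in>carrier_vec m. k x \<in> carrier_vec m) \<and> (\<forall>i<m. entire_fun m (\<lambda>x. k x $ i)) \<and>
    tangent_to_id m k \<and> (\<forall>y\<in>carrier_vec m. \<mu> \<cdot>\<^sub>v h (k y) = k (\<mu> \<cdot>\<^sub>v y))"
proof (cases "(\<forall>x\<in>carrier_vec m. k x \<in> carrier_vec m) \<and> (\<forall>i<m. entire_fun m (\<lambda>x. k x $ i))")
  case True
  then have k: "\<And>x. x \<in> carrier_vec m \<Longrightarrow> k x \<in> carrier_vec m"
    and e: "\<And>i. i < m \<Longrightarrow> entire_fun m (\<lambda>x. k x $ i)" by auto
  have z0: "0 \<cdot>\<^sub>v unit_vec m j = (0\<^sub>v m :: complex vec)" for j by (intro eq_vecI) auto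
  have z: "(0\<^sub>v m :: complex vec) + x = x" if "x \<in> carrier_vec m" for x using that by simp
  \<comment> \<open>The linear coefficients of any quadratic approximation at the origin are the
    partial derivatives; this serves both directions.\<close>
  have jac: "jacobian_mat m k (0\<^sub>v m) $$ (i, j) = l"
    if ij: "i < m" "j < m" and r: "r > 0"
      and q: "\<And>y. y \<in> carrier_vec m \<Longrightarrow> vnorm y \<le> r \<Longrightarrow> cmod (k y $ i - k (0\<^sub>v m) $ i - (\<Sum>j<m. L j * y $ j)) \<le> C * (vnorm y)\<^sup>2"
      and l: "L j = l"
    for i j r L C l
  proof -
    have u: "vnorm (unit_vec m j) \<le> 1" using ij by (subst vnorm_le_iff[of _ m]) auto
    have "deriv (\<lambda>t. k (0\<^sub>v m + t \<cdot>\<^sub>v unit_vec m j) $ i) 0 = L j"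
    proof (rule deriv_eqI_quadratic[OF r, where C = "\<bar>C\<bar>"])
      fix t assume t: "cmod t \<le> r"
      have n: "vnorm (t \<cdot>\<^sub>v unit_vec m j) \<le> cmod t"
        using u by (simp add: vnorm_smult[of _ m] mult_left_le)
      have "(\<Sum>i<m. L i * (t \<cdot>\<^sub>v unit_vec m j) $ i) = (\<Sum>i<m. if i = j then L j * t else 0)"
        using ij by (intro sum.cong) auto
      then have "(\<Sum>i<m. L i * (t \<cdot>\<^sub>v unit_vec m j) $ i) = L j * t" using ij by simp
      then have "cmod (k (t \<cdot>\<^sub>v unit_vec m j) $ i - k (0\<^sub>v m) $ i - L j * t) \<le> C * (vnorm (t \<cdot>\<^sub>v unit_vec m j))\<^sup>2"
        using q[of "t \<cdot>\<^sub>v unit_vec m j"] n t by simp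
      also have "\<dots> \<le> \<bar>C\<bar> * (cmod t)\<^sup>2" using n by (intro mult_mono power_mono) auto
      finally show "cmod (k (0\<^sub>v m + t \<cdot>\<^sub>v unit_vec m j) $ i - k (0\<^sub>v m + 0 \<cdot>\<^sub>v unit_vec m j) $ i - L j * t) \<le> \<bar>C\<bar> * (cmod t)\<^sup>2"
        by (simp add: z z0)
    qed
    then show ?thesis using ij l by (simp add: jacobian_mat_def)
  qed
  have "k (0\<^sub>v m) = 0\<^sub>v m \<and> jacobian_mat m k (0\<^sub>v m) = 1\<^sub>m m \<longleftrightarrow> tangent_to_id m k"
  proof
    assume asm: "k (0\<^sub>v m) = 0\<^sub>v m \<and> jacobian_mat m k (0\<^sub>v m) = 1\<^sub>m m"
    have "\<forall>i. \<exists>C r. i < m \<longrightarrow> r > 0 \<and> (\<forall>y\<in>carrier_vec m. vnorm y \<le> r \<longrightarrow> cmod (k y $ i - y $ i) \<le> C * (vnorm y)\<^sup>2)"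
    proof
      fix i
      show "\<exists>C r. i < m \<longrightarrow> r > 0 \<and> (\<forall>y\<in>carrier_vec m. vnorm y \<le> r \<longrightarrow> cmod (k y $ i - y $ i) \<le> C * (vnorm y)\<^sup>2)"
      proof (cases "i < m")
        case True
        obtain L C r where r: "r > 0" and L: "\<forall>y\<in>carrier_vec m. vnorm y \<le> r \<longrightarrow>
          cmod (k (0\<^sub>v m + y) $ i - k (0\<^sub>v m) $ i - (\<Sum>j<m. L j * y $ j)) \<le> C * (vnorm y)\<^sup>2"
          using entire_fun_quadratic_approx[OF e[OF True] zero_carrier_vec] by blast
        have "L j = (if i = j then 1 else 0)" if "j < m" for j
          using jac[OF True that r _ refl, of L C] L asm True that by (simp add: z)
        then have "(\<Sum>j<m. L j * y $ j) = (\<Sum>j<m. if j = i then y $ i else 0)" for y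
          by (intro sum.cong) auto
        then have "(\<Sum>j<m. L j * y $ j) = y $ i" for y using True by simp
        with L r asm True show ?thesis
          by (intro exI[of _ C] exI[of _ r]) (simp add: z)
      qed auto
    qed
    then obtain C r where C: "\<And>i. i < m \<Longrightarrow> r i > 0"
      "\<And>i y. i < m \<Longrightarrow> y \<in> carrier_vec m \<Longrightarrow> vnorm y \<le> r i \<Longrightarrow> cmod (k y $ i - y $ i) \<le> C i * (vnorm y)\<^sup>2"
      by metis
    \<comment> \<open>A radius common to all components; the inserted 1 covers m = 0.\<close>
    define \<rho> where "\<rho> = Min (insert 1 (r ` {..<m}))"
    have \<rho>: "\<rho> > 0" "\<And>i. i < m \<Longrightarrow> \<rho> \<le> r i" unfolding \<rho>_def using C(1) by auto
    show "tangent_to_id m k"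
      unfolding tangent_to_id_def
    proof (rule exI[of _ "\<Sum>i<m. \<bar>C i\<bar>"], rule exI[of _ \<rho>], intro conjI ballI impI \<rho>(1))
      fix y assume y: "y \<in> carrier_vec m" "vnorm y \<le> \<rho>"
      show "vnorm (k y - y) \<le> (\<Sum>i<m. \<bar>C i\<bar>) * (vnorm y)\<^sup>2"
      proof (rule vnorm_leI)
        show "k y - y \<in> carrier_vec m" using y k by simp
        fix i assume i: "i < m"
        have "cmod (k y $ i - y $ i) \<le> C i * (vnorm y)\<^sup>2" using y \<rho>(2)[OF i] by (intro C i) auto
        also have "\<dots> \<le> (\<Sum>i<m. \<bar>C i\<bar>) * (vnorm y)\<^sup>2"
          using i member_le_sum[of i "{..<m}" "\<lambda>i. \<bar>C i\<bar>"] by (intro mult_right_mono) auto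
        finally show "cmod ((k y - y) $ i) \<le> (\<Sum>i<m. \<bar>C i\<bar>) * (vnorm y)\<^sup>2" using y k i by simp
      qed (auto intro!: mult_nonneg_nonneg sum_nonneg)
    qed
  next
    assume "tangent_to_id m k"
    then obtain C r where r: "r > 0" "\<And>y. y \<in> carrier_vec m \<Longrightarrow> vnorm y \<le> r \<Longrightarrow> vnorm (k y - y) \<le> C * (vnorm y)\<^sup>2"
      unfolding tangent_to_id_def by blast
    have "vnorm (k (0\<^sub>v m) - 0\<^sub>v m) \<le> 0" using r(2)[of "0\<^sub>v m"] r(1) by simp
    moreover have "k (0\<^sub>v m) - 0\<^sub>v m = k (0\<^sub>v m)" using k[of "0\<^sub>v m"] by (intro eq_vecI) auto
    ultimately have "vnorm (k (0\<^sub>v m)) = 0" by (simp add: antisym)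
    then have k0: "k (0\<^sub>v m) = 0\<^sub>v m" using vnorm_eq_0_iff[of "k (0\<^sub>v m)" m] k[of "0\<^sub>v m"] by simp
    have "jacobian_mat m k (0\<^sub>v m) $$ (i, j) = (if i = j then 1 else 0)" if ij: "i < m" "j < m" for i j
    proof (rule jac[OF ij r(1), where C = C and L = "\<lambda>j. if i = j then 1 else 0"])
      fix y assume y: "y \<in> carrier_vec m" "vnorm y \<le> r"
      have "(\<Sum>j<m. (if i = j then 1 else 0) * y $ j) = (\<Sum>j<m. if j = i then y $ i else 0)"
        by (intro sum.cong) auto
      then have "(\<Sum>j<m. (if i = j then 1 else 0) * y $ j) = y $ i" using ij by simp
      moreover have "cmod ((k y - y) $ i) \<le> C * (vnorm y)\<^sup>2"
        using r(2)[OF y] cmod_index_le_vnorm'[of "k y - y" m i] k y ij by (auto intro: order_trans)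
      ultimately show "cmod (k y $ i - k (0\<^sub>v m) $ i - (\<Sum>j<m. (if i = j then 1 else 0) * y $ j)) \<le> C * (vnorm y)\<^sup>2"
        using k y ij k0 by simp
    qed auto
    then show "k (0\<^sub>v m) = 0\<^sub>v m \<and> jacobian_mat m k (0\<^sub>v m) = 1\<^sub>m m"
      using k0 by (auto intro!: eq_matI simp: jacobian_mat_def)
  qed
  then show ?thesis unfolding global_pre_conjugation_def analytic_map_iff_entire_fun by blast
next
  case False
  then show ?thesis unfolding global_pre_conjugation_def analytic_map_iff_entire_fun by blast
qed

section \<open>Uniqueness and existence of pre-conjugations\<close>

lemma smult_diff_distrib_vec:
  fixes x y :: "complex vec"
  assumes "x \<in> carrier_vec m" "y \<in> carrier_vec m"
  shows "c \<cdot>\<^sub>v (x - y) = c \<cdot>\<^sub>v x - c \<cdot>\<^sub>v y"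
  using assms by (intro eq_vecI) (auto simp: right_diff_distrib)

lemma uniform_radius:
  fixes P :: "nat \<Rightarrow> real \<Rightarrow> bool"
  assumes "\<And>i. i < m \<Longrightarrow> \<exists>r>0. P i r" "\<And>i r s. P i r \<Longrightarrow> 0 < s \<Longrightarrow> s \<le> r \<Longrightarrow> P i s"
  shows "\<exists>r>0. \<forall>i<m. P i r"
  using assms(1)
proof (induction m)
  case 0
  show ?case by (rule exI[of _ 1]) simp
next
  case (Suc m)
  obtain r where r: "r > 0" "\<forall>i<m. P i r" using Suc by auto
  obtain s where s: "s > 0" "P m s" using Suc.prems[of m] by auto
  have "P i (min r s)" if "i < Suc m" for i
    using r s assms(2)[of i r "min r s"] assms(2)[of i s "min r s"] that by (auto simp: less_Suc_eq)
  then show ?case using r s by (intro exI[of _ "min r s"]) auto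
qed

text \<open>On the multiples s e_j of a unit vector the bound reads |a j| \<le> C s, and s ->
  0.\<close>

lemma linear_form_eq_0:
  assumes r: "r > 0" and le: "\<And>x. x \<in> carrier_vec m \<Longrightarrow> vnorm x \<le> r \<Longrightarrow> cmod (\<Sum>j<m. a j * x $ j) \<le> C * (vnorm x)\<^sup>2"
    and j: "j < m"
  shows "a j = 0"
proof -
  have u: "vnorm (unit_vec m j) = 1"
  proof (rule antisym)
    show "vnorm (unit_vec m j) \<le> 1" using j by (subst vnorm_le_iff[of _ m]) auto
    show "1 \<le> vnorm (unit_vec m j)" using cmod_index_le_vnorm'[of "unit_vec m j" m j] j by simp
  qed
  have *: "cmod (a j) \<le> \<bar>C\<bar> * s" if s: "0 < s" "s \<le> r" for s
  proof -
    let ?x = "of_real s \<cdot>\<^sub>v unit_vec m j"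
    have n: "vnorm ?x = s" using s u by (simp add: vnorm_smult[of _ m])
    have "(\<Sum>i<m. a i * ?x $ i) = (\<Sum>i<m. if i = j then a j * of_real s else 0)"
      using j by (intro sum.cong) auto
    then have "(\<Sum>i<m. a i * ?x $ i) = a j * of_real s" using j by simp
    then have "cmod (a j) * s \<le> C * s\<^sup>2" using le[of ?x] n s by (simp add: norm_mult)
    then have "cmod (a j) \<le> C * s" using s by (simp add: power2_eq_square)
    also have "\<dots> \<le> \<bar>C\<bar> * s" using s by (intro mult_right_mono) auto
    finally show ?thesis .
  qed
  have "((\<lambda>s. \<bar>C\<bar> * s) \<longlongrightarrow> \<bar>C\<bar> * 0) (at_right 0)" by (intro tendsto_intros)
  then have "cmod (a j) \<le> \<bar>C\<bar> * 0"
    by (rule tendsto_lowerbound) (use * r in \<open>auto simp: eventually_at_right intro!: exI[of _ r]\<close>)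
  then show ?thesis by simp
qed

lemma tangent_to_idE:
  assumes "tangent_to_id m k"
  obtains C r where "r > 0" "C \<ge> 0" "\<And>y. y \<in> carrier_vec m \<Longrightarrow> vnorm y \<le> r \<Longrightarrow> vnorm (k y - y) \<le> C * (vnorm y)\<^sup>2"
proof -
  obtain C r where r: "r > 0" and k: "\<And>y. y \<in> carrier_vec m \<Longrightarrow> vnorm y \<le> r \<Longrightarrow> vnorm (k y - y) \<le> C * (vnorm y)\<^sup>2"
    using assms unfolding tangent_to_id_def by blast
  have "vnorm (k y - y) \<le> \<bar>C\<bar> * (vnorm y)\<^sup>2" if "y \<in> carrier_vec m" "vnorm y \<le> r" for y
    using k[OF that] mult_right_mono[OF abs_ge_self, of "(vnorm y)\<^sup>2" C] by simp
  with r show ?thesis by (intro that[of r "\<bar>C\<bar>"]) auto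
qed

lemma tangent_to_id_zero:
  assumes "tangent_to_id m k" "\<And>x. x \<in> carrier_vec m \<Longrightarrow> k x \<in> carrier_vec m"
  shows "k (0\<^sub>v m) = 0\<^sub>v m"
proof -
  obtain C r where "r > 0" "C \<ge> 0" "\<And>y. y \<in> carrier_vec m \<Longrightarrow> vnorm y \<le> r \<Longrightarrow> vnorm (k y - y) \<le> C * (vnorm y)\<^sup>2"
    using tangent_to_idE[OF assms(1)] by blast
  from this(1) this(3)[of "0\<^sub>v m"] have "vnorm (k (0\<^sub>v m) - 0\<^sub>v m) \<le> 0" by simp
  moreover have "k (0\<^sub>v m) - 0\<^sub>v m = k (0\<^sub>v m)" using assms(2)[of "0\<^sub>v m"] by (intro eq_vecI) auto
  ultimately have "vnorm (k (0\<^sub>v m)) = 0" by (simp add: antisym)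
  then show ?thesis using vnorm_eq_0_iff[of "k (0\<^sub>v m)" m] assms(2)[of "0\<^sub>v m"] by simp
qed

text \<open>The Taylor formula and tangency give two first-order approximations of the same
  component at the origin; their difference is a linear form of quadratic size, hence zero.\<close>

lemma taylor_coeff_tangent_to_id:
  assumes f: "tangent_to_id m f" "\<And>x. x \<in> carrier_vec m \<Longrightarrow> f x \<in> carrier_vec m" and i: "i < m" and R: "R > 0"
    and C: "\<And>x. x \<in> carrier_vec m \<Longrightarrow> vnorm x \<le> R \<Longrightarrow>
      cmod (f x $ i - f (0\<^sub>v m) $ i - (\<Sum>j<m. L j * (x $ j - 0\<^sub>v m $ j))) \<le> C * (vnorm (x - 0\<^sub>v m))\<^sup>2"
    and j: "j < m"
  shows "L j = (if j = i then 1 else 0)"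
proof -
  obtain C0 r0 where C0: "r0 > 0" "C0 \<ge> 0"
    "\<And>y. y \<in> carrier_vec m \<Longrightarrow> vnorm y \<le> r0 \<Longrightarrow> vnorm (f y - y) \<le> C0 * (vnorm y)\<^sup>2"
    using tangent_to_idE[OF f(1)] by blast
  have f0: "f (0\<^sub>v m) = 0\<^sub>v m" by (rule tangent_to_id_zero[OF f])
  define \<delta> where "\<delta> j = (if j = i then 1 else 0 :: complex)" for j
  have sum_\<delta>: "(\<Sum>j<m. \<delta> j * (x $ j)) = x $ i" for x :: "complex vec"
  proof -
    have "(\<Sum>j<m. \<delta> j * (x $ j)) = (\<Sum>j<m. if j = i then x $ i else 0)"
      by (intro sum.cong) (auto simp: \<delta>_def)
    then show ?thesis using i by simp
  qed
  have "L j - \<delta> j = 0"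
  proof (rule linear_form_eq_0[of "min R r0" m "\<lambda>j. L j - \<delta> j" "C + C0"])
    fix x assume x: "x \<in> carrier_vec m" "vnorm x \<le> min R r0"
    have x0: "x - 0\<^sub>v m = x" using x by (intro eq_vecI) auto
    have s: "(\<Sum>j<m. L j * (x $ j - 0\<^sub>v m $ j)) = (\<Sum>j<m. L j * x $ j)"
      by (intro sum.cong) auto
    have 1: "cmod (f x $ i - (\<Sum>j<m. L j * x $ j)) \<le> C * (vnorm x)\<^sup>2"
      using C[of x] x i by (simp add: x0 s f0)
    have 2: "cmod (f x $ i - x $ i) \<le> C0 * (vnorm x)\<^sup>2"
      using C0(3)[of x] cmod_index_le_vnorm'[of "f x - x" m i] f(2) x i by (auto intro: order_trans)
    have "(\<Sum>j<m. (L j - \<delta> j) * x $ j) = (f x $ i - x $ i) - (f x $ i - (\<Sum>j<m. L j * x $ j))"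
      by (simp add: left_diff_distrib sum_subtractf sum_\<delta>)
    then show "cmod (\<Sum>j<m. (L j - \<delta> j) * x $ j) \<le> (C + C0) * (vnorm x)\<^sup>2"
      using norm_triangle_le_diff[OF add_mono[OF 2 1]] by (simp add: distrib_right add.commute)
  qed (use R C0 j in auto)
  then show ?thesis by (simp add: \<delta>_def)
qed

text \<open>Strict differentiability at the origin: f - id is Lipschitz with an arbitrarily small
  constant. The Taylor coefficients at \<open>y\<close> differ from the Kronecker delta by O(|y|),
  since they are Lipschitz and equal to it at 0.\<close>

lemma polynomial_map_strict_tangent:
  assumes p: "polynomial_map m f" and t: "tangent_to_id m f" and \<epsilon>: "\<epsilon> > 0"
  shows "\<exists>r>0. \<forall>x\<in>carrier_vec m. \<forall>y\<in>carrier_vec m. vnorm x \<le> r \<longrightarrow> vnorm y \<le> r \<longrightarrow>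
    vnorm (f x - f y - (x - y)) \<le> \<epsilon> * vnorm (x - y)"
proof -
  have car: "\<And>x. x \<in> carrier_vec m \<Longrightarrow> f x \<in> carrier_vec m" and pf: "\<And>i. i < m \<Longrightarrow> polyfun m (\<lambda>x. f x $ i)"
    using p unfolding polynomial_map_iff_polyfun by auto
  let ?P = "\<lambda>i r. \<forall>x\<in>carrier_vec m. \<forall>y\<in>carrier_vec m. vnorm x \<le> r \<longrightarrow> vnorm y \<le> r \<longrightarrow>
    cmod (f x $ i - f y $ i - (x $ i - y $ i)) \<le> \<epsilon> * vnorm (x - y)"
  have "\<exists>r>0. \<forall>i<m. ?P i r"
  proof (rule uniform_radius)
    fix i assume i: "i < m"
    obtain L where L: "\<forall>j<m. polyfun m (L j)" and T: "\<forall>R. \<exists>C. \<forall>x\<in>carrier_vec m. \<forall>y\<in>carrier_vec m.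
      vnorm x \<le> R \<longrightarrow> vnorm y \<le> R \<longrightarrow>
      cmod (f x $ i - f y $ i - (\<Sum>j<m. L j y * (x $ j - y $ j))) \<le> C * (vnorm (x - y))\<^sup>2"
      using polyfun_taylor[OF pf[OF i]] by (elim exE conjE)
    from T[THEN spec, of 1] obtain C where C: "\<And>x y. x \<in> carrier_vec m \<Longrightarrow> y \<in> carrier_vec m \<Longrightarrow>
      vnorm x \<le> 1 \<Longrightarrow> vnorm y \<le> 1 \<Longrightarrow>
      cmod (f x $ i - f y $ i - (\<Sum>j<m. L j y * (x $ j - y $ j))) \<le> C * (vnorm (x - y))\<^sup>2"
      by blast
    define \<delta> where "\<delta> j = (if j = i then 1 else 0 :: complex)" for j
    have sum_\<delta>: "(\<Sum>j<m. \<delta> j * (x $ j)) = x $ i" for x :: "complex vec"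
    proof -
      have "(\<Sum>j<m. \<delta> j * (x $ j)) = (\<Sum>j<m. if j = i then x $ i else 0)"
        by (intro sum.cong) (auto simp: \<delta>_def)
      then show ?thesis using i by simp
    qed
    have L0: "L j (0\<^sub>v m) = \<delta> j" if "j < m" for j
      unfolding \<delta>_def
      by (rule taylor_coeff_tangent_to_id[OF t car i, of 1 "\<lambda>j. L j (0\<^sub>v m)" C]) (use C[OF _ zero_carrier_vec] that in auto)
    have "\<forall>j. \<exists>D. j < m \<longrightarrow> (\<forall>x\<in>carrier_vec m. \<forall>y\<in>carrier_vec m. vnorm x \<le> 1 \<longrightarrow> vnorm y \<le> 1 \<longrightarrow>
      cmod (L j x - L j y) \<le> D * vnorm (x - y))"
      using polyfun_lipschitz[of m _ 1] L by blast
    then obtain D where "\<forall>j. j < m \<longrightarrow> (\<forall>x\<in>carrier_vec m. \<forall>y\<in>carrier_vec m. vnorm x \<le> 1 \<longrightarrow> vnorm y \<le> 1 \<longrightarrow>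
      cmod (L j x - L j y) \<le> D j * vnorm (x - y))" using choice by metis
    then have D: "cmod (L j x - L j y) \<le> D j * vnorm (x - y)"
      if "j < m" "x \<in> carrier_vec m" "y \<in> carrier_vec m" "vnorm x \<le> 1" "vnorm y \<le> 1" for j x y
      using that by blast
    \<comment> \<open>The remainder contributes 2|C|, from |x - y| \<le> 2\<epsilon>/E, and the
      coefficients contribute the sum of the |D j|. The total is (E - 1)\<epsilon>/E, below
      \<epsilon>; the summand 1 keeps \<open>E\<close> positive.\<close>
    define E where "E = 2 * \<bar>C\<bar> + (\<Sum>j<m. \<bar>D j\<bar>) + 1"
    have E: "E > 0" unfolding E_def by (intro add_nonneg_pos add_nonneg_nonneg sum_nonneg) auto
    have "cmod (f x $ i - f y $ i - (x $ i - y $ i)) \<le> \<epsilon> * vnorm (x - y)"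
      if x: "x \<in> carrier_vec m" "vnorm x \<le> min 1 (\<epsilon> / E)" and y: "y \<in> carrier_vec m" "vnorm y \<le> min 1 (\<epsilon> / E)" for x y
    proof -
      let ?v = "vnorm (x - y)"
      have d: "x - y \<in> carrier_vec m" using x y by simp
      have "?v \<le> vnorm x + vnorm y"
        using vnorm_triangle[of x m "- y"] vnorm_smult[of y m "-1"] x y
        by (simp add: minus_add_uminus_vec[OF x(1) y(1)] uminus_vec_def smult_vec_def)
      with x y have v: "?v \<le> 2 * (\<epsilon> / E)" by simp
      have y0: "y - 0\<^sub>v m = y" using y by (intro eq_vecI) auto
      have split: "f x $ i - f y $ i - (x $ i - y $ i) =
        (f x $ i - f y $ i - (\<Sum>j<m. L j y * (x $ j - y $ j))) + (\<Sum>j<m. (L j y - \<delta> j) * (x $ j - y $ j))"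
      proof -
        have "(\<Sum>j<m. (L j y - \<delta> j) * (x $ j - y $ j)) =
          (\<Sum>j<m. L j y * (x $ j - y $ j)) - (\<Sum>j<m. \<delta> j * (x $ j)) + (\<Sum>j<m. \<delta> j * (y $ j))"
          by (simp add: left_diff_distrib right_diff_distrib sum_subtractf sum.distrib)
        then show ?thesis by (simp add: sum_\<delta>)
      qed
      have 1: "cmod (f x $ i - f y $ i - (\<Sum>j<m. L j y * (x $ j - y $ j))) \<le> \<bar>C\<bar> * (2 * (\<epsilon> / E)) * ?v"
      proof -
        have "cmod (f x $ i - f y $ i - (\<Sum>j<m. L j y * (x $ j - y $ j))) \<le> C * ?v\<^sup>2"
          using x y by (intro C) auto
        also have "\<dots> \<le> \<bar>C\<bar> * (2 * (\<epsilon> / E) * ?v)"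
          unfolding power2_eq_square using v \<epsilon> E by (intro mult_mono) auto
        finally show ?thesis by simp
      qed
      have 2: "cmod (\<Sum>j<m. (L j y - \<delta> j) * (x $ j - y $ j)) \<le> (\<Sum>j<m. \<bar>D j\<bar> * (\<epsilon> / E) * ?v)"
      proof (rule sum_norm_le)
        fix j assume "j \<in> {..<m}"
        then have j: "j < m" by simp
        have "cmod (L j y - \<delta> j) \<le> D j * vnorm y"
          using D[OF j y(1), of "0\<^sub>v m"] y L0[OF j] by (simp add: y0)
        also have "\<dots> \<le> \<bar>D j\<bar> * (\<epsilon> / E)" using y by (intro mult_mono) auto
        finally show "cmod ((L j y - \<delta> j) * (x $ j - y $ j)) \<le> \<bar>D j\<bar> * (\<epsilon> / E) * ?v"
          unfolding norm_mult using cmod_index_le_vnorm'[OF d j] x y j \<epsilon> E by (intro mult_mono) auto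
      qed
      have "cmod (f x $ i - f y $ i - (x $ i - y $ i)) \<le> \<bar>C\<bar> * (2 * (\<epsilon> / E)) * ?v + (\<Sum>j<m. \<bar>D j\<bar> * (\<epsilon> / E) * ?v)"
        unfolding split by (rule norm_triangle_le[OF add_mono[OF 1 2]])
      also have "\<dots> = (E - 1) * (\<epsilon> / E) * ?v"
      proof -
        have s: "(\<Sum>j<m. \<bar>D j\<bar> * (\<epsilon> / E) * ?v) = (\<Sum>j<m. \<bar>D j\<bar>) * (\<epsilon> / E) * ?v"
          by (simp only: sum_distrib_right)
        have "E - 1 = 2 * \<bar>C\<bar> + (\<Sum>j<m. \<bar>D j\<bar>)" by (simp add: E_def)
        then show ?thesis unfolding s by (simp only: distrib_right) simp
      qed
      also have "\<dots> \<le> E * (\<epsilon> / E) * ?v" using \<epsilon> E by (intro mult_right_mono) auto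
      also have "\<dots> = \<epsilon> * ?v" using E by simp
      finally show ?thesis .
    qed
    then show "\<exists>r>0. ?P i r" using \<epsilon> E by (intro exI[of _ "min 1 (\<epsilon> / E)"]) auto
  qed auto
  then obtain r where r: "r > 0" and P: "\<And>i x y. i < m \<Longrightarrow> x \<in> carrier_vec m \<Longrightarrow> y \<in> carrier_vec m \<Longrightarrow>
    vnorm x \<le> r \<Longrightarrow> vnorm y \<le> r \<Longrightarrow> cmod (f x $ i - f y $ i - (x $ i - y $ i)) \<le> \<epsilon> * vnorm (x - y)"
    by blast
  have "vnorm (f x - f y - (x - y)) \<le> \<epsilon> * vnorm (x - y)"
    if "x \<in> carrier_vec m" "y \<in> carrier_vec m" "vnorm x \<le> r" "vnorm y \<le> r" for x y
    by (rule vnorm_leI[of _ m]) (use that P \<epsilon> in \<open>auto simp: car car[THEN carrier_vecD]\<close>)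
  with r show ?thesis by blast
qed

text \<open>Iterating the inequality k times costs A^k, while the quadratic bound at \<nu>^k y gains
  |\<nu>|^(2k); the product tends to 0.\<close>

lemma vnorm_scaling_contraction:
  assumes le: "\<And>y. y \<in> carrier_vec m \<Longrightarrow> vnorm y \<le> \<rho> \<Longrightarrow> d y \<le> A * d (\<nu> \<cdot>\<^sub>v y)"
    and q: "\<And>y. y \<in> carrier_vec m \<Longrightarrow> vnorm y \<le> \<rho> \<Longrightarrow> d y \<le> C * (vnorm y)\<^sup>2"
    and A: "0 \<le> A" "A * (cmod \<nu>)\<^sup>2 < 1" "cmod \<nu> \<le> 1" and y: "y \<in> carrier_vec m" "vnorm y \<le> \<rho>"
  shows "d y \<le> 0"
proof -
  have n: "vnorm (\<nu> \<cdot>\<^sub>v y) \<le> \<rho>" if "y \<in> carrier_vec m" "vnorm y \<le> \<rho>" for y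
    using that A(3) mult_left_le_one_le[of "vnorm y" "cmod \<nu>"] by (simp add: vnorm_smult[of _ m])
  have "d y \<le> (A * (cmod \<nu>)\<^sup>2) ^ k * (C * (vnorm y)\<^sup>2)" for k
    using y
  proof (induction k arbitrary: y)
    case (Suc k)
    have "d y \<le> A * d (\<nu> \<cdot>\<^sub>v y)" using Suc.prems by (rule le)
    also have "\<dots> \<le> A * ((A * (cmod \<nu>)\<^sup>2) ^ k * (C * (vnorm (\<nu> \<cdot>\<^sub>v y))\<^sup>2))"
      using Suc.prems n A by (intro mult_left_mono Suc.IH) auto
    also have "\<dots> = (A * (cmod \<nu>)\<^sup>2) ^ Suc k * (C * (vnorm y)\<^sup>2)"
      using Suc.prems by (simp add: vnorm_smult[of _ m] power_mult_distrib)
    finally show ?case .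
  qed (use q in auto)
  moreover have "(\<lambda>k. (A * (cmod \<nu>)\<^sup>2) ^ k * (C * (vnorm y)\<^sup>2)) \<longlonglongrightarrow> 0 * (C * (vnorm y)\<^sup>2)"
    using A by (intro tendsto_mult LIMSEQ_power_zero tendsto_const) auto
  ultimately show ?thesis
    by (intro tendsto_lowerbound[of _ "0 :: real" sequentially "d y"]) auto
qed

text \<open>The identity theorem in one variable, on the complex line through 0 and
  \<open>y\<close>.\<close>

lemma entire_fun_eqI:
  assumes e: "entire_fun m \<phi>" "entire_fun m \<psi>" and \<rho>: "\<rho> > 0"
    and eq: "\<And>y. y \<in> carrier_vec m \<Longrightarrow> vnorm y \<le> \<rho> \<Longrightarrow> \<phi> y = \<psi> y" and y: "y \<in> carrier_vec m"
  shows "\<phi> y = \<psi> y"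
proof -
  define \<delta> where "\<delta> = \<rho> / (vnorm y + 1)"
  have \<delta>: "\<delta> > 0" using \<rho> by (simp add: \<delta>_def add_nonneg_pos)
  have "\<phi> (0\<^sub>v m + 1 \<cdot>\<^sub>v y) = \<psi> (0\<^sub>v m + 1 \<cdot>\<^sub>v y)"
  proof (rule analytic_continuation_open[of "ball 0 \<delta>" UNIV "\<lambda>t. \<phi> (0\<^sub>v m + t \<cdot>\<^sub>v y)" "\<lambda>t. \<psi> (0\<^sub>v m + t \<cdot>\<^sub>v y)"])
    show "(\<lambda>t. \<phi> (0\<^sub>v m + t \<cdot>\<^sub>v y)) holomorphic_on UNIV" "(\<lambda>t. \<psi> (0\<^sub>v m + t \<cdot>\<^sub>v y)) holomorphic_on UNIV"
      by (rule entire_fun_line[OF e(1) zero_carrier_vec y], rule entire_fun_line[OF e(2) zero_carrier_vec y])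
    fix t :: complex assume "t \<in> ball 0 \<delta>"
    then have "cmod t \<le> \<delta>" by simp
    have "cmod t * vnorm y \<le> \<delta> * (vnorm y + 1)" using \<open>cmod t \<le> \<delta>\<close> \<delta> by (intro mult_mono) auto
    also have "\<dots> = \<rho>" using vnorm_nonneg[of y] by (simp add: \<delta>_def add_nonneg_eq_0_iff)
    finally show "\<phi> (0\<^sub>v m + t \<cdot>\<^sub>v y) = \<psi> (0\<^sub>v m + t \<cdot>\<^sub>v y)"
      using y by (intro eq) (auto simp: vnorm_smult[of _ m])
  qed (use \<delta> in auto)
  then show ?thesis using y by simp
qed

text \<open>The distance d(y) of the two maps is of quadratic order, as both are tangent to the
  identity. Near 0 the map \<open>f\<close> almost preserves distances, so d(\<mu>y) is |\<mu>| d(y)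
  up to a factor close to 1. A quantity that scales almost linearly and is bounded quadratically is
  zero.\<close>

lemma global_pre_conjugation_unique:
  assumes p: "polynomial_map m f" "tangent_to_id m f" and \<mu>: "\<mu> \<noteq> 0" "cmod \<mu> \<noteq> 1"
    and K: "global_pre_conjugation m \<mu> f K" and K': "global_pre_conjugation m \<mu> f K'"
    and y: "y \<in> carrier_vec m"
  shows "K y = K' y"
proof -
  have K: "\<And>x. x \<in> carrier_vec m \<Longrightarrow> K x \<in> carrier_vec m" "\<And>i. i < m \<Longrightarrow> entire_fun m (\<lambda>x. K x $ i)"
    "tangent_to_id m K" "\<And>y. y \<in> carrier_vec m \<Longrightarrow> \<mu> \<cdot>\<^sub>v f (K y) = K (\<mu> \<cdot>\<^sub>v y)"
    using K unfolding global_pre_conjugation_iff by auto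
  have K': "\<And>x. x \<in> carrier_vec m \<Longrightarrow> K' x \<in> carrier_vec m" "\<And>i. i < m \<Longrightarrow> entire_fun m (\<lambda>x. K' x $ i)"
    "tangent_to_id m K'" "\<And>y. y \<in> carrier_vec m \<Longrightarrow> \<mu> \<cdot>\<^sub>v f (K' y) = K' (\<mu> \<cdot>\<^sub>v y)"
    using K' unfolding global_pre_conjugation_iff by auto
  have f: "\<And>x. x \<in> carrier_vec m \<Longrightarrow> f x \<in> carrier_vec m" using p unfolding polynomial_map_def by auto
  obtain C r where C: "r > 0" "C \<ge> 0" "\<And>y. y \<in> carrier_vec m \<Longrightarrow> vnorm y \<le> r \<Longrightarrow> vnorm (K y - y) \<le> C * (vnorm y)\<^sup>2"
    using tangent_to_idE[OF K(3)] by blast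
  obtain C' r' where C': "r' > 0" "C' \<ge> 0" "\<And>y. y \<in> carrier_vec m \<Longrightarrow> vnorm y \<le> r' \<Longrightarrow> vnorm (K' y - y) \<le> C' * (vnorm y)\<^sup>2"
    using tangent_to_idE[OF K'(3)] by blast
  \<comment> \<open>Chosen so that 1 + \<epsilon> < |\<mu>| in the expanding case and 1 - \<epsilon>
    > |\<mu>| in the contracting case.\<close>
  define \<epsilon> where "\<epsilon> = (if cmod \<mu> > 1 then (cmod \<mu> - 1) / 2 else (1 - cmod \<mu>) / 2)"
  have \<epsilon>: "\<epsilon> > 0" using \<mu> by (auto simp: \<epsilon>_def)
  obtain s where s: "s > 0" "\<And>x y. x \<in> carrier_vec m \<Longrightarrow> y \<in> carrier_vec m \<Longrightarrow> vnorm x \<le> s \<Longrightarrow> vnorm y \<le> s \<Longrightarrow>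
    vnorm (f x - f y - (x - y)) \<le> \<epsilon> * vnorm (x - y)"
    using polynomial_map_strict_tangent[OF p \<epsilon>] by blast
  \<comment> \<open>Small enough for both tangency estimates and for both maps to stay in the ball
    of radius \<open>s\<close>; the bound 1 gives |y|^2 \<le> |y|.\<close>
  define \<rho> where "\<rho> = Min {r, r', s / (C + 1), s / (C' + 1), 1}"
  have \<rho>: "\<rho> > 0" "\<rho> \<le> r" "\<rho> \<le> r'" "\<rho> \<le> s / (C + 1)" "\<rho> \<le> s / (C' + 1)" "\<rho> \<le> 1"
    unfolding \<rho>_def using C C' s by auto
  have small: "vnorm (k y) \<le> s"
    if "\<And>y. y \<in> carrier_vec m \<Longrightarrow> vnorm y \<le> \<rho> \<Longrightarrow> vnorm (k y - y) \<le> D * (vnorm y)\<^sup>2" "D \<ge> 0" "\<rho> \<le> s / (D + 1)"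
      "k y \<in> carrier_vec m" "y \<in> carrier_vec m" "vnorm y \<le> \<rho>" for k D y
  proof -
    have "vnorm y \<le> 1" using that(6) \<rho>(6) by linarith
    then have "D * (vnorm y)\<^sup>2 \<le> D * (vnorm y * 1)"
      unfolding power2_eq_square using that(2) by (intro mult_left_mono) auto
    moreover have "vnorm (k y - y) \<le> D * (vnorm y)\<^sup>2" by (rule that(1)[OF that(5,6)])
    moreover have "vnorm (k y) \<le> vnorm y + vnorm (k y - y)" using that by (intro vnorm_triangle_sub) auto
    ultimately have "vnorm (k y) \<le> (D + 1) * vnorm y" by (simp add: distrib_right)
    also have "\<dots> \<le> (D + 1) * (s / (D + 1))" using that by (intro mult_left_mono) auto
    also have "\<dots> = s" using that by simp
    finally show ?thesis .
  qed
  have Ks: "vnorm (K y) \<le> s" "vnorm (K' y) \<le> s" if "y \<in> carrier_vec m" "vnorm y \<le> \<rho>" for y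
    using small[of K C y] small[of K' C' y] C C' K(1) K'(1) \<rho> that by auto
  define d where "d y = vnorm (K y - K' y)" for y
  have dq: "d y \<le> (C + C') * (vnorm y)\<^sup>2" if y: "y \<in> carrier_vec m" "vnorm y \<le> \<rho>" for y
  proof -
    have "K y - K' y = (K y - y) + (y - K' y)"
      using y by (intro eq_vecI) (auto simp: K(1)[THEN carrier_vecD] K'(1)[THEN carrier_vecD])
    then have "d y \<le> vnorm (K y - y) + vnorm (y - K' y)"
      unfolding d_def using vnorm_triangle[of "K y - y" m "y - K' y"] y K(1) K'(1) by auto
    also have "vnorm (y - K' y) = vnorm (K' y - y)" using y K'(1) by (intro vnorm_minus_commute) auto
    also have "vnorm (K y - y) + vnorm (K' y - y) \<le> (C + C') * (vnorm y)\<^sup>2"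
      unfolding distrib_right using y \<rho> by (intro add_mono C C') auto
    finally show ?thesis .
  qed
  have d\<mu>: "d (\<mu> \<cdot>\<^sub>v y) = cmod \<mu> * vnorm (f (K y) - f (K' y))" if y: "y \<in> carrier_vec m" for y
  proof -
    have "K (\<mu> \<cdot>\<^sub>v y) - K' (\<mu> \<cdot>\<^sub>v y) = \<mu> \<cdot>\<^sub>v (f (K y) - f (K' y))"
      using K K' f y by (simp add: K(4)[symmetric] K'(4)[symmetric] smult_diff_distrib_vec[of _ m])
    then show ?thesis unfolding d_def using vnorm_smult[of "f (K y) - f (K' y)" m \<mu>] f K(1) K'(1) y by simp
  qed
  have ff: "vnorm (f (K y) - f (K' y)) \<le> (1 + \<epsilon>) * d y" "(1 - \<epsilon>) * d y \<le> vnorm (f (K y) - f (K' y))"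
    if y: "y \<in> carrier_vec m" "vnorm y \<le> \<rho>" for y
  proof -
    let ?a = "f (K y) - f (K' y)" and ?b = "K y - K' y"
    have c: "?a \<in> carrier_vec m" "?b \<in> carrier_vec m" using f K(1) K'(1) y by auto
    have "vnorm (?a - ?b) \<le> \<epsilon> * d y" unfolding d_def using y K(1) K'(1) Ks[OF y] by (intro s) auto
    moreover have "vnorm ?a \<le> vnorm ?b + vnorm (?a - ?b)" by (rule vnorm_triangle_sub[OF c])
    moreover have "vnorm ?b \<le> vnorm ?a + vnorm (?b - ?a)" by (rule vnorm_triangle_sub[OF c(2,1)])
    moreover have "vnorm (?b - ?a) = vnorm (?a - ?b)" by (rule vnorm_minus_commute[OF c(2,1)])
    ultimately show "vnorm ?a \<le> (1 + \<epsilon>) * d y" "(1 - \<epsilon>) * d y \<le> vnorm ?a"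
      by (auto simp: d_def algebra_simps)
  qed
  have local: "d y \<le> 0" if y: "y \<in> carrier_vec m" "vnorm y \<le> \<rho>" for y
  proof (cases "cmod \<mu> > 1")
    case True
    \<comment> \<open>Inwards along 1/\<mu>: the factor |\<mu>|(1 + \<epsilon>) is beaten by the
      square of 1/|\<mu>|.\<close>
    show ?thesis
    proof (rule vnorm_scaling_contraction[OF _ dq _ _ _ y])
      show "0 \<le> cmod \<mu> * (1 + \<epsilon>)" using \<epsilon> by simp
      have "cmod \<mu> * (1 + \<epsilon>) * (cmod (1 / \<mu>))\<^sup>2 = (1 + \<epsilon>) / cmod \<mu>"
        using \<mu> by (simp add: norm_divide power2_eq_square)
      also have "\<dots> < 1"
      proof -
        have "1 + \<epsilon> < cmod \<mu>" using True by (simp add: \<epsilon>_def field_simps)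
        with True show ?thesis by (subst divide_less_eq_1_pos) auto
      qed
      finally show "cmod \<mu> * (1 + \<epsilon>) * (cmod (1 / \<mu>))\<^sup>2 < 1" .
      have "1 / cmod \<mu> \<le> 1 / 1" using True by (intro divide_left_mono) auto
      then show "cmod (1 / \<mu>) \<le> 1" by (simp add: norm_divide)
      fix x assume x: "x \<in> carrier_vec m" "vnorm x \<le> \<rho>"
      let ?z = "(1 / \<mu>) \<cdot>\<^sub>v x"
      have "vnorm ?z \<le> \<rho>"
      proof -
        have "vnorm ?z = vnorm x / cmod \<mu>" using x by (simp add: vnorm_smult[of _ m] norm_divide)
        also have "\<dots> \<le> vnorm x / 1" using True by (intro divide_left_mono) auto
        finally show ?thesis using x by simp
      qed
      moreover have "\<mu> \<cdot>\<^sub>v ?z = x" using \<mu> by (simp add: smult_smult_assoc)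
      ultimately have "d x = cmod \<mu> * vnorm (f (K ?z) - f (K' ?z))" using d\<mu>[of ?z] x by simp
      also have "\<dots> \<le> cmod \<mu> * ((1 + \<epsilon>) * d ?z)"
        using ff(1)[of ?z] x \<open>vnorm ?z \<le> \<rho>\<close> by (intro mult_left_mono) auto
      finally show "d x \<le> cmod \<mu> * (1 + \<epsilon>) * d ?z" by (simp add: mult.assoc)
    qed
  next
    case False
    have m1: "cmod \<mu> < 1" using False \<mu> by simp
    have e1: "1 - \<epsilon> > 0" "1 - \<epsilon> > cmod \<mu>" using False m1 by (auto simp: \<epsilon>_def field_simps add_pos_nonneg)
    \<comment> \<open>Multiplication by \<mu> itself contracts, and the lower bound in
      \<open>ff\<close> turns the functional equation into an upper bound for d(x) by
      d(\<mu>x).\<close>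
    show ?thesis
    proof (rule vnorm_scaling_contraction[OF _ dq _ _ _ y])
      show "0 \<le> 1 / (cmod \<mu> * (1 - \<epsilon>))" using e1 by simp
      have "1 / (cmod \<mu> * (1 - \<epsilon>)) * (cmod \<mu>)\<^sup>2 = cmod \<mu> / (1 - \<epsilon>)" using \<mu> by (simp add: power2_eq_square)
      also have "\<dots> < 1" using e1 by simp
      finally show "1 / (cmod \<mu> * (1 - \<epsilon>)) * (cmod \<mu>)\<^sup>2 < 1" .
      show "cmod \<mu> \<le> 1" using m1 by simp
      fix x assume x: "x \<in> carrier_vec m" "vnorm x \<le> \<rho>"
      have "cmod \<mu> * ((1 - \<epsilon>) * d x) \<le> d (\<mu> \<cdot>\<^sub>v x)"
        unfolding d\<mu>[OF x(1)] using ff(2)[OF x] by (intro mult_left_mono) auto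
      then show "d x \<le> 1 / (cmod \<mu> * (1 - \<epsilon>)) * d (\<mu> \<cdot>\<^sub>v x)"
        using \<mu> e1 by (simp add: field_simps)
    qed
  qed
  have loc: "K y $ i = K' y $ i" if y: "y \<in> carrier_vec m" "vnorm y \<le> \<rho>" and i: "i < m" for y i
  proof -
    have c: "K y - K' y \<in> carrier_vec m" using K(1) K'(1) y by simp
    have "cmod ((K y - K' y) $ i) \<le> 0"
      using local[OF y] cmod_index_le_vnorm'[OF c i] unfolding d_def by linarith
    then show ?thesis using K'(1)[OF y(1)] i by auto
  qed
  show ?thesis
  proof (rule eq_vecI)
    show "dim_vec (K y) = dim_vec (K' y)"
      using K(1)[OF y] K'(1)[OF y] by (metis carrier_vecD)
    fix i assume "i < dim_vec (K' y)"
    then have i: "i < m" using K'(1)[OF y] by auto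
    show "K y $ i = K' y $ i"
      by (rule entire_fun_eqI[OF K(2)[OF i] K'(2)[OF i] \<rho>(1) loc[OF _ _ i] y])
  qed
qed

section \<open>Linearization for an expanding multiplier\<close>

lemma polyfun_tendsto:
  assumes "polyfun m \<phi>" and X: "\<And>j. X j \<in> carrier_vec m" "x \<in> carrier_vec m"
    and t: "\<And>i. i < m \<Longrightarrow> ((\<lambda>j. X j $ i) \<longlongrightarrow> x $ i) F"
  shows "((\<lambda>j. \<phi> (X j)) \<longlongrightarrow> \<phi> x) F"
  using assms(1)
proof (induction rule: polyfun_induct)
  case (cong \<phi> \<psi>)
  then show ?case using X by simp
qed (auto intro!: tendsto_intros t)

lemma polynomial_map_lipschitz:
  assumes "polynomial_map m f"
  shows "\<exists>D\<ge>0. \<forall>x\<in>carrier_vec m. \<forall>y\<in>carrier_vec m. vnorm x \<le> R \<longrightarrow> vnorm y \<le> R \<longrightarrow>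
    vnorm (f x - f y) \<le> D * vnorm (x - y)"
proof -
  have car: "\<And>x. x \<in> carrier_vec m \<Longrightarrow> f x \<in> carrier_vec m" and pf: "\<And>i. i < m \<Longrightarrow> polyfun m (\<lambda>x. f x $ i)"
    using assms unfolding polynomial_map_iff_polyfun by auto
  have "\<forall>i. \<exists>D. i < m \<longrightarrow> D \<ge> 0 \<and> (\<forall>x\<in>carrier_vec m. \<forall>y\<in>carrier_vec m. vnorm x \<le> R \<longrightarrow> vnorm y \<le> R \<longrightarrow>
      cmod (f x $ i - f y $ i) \<le> D * vnorm (x - y))"
  proof
    fix i
    show "\<exists>D. i < m \<longrightarrow> D \<ge> 0 \<and> (\<forall>x\<in>carrier_vec m. \<forall>y\<in>carrier_vec m. vnorm x \<le> R \<longrightarrow> vnorm y \<le> R \<longrightarrow>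
      cmod (f x $ i - f y $ i) \<le> D * vnorm (x - y))"
    proof (cases "i < m")
      case True
      from polyfun_lipschitz[OF pf[OF True], of R] show ?thesis by blast
    qed auto
  qed
  from choice[OF this] obtain D where D: "\<And>i. i < m \<Longrightarrow> D i \<ge> 0"
    "\<And>i x y. i < m \<Longrightarrow> x \<in> carrier_vec m \<Longrightarrow> y \<in> carrier_vec m \<Longrightarrow> vnorm x \<le> R \<Longrightarrow> vnorm y \<le> R \<Longrightarrow>
      cmod (f x $ i - f y $ i) \<le> D i * vnorm (x - y)"
    by blast
  have S: "(\<Sum>i<m. D i) \<ge> 0" using D(1) by (intro sum_nonneg) auto
  have "vnorm (f x - f y) \<le> (\<Sum>i<m. D i) * vnorm (x - y)"
    if xy: "x \<in> carrier_vec m" "y \<in> carrier_vec m" "vnorm x \<le> R" "vnorm y \<le> R" for x y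
  proof (rule vnorm_leI)
    show "f x - f y \<in> carrier_vec m" using car xy by simp
    show "0 \<le> (\<Sum>i<m. D i) * vnorm (x - y)" using S by simp
    fix i assume i: "i < m"
    have "cmod (f x $ i - f y $ i) \<le> D i * vnorm (x - y)" by (rule D(2)[OF i xy])
    also have "\<dots> \<le> (\<Sum>i<m. D i) * vnorm (x - y)"
      using i D(1) by (intro mult_right_mono member_le_sum) auto
    finally show "cmod ((f x - f y) $ i) \<le> (\<Sum>i<m. D i) * vnorm (x - y)"
      using i car[OF xy(2), THEN carrier_vecD] by simp
  qed
  with S show ?thesis by blast
qed

lemma polynomial_map_bounded:
  assumes "polynomial_map m f"
  shows "\<exists>M\<ge>0. \<forall>x\<in>carrier_vec m. vnorm x \<le> R \<longrightarrow> vnorm (f x) \<le> M"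
proof -
  obtain D where D: "D \<ge> 0" "\<And>x y. x \<in> carrier_vec m \<Longrightarrow> y \<in> carrier_vec m \<Longrightarrow> vnorm x \<le> R \<Longrightarrow> vnorm y \<le> R \<Longrightarrow>
    vnorm (f x - f y) \<le> D * vnorm (x - y)"
    using polynomial_map_lipschitz[OF assms, of R] by blast
  have car: "\<And>x. x \<in> carrier_vec m \<Longrightarrow> f x \<in> carrier_vec m"
    using assms unfolding polynomial_map_def by auto
  have "vnorm (f x) \<le> vnorm (f (0\<^sub>v m)) + D * \<bar>R\<bar>" if x: "x \<in> carrier_vec m" "vnorm x \<le> R" for x
  proof -
    have "R \<ge> 0" using x vnorm_nonneg[of x] by linarith
    have x0: "x - 0\<^sub>v m = x" using x by (intro eq_vecI) auto
    have "vnorm (f x) \<le> vnorm (f (0\<^sub>v m)) + vnorm (f x - f (0\<^sub>v m))"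
      using x car by (intro vnorm_triangle_sub) auto
    also have "vnorm (f x - f (0\<^sub>v m)) \<le> D * vnorm x"
      using D(2)[of x "0\<^sub>v m"] x \<open>R \<ge> 0\<close> by (simp add: x0)
    also have "D * vnorm x \<le> D * \<bar>R\<bar>" using x D(1) by (intro mult_left_mono) auto
    finally show ?thesis by simp
  qed
  moreover have "vnorm (f (0\<^sub>v m)) + D * \<bar>R\<bar> \<ge> 0" using D(1) by simp
  ultimately show ?thesis by blast
qed

text \<open>Poincare's linearization: \<open>k\<close> is the limit of \<open>y \<mapsto> (\<mu>f)\<^sup>j (\<mu>\<^sup>-\<^sup>j y)\<close>. Near the origin
  the iterates stay below the quadratic barrier \<open>s + c s\<^sup>2\<close> and converge geometrically; the
  functional equation propagates the convergence to all of space.\<close>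

lemma global_pre_conjugation_expanding:
  assumes p: "polynomial_map m f" and t: "tangent_to_id m f" and \<mu>: "cmod \<mu> > 1"
  shows "\<exists>k. global_pre_conjugation m \<mu> f k"
proof -
  have f: "\<And>x. x \<in> carrier_vec m \<Longrightarrow> f x \<in> carrier_vec m" and pf: "\<And>i. i < m \<Longrightarrow> polyfun m (\<lambda>x. f x $ i)"
    using p unfolding polynomial_map_iff_polyfun by auto
  define L where "L = cmod \<mu>"
  have L: "L > 1" "L > 0" "\<mu> \<noteq> 0" using \<mu> by (auto simp: L_def)
  define \<nu> where "\<nu> = 1 / \<mu>"
  have \<nu>L: "cmod \<nu> = 1 / L" by (simp add: \<nu>_def L_def norm_divide)
  obtain C r0 where C: "r0 > 0" "C \<ge> 0" "\<And>y. y \<in> carrier_vec m \<Longrightarrow> vnorm y \<le> r0 \<Longrightarrow> vnorm (f y - y) \<le> C * (vnorm y)\<^sup>2"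
    using tangent_to_idE[OF t] by blast
  define \<epsilon> where "\<epsilon> = (L - 1) / 2"
  have \<epsilon>: "\<epsilon> > 0" using L by (simp add: \<epsilon>_def)
  obtain r1 where r1: "r1 > 0" "\<And>x y. x \<in> carrier_vec m \<Longrightarrow> y \<in> carrier_vec m \<Longrightarrow> vnorm x \<le> r1 \<Longrightarrow> vnorm y \<le> r1 \<Longrightarrow>
    vnorm (f x - f y - (x - y)) \<le> \<epsilon> * vnorm (x - y)"
    using polynomial_map_strict_tangent[OF p t \<epsilon>] by blast
  have lip: "vnorm (f x - f y) \<le> (1 + \<epsilon>) * vnorm (x - y)"
    if "x \<in> carrier_vec m" "y \<in> carrier_vec m" "vnorm x \<le> r1" "vnorm y \<le> r1" for x y
  proof -
    have "vnorm (f x - f y) \<le> vnorm (x - y) + vnorm (f x - f y - (x - y))"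
      using that f by (intro vnorm_triangle_sub[of _ m]) auto
    with r1(2)[OF that] show ?thesis by (simp add: distrib_right)
  qed
  \<comment> \<open>One step multiplies an increment by L(1 + \<epsilon>), while evaluating its
    quadratic bound at y/\<mu> gains 1/L^2; together this is \<open>q\<close>.\<close>
  define q where "q = (1 + \<epsilon>) / L"
  have q: "0 < q" "q < 1" using L \<epsilon> by (auto simp: q_def \<epsilon>_def field_simps)
  \<comment> \<open>The solution of c + 4C = cL, which makes the barrier reproduce itself: with s =
    |y| the error after one step is (c + 4C) s^2 / L = c s^2.\<close>
  define c where "c = 4 * C / (L - 1)"
  have c: "c \<ge> 0" "c + 4 * C = c * L" using L C by (auto simp: c_def field_simps)
  \<comment> \<open>With c\<rho> \<le> 1 the barrier s + c s^2 is at most 2s, so the iterates stay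
    within the radii \<open>r0\<close> and \<open>r1\<close>.\<close>
  define \<rho> where "\<rho> = Min {r0 / 2, r1 / 2, 1 / (c + 1)}"
  have \<rho>: "\<rho> > 0" "2 * \<rho> \<le> r0" "2 * \<rho> \<le> r1" "\<rho> \<le> 1 / (c + 1)"
    using C(1) r1(1) c unfolding \<rho>_def by (auto simp: min_le_iff_disj)
  have c\<rho>: "c * \<rho> \<le> 1"
  proof -
    have "c * \<rho> \<le> c * (1 / (c + 1))" using \<rho> c by (intro mult_left_mono) auto
    also have "\<dots> \<le> 1" using c by simp
    finally show ?thesis .
  qed
  define K where "K = rec_nat (\<lambda>y. y) (\<lambda>j k y. \<mu> \<cdot>\<^sub>v f (k (\<nu> \<cdot>\<^sub>v y)))"
  have K0: "K 0 y = y" and KS: "K (Suc j) y = \<mu> \<cdot>\<^sub>v f (K j (\<nu> \<cdot>\<^sub>v y))" for j y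
    by (simp_all add: K_def)
  have Kc: "K j y \<in> carrier_vec m" if "y \<in> carrier_vec m" for j y
    using that by (induction j arbitrary: y) (auto simp: K0 KS f)
  have scale: "vnorm (\<nu> \<cdot>\<^sub>v y) = vnorm y / L" if "y \<in> carrier_vec m" for y
    using that by (simp add: vnorm_smult \<nu>L)
  have scale_le: "vnorm (\<nu> \<cdot>\<^sub>v y) \<le> vnorm y" if "y \<in> carrier_vec m" for y
    unfolding scale[OF that] using L(1) divide_left_mono[of 1 L "vnorm y"] by simp
  have barrier: "vnorm (K j y) \<le> vnorm y + c * (vnorm y)\<^sup>2" if "y \<in> carrier_vec m" "vnorm y \<le> \<rho>" for j y
    using that
  proof (induction j arbitrary: y)
    case 0
    then show ?case using c by (simp add: K0)
  next
    case (Suc j)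
    let ?s = "vnorm y" and ?x = "K j (\<nu> \<cdot>\<^sub>v y)"
    have x: "?x \<in> carrier_vec m" using Suc.prems Kc by simp
    have "vnorm ?x \<le> vnorm (\<nu> \<cdot>\<^sub>v y) + c * (vnorm (\<nu> \<cdot>\<^sub>v y))\<^sup>2"
      using Suc.prems scale_le[of y] by (intro Suc.IH) auto
    then have x1: "vnorm ?x \<le> ?s / L + c * (?s / L)\<^sup>2" using Suc.prems by (simp add: scale)
    have sL: "?s / L \<le> ?s" "0 \<le> ?s / L" using scale_le[of y] scale[of y] Suc.prems L by auto
    have "c * (?s / L)\<^sup>2 \<le> ?s / L"
    proof -
      have "c * (?s / L) \<le> c * \<rho>" using c sL Suc.prems by (intro mult_left_mono) auto
      then have "c * (?s / L) * (?s / L) \<le> 1 * (?s / L)" using c\<rho> sL by (intro mult_right_mono) auto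
      then show ?thesis by (simp only: power2_eq_square mult.assoc mult_1)
    qed
    with x1 have x2: "vnorm ?x \<le> 2 * (?s / L)" by simp
    then have "vnorm ?x \<le> r0" using sL Suc.prems \<rho> by linarith
    then have "vnorm (f ?x - ?x) \<le> C * (vnorm ?x)\<^sup>2" by (rule C(3)[OF x])
    also have "\<dots> \<le> C * (2 * (?s / L))\<^sup>2" using x2 C(2) by (intro mult_left_mono power_mono) auto
    finally have "vnorm (f ?x) \<le> ?s / L + c * (?s / L)\<^sup>2 + C * (2 * (?s / L))\<^sup>2"
      using vnorm_triangle_sub[of "f ?x" m ?x] x f x1 by fastforce
    then have "L * vnorm (f ?x) \<le> L * (?s / L + c * (?s / L)\<^sup>2 + C * (2 * (?s / L))\<^sup>2)"
      using L by (intro mult_left_mono) auto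
    also have "\<dots> = ?s + (c + 4 * C) * ?s\<^sup>2 / L"
      using L by (simp add: field_simps power2_eq_square)
    also have "\<dots> = ?s + c * ?s\<^sup>2" unfolding c(2) using L by simp
    finally show ?case using vnorm_smult[of "f ?x" m \<mu>] f[OF x] by (simp add: KS L_def)
  qed
  have Kr: "vnorm (K j y) \<le> 2 * \<rho>" if y: "y \<in> carrier_vec m" "vnorm y \<le> \<rho>" for j y
  proof -
    have "c * (vnorm y)\<^sup>2 \<le> (c * \<rho>) * \<rho>"
      unfolding power2_eq_square mult.assoc[symmetric] using y c \<rho> by (intro mult_mono) auto
    also have "\<dots> \<le> 1 * \<rho>" using c\<rho> \<rho> by (intro mult_right_mono) auto
    finally show ?thesis using barrier[OF y, of j] y by linarith
  qed
  have diffS: "vnorm (K (Suc (Suc j)) y - K (Suc j) y) = L * vnorm (f (K (Suc j) (\<nu> \<cdot>\<^sub>v y)) - f (K j (\<nu> \<cdot>\<^sub>v y)))"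
    if y: "y \<in> carrier_vec m" for j y
  proof -
    have "K (Suc (Suc j)) y - K (Suc j) y = \<mu> \<cdot>\<^sub>v (f (K (Suc j) (\<nu> \<cdot>\<^sub>v y)) - f (K j (\<nu> \<cdot>\<^sub>v y)))"
      using y f Kc by (simp add: KS[of "Suc j"] KS[of j y] smult_diff_distrib_vec[of _ m])
    then show ?thesis
      using vnorm_smult[of "f (K (Suc j) (\<nu> \<cdot>\<^sub>v y)) - f (K j (\<nu> \<cdot>\<^sub>v y))" m \<mu>] f Kc y by (simp add: L_def)
  qed
  have dif: "vnorm (K (Suc j) y - K j y) \<le> C * q ^ j * (vnorm y)\<^sup>2" if "y \<in> carrier_vec m" "vnorm y \<le> \<rho>" for j y
    using that
  proof (induction j arbitrary: y)
    case 0
    let ?z = "\<nu> \<cdot>\<^sub>v y"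
    have z: "?z \<in> carrier_vec m" "vnorm ?z \<le> r0" using 0 scale_le[of y] \<rho> by auto
    have "\<mu> \<cdot>\<^sub>v ?z = y" using L by (simp add: smult_smult_assoc \<nu>_def)
    then have "K (Suc 0) y - K 0 y = \<mu> \<cdot>\<^sub>v (f ?z - ?z)"
      using f[OF z(1)] z(1) by (simp add: KS K0 smult_diff_distrib_vec[of _ m])
    then have "vnorm (K (Suc 0) y - K 0 y) = L * vnorm (f ?z - ?z)"
      using vnorm_smult[of "f ?z - ?z" m \<mu>] f[OF z(1)] z(1) by (simp add: L_def)
    also have "\<dots> \<le> L * (C * (vnorm ?z)\<^sup>2)" using L by (intro mult_left_mono C z) auto
    also have "\<dots> = C * (vnorm y)\<^sup>2 / L" using L 0 by (simp add: scale power2_eq_square)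
    also have "\<dots> \<le> C * (vnorm y)\<^sup>2" using L C divide_left_mono[of 1 L "C * (vnorm y)\<^sup>2"] by simp
    finally show ?case by simp
  next
    case (Suc j)
    let ?z = "\<nu> \<cdot>\<^sub>v y"
    have z: "?z \<in> carrier_vec m" "vnorm ?z \<le> \<rho>" using Suc.prems scale_le[of y] by auto
    have "vnorm (K (Suc (Suc j)) y - K (Suc j) y) = L * vnorm (f (K (Suc j) ?z) - f (K j ?z))"
      by (rule diffS) (rule Suc.prems)
    also have "\<dots> \<le> L * ((1 + \<epsilon>) * vnorm (K (Suc j) ?z - K j ?z))"
      using L Kr[OF z] \<rho>(3) Kc[OF z(1)] by (intro mult_left_mono lip) (auto intro: order_trans)
    also have "\<dots> \<le> L * ((1 + \<epsilon>) * (C * q ^ j * (vnorm ?z)\<^sup>2))"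
      using L \<epsilon> z by (intro mult_left_mono Suc.IH) auto
    also have "\<dots> = C * q ^ Suc j * (vnorm y)\<^sup>2"
      using L Suc.prems by (simp add: scale q_def power2_eq_square)
    finally show ?case .
  qed
  \<comment> \<open>On the ball of radius \<open>R\<close> the iterates are bounded and their
    increments decay like \<open>q ^ j\<close>. Only the constant \<open>M\<close> depends on
    \<open>R\<close>; the ratio stays the same when the ball grows.\<close>
  define G where "G R \<longleftrightarrow> (\<exists>M\<ge>0. \<forall>y\<in>carrier_vec m. vnorm y \<le> R \<longrightarrow>
    (\<forall>j. vnorm (K j y) \<le> M \<and> vnorm (K (Suc j) y - K j y) \<le> M * q ^ j))" for R
  have G\<rho>: "G \<rho>"
    unfolding G_def
  proof (rule exI[of _ "2 * \<rho> + C * \<rho>\<^sup>2"], intro conjI ballI impI allI)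
    show "2 * \<rho> + C * \<rho>\<^sup>2 \<ge> 0" using \<rho> C by simp
    fix y j assume y: "y \<in> carrier_vec m" "vnorm y \<le> \<rho>"
    show "vnorm (K j y) \<le> 2 * \<rho> + C * \<rho>\<^sup>2" using Kr[OF y, of j] C by (simp add: add_increasing2)
    have "vnorm (K (Suc j) y - K j y) \<le> C * q ^ j * (vnorm y)\<^sup>2" by (rule dif[OF y])
    also have "\<dots> \<le> C * q ^ j * \<rho>\<^sup>2" using y C q by (intro mult_left_mono power_mono) auto
    also have "\<dots> \<le> (2 * \<rho> + C * \<rho>\<^sup>2) * q ^ j" using \<rho> q by (simp add: distrib_right)
    finally show "vnorm (K (Suc j) y - K j y) \<le> (2 * \<rho> + C * \<rho>\<^sup>2) * q ^ j" .
  qed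
  \<comment> \<open>\<open>K (Suc j)\<close> on the ball of radius \<open>L * R\<close> is \<mu>f
    applied to \<open>K j\<close> on the ball of radius \<open>R\<close>, and \<open>f\<close> is
    Lipschitz on the bounded set of values taken there.\<close>
  have GL: "G (L * R)" if "G R" for R
  proof -
    obtain M where M: "M \<ge> 0" "\<And>y j. y \<in> carrier_vec m \<Longrightarrow> vnorm y \<le> R \<Longrightarrow> vnorm (K j y) \<le> M"
      "\<And>y j. y \<in> carrier_vec m \<Longrightarrow> vnorm y \<le> R \<Longrightarrow> vnorm (K (Suc j) y - K j y) \<le> M * q ^ j"
      using \<open>G R\<close> unfolding G_def by blast
    obtain \<Lambda> where \<Lambda>: "\<Lambda> \<ge> 0" "\<And>x y. x \<in> carrier_vec m \<Longrightarrow> y \<in> carrier_vec m \<Longrightarrow> vnorm x \<le> M \<Longrightarrow> vnorm y \<le> M \<Longrightarrow>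
      vnorm (f x - f y) \<le> \<Lambda> * vnorm (x - y)" using polynomial_map_lipschitz[OF p, of M] by blast
    obtain B where B: "B \<ge> 0" "\<And>x. x \<in> carrier_vec m \<Longrightarrow> vnorm x \<le> M \<Longrightarrow> vnorm (f x) \<le> B"
      using polynomial_map_bounded[OF p, of M] by blast
    \<comment> \<open>Division by \<open>q\<close> compensates the shift of the index; the first two
      summands bound the increment for j = 0.\<close>
    define M' where "M' = L * \<bar>R\<bar> + L * B + L * \<Lambda> * M / q"
    have nn: "L * \<bar>R\<bar> \<ge> 0" "L * B \<ge> 0" "L * \<Lambda> * M / q \<ge> 0" using L B \<Lambda> M q by auto
    then have M'0: "M' \<ge> 0" by (simp add: M'_def)
    have "vnorm (K j y) \<le> L * \<bar>R\<bar> + L * B \<and> vnorm (K (Suc j) y - K j y) \<le> M' * q ^ j"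
      if y: "y \<in> carrier_vec m" "vnorm y \<le> L * R" for y j
    proof -
      let ?z = "\<nu> \<cdot>\<^sub>v y"
      have z: "?z \<in> carrier_vec m" "vnorm ?z \<le> R" using y L by (auto simp: scale field_simps)
      have KSb: "vnorm (K (Suc j) y) \<le> L * B" for j
        using vnorm_smult[of "f (K j ?z)" m \<mu>] f Kc z L M B by (simp add: KS L_def[symmetric] mult_left_mono)
      have "L * R \<le> L * \<bar>R\<bar>" using L by (intro mult_left_mono) auto
      then have K0b: "vnorm (K 0 y) \<le> L * \<bar>R\<bar>" using y by (simp add: K0)
      have b: "vnorm (K j y) \<le> L * \<bar>R\<bar> + L * B" for j
        using KSb[of "j - 1"] K0b nn by (cases j) auto
      moreover have "vnorm (K (Suc j) y - K j y) \<le> M' * q ^ j"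
      proof (cases j)
        case 0
        have "vnorm (K (Suc 0) y - K 0 y) \<le> vnorm (K (Suc 0) y) + vnorm (K 0 y)"
          using vnorm_triangle[of "K (Suc 0) y" m "- K 0 y"] vnorm_smult[of "K 0 y" m "-1"] Kc[OF y(1)]
          by (simp add: minus_add_uminus_vec[of _ m] uminus_vec_def smult_vec_def)
        then show ?thesis using KSb[of 0] K0b nn 0 by (simp add: M'_def)
      next
        case (Suc i)
        have "vnorm (K (Suc (Suc i)) y - K (Suc i) y) = L * vnorm (f (K (Suc i) ?z) - f (K i ?z))"
          by (rule diffS[OF y(1)])
        also have "\<dots> \<le> L * (\<Lambda> * vnorm (K (Suc i) ?z - K i ?z))"
          using L z Kc M by (intro mult_left_mono \<Lambda>) auto
        also have "\<dots> \<le> L * (\<Lambda> * (M * q ^ i))"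
          using L z \<Lambda> M by (intro mult_left_mono) auto
        also have "\<dots> = L * \<Lambda> * M / q * q ^ Suc i" using q by simp
        also have "\<dots> \<le> M' * q ^ Suc i" using nn q by (intro mult_right_mono) (auto simp: M'_def)
        finally show ?thesis using Suc by simp
      qed
      ultimately show ?thesis by blast
    qed
    moreover have "L * \<bar>R\<bar> + L * B \<le> M'" using nn by (simp add: M'_def)
    ultimately show ?thesis unfolding G_def using M'0 by (meson order_trans)
  qed
  have GR: "G R" for R
  proof -
    have pw: "G (L ^ n * \<rho>)" for n
      by (induction n) (use G\<rho> GL in \<open>auto simp: mult.assoc\<close>)
    obtain n where "R / \<rho> < L ^ n" using real_arch_pow[OF L(1)] by blast
    then have "R \<le> L ^ n * \<rho>" using \<rho> by (simp add: field_simps)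
    then show ?thesis using pw[of n] unfolding G_def by (meson order_trans)
  qed
  define u where "u i j y = K (Suc j) y $ i - K j y $ i" for i j y
  have Ke: "entire_fun m (\<lambda>y. K j y $ i)" if "i < m" for i j
    using that
  proof (induction j arbitrary: i)
    case 0
    then show ?case by (simp add: K0 entire_fun_index)
  next
    case (Suc j)
    have "entire_fun m (\<lambda>y. f (K j (\<nu> \<cdot>\<^sub>v y)) $ i)"
      by (rule entire_fun_polyfun_compose[OF pf[OF Suc.prems]])
         (use Kc in \<open>auto intro: entire_fun_smult_compose[OF Suc.IH]\<close>)
    then have "entire_fun m (\<lambda>y. \<mu> * f (K j (\<nu> \<cdot>\<^sub>v y)) $ i)"
      by (rule entire_fun_mult[OF entire_fun_const])
    then show ?case
      by (rule entire_fun_cong)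
         (use Suc.prems f[THEN carrier_vecD] Kc in \<open>auto simp: KS\<close>)
  qed
  have ue: "entire_fun m (u i j)" if "i < m" for i j
    unfolding u_def using that by (intro entire_fun_diff Ke)
  have ub: "cmod (u i j y) \<le> vnorm (K (Suc j) y - K j y)" if "i < m" "y \<in> carrier_vec m" for i j y
    using cmod_index_le_vnorm'[of "K (Suc j) y - K j y" m i] Kc[OF that(2)] Kc[OF that(2), THEN carrier_vecD] that
    by (simp add: u_def)
  have us: "\<exists>J M. summable M \<and> (\<forall>j\<ge>J. \<forall>y\<in>carrier_vec m. vnorm y \<le> R \<longrightarrow> cmod (u i j y) \<le> M j)" if i: "i < m" for i R
  proof -
    obtain M where "\<And>y j. y \<in> carrier_vec m \<Longrightarrow> vnorm y \<le> R \<Longrightarrow> vnorm (K (Suc j) y - K j y) \<le> M * q ^ j"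
      using GR[of R] unfolding G_def by blast
    moreover have "summable (\<lambda>j. M * q ^ j)" using q by (intro summable_mult summable_geometric) auto
    ultimately show ?thesis using ub[OF i] by (intro exI[of _ 0] exI[of _ "\<lambda>j. M * q ^ j"]) (meson order_trans)
  qed
  \<comment> \<open>The limit is written as a telescoping series of increments, so that
    \<open>entire_fun_suminf\<close> applies.\<close>
  define k where "k y = vec m (\<lambda>i. y $ i + suminf (\<lambda>j. u i j y))" for y
  have kc: "k y \<in> carrier_vec m" for y by (simp add: k_def)
  have lim: "(\<lambda>j. K j y $ i) \<longlonglongrightarrow> k y $ i" if i: "i < m" and y: "y \<in> carrier_vec m" for i y
  proof -
    have "(\<lambda>n. \<Sum>j<n. u i j y) \<longlonglongrightarrow> suminf (\<lambda>j. u i j y)"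
      by (rule summable_LIMSEQ[OF entire_fun_suminf(2)[of m "u i", OF ue[OF i] us[OF i] y]])
    moreover have "(\<Sum>j<n. u i j y) = K n y $ i - y $ i" for n
      unfolding u_def using sum_lessThan_telescope[of "\<lambda>j. K j y $ i" n] by (simp add: K0)
    ultimately have "(\<lambda>n. y $ i + (K n y $ i - y $ i)) \<longlonglongrightarrow> y $ i + suminf (\<lambda>j. u i j y)"
      by (intro tendsto_intros) simp
    then show ?thesis using i by (simp add: k_def)
  qed
  have ke: "entire_fun m (\<lambda>y. k y $ i)" if i: "i < m" for i
    by (rule entire_fun_cong[OF entire_fun_add[OF entire_fun_index[OF i] entire_fun_suminf(1)[of m "u i", OF ue[OF i] us[OF i]]]])
       (use i in \<open>simp add: k_def\<close>)
  have kt: "tangent_to_id m k"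
    unfolding tangent_to_id_def
  proof (rule exI[of _ "C / (1 - q)"], rule exI[of _ \<rho>], intro conjI ballI impI \<rho>(1))
    fix y assume y: "y \<in> carrier_vec m" "vnorm y \<le> \<rho>"
    show "vnorm (k y - y) \<le> C / (1 - q) * (vnorm y)\<^sup>2"
    proof (rule vnorm_leI[of _ m])
      show "k y - y \<in> carrier_vec m" using kc y by simp
      show "0 \<le> C / (1 - q) * (vnorm y)\<^sup>2" using C q by simp
      fix i assume i: "i < m"
      have s: "(\<lambda>j. C * (vnorm y)\<^sup>2 * q ^ j) sums (C * (vnorm y)\<^sup>2 * (1 / (1 - q)))"
        using q by (intro sums_mult geometric_sums) auto
      have "cmod (suminf (\<lambda>j. u i j y)) \<le> suminf (\<lambda>j. C * (vnorm y)\<^sup>2 * q ^ j)"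
      proof (rule norm_suminf_le[OF _ sums_summable[OF s]])
        fix j
        have "cmod (u i j y) \<le> C * q ^ j * (vnorm y)\<^sup>2"
          using ub[OF i y(1), of j] dif[OF y, of j] by linarith
        then show "cmod (u i j y) \<le> C * (vnorm y)\<^sup>2 * q ^ j" by (simp add: mult_ac)
      qed
      also have "\<dots> = C * (vnorm y)\<^sup>2 * (1 / (1 - q))" by (rule sums_unique[OF s, symmetric])
      finally show "cmod ((k y - y) $ i) \<le> C / (1 - q) * (vnorm y)\<^sup>2"
        using i y by (simp add: k_def)
    qed
  qed
  have "\<mu> \<cdot>\<^sub>v f (k y) = k (\<mu> \<cdot>\<^sub>v y)" if y: "y \<in> carrier_vec m" for y
  proof (rule eq_vecI)
    fix i assume "i < dim_vec (k (\<mu> \<cdot>\<^sub>v y))"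
    then have i: "i < m" by (simp add: k_def)
    have \<nu>\<mu>: "\<nu> \<cdot>\<^sub>v (\<mu> \<cdot>\<^sub>v y) = y" using L by (simp add: smult_smult_assoc \<nu>_def)
    have "(\<lambda>j. f (K j y) $ i) \<longlonglongrightarrow> f (k y) $ i"
      using Kc[OF y] kc lim y by (intro polyfun_tendsto[OF pf[OF i]]) auto
    then have "(\<lambda>j. \<mu> * f (K j y) $ i) \<longlonglongrightarrow> \<mu> * f (k y) $ i" by (intro tendsto_intros)
    moreover have "(\<lambda>j. K (Suc j) (\<mu> \<cdot>\<^sub>v y) $ i) \<longlonglongrightarrow> k (\<mu> \<cdot>\<^sub>v y) $ i"
      by (rule LIMSEQ_Suc[OF lim[OF i]]) (use y in simp)
    moreover have "K (Suc j) (\<mu> \<cdot>\<^sub>v y) $ i = \<mu> * f (K j y) $ i" for j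
      using i f[OF Kc[OF y], THEN carrier_vecD] by (simp add: KS \<nu>\<mu>)
    ultimately have "\<mu> * f (k y) $ i = k (\<mu> \<cdot>\<^sub>v y) $ i" using LIMSEQ_unique by simp
    then show "(\<mu> \<cdot>\<^sub>v f (k y)) $ i = k (\<mu> \<cdot>\<^sub>v y) $ i" using i f[OF kc, THEN carrier_vecD] by simp
  qed (use f kc in \<open>auto simp: f[OF kc, THEN carrier_vecD] k_def\<close>)
  then show ?thesis
    unfolding global_pre_conjugation_iff using kc ke kt by blast
qed

section \<open>The linear functional equation\<close>

lemma poly_quadratic_bound_coeff:
  fixes p :: "complex poly"
  assumes r: "r > 0" and le: "\<And>t. cmod t \<le> r \<Longrightarrow> cmod (poly p t) \<le> C * (cmod t)\<^sup>2"
  shows "coeff p 0 = 0" "coeff p 1 = 0"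
proof -
  obtain a p' where p: "p = pCons a p'" by (cases p)
  obtain b p'' where p': "p' = pCons b p''" by (cases p')
  have "a = 0" using le[of 0] r by (simp add: p)
  moreover have "b = 0"
  proof -
    have "((\<lambda>t. cmod (poly p' (of_real t))) \<longlongrightarrow> cmod (poly p' (of_real 0))) (at_right 0)"
      by (intro tendsto_intros)
    moreover have "((\<lambda>t. C * t) \<longlongrightarrow> C * 0) (at_right 0)" by (intro tendsto_intros)
    moreover have "cmod (poly p' (of_real t)) \<le> C * t" if t: "0 < t" "t < r" for t
    proof -
      have "t * cmod (poly p' (of_real t)) \<le> t * (C * t)"
        using le[of "of_real t"] t \<open>a = 0\<close> by (simp add: p norm_mult power2_eq_square mult_ac)
      then show ?thesis using t by simp
    qed
    then have "eventually (\<lambda>t. cmod (poly p' (of_real t)) \<le> C * t) (at_right 0)"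
      using r by (auto simp: eventually_at_right intro!: exI[of _ r])
    ultimately have "cmod (poly p' (of_real 0)) \<le> C * 0"
      by (intro tendsto_le[OF trivial_limit_at_right_real]) auto
    then show ?thesis by (simp add: p')
  qed
  ultimately show "coeff p 0 = 0" "coeff p 1 = 0" by (simp_all add: p p')
qed

text \<open>The linear equation \<open>\<phi>(y) - \<phi>(\<mu>y)/\<mu> = P(y)\<close> multiplies the coefficient of \<open>y\<^sup>\<alpha>\<close> by
  \<open>1 - \<mu>\<^sup>d\<close> with \<open>d = |\<alpha>| - 1\<close>, so it can be solved as soon as \<open>P\<close> has order at least 2.\<close>

lemma polyfun_cohomological_equation:
  assumes P: "polyfun m P" and \<mu>: "\<mu> \<noteq> 0" "cmod \<mu> \<noteq> 1"
    and r: "r > 0" "\<And>y. y \<in> carrier_vec m \<Longrightarrow> vnorm y \<le> r \<Longrightarrow> cmod (P y) \<le> C * (vnorm y)\<^sup>2"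
  shows "\<exists>\<phi>. polyfun m \<phi> \<and> (\<exists>D s. s > 0 \<and> (\<forall>y\<in>carrier_vec m. vnorm y \<le> s \<longrightarrow> cmod (\<phi> y) \<le> D * (vnorm y)\<^sup>2)) \<and>
    (\<forall>y\<in>carrier_vec m. \<phi> y - \<phi> (\<mu> \<cdot>\<^sub>v y) / \<mu> = P y)"
proof -
  obtain S c where S: "finite S" "S \<subseteq> multi_indices m"
    and Pc: "\<And>y. y \<in> carrier_vec m \<Longrightarrow> P y = (\<Sum>\<alpha>\<in>S. c \<alpha> * vec_monomial m \<alpha> y)"
    using P unfolding polyfun_def by auto
  define d where "d \<alpha> = (\<Sum>j<m. \<alpha> j)" for \<alpha> :: "nat \<Rightarrow> nat"
  define T where "T = {\<alpha>\<in>S. d \<alpha> \<ge> 2}"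
  have T: "finite T" "T \<subseteq> multi_indices m" "T \<subseteq> S" using S by (auto simp: T_def)
  \<comment> \<open>On the line through \<open>y\<close> the sums of the terms of degree 0 and 1 are
    the two lowest coefficients of a polynomial in t, and the quadratic bound makes these
    vanish.\<close>
  have PT: "P y = (\<Sum>\<alpha>\<in>T. c \<alpha> * vec_monomial m \<alpha> y)" if y: "y \<in> carrier_vec m" for y
  proof -
    define p where "p = (\<Sum>\<alpha>\<in>S. monom (c \<alpha> * vec_monomial m \<alpha> y) (d \<alpha>))"
    have Pt: "P (t \<cdot>\<^sub>v y) = poly p t" for t
      using y by (simp add: Pc p_def poly_sum poly_monom vec_monomial_smult[OF y] d_def mult_ac)
    define s where "s = r / (vnorm y + 1)"
    have s: "s > 0" using r by (simp add: s_def add_nonneg_pos)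
    have b: "cmod (poly p t) \<le> (C * (vnorm y)\<^sup>2) * (cmod t)\<^sup>2" if t: "cmod t \<le> s" for t
    proof -
      have "cmod t * vnorm y \<le> s * (vnorm y + 1)" using t s by (intro mult_mono) auto
      also have "\<dots> = r" using vnorm_nonneg[of y] by (simp add: s_def add_nonneg_eq_0_iff)
      finally have "cmod (P (t \<cdot>\<^sub>v y)) \<le> C * (vnorm (t \<cdot>\<^sub>v y))\<^sup>2"
        using y by (intro r) (auto simp: vnorm_smult[of _ m])
      then show ?thesis using y by (simp add: Pt vnorm_smult[of _ m] power_mult_distrib mult_ac)
    qed
    have coeff: "coeff p k = (\<Sum>\<alpha>\<in>S. if d \<alpha> = k then c \<alpha> * vec_monomial m \<alpha> y else 0)" for k
      by (simp add: p_def coeff_sum)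
    have "(\<Sum>\<alpha>\<in>S - T. c \<alpha> * vec_monomial m \<alpha> y) =
      (\<Sum>\<alpha>\<in>S. (if d \<alpha> = 0 then c \<alpha> * vec_monomial m \<alpha> y else 0) + (if d \<alpha> = 1 then c \<alpha> * vec_monomial m \<alpha> y else 0))"
    proof (rule sum.mono_neutral_cong_left[OF S(1)])
      show "\<forall>\<alpha>\<in>S - (S - T). (if d \<alpha> = 0 then c \<alpha> * vec_monomial m \<alpha> y else 0) +
        (if d \<alpha> = 1 then c \<alpha> * vec_monomial m \<alpha> y else 0) = 0"
      proof
        fix \<alpha> assume "\<alpha> \<in> S - (S - T)"
        then have "d \<alpha> \<noteq> 0" "d \<alpha> \<noteq> 1" unfolding T_def by auto
        then show "(if d \<alpha> = 0 then c \<alpha> * vec_monomial m \<alpha> y else 0) +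
          (if d \<alpha> = 1 then c \<alpha> * vec_monomial m \<alpha> y else 0) = 0" by simp
      qed
      fix \<alpha> assume "\<alpha> \<in> S - T"
      then have "d \<alpha> = 0 \<or> d \<alpha> = 1" unfolding T_def by auto
      then show "c \<alpha> * vec_monomial m \<alpha> y = (if d \<alpha> = 0 then c \<alpha> * vec_monomial m \<alpha> y else 0) +
        (if d \<alpha> = 1 then c \<alpha> * vec_monomial m \<alpha> y else 0)" by auto
    qed auto
    also have "\<dots> = coeff p 0 + coeff p 1" by (simp only: sum.distrib coeff)
    also have "\<dots> = 0" using poly_quadratic_bound_coeff[OF s b] by simp
    finally show ?thesis
      using sum.subset_diff[OF T(3) S(1), of "\<lambda>\<alpha>. c \<alpha> * vec_monomial m \<alpha> y"] by (simp add: Pc[OF y])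
  qed
  \<comment> \<open>Degree at least 2 gives a positive exponent, and a positive power of \<mu> with
    |\<mu>| \<noteq> 1 is not 1.\<close>
  have ne: "1 - \<mu> ^ (d \<alpha> - 1) \<noteq> 0" if "\<alpha> \<in> T" for \<alpha>
  proof
    assume "1 - \<mu> ^ (d \<alpha> - 1) = 0"
    then have "\<mu> ^ (d \<alpha> - 1) = 1" by simp
    from power_eq_1_iff[OF this] show False using that \<mu>(2) by (auto simp: T_def)
  qed
  define e where "e \<alpha> = c \<alpha> / (1 - \<mu> ^ (d \<alpha> - 1))" for \<alpha>
  define \<phi> where "\<phi> y = (\<Sum>\<alpha>\<in>T. e \<alpha> * vec_monomial m \<alpha> y)" for y
  have pf: "polyfun m \<phi>" unfolding polyfun_def \<phi>_def using T by blast
  have bound: "cmod (\<phi> y) \<le> (\<Sum>\<alpha>\<in>T. cmod (e \<alpha>)) * (vnorm y)\<^sup>2" if y: "y \<in> carrier_vec m" "vnorm y \<le> 1" for y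
    unfolding \<phi>_def sum_distrib_right
  proof (rule sum_norm_le)
    fix \<alpha> assume \<alpha>: "\<alpha> \<in> T"
    then have "cmod (vec_monomial m \<alpha> y) \<le> vnorm y ^ d \<alpha>"
      unfolding d_def by (intro norm_vec_monomial_le[OF y(1)]) simp
    also have "\<dots> \<le> (vnorm y)\<^sup>2" using \<alpha> y by (intro power_decreasing) (auto simp: T_def)
    finally show "cmod (e \<alpha> * vec_monomial m \<alpha> y) \<le> cmod (e \<alpha>) * (vnorm y)\<^sup>2"
      unfolding norm_mult by (intro mult_left_mono) auto
  qed
  have eq: "\<phi> y - \<phi> (\<mu> \<cdot>\<^sub>v y) / \<mu> = P y" if y: "y \<in> carrier_vec m" for y
  proof -
    have "\<phi> y - \<phi> (\<mu> \<cdot>\<^sub>v y) / \<mu> = (\<Sum>\<alpha>\<in>T. e \<alpha> * vec_monomial m \<alpha> y - e \<alpha> * vec_monomial m \<alpha> (\<mu> \<cdot>\<^sub>v y) / \<mu>)"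
      by (simp add: \<phi>_def sum_subtractf sum_divide_distrib)
    also have "\<dots> = (\<Sum>\<alpha>\<in>T. c \<alpha> * vec_monomial m \<alpha> y)"
    proof (rule sum.cong[OF refl])
      fix \<alpha> assume \<alpha>: "\<alpha> \<in> T"
      then obtain k where k: "d \<alpha> = Suc k" by (cases "d \<alpha>") (auto simp: T_def)
      have v: "vec_monomial m \<alpha> (\<mu> \<cdot>\<^sub>v y) / \<mu> = \<mu> ^ k * vec_monomial m \<alpha> y"
        using \<mu> by (simp add: vec_monomial_smult[OF y] d_def[symmetric] k)
      have c: "c \<alpha> = e \<alpha> * (1 - \<mu> ^ k)" using ne[OF \<alpha>] by (simp add: e_def k)
      show "e \<alpha> * vec_monomial m \<alpha> y - e \<alpha> * vec_monomial m \<alpha> (\<mu> \<cdot>\<^sub>v y) / \<mu> = c \<alpha> * vec_monomial m \<alpha> y"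
        unfolding c times_divide_eq_right[symmetric] v by (simp add: algebra_simps)
    qed
    finally show ?thesis by (simp add: PT[OF y])
  qed
  show ?thesis using pf bound eq by (intro exI[of _ \<phi>] conjI exI[of _ "\<Sum>\<alpha>\<in>T. cmod (e \<alpha>)"] exI[of _ "1::real"]) auto
qed

text \<open>The solution is the sum of P(\<nu>^j y)/\<nu>^j, for which an index shift is the
  equation. The quadratic order of \<open>P\<close> turns the denominators into a convergent factor
  |\<nu>|^j, on a large ball from the index on at which \<nu>^j y is small.\<close>

lemma entire_cohomological_series:
  assumes P: "entire_fun m P" and \<nu>: "\<nu> \<noteq> 0" "cmod \<nu> < 1"
    and r: "r > 0" "\<And>y. y \<in> carrier_vec m \<Longrightarrow> vnorm y \<le> r \<Longrightarrow> cmod (P y) \<le> C * (vnorm y)\<^sup>2"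
  shows "\<exists>\<phi>. entire_fun m \<phi> \<and> (\<exists>D. \<forall>y\<in>carrier_vec m. vnorm y \<le> r \<longrightarrow> cmod (\<phi> y) \<le> D * (vnorm y)\<^sup>2) \<and>
    (\<forall>y\<in>carrier_vec m. \<phi> y - \<phi> (\<nu> \<cdot>\<^sub>v y) / \<nu> = P y)"
proof -
  define u where "u j y = P (\<nu> ^ j \<cdot>\<^sub>v y) / \<nu> ^ j" for j y
  have ue: "entire_fun m (u j)" for j
    using entire_fun_mult[OF entire_fun_const entire_fun_smult_compose[OF P], of "1 / \<nu> ^ j" "\<nu> ^ j"]
    by (simp add: u_def[abs_def])
  have ub: "cmod (u j y) \<le> \<bar>C\<bar> * R\<^sup>2 * cmod \<nu> ^ j"
    if y: "y \<in> carrier_vec m" "vnorm y \<le> R" "cmod \<nu> ^ j * R \<le> r" for j y R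
  proof -
    have n: "vnorm (\<nu> ^ j \<cdot>\<^sub>v y) = cmod \<nu> ^ j * vnorm y" using y by (simp add: vnorm_smult norm_power)
    have "cmod \<nu> ^ j * vnorm y \<le> cmod \<nu> ^ j * R" using y by (intro mult_left_mono) auto
    with y have "vnorm (\<nu> ^ j \<cdot>\<^sub>v y) \<le> r" unfolding n by linarith
    then have "cmod (P (\<nu> ^ j \<cdot>\<^sub>v y)) \<le> C * (cmod \<nu> ^ j * vnorm y)\<^sup>2" using r(2)[of "\<nu> ^ j \<cdot>\<^sub>v y"] y n by simp
    also have "\<dots> \<le> \<bar>C\<bar> * (cmod \<nu> ^ j * R)\<^sup>2" using y by (intro mult_mono power_mono mult_left_mono) auto
    finally have "cmod (u j y) \<le> \<bar>C\<bar> * (cmod \<nu> ^ j * R)\<^sup>2 / cmod \<nu> ^ j"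
      unfolding u_def norm_divide norm_power by (intro divide_right_mono) auto
    also have "\<dots> = \<bar>C\<bar> * R\<^sup>2 * cmod \<nu> ^ j" using \<nu> by (simp add: power2_eq_square)
    finally show ?thesis .
  qed
  have sm: "summable (\<lambda>j. K * cmod \<nu> ^ j)" for K :: real using \<nu> by (intro summable_mult summable_geometric) auto
  have us: "\<exists>J M. summable M \<and> (\<forall>j\<ge>J. \<forall>y\<in>carrier_vec m. vnorm y \<le> R \<longrightarrow> cmod (u j y) \<le> M j)" for R
  proof -
    have "(\<lambda>j. cmod \<nu> ^ j * R) \<longlonglongrightarrow> 0 * R" using \<nu> by (intro tendsto_intros LIMSEQ_power_zero) auto
    then have "\<forall>\<^sub>F j in sequentially. cmod \<nu> ^ j * R < r" using r(1) by (intro order_tendstoD(2)) auto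
    then obtain J where "\<And>j. j \<ge> J \<Longrightarrow> cmod \<nu> ^ j * R < r" unfolding eventually_sequentially by blast
    then have "cmod (u j y) \<le> \<bar>C\<bar> * R\<^sup>2 * cmod \<nu> ^ j" if "j \<ge> J" "y \<in> carrier_vec m" "vnorm y \<le> R" for j y
      using that by (intro ub) (auto intro: less_imp_le)
    then show ?thesis using sm[of "\<bar>C\<bar> * R\<^sup>2"] by (intro exI[of _ J] exI[of _ "\<lambda>j. \<bar>C\<bar> * R\<^sup>2 * cmod \<nu> ^ j"]) auto
  qed
  define \<phi> where "\<phi> y = suminf (\<lambda>j. u j y)" for y
  have e: "entire_fun m \<phi>" unfolding \<phi>_def[abs_def] by (rule entire_fun_suminf(1)[OF ue us])
  have su: "summable (\<lambda>j. u j y)" if "y \<in> carrier_vec m" for y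
    by (rule entire_fun_suminf(2)[OF ue us that])
  have bound: "cmod (\<phi> y) \<le> suminf (\<lambda>j. \<bar>C\<bar> * cmod \<nu> ^ j) * (vnorm y)\<^sup>2" if y: "y \<in> carrier_vec m" "vnorm y \<le> r" for y
  proof -
    have "cmod (u j y) \<le> \<bar>C\<bar> * (vnorm y)\<^sup>2 * cmod \<nu> ^ j" for j
    proof (rule ub[OF y(1) order_refl])
      have "cmod \<nu> ^ j * vnorm y \<le> 1 * vnorm y" using \<nu> by (intro mult_right_mono power_le_one) auto
      with y show "cmod \<nu> ^ j * vnorm y \<le> r" by simp
    qed
    then have "cmod (u j y) \<le> \<bar>C\<bar> * cmod \<nu> ^ j * (vnorm y)\<^sup>2" for j by (simp add: mult_ac)
    then have "cmod (\<phi> y) \<le> suminf (\<lambda>j. \<bar>C\<bar> * cmod \<nu> ^ j * (vnorm y)\<^sup>2)"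
      unfolding \<phi>_def by (intro norm_suminf_le summable_mult2 sm)
    then show ?thesis by (simp only: suminf_mult2[OF sm])
  qed
  have eq: "\<phi> y - \<phi> (\<nu> \<cdot>\<^sub>v y) / \<nu> = P y" if y: "y \<in> carrier_vec m" for y
  proof -
    have "u (Suc j) y = u j (\<nu> \<cdot>\<^sub>v y) / \<nu>" for j
      by (simp add: u_def smult_smult_assoc mult.commute)
    then have "suminf (\<lambda>j. u (Suc j) y) = \<phi> (\<nu> \<cdot>\<^sub>v y) / \<nu>"
      unfolding \<phi>_def using suminf_divide[OF su, of "\<nu> \<cdot>\<^sub>v y" \<nu>] y by simp
    moreover have "u 0 y = P y" by (simp add: u_def)
    ultimately have "\<phi> (\<nu> \<cdot>\<^sub>v y) / \<nu> = \<phi> y - P y"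
      using suminf_split_head[OF su[OF y]] by (simp add: \<phi>_def)
    then show ?thesis by simp
  qed
  show ?thesis using e bound eq by (intro exI[of _ \<phi>]) blast
qed

text \<open>For |\<mu>| > 1 the equation for 1/\<mu> is solved and substituted. Polynomial
  \<open>P\<close> is a separate case, since the coefficientwise solution is visibly a polynomial
  and the series is not.\<close>

lemma cohomological_equation:
  assumes P: "entire_fun m P" and \<mu>: "\<mu> \<noteq> 0" "cmod \<mu> \<noteq> 1"
    and r: "r > 0" "\<And>y. y \<in> carrier_vec m \<Longrightarrow> vnorm y \<le> r \<Longrightarrow> cmod (P y) \<le> C * (vnorm y)\<^sup>2"
  shows "\<exists>\<phi>. entire_fun m \<phi> \<and> (\<exists>D s. s > 0 \<and> (\<forall>y\<in>carrier_vec m. vnorm y \<le> s \<longrightarrow> cmod (\<phi> y) \<le> D * (vnorm y)\<^sup>2)) \<and>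
    (\<forall>y\<in>carrier_vec m. \<phi> y - \<phi> (\<mu> \<cdot>\<^sub>v y) / \<mu> = P y) \<and> (polyfun m P \<longrightarrow> polyfun m \<phi>)"
proof (cases "polyfun m P")
  case True
  from polyfun_cohomological_equation[OF True \<mu> r] show ?thesis
    using polyfun_imp_entire_fun by blast
next
  case False
  show ?thesis
  proof (cases "cmod \<mu> < 1")
    case True
    from entire_cohomological_series[OF P \<mu>(1) True r] show ?thesis using False r(1) by blast
  next
    case 2: False
    define \<nu> where "\<nu> = 1 / \<mu>"
    have \<nu>: "\<nu> \<noteq> 0" "cmod \<nu> < 1" using \<mu> 2 by (auto simp: \<nu>_def norm_divide)
    from entire_cohomological_series[OF P \<nu> r] obtain \<phi> D where \<phi>: "entire_fun m \<phi>"
      "\<And>y. y \<in> carrier_vec m \<Longrightarrow> vnorm y \<le> r \<Longrightarrow> cmod (\<phi> y) \<le> D * (vnorm y)\<^sup>2"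
      "\<And>y. y \<in> carrier_vec m \<Longrightarrow> \<phi> y - \<phi> (\<nu> \<cdot>\<^sub>v y) / \<nu> = P y" by blast
    \<comment> \<open>As 1/\<nu> = \<mu>, the equation for \<phi> reads \<phi>(y) -
      \<mu>\<phi>(\<nu>y) = P(y). In terms of \<psi>(y) = -\<mu>\<phi>(\<nu>y) its first term is
      -\<psi>(\<mu>y)/\<mu>.\<close>
    let ?\<psi> = "\<lambda>y. - \<mu> * \<phi> (\<nu> \<cdot>\<^sub>v y)"
    have "entire_fun m ?\<psi>"
      by (rule entire_fun_mult[OF entire_fun_const entire_fun_smult_compose[OF \<phi>(1)]])
    moreover have "cmod (?\<psi> y) \<le> (cmod \<mu> * (\<bar>D\<bar> * (cmod \<nu>)\<^sup>2)) * (vnorm y)\<^sup>2" if y: "y \<in> carrier_vec m" "vnorm y \<le> r" for y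
    proof -
      have n: "vnorm (\<nu> \<cdot>\<^sub>v y) = cmod \<nu> * vnorm y" using y by (simp add: vnorm_smult)
      have "cmod \<nu> * vnorm y \<le> 1 * vnorm y" using \<nu> by (intro mult_right_mono) auto
      then have "cmod (\<phi> (\<nu> \<cdot>\<^sub>v y)) \<le> D * (cmod \<nu> * vnorm y)\<^sup>2" using \<phi>(2)[of "\<nu> \<cdot>\<^sub>v y"] y n by simp
      also have "\<dots> \<le> \<bar>D\<bar> * (cmod \<nu> * vnorm y)\<^sup>2" by (intro mult_right_mono) auto
      finally have "cmod \<mu> * cmod (\<phi> (\<nu> \<cdot>\<^sub>v y)) \<le> cmod \<mu> * (\<bar>D\<bar> * (cmod \<nu> * vnorm y)\<^sup>2)"
        by (intro mult_left_mono) auto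
      then show ?thesis by (simp add: norm_mult power_mult_distrib mult_ac)
    qed
    moreover have "?\<psi> y - ?\<psi> (\<mu> \<cdot>\<^sub>v y) / \<mu> = P y" if y: "y \<in> carrier_vec m" for y
    proof -
      have "\<nu> \<cdot>\<^sub>v (\<mu> \<cdot>\<^sub>v y) = y" using \<mu> by (simp add: smult_smult_assoc \<nu>_def)
      then show ?thesis using \<phi>(3)[OF y] \<mu> by (simp add: \<nu>_def mult.commute)
    qed
    ultimately show ?thesis using False r(1) by (intro exI[of _ ?\<psi>]) blast
  qed
qed

section \<open>Bijective polynomial maps\<close>

text \<open>Induction on the number of variables: as a polynomial in the last variable the sum has
  zero coefficients, and these are the sums over the slices of \<open>S\<close> with fixed last
  exponent.\<close>

lemma monomial_sum_eq_0_imp_coeff_eq_0: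
  fixes c :: "(nat \<Rightarrow> nat) \<Rightarrow> complex"
  assumes "finite S" "S \<subseteq> multi_indices m" "\<And>x. (\<Sum>\<alpha>\<in>S. c \<alpha> * (\<Prod>j<m. x j ^ \<alpha> j)) = 0" "\<alpha> \<in> S"
  shows "c \<alpha> = 0"
  using assms
proof (induction m arbitrary: S c \<alpha>)
  case 0
  then have "S = {\<alpha>}" using multi_indices_0 by auto
  then show ?case using 0(3) by simp
next
  case (Suc m)
  have part: "(\<Sum>\<alpha>\<in>{\<alpha>\<in>S. \<alpha> m = d}. c \<alpha> * (\<Prod>j<m. x j ^ \<alpha> j)) = 0" for d x
  proof -
    define p where "p = (\<Sum>\<alpha>\<in>S. monom (c \<alpha> * (\<Prod>j<m. x j ^ \<alpha> j)) (\<alpha> m))"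
    have "poly p t = 0" for t
    proof -
      have "(\<Prod>j<m. (x(m := t)) j ^ \<alpha> j) = (\<Prod>j<m. x j ^ \<alpha> j)" for \<alpha> :: "nat \<Rightarrow> nat" by (intro prod.cong) auto
      then show ?thesis using Suc.prems(3)[of "x(m := t)"] by (simp add: p_def poly_sum poly_monom mult.assoc)
    qed
    then have "p = 0" by (simp add: poly_all_0_iff_0[symmetric])
    then have "coeff p d = 0" by simp
    then show ?thesis using Suc.prems(1) by (simp add: p_def coeff_sum sum.inter_filter)
  qed
  let ?S = "{\<beta>\<in>S. \<beta> m = \<alpha> m}" and ?f = "\<lambda>\<beta>::nat \<Rightarrow> nat. \<beta>(m := undefined)"
  have inj: "inj_on ?f ?S"
  proof (rule inj_onI)
    fix \<beta> \<gamma> assume *: "\<beta> \<in> ?S" "\<gamma> \<in> ?S" "?f \<beta> = ?f \<gamma>"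
    show "\<beta> = \<gamma>"
    proof
      fix j show "\<beta> j = \<gamma> j" using *(1,2) fun_cong[OF *(3), of j] by (cases "j = m") auto
    qed
  qed
  have restore: "(?f \<beta>)(m := \<alpha> m) = \<beta>" if "\<beta> \<in> ?S" for \<beta> using that by (auto simp: fun_eq_iff)
  have "(\<lambda>\<beta>. c (\<beta>(m := \<alpha> m))) (?f \<alpha>) = 0"
  proof (rule Suc.IH[where S = "?f ` ?S" and c = "\<lambda>\<beta>. c (\<beta>(m := \<alpha> m))" and \<alpha> = "?f \<alpha>"])
    show "finite (?f ` ?S)" using Suc.prems by simp
    show "?f ` ?S \<subseteq> multi_indices m"
      using Suc.prems(2) by (auto simp: multi_indices_def PiE_def extensional_def)
    show "?f \<alpha> \<in> ?f ` ?S" using Suc.prems by blast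
    fix x :: "nat \<Rightarrow> complex"
    have "(\<Sum>\<beta>\<in>?f ` ?S. c (\<beta>(m := \<alpha> m)) * (\<Prod>j<m. x j ^ \<beta> j)) =
      (\<Sum>\<beta>\<in>?S. c ((?f \<beta>)(m := \<alpha> m)) * (\<Prod>j<m. x j ^ (?f \<beta>) j))"
      by (subst sum.reindex[OF inj]) (simp add: o_def)
    also have "\<dots> = (\<Sum>\<beta>\<in>?S. c \<beta> * (\<Prod>j<m. x j ^ \<beta> j))"
    proof (rule sum.cong[OF refl])
      fix \<beta> assume "\<beta> \<in> ?S"
      have "(\<Prod>j<m. x j ^ (?f \<beta>) j) = (\<Prod>j<m. x j ^ \<beta> j)" by (intro prod.cong) auto
      then show "c ((?f \<beta>)(m := \<alpha> m)) * (\<Prod>j<m. x j ^ (?f \<beta>) j) = c \<beta> * (\<Prod>j<m. x j ^ \<beta> j)"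
        by (simp only: restore[OF \<open>\<beta> \<in> ?S\<close>])
    qed
    also have "\<dots> = 0" by (rule part)
    finally show "(\<Sum>\<beta>\<in>?f ` ?S. c (\<beta>(m := \<alpha> m)) * (\<Prod>j<m. x j ^ \<beta> j)) = 0" .
  qed
  then show ?case by simp
qed

lemma vec_monomial_sum_eq_0_imp_coeff_eq_0:
  assumes "finite S" "S \<subseteq> multi_indices m" "\<And>x. x \<in> carrier_vec m \<Longrightarrow> (\<Sum>\<alpha>\<in>S. c \<alpha> * vec_monomial m \<alpha> x) = 0" "\<alpha> \<in> S"
  shows "c \<alpha> = 0"
proof (rule monomial_sum_eq_0_imp_coeff_eq_0[OF assms(1,2) _ assms(4)])
  fix x :: "nat \<Rightarrow> complex"
  have "vec_monomial m \<alpha> (vec m x) = (\<Prod>j<m. x j ^ \<alpha> j)" for \<alpha>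
    unfolding vec_monomial_def by (intro prod.cong) auto
  then show "(\<Sum>\<alpha>\<in>S. c \<alpha> * (\<Prod>j<m. x j ^ \<alpha> j)) = 0" using assms(3)[of "vec m x"] by simp
qed

text \<open>Gaussian elimination: an unknown \<open>k\<close> with nonzero coefficient in equation
  \<open>j\<close> is removed from the others, which costs one equation and one unknown.\<close>

lemma underdetermined_homogeneous_system:
  fixes a :: "'i \<Rightarrow> 'j \<Rightarrow> complex"
  assumes "finite J" "finite I" "card J < card I"
  shows "\<exists>x. (\<exists>i\<in>I. x i \<noteq> 0) \<and> (\<forall>j\<in>J. (\<Sum>i\<in>I. x i * a i j) = 0)"
  using assms
proof (induction J arbitrary: I a rule: finite_induct)
  case empty
  then obtain i where "i \<in> I" by fastforce
  then show ?case by (intro exI[of _ "\<lambda>_. 1"]) auto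
next
  case (insert j J)
  show ?case
  proof (cases "\<forall>i\<in>I. a i j = 0")
    case True
    have "card J < card I" using insert by simp
    from insert.IH[OF insert.prems(1) this, of a] obtain x where
      "\<exists>i\<in>I. x i \<noteq> 0" "\<forall>j\<in>J. (\<Sum>i\<in>I. x i * a i j) = 0" by blast
    with True show ?thesis by (intro exI[of _ x]) auto
  next
    case False
    then obtain k where k: "k \<in> I" "a k j \<noteq> 0" by blast
    let ?I = "I - {k}"
    have "card J < card ?I" using insert k by simp
    from insert.IH[OF _ this, of "\<lambda>i l. a i l - a i j / a k j * a k l"] insert.prems obtain x where
      x: "\<exists>i\<in>?I. x i \<noteq> 0" "\<And>l. l \<in> J \<Longrightarrow> (\<Sum>i\<in>?I. x i * (a i l - a i j / a k j * a k l)) = 0"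
      by blast
    define y where "y i = (if i = k then - (\<Sum>i\<in>?I. x i * a i j) / a k j else x i)" for i
    have split: "(\<Sum>i\<in>I. y i * a i l) = (\<Sum>i\<in>?I. x i * a i l) - (\<Sum>i\<in>?I. x i * a i j) / a k j * a k l" for l
    proof -
      have "(\<Sum>i\<in>I. y i * a i l) = y k * a k l + (\<Sum>i\<in>?I. y i * a i l)"
        using insert.prems k by (simp add: sum.remove)
      also have "(\<Sum>i\<in>?I. y i * a i l) = (\<Sum>i\<in>?I. x i * a i l)"
        by (intro sum.cong) (auto simp: y_def)
      finally show ?thesis by (simp add: y_def)
    qed
    have "(\<Sum>i\<in>I. y i * a i l) = 0" if "l \<in> J" for l
    proof -
      have "(\<Sum>i\<in>?I. x i * (a i l - a i j / a k j * a k l)) =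
        (\<Sum>i\<in>?I. x i * a i l) - (\<Sum>i\<in>?I. x i * a i j) / a k j * a k l"
        by (simp add: right_diff_distrib sum_subtractf sum_distrib_right sum_divide_distrib mult.assoc)
      then show ?thesis using x(2)[OF that] split by simp
    qed
    moreover have "(\<Sum>i\<in>I. y i * a i j) = 0" using split[of j] k by simp
    moreover have "\<exists>i\<in>I. y i \<noteq> 0" using x(1) by (auto simp: y_def)
    ultimately show ?thesis by (intro exI[of _ y]) auto
  qed
qed

text \<open>Bounding each exponent, and not the total degree, makes the number of monomials a plain
  power \<open>Suc D ^ m\<close>, which keeps the counting in \<open>algebraic_dependence\<close>
  short.\<close>

definition degree_box :: "nat \<Rightarrow> nat \<Rightarrow> (nat \<Rightarrow> nat) set" where
  "degree_box m D = {..<m} \<rightarrow>\<^sub>E {..D}"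

lemma degree_box_subset: "degree_box m D \<subseteq> multi_indices m"
  unfolding degree_box_def multi_indices_def by (intro PiE_mono) auto

lemma finite_degree_box [simp]: "finite (degree_box m D)"
  unfolding degree_box_def by (intro finite_PiE) auto

lemma card_degree_box: "card (degree_box m D) = Suc D ^ m"
  unfolding degree_box_def by (simp add: card_PiE)

section \<open>Algebraic dependence by counting monomials\<close>

definition box_polyfun :: "nat \<Rightarrow> nat \<Rightarrow> (complex vec \<Rightarrow> complex) \<Rightarrow> bool" where
  "box_polyfun m D \<phi> \<longleftrightarrow> (\<exists>c. \<forall>x\<in>carrier_vec m. \<phi> x = (\<Sum>\<alpha>\<in>degree_box m D. c \<alpha> * vec_monomial m \<alpha> x))"

lemma box_polyfunI:
  assumes "finite S" "S \<subseteq> degree_box m D" "\<And>x. x \<in> carrier_vec m \<Longrightarrow> \<phi> x = (\<Sum>\<alpha>\<in>S. c \<alpha> * vec_monomial m \<alpha> x)"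
  shows "box_polyfun m D \<phi>"
  unfolding box_polyfun_def
proof (intro exI[of _ "\<lambda>\<alpha>. if \<alpha> \<in> S then c \<alpha> else 0"] ballI)
  fix x :: "complex vec" assume "x \<in> carrier_vec m"
  have "(\<Sum>\<alpha>\<in>degree_box m D. (if \<alpha> \<in> S then c \<alpha> else 0) * vec_monomial m \<alpha> x) = (\<Sum>\<alpha>\<in>S. c \<alpha> * vec_monomial m \<alpha> x)"
    using assms(1,2) by (intro sum.mono_neutral_cong_right) auto
  then show "\<phi> x = (\<Sum>\<alpha>\<in>degree_box m D. (if \<alpha> \<in> S then c \<alpha> else 0) * vec_monomial m \<alpha> x)"
    using assms(3) \<open>x \<in> carrier_vec m\<close> by simp
qed

lemma polyfun_imp_box_polyfun:
  assumes "polyfun m \<phi>" shows "\<exists>D. box_polyfun m D \<phi>"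
proof -
  obtain S c where S: "finite S" "S \<subseteq> multi_indices m"
    and c: "\<And>x. x \<in> carrier_vec m \<Longrightarrow> \<phi> x = (\<Sum>\<alpha>\<in>S. c \<alpha> * vec_monomial m \<alpha> x)"
    using assms unfolding polyfun_def by auto
  define D where "D = (\<Sum>\<alpha>\<in>S. \<Sum>j<m. \<alpha> j)"
  have "\<alpha> j \<le> D" if "\<alpha> \<in> S" "j < m" for \<alpha> j
  proof -
    have "\<alpha> j \<le> (\<Sum>j<m. \<alpha> j)" using that by (intro member_le_sum) auto
    also have "\<dots> \<le> D" unfolding D_def using that S by (intro member_le_sum[of \<alpha> S "\<lambda>\<alpha>. \<Sum>j<m. \<alpha> j"]) auto
    finally show ?thesis .
  qed
  then have "S \<subseteq> degree_box m D"
    using S(2) unfolding degree_box_def multi_indices_def by (auto simp: PiE_def Pi_def)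
  then show ?thesis using box_polyfunI[OF S(1) _ c] by blast
qed

lemma box_polyfun_mono:
  assumes "box_polyfun m D \<phi>" "D \<le> E" shows "box_polyfun m E \<phi>"
proof -
  have "degree_box m D \<subseteq> degree_box m E" using assms(2) unfolding degree_box_def by (intro PiE_mono) auto
  then show ?thesis using assms(1) box_polyfunI[OF finite_degree_box] unfolding box_polyfun_def by blast
qed

lemma box_polyfun_cong:
  assumes "box_polyfun m D \<phi>" "\<And>x. x \<in> carrier_vec m \<Longrightarrow> \<psi> x = \<phi> x"
  shows "box_polyfun m D \<psi>"
  using assms unfolding box_polyfun_def by simp

lemma box_polyfun_add:
  assumes "box_polyfun m D \<phi>" "box_polyfun m D \<psi>" shows "box_polyfun m D (\<lambda>x. \<phi> x + \<psi> x)"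
proof -
  obtain c d where "\<forall>x\<in>carrier_vec m. \<phi> x = (\<Sum>\<alpha>\<in>degree_box m D. c \<alpha> * vec_monomial m \<alpha> x)"
    "\<forall>x\<in>carrier_vec m. \<psi> x = (\<Sum>\<alpha>\<in>degree_box m D. d \<alpha> * vec_monomial m \<alpha> x)"
    using assms unfolding box_polyfun_def by blast
  then show ?thesis unfolding box_polyfun_def
    by (intro exI[of _ "\<lambda>\<alpha>. c \<alpha> + d \<alpha>"]) (simp add: distrib_right sum.distrib)
qed

lemma box_polyfun_const: "box_polyfun m D (\<lambda>x. c)"
  by (rule box_polyfunI[of "{\<lambda>j\<in>{..<m}. 0}" _ _ _ "\<lambda>_. c"])
     (auto simp: degree_box_def vec_monomial_def)

lemma box_polyfun_sum:
  assumes "\<And>i. i \<in> I \<Longrightarrow> box_polyfun m D (\<phi> i)" shows "box_polyfun m D (\<lambda>x. \<Sum>i\<in>I. \<phi> i x)"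
  using assms by (induction I rule: infinite_finite_induct) (auto intro: box_polyfun_add box_polyfun_const)

lemma box_polyfun_mult:
  assumes "box_polyfun m D \<phi>" "box_polyfun m E \<psi>" shows "box_polyfun m (D + E) (\<lambda>x. \<phi> x * \<psi> x)"
proof -
  obtain c d where c: "\<And>x. x \<in> carrier_vec m \<Longrightarrow> \<phi> x = (\<Sum>\<alpha>\<in>degree_box m D. c \<alpha> * vec_monomial m \<alpha> x)"
    and d: "\<And>x. x \<in> carrier_vec m \<Longrightarrow> \<psi> x = (\<Sum>\<alpha>\<in>degree_box m E. d \<alpha> * vec_monomial m \<alpha> x)"
    using assms unfolding box_polyfun_def by blast
  have mon: "box_polyfun m (D + E) (\<lambda>x. (c \<alpha> * d \<beta>) * vec_monomial m (\<lambda>j\<in>{..<m}. \<alpha> j + \<beta> j) x)"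
    if "\<alpha> \<in> degree_box m D" "\<beta> \<in> degree_box m E" for \<alpha> \<beta>
    by (rule box_polyfunI[of "{\<lambda>j\<in>{..<m}. \<alpha> j + \<beta> j}" _ _ _ "\<lambda>_. c \<alpha> * d \<beta>"])
       (use that in \<open>auto simp: degree_box_def PiE_def Pi_def intro!: add_mono\<close>)
  have "box_polyfun m (D + E) (\<lambda>x. \<Sum>\<alpha>\<in>degree_box m D. \<Sum>\<beta>\<in>degree_box m E.
      (c \<alpha> * d \<beta>) * vec_monomial m (\<lambda>j\<in>{..<m}. \<alpha> j + \<beta> j) x)"
    by (intro box_polyfun_sum mon)
  moreover have "(\<Sum>\<alpha>\<in>degree_box m D. \<Sum>\<beta>\<in>degree_box m E. (c \<alpha> * d \<beta>) * vec_monomial m (\<lambda>j\<in>{..<m}. \<alpha> j + \<beta> j) x) = \<phi> x * \<psi> x"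
    if "x \<in> carrier_vec m" for x
    by (auto simp: c[OF that] d[OF that] sum_product vec_monomial_def power_add prod.distrib mult_ac intro!: sum.cong)
  ultimately show ?thesis by (rule box_polyfun_cong[OF _ sym])
qed

lemma box_polyfun_power:
  assumes "box_polyfun m D \<phi>" shows "box_polyfun m (k * D) (\<lambda>x. \<phi> x ^ k)"
  by (induction k) (auto intro: box_polyfun_mult box_polyfun_const assms)

lemma box_polyfun_monomial_compose:
  assumes "\<And>j. j < m \<Longrightarrow> box_polyfun n D (\<lambda>x. p x $ j)" "\<And>j. j < m \<Longrightarrow> \<alpha> j \<le> E"
  shows "box_polyfun n (m * (E * D)) (\<lambda>x. vec_monomial m \<alpha> (p x))"
  unfolding vec_monomial_def using assms
proof (induction m)
  case (Suc m)
  have "box_polyfun n (m * (E * D)) (\<lambda>x. \<Prod>j<m. p x $ j ^ \<alpha> j)" using Suc by auto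
  moreover have "box_polyfun n (E * D) (\<lambda>x. p x $ m ^ \<alpha> m)"
    by (rule box_polyfun_mono[OF box_polyfun_power]) (use Suc.prems in auto)
  ultimately have "box_polyfun n (m * (E * D) + E * D) (\<lambda>x. (\<Prod>j<m. p x $ j ^ \<alpha> j) * p x $ m ^ \<alpha> m)"
    by (rule box_polyfun_mult)
  then show ?case by (simp add: add.commute)
qed (simp add: box_polyfun_const)

text \<open>Any \<open>m + 1\<close> polynomials in \<open>m\<close> variables are algebraically dependent: there are
  \<open>(E + 1)\<^sup>m (B + 1)\<close> monomials \<open>p\<^sup>\<alpha> w\<^sup>\<beta>\<close> with \<open>\<alpha>\<^sub>j \<le> E\<close>, \<open>\<beta> \<le> B\<close>, and for \<open>B\<close> large, \<open>E = DB\<close>, this exceeds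
  the dimension of the space of polynomials in which they live.\<close>

lemma algebraic_dependence:
  assumes p: "polynomial_map m p" and w: "polyfun m w"
  shows "\<exists>E B x. (\<exists>\<alpha>\<in>degree_box m E. \<exists>\<beta>\<le>B. x \<alpha> \<beta> \<noteq> 0) \<and>
    (\<forall>z\<in>carrier_vec m. (\<Sum>\<beta>\<le>B. (\<Sum>\<alpha>\<in>degree_box m E. x \<alpha> \<beta> * vec_monomial m \<alpha> (p z)) * w z ^ \<beta>) = 0)"
proof -
  have "\<forall>j. \<exists>D. j < m \<longrightarrow> box_polyfun m D (\<lambda>x. p x $ j)"
    using p polyfun_imp_box_polyfun unfolding polynomial_map_iff_polyfun by blast
  from choice[OF this] obtain D0 where D0: "\<And>j. j < m \<Longrightarrow> box_polyfun m (D0 j) (\<lambda>x. p x $ j)" by blast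
  obtain D1 where D1: "box_polyfun m D1 w" using polyfun_imp_box_polyfun[OF w] by blast
  define D where "D = (\<Sum>j<m. D0 j) + D1"
  have Dp: "box_polyfun m D (\<lambda>x. p x $ j)" if "j < m" for j
  proof (rule box_polyfun_mono[OF D0[OF that]])
    have "D0 j \<le> (\<Sum>j<m. D0 j)" using that by (intro member_le_sum) auto
    then show "D0 j \<le> D" by (simp add: D_def)
  qed
  have Dw: "box_polyfun m D w" by (rule box_polyfun_mono[OF D1]) (simp add: D_def)
  \<comment> \<open>The powers of \<open>w\<close> add at most BD = E to an exponent and the
    monomials in \<open>p\<close> at most mED, so G + 1 \<le> (Dm + 1)(E + 1). Hence there are at
    most B(E + 1)^m monomials in the target, fewer than the (B + 1)(E + 1)^m products.\<close>
  define B where "B = (D * m + 1) ^ m"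
  define E where "E = D * B"
  define G where "G = m * (E * D) + B * D"
  let ?I = "degree_box m E \<times> {..B}"
  have mon: "box_polyfun m G (\<lambda>z. vec_monomial m \<alpha> (p z) * w z ^ \<beta>)" if "(\<alpha>, \<beta>) \<in> ?I" for \<alpha> \<beta>
    unfolding G_def
  proof (rule box_polyfun_mult)
    show "box_polyfun m (m * (E * D)) (\<lambda>z. vec_monomial m \<alpha> (p z))"
      using that by (intro box_polyfun_monomial_compose Dp) (auto simp: degree_box_def PiE_def Pi_def)
    show "box_polyfun m (B * D) (\<lambda>z. w z ^ \<beta>)"
      by (rule box_polyfun_mono[OF box_polyfun_power[OF Dw]]) (use that in auto)
  qed
  have "\<forall>i. \<exists>c. i \<in> ?I \<longrightarrow> (\<forall>z\<in>carrier_vec m. vec_monomial m (fst i) (p z) * w z ^ snd i =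
    (\<Sum>\<gamma>\<in>degree_box m G. c \<gamma> * vec_monomial m \<gamma> z))"
    using mon unfolding box_polyfun_def by (metis prod.collapse)
  from choice[OF this] obtain a where a: "\<And>i z. i \<in> ?I \<Longrightarrow> z \<in> carrier_vec m \<Longrightarrow> vec_monomial m (fst i) (p z) * w z ^ snd i =
    (\<Sum>\<gamma>\<in>degree_box m G. a i \<gamma> * vec_monomial m \<gamma> z)" by blast
  have "card (degree_box m G) < card ?I"
  proof -
    have "G + 1 = (D * m) * E + (E + 1)" by (simp add: G_def E_def algebra_simps)
    also have "\<dots> \<le> (D * m + 1) * (E + 1)" by (simp add: algebra_simps)
    finally have "(G + 1) ^ m \<le> ((D * m + 1) * (E + 1)) ^ m" by (rule power_mono) simp
    also have "\<dots> = B * (E + 1) ^ m" by (simp only: power_mult_distrib B_def)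
    also have "\<dots> < (B + 1) * (E + 1) ^ m" by simp
    finally show ?thesis by (simp add: card_degree_box card_cartesian_product mult.commute)
  qed
  from underdetermined_homogeneous_system[OF _ _ this, of a] obtain x where
    x: "\<exists>i\<in>?I. x i \<noteq> 0" "\<And>\<gamma>. \<gamma> \<in> degree_box m G \<Longrightarrow> (\<Sum>i\<in>?I. x i * a i \<gamma>) = 0" by auto
  have "(\<Sum>\<beta>\<le>B. (\<Sum>\<alpha>\<in>degree_box m E. x (\<alpha>, \<beta>) * vec_monomial m \<alpha> (p z)) * w z ^ \<beta>) = 0"
    if z: "z \<in> carrier_vec m" for z
  proof -
    have "(\<Sum>\<beta>\<le>B. (\<Sum>\<alpha>\<in>degree_box m E. x (\<alpha>, \<beta>) * vec_monomial m \<alpha> (p z)) * w z ^ \<beta>) =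
      (\<Sum>\<alpha>\<in>degree_box m E. \<Sum>\<beta>\<le>B. x (\<alpha>, \<beta>) * (vec_monomial m \<alpha> (p z) * w z ^ \<beta>))"
      by (subst sum.swap) (simp add: sum_distrib_right mult.assoc)
    also have "\<dots> = (\<Sum>i\<in>?I. x i * (vec_monomial m (fst i) (p z) * w z ^ snd i))"
      by (simp add: sum.cartesian_product case_prod_beta)
    also have "\<dots> = (\<Sum>i\<in>?I. \<Sum>\<gamma>\<in>degree_box m G. x i * a i \<gamma> * vec_monomial m \<gamma> z)"
      by (intro sum.cong refl) (simp only: a[OF _ z] sum_distrib_left mult.assoc)
    also have "\<dots> = (\<Sum>\<gamma>\<in>degree_box m G. (\<Sum>i\<in>?I. x i * a i \<gamma>) * vec_monomial m \<gamma> z)"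
      by (subst sum.swap) (simp only: sum_distrib_right)
    also have "\<dots> = 0" by (simp add: x(2))
    finally show ?thesis .
  qed
  then show ?thesis using x(1) by (intro exI[of _ E] exI[of _ B] exI[of _ "\<lambda>\<alpha> \<beta>. x (\<alpha>, \<beta>)"]) auto
qed

text \<open>On the line from \<open>a\<close> to \<open>x\<close> the two functions are polynomials
  in t with product zero, and the first is nonzero at t = 0.\<close>

lemma polyfun_no_zero_divisors:
  assumes \<phi>: "polyfun m \<phi>" and \<psi>: "polyfun m \<psi>" and z: "\<And>x. x \<in> carrier_vec m \<Longrightarrow> \<phi> x * \<psi> x = 0"
    and a: "a \<in> carrier_vec m" "\<phi> a \<noteq> 0" and x: "x \<in> carrier_vec m"
  shows "\<psi> x = 0"
proof -
  have d: "x - a \<in> carrier_vec m" using a x by simp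
  obtain p where p: "\<And>t. \<phi> (a + t \<cdot>\<^sub>v (x - a)) = poly p t" using polyfun_line[OF \<phi>] a(1) d by blast
  obtain q where q: "\<And>t. \<psi> (a + t \<cdot>\<^sub>v (x - a)) = poly q t" using polyfun_line[OF \<psi>] a(1) d by blast
  have "\<forall>t. poly (p * q) t = 0"
  proof
    fix t show "poly (p * q) t = 0" using z[of "a + t \<cdot>\<^sub>v (x - a)"] p q a(1) d by simp
  qed
  then have "p * q = 0" using poly_all_0_iff_0 by blast
  moreover have "poly p 0 \<noteq> 0"
  proof -
    have "a + 0 \<cdot>\<^sub>v (x - a) = a" using a x by (intro eq_vecI) auto
    then show ?thesis using p[of 0] a(2) by simp
  qed
  ultimately have "q = 0" by auto
  moreover have "a + 1 \<cdot>\<^sub>v (x - a) = x" using a x by (intro eq_vecI) auto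
  ultimately show ?thesis using q[of 1] by simp
qed

text \<open>The Lagrange basis for the nodes 0, ..., M. Stating "polynomial of degree at most M" as
  an interpolation identity turns it into a condition that survives limits of functions.\<close>

definition lagrange_basis :: "nat \<Rightarrow> nat \<Rightarrow> complex poly" where
  "lagrange_basis M i = (\<Prod>k\<in>{..M} - {i}. smult (1 / (of_nat i - of_nat k)) [:- of_nat k, 1:])"

lemma poly_lagrange_basis:
  assumes "i \<le> M" "j \<le> M" shows "poly (lagrange_basis M i) (of_nat j) = (if i = j then 1 else 0)"
proof (cases "i = j")
  case True
  have "poly (smult (1 / (of_nat i - of_nat k)) [:- of_nat k, 1:]) (of_nat j) = (1 :: complex)"
    if "k \<in> {..M} - {i}" for k
  proof -
    have "of_nat i - of_nat k \<noteq> (0 :: complex)" using that by simp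
    then show ?thesis using True by (simp add: diff_divide_distrib[symmetric])
  qed
  then show ?thesis using True by (simp add: lagrange_basis_def poly_prod del: poly_smult poly_pCons)
next
  case False
  then have "\<exists>k\<in>{..M} - {i}. poly (smult (1 / (of_nat i - of_nat k)) [:- of_nat k, 1:]) (of_nat j) = (0 :: complex)"
    using assms by (intro bexI[of _ j]) auto
  then show ?thesis using False by (auto simp: lagrange_basis_def poly_prod intro!: prod_zero)
qed

lemma degree_lagrange_basis:
  assumes "i \<le> M" shows "degree (lagrange_basis M i) \<le> M"
proof -
  have "degree (lagrange_basis M i) \<le> (\<Sum>k\<in>{..M} - {i}. degree (smult (1 / (of_nat i - of_nat k)) [:- of_nat k, 1 :: complex:]))"
    unfolding lagrange_basis_def by (rule degree_prod_sum_le[unfolded o_def]) simp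
  also have "\<dots> \<le> (\<Sum>k\<in>{..M} - {i}. 1)"
    by (intro sum_mono order_trans[OF degree_smult_le]) simp
  also have "\<dots> = M" using assms by simp
  finally show ?thesis .
qed

lemma lagrange_interpolation:
  assumes "degree p \<le> M"
  shows "poly p t = (\<Sum>i\<le>M. poly (lagrange_basis M i) t * poly p (of_nat i))"
proof -
  define q where "q = p - (\<Sum>i\<le>M. smult (poly p (of_nat i)) (lagrange_basis M i))"
  have dq: "degree q \<le> M"
    unfolding q_def using assms degree_lagrange_basis
    by (intro degree_diff_le degree_sum_le) (auto intro: order_trans[OF degree_smult_le])
  have root: "poly q (of_nat j) = 0" if "j \<le> M" for j
  proof -
    have "(\<Sum>i\<le>M. poly p (of_nat i) * poly (lagrange_basis M i) (of_nat j)) = (\<Sum>i\<le>M. if i = j then poly p (of_nat j) else 0)"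
      using that by (intro sum.cong) (auto simp: poly_lagrange_basis)
    then show ?thesis using that by (simp add: q_def poly_sum)
  qed
  have "q = 0"
  proof (rule ccontr)
    assume "q \<noteq> 0"
    have "(of_nat ` {..M} :: complex set) \<subseteq> {x. poly q x = 0}" using root by auto
    then have "card (of_nat ` {..M} :: complex set) \<le> card {x. poly q x = 0}"
      using \<open>q \<noteq> 0\<close> by (intro card_mono poly_roots_finite)
    also have "\<dots> \<le> degree q" by (rule card_poly_roots_bound[OF \<open>q \<noteq> 0\<close>])
    finally show False using dq by (simp add: card_image inj_on_def)
  qed
  then have "poly p t = poly (\<Sum>i\<le>M. smult (poly p (of_nat i)) (lagrange_basis M i)) t" by (simp add: q_def)
  then show ?thesis by (simp add: poly_sum mult.commute)
qed

lemma polyfun_poly_compose: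
  assumes "polyfun m \<phi>" shows "polyfun m (\<lambda>x. poly p (\<phi> x))"
proof -
  have "polyfun m (\<lambda>x. \<Sum>i\<le>degree p. coeff p i * \<phi> x ^ i)"
    by (intro polyfun_sum polyfun_mult polyfun_const polyfun_power assms)
  then show ?thesis by (simp add: poly_altdef)
qed

text \<open>One coordinate at a time is replaced by interpolation: its variable value enters only
  through the basis polynomials, while the function is evaluated at fixed nodes in that
  coordinate.\<close>

lemma separately_polynomial_imp_polyfun:
  assumes sep: "\<And>y i t. y \<in> carrier_vec m \<Longrightarrow> i < m \<Longrightarrow>
    \<phi> (y + t \<cdot>\<^sub>v unit_vec m i) = (\<Sum>k\<le>M. poly (lagrange_basis M k) t * \<phi> (y + of_nat k \<cdot>\<^sub>v unit_vec m i))"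
  shows "polyfun m \<phi>"
proof -
  \<comment> \<open>The first \<open>r\<close> coordinates are the variables, the others parameters;
    the claim for \<open>mix r\<close> is needed for all parameter vectors \<open>z\<close>.\<close>
  define mix where "mix r y z = vec m (\<lambda>i. if i < r then y $ i else z $ i)" for r and y z :: "complex vec"
  have "polyfun m (\<lambda>y. \<phi> (mix r y z))" if "r \<le> m" for r z
    using that
  proof (induction r arbitrary: z)
    case 0
    have "(\<lambda>y. \<phi> (mix 0 y z)) = (\<lambda>_. \<phi> (mix 0 (0\<^sub>v m) z))" by (simp add: mix_def)
    then show ?case using polyfun_const[of m "\<phi> (mix 0 (0\<^sub>v m) z)"] by (simp only:)
  next
    case (Suc r)
    have r: "r < m" using Suc.prems by simp
    \<comment> \<open>Coordinate \<open>r\<close> is cleared, so that any value of it is added as a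
      multiple of \<open>unit_vec m r\<close>, the form required by \<open>sep\<close>.\<close>
    define w where "w = vec m (\<lambda>i. if i = r then 0 else z $ i)"
    have *: "mix r y w + t \<cdot>\<^sub>v unit_vec m r = mix r y (w + t \<cdot>\<^sub>v unit_vec m r)" for y t
      using r by (intro eq_vecI) (auto simp: mix_def w_def)
    have "mix (Suc r) y z = mix r y w + (y $ r) \<cdot>\<^sub>v unit_vec m r" for y
      using r by (intro eq_vecI) (auto simp: mix_def w_def less_Suc_eq)
    then have "\<phi> (mix (Suc r) y z) =
      (\<Sum>k\<le>M. poly (lagrange_basis M k) (y $ r) * \<phi> (mix r y (w + of_nat k \<cdot>\<^sub>v unit_vec m r)))" for y
      using sep[OF _ r, of "mix r y w" "y $ r"] by (simp add: *) (simp add: mix_def)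
    moreover have "polyfun m (\<lambda>y. \<Sum>k\<le>M. poly (lagrange_basis M k) (y $ r) * \<phi> (mix r y (w + of_nat k \<cdot>\<^sub>v unit_vec m r)))"
      using Suc by (intro polyfun_sum polyfun_mult polyfun_poly_compose polyfun_index r) auto
    ultimately show ?case by simp
  qed
  from this[of m "0\<^sub>v m"] show ?thesis
  proof (rule polyfun_cong)
    fix x :: "complex vec" assume "x \<in> carrier_vec m"
    then have "mix m x (0\<^sub>v m) = x" by (intro eq_vecI) (auto simp: mix_def)
    then show "\<phi> x = \<phi> (mix m x (0\<^sub>v m))" by simp
  qed auto
qed

text \<open>Real coordinates, to make the invariance of domain theorem of \<open>\<real>\<^sup>2\<^sup>m\<close> available.\<close>

definition vec_of_reals :: "nat \<Rightarrow> (nat \<Rightarrow> real) \<Rightarrow> complex vec" where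
  "vec_of_reals m v = vec m (\<lambda>i. of_real (v (2 * i)) + \<i> * of_real (v (2 * i + 1)))"

definition reals_of_vec :: "complex vec \<Rightarrow> nat \<Rightarrow> real" where
  "reals_of_vec x k = (if k div 2 < dim_vec x then if even k then Re (x $ (k div 2)) else Im (x $ (k div 2)) else 0)"

lemma vec_of_reals_of_vec: "x \<in> carrier_vec m \<Longrightarrow> vec_of_reals m (reals_of_vec x) = x"
  by (intro eq_vecI) (auto simp: vec_of_reals_def reals_of_vec_def complex_eq_iff)

lemma reals_of_vec_of_reals:
  assumes "\<forall>k\<ge>2 * m. v k = 0" shows "reals_of_vec (vec_of_reals m v) = v"
proof
  fix k
  show "reals_of_vec (vec_of_reals m v) k = v k"
  proof (cases "k div 2 < m")
    case True
    then show ?thesis by (cases "even k") (auto simp: reals_of_vec_def vec_of_reals_def elim!: evenE oddE)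
  next
    case False
    then have "k \<ge> 2 * m" by linarith
    then show ?thesis using False assms by (auto simp: reals_of_vec_def vec_of_reals_def)
  qed
qed

lemma reals_of_vec_support: "x \<in> carrier_vec m \<Longrightarrow> \<forall>k\<ge>2 * m. reals_of_vec x k = 0"
  by (auto simp: reals_of_vec_def)

lemma Euclidean_space_eq_top_of_set: "Euclidean_space n = top_of_set {v. \<forall>i\<ge>n. v i = 0}"
  by (simp add: Euclidean_space_def euclidean_product_topology)

lemma continuous_on_reals_of_vec:
  assumes "\<And>s. s \<in> S \<Longrightarrow> Y s \<in> carrier_vec m" "\<And>i. i < m \<Longrightarrow> continuous_on S (\<lambda>s. Y s $ i)"
  shows "continuous_on S (\<lambda>s. reals_of_vec (Y s))"
proof (rule continuous_on_coordinatewise_then_product)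
  fix k
  have "continuous_on S (\<lambda>s. if k div 2 < m then if even k then Re (Y s $ (k div 2)) else Im (Y s $ (k div 2)) else 0)"
    by (cases "k div 2 < m"; cases "even k") (auto intro!: continuous_intros assms(2))
  then show "continuous_on S (\<lambda>s. reals_of_vec (Y s) k)"
    by (rule continuous_on_cong[THEN iffD1, rotated 2]) (auto simp: reals_of_vec_def assms(1)[THEN carrier_vecD])
qed

lemma polyfun_continuous_on:
  assumes "polyfun m \<phi>" "\<And>s. s \<in> S \<Longrightarrow> Y s \<in> carrier_vec m" "\<And>i. i < m \<Longrightarrow> continuous_on S (\<lambda>s. Y s $ i)"
  shows "continuous_on S (\<lambda>s. \<phi> (Y s))"
  using assms(1)
proof (induction rule: polyfun_induct)
  case (cong \<phi> \<psi>)
  then show ?case using assms(2) by (auto cong: continuous_on_cong_simp)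
qed (auto intro!: continuous_intros assms(3))

text \<open>A bijective polynomial map is a homeomorphism by invariance of domain.\<close>

lemma bijective_polynomial_map_inverse_continuous:
  assumes p: "polynomial_map m p" and bij: "bij_betw p (carrier_vec m) (carrier_vec m)"
    and Y: "\<And>s. s \<in> S \<Longrightarrow> Y s \<in> carrier_vec m" "\<And>i. i < m \<Longrightarrow> continuous_on S (\<lambda>s. Y s $ i)"
    and i: "i < m"
  shows "continuous_on S (\<lambda>s. inv_into (carrier_vec m) p (Y s) $ i)"
proof -
  have car: "\<And>x. x \<in> carrier_vec m \<Longrightarrow> p x \<in> carrier_vec m" and pf: "\<And>i. i < m \<Longrightarrow> polyfun m (\<lambda>x. p x $ i)"
    using p unfolding polynomial_map_iff_polyfun by auto
  define T where "T = {v :: nat \<Rightarrow> real. \<forall>i\<ge>2 * m. v i = 0}"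
  define f where "f v = reals_of_vec (p (vec_of_reals m v))" for v
  have E: "Euclidean_space (2 * m) = top_of_set T" unfolding T_def by (rule Euclidean_space_eq_top_of_set)
  have dc: "vec_of_reals m v \<in> carrier_vec m" for v by (simp add: vec_of_reals_def)
  have fT: "f v \<in> T" for v unfolding f_def T_def using reals_of_vec_support[OF car[OF dc]] by simp
  have dcont: "continuous_on T (\<lambda>v. vec_of_reals m v $ i)" if "i < m" for i
    unfolding vec_of_reals_def using that
    by (auto intro!: continuous_intros continuous_on_subset[OF continuous_on_product_coordinates])
  have fcont: "continuous_on T f"
    unfolding f_def by (intro continuous_on_reals_of_vec[of _ _ m] car dc polyfun_continuous_on[OF pf] dcont)
  have inj: "inj_on f T"
  proof (rule inj_onI)
    fix v w assume v: "v \<in> T" and w: "w \<in> T" and eq: "f v = f w"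
    have "p (vec_of_reals m v) = p (vec_of_reals m w)"
      using arg_cong[OF eq, of "vec_of_reals m"] by (simp add: f_def vec_of_reals_of_vec car dc)
    then have "vec_of_reals m v = vec_of_reals m w"
      by (rule inj_onD[OF bij_betw_imp_inj_on[OF bij] _ dc dc])
    from arg_cong[OF this, of reals_of_vec] show "v = w"
      using v w by (simp add: T_def reals_of_vec_of_reals)
  qed
  have surj: "f ` T = T"
  proof
    show "T \<subseteq> f ` T"
    proof
      fix v assume v: "v \<in> T"
      have "vec_of_reals m v \<in> p ` carrier_vec m" using bij_betw_imp_surj_on[OF bij] dc by simp
      then obtain x where x: "x \<in> carrier_vec m" "p x = vec_of_reals m v" by auto
      have "f (reals_of_vec x) = v"
        using x v reals_of_vec_of_reals unfolding f_def T_def by (simp add: vec_of_reals_of_vec)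
      moreover have "reals_of_vec x \<in> T" using reals_of_vec_support[OF x(1)] by (simp add: T_def)
      ultimately show "v \<in> f ` T" by blast
    qed
  qed (use fT in auto)
  \<comment> \<open>Continuity and injectivity on the whole space of real dimension 2m give an
    embedding; surjectivity makes it a homeomorphism.\<close>
  have "embedding_map (subtopology (Euclidean_space (2 * m)) T) (Euclidean_space (2 * m)) f"
  proof (rule invariance_of_domain_Euclidean_space_embedding_map)
    show "openin (Euclidean_space (2 * m)) T" by (simp add: E)
    show "continuous_map (subtopology (Euclidean_space (2 * m)) T) (Euclidean_space (2 * m)) f"
      using fcont fT by (auto simp: E subtopology_subtopology continuous_map_in_subtopology)
  qed (rule inj)
  then have "homeomorphic_map (top_of_set T) (top_of_set T) f"
    by (simp add: E embedding_map_def subtopology_subtopology surj)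
  then obtain g where "homeomorphic_maps (top_of_set T) (top_of_set T) f g"
    by (auto simp: homeomorphic_map_maps)
  then have g: "continuous_on T g" "\<And>v. v \<in> T \<Longrightarrow> g (f v) = v" "\<And>v. v \<in> T \<Longrightarrow> g v \<in> T"
    unfolding homeomorphic_maps_def continuous_map_subtopology_eu by auto
  let ?q = "inv_into (carrier_vec m) p"
  have q: "?q y \<in> carrier_vec m" "p (?q y) = y" if "y \<in> carrier_vec m" for y
    using bij that unfolding bij_betw_def by (auto intro: inv_into_into f_inv_into_f)
  have q_eq: "?q y = vec_of_reals m (g (reals_of_vec y))" if y: "y \<in> carrier_vec m" for y
  proof -
    have "f (reals_of_vec (?q y)) = reals_of_vec y" unfolding f_def by (simp add: vec_of_reals_of_vec q y)
    moreover have "reals_of_vec (?q y) \<in> T" using reals_of_vec_support[OF q(1)[OF y]] by (simp add: T_def)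
    ultimately have "g (reals_of_vec y) = reals_of_vec (?q y)" using g(2) by metis
    then show ?thesis by (simp add: vec_of_reals_of_vec q y)
  qed
  have "continuous_on S (\<lambda>s. vec_of_reals m (g (reals_of_vec (Y s))) $ i)"
  proof (rule continuous_on_compose2[OF dcont[OF i]])
    show "continuous_on S (\<lambda>s. g (reals_of_vec (Y s)))"
      by (rule continuous_on_compose2[OF g(1) continuous_on_reals_of_vec[OF Y]])
         (use reals_of_vec_support Y(1) in \<open>auto simp: T_def\<close>)
    show "(\<lambda>s. g (reals_of_vec (Y s))) ` S \<subseteq> T"
      using g(3) reals_of_vec_support Y(1) by (auto simp: T_def)
  qed
  then show ?thesis
    by (rule continuous_on_cong[THEN iffD1, rotated 2]) (use q_eq Y(1) in auto)
qed

section \<open>One-variable criteria for holomorphy and polynomiality\<close>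

lemma field_differentiable_quadratic:
  fixes u :: "complex \<Rightarrow> complex"
  assumes "eventually (\<lambda>s. cmod (u s - u t - l * (s - t)) \<le> C * (cmod (s - t))\<^sup>2) (at t)"
  shows "u field_differentiable at t"
proof -
  have "((\<lambda>s. (u s - u t) / (s - t) - l) \<longlongrightarrow> 0) (at t)"
  proof (rule Lim_null_comparison)
    show "\<forall>\<^sub>F s in at t. norm ((u s - u t) / (s - t) - l) \<le> C * cmod (s - t)"
      using assms eventually_neq_at_within[of t]
    proof eventually_elim
      case (elim s)
      have "(u s - u t) / (s - t) - l = (u s - u t - l * (s - t)) / (s - t)" using elim by (simp add: field_simps)
      then have "norm ((u s - u t) / (s - t) - l) = cmod (u s - u t - l * (s - t)) / cmod (s - t)" by (simp add: norm_divide)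
      also have "\<dots> \<le> (C * (cmod (s - t))\<^sup>2) / cmod (s - t)" using elim by (intro divide_right_mono) auto
      also have "\<dots> = C * cmod (s - t)" using elim by (simp add: power2_eq_square)
      finally show ?case .
    qed
    have "((\<lambda>s. C * cmod (s - t)) \<longlongrightarrow> C * cmod (t - t)) (at t)" by (intro tendsto_intros)
    then show "((\<lambda>s. C * cmod (s - t)) \<longlongrightarrow> 0) (at t)" by simp
  qed
  then have "(u has_field_derivative l) (at t)"
    by (simp add: has_field_derivative_iff Lim_null[symmetric])
  then show ?thesis unfolding field_differentiable_def by blast
qed

lemma polynomial_growth_bound:
  fixes p :: "complex poly"
  assumes "degree p \<le> D" "cmod t \<ge> 1"
  shows "cmod (poly p t) \<le> (\<Sum>i\<le>D. cmod (coeff p i)) * cmod t ^ D"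
proof -
  have "poly p t = (\<Sum>i\<le>D. coeff p i * t ^ i)"
    using assms(1) by (simp add: poly_altdef coeff_eq_0 sum.mono_neutral_left[of "{..D}" "{..degree p}"])
  also have "cmod \<dots> \<le> (\<Sum>i\<le>D. cmod (coeff p i) * cmod t ^ D)"
    using assms(2) by (intro sum_norm_le) (auto simp: norm_mult norm_power intro!: mult_left_mono power_increasing)
  finally show ?thesis by (simp add: sum_distrib_right)
qed

lemma poly_bounded_below_at_infinity:
  fixes p :: "complex poly"
  assumes "p \<noteq> 0" shows "\<exists>c>0. \<exists>T. \<forall>t. T \<le> cmod t \<longrightarrow> c \<le> cmod (poly p t)"
proof -
  obtain a q where p: "p = pCons a q" by (cases p)
  show ?thesis
  proof (cases "q = 0")
    case True
    then show ?thesis using assms p by (intro exI[of _ "cmod a"]) auto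
  next
    case False
    from poly_infinity[OF this, of 1 a] show ?thesis unfolding p by (intro exI[of _ 1]) auto
  qed
qed

text \<open>A root of a polynomial equation grows no faster than the coefficients divided by the leading
  one, so an entire algebraic function is a polynomial by Liouville's theorem.\<close>

lemma entire_algebraic_imp_poly:
  fixes w :: "complex \<Rightarrow> complex"
  assumes w: "w holomorphic_on UNIV" and deg: "\<And>\<beta>. \<beta> \<le> d \<Longrightarrow> degree (P \<beta>) \<le> D" and d: "d \<ge> 1" "P d \<noteq> 0"
    and eq: "\<And>t. (\<Sum>\<beta>\<le>d. poly (P \<beta>) t * w t ^ \<beta>) = 0"
  shows "\<exists>p. degree p \<le> D \<and> (\<forall>t. w t = poly p t)"
proof -
  obtain c T where c: "c > 0" "\<And>t. T \<le> cmod t \<Longrightarrow> c \<le> cmod (poly (P d) t)"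
    using poly_bounded_below_at_infinity[OF d(2)] by blast
  \<comment> \<open>For |w t| > 1 the equation is divided by the power d - 1 of \<open>w t\<close>;
    for |w t| \<le> 1 the leading term alone suffices.\<close>
  have lead: "cmod (poly (P d) t) * cmod (w t) \<le> (\<Sum>\<beta>\<le>d. cmod (poly (P \<beta>) t))" for t
  proof (cases "cmod (w t) \<le> 1")
    case True
    then have "cmod (poly (P d) t) * cmod (w t) \<le> cmod (poly (P d) t)" by (simp add: mult_left_le)
    also have "\<dots> \<le> (\<Sum>\<beta>\<le>d. cmod (poly (P \<beta>) t))"
      by (rule member_le_sum[of d "{..d}" "\<lambda>\<beta>. cmod (poly (P \<beta>) t)"]) auto
    finally show ?thesis .
  next
    case False
    then have w1: "cmod (w t) > 1" by simp
    obtain e where e: "d = Suc e" using d(1) by (cases d) auto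
    have "poly (P d) t * w t ^ d = - (\<Sum>\<beta>\<le>e. poly (P \<beta>) t * w t ^ \<beta>)"
      using eq[of t] by (simp add: e add_eq_0_iff)
    then have "cmod (poly (P d) t) * cmod (w t) ^ d = cmod (\<Sum>\<beta>\<le>e. poly (P \<beta>) t * w t ^ \<beta>)"
      by (metis norm_minus_cancel norm_mult norm_power)
    also have "\<dots> \<le> (\<Sum>\<beta>\<le>e. cmod (poly (P \<beta>) t) * cmod (w t) ^ e)"
      using w1 by (intro sum_norm_le) (auto simp: norm_mult norm_power intro!: mult_left_mono power_increasing)
    finally have "cmod (w t) ^ e * (cmod (poly (P d) t) * cmod (w t)) \<le> cmod (w t) ^ e * (\<Sum>\<beta>\<le>e. cmod (poly (P \<beta>) t))"
      by (simp add: e sum_distrib_left mult_ac)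
    then have "cmod (poly (P d) t) * cmod (w t) \<le> (\<Sum>\<beta>\<le>e. cmod (poly (P \<beta>) t))"
    proof (subst (asm) mult_le_cancel_left_pos)
      show "0 < cmod (w t) ^ e" by (intro zero_less_power) (use w1 in linarith)
    qed
    also have "\<dots> \<le> (\<Sum>\<beta>\<le>d. cmod (poly (P \<beta>) t))" by (simp add: e)
    finally show ?thesis .
  qed
  define K where "K = (\<Sum>\<beta>\<le>d. \<Sum>i\<le>D. cmod (coeff (P \<beta>) i))"
  have "cmod (w t) \<le> K / c * cmod t ^ D" if t: "max 1 T \<le> cmod t" for t
  proof -
    have "c * cmod (w t) \<le> cmod (poly (P d) t) * cmod (w t)" using c t by (intro mult_right_mono) auto
    also note lead
    also have "(\<Sum>\<beta>\<le>d. cmod (poly (P \<beta>) t)) \<le> (\<Sum>\<beta>\<le>d. (\<Sum>i\<le>D. cmod (coeff (P \<beta>) i)) * cmod t ^ D)"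
      using t deg by (intro sum_mono polynomial_growth_bound) auto
    also have "\<dots> = K * cmod t ^ D" by (simp add: K_def sum_distrib_right)
    finally show ?thesis using c(1) by (simp add: field_simps)
  qed
  then have "w t = (\<Sum>k\<le>D. (deriv ^^ k) w 0 / fact k * t ^ k)" for t
    by (rule Liouville_polynomial[OF w])
  then have "w t = poly (\<Sum>k\<le>D. monom ((deriv ^^ k) w 0 / fact k) k) t" for t
    by (simp add: poly_sum poly_monom)
  moreover have "degree (\<Sum>k\<le>D. monom ((deriv ^^ k) w 0 / fact k) k) \<le> D"
    by (intro degree_sum_le) (auto intro: order_trans[OF degree_monom_le])
  ultimately show ?thesis by blast
qed

text \<open>The inverse \<open>q\<close> is continuous. Points with \<open>det p'(q(y)) = 0\<close> lie in a proper hypersurface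
  \<open>R = 0\<close> because \<open>det p'\<close> is algebraic over the components of \<open>p\<close>; so on a generic line \<open>q\<close> is
  holomorphic off a finite set, hence entire, and algebraic, hence polynomial of bounded degree.
  By continuity the same holds on all lines.\<close>

theorem bijective_polynomial_map_inverse_polynomial:
  assumes p: "polynomial_map m p" and t: "tangent_to_id m p"
    and bij: "bij_betw p (carrier_vec m) (carrier_vec m)"
  shows "polynomial_map m (inv_into (carrier_vec m) p)"
proof -
  let ?q = "inv_into (carrier_vec m) p"
  have car: "\<And>x. x \<in> carrier_vec m \<Longrightarrow> p x \<in> carrier_vec m" and pf: "\<And>i. i < m \<Longrightarrow> polyfun m (\<lambda>x. p x $ i)"
    using p unfolding polynomial_map_iff_polyfun by auto
  have q: "?q y \<in> carrier_vec m" "p (?q y) = y" if "y \<in> carrier_vec m" for y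
    using bij that unfolding bij_betw_def by (auto intro: inv_into_into f_inv_into_f)
  have "\<forall>i. \<exists>L. i < m \<longrightarrow> (\<forall>j<m. polyfun m (L j)) \<and> (\<forall>R. \<exists>C. \<forall>x\<in>carrier_vec m. \<forall>y\<in>carrier_vec m.
    vnorm x \<le> R \<longrightarrow> vnorm y \<le> R \<longrightarrow>
    cmod (p x $ i - p y $ i - (\<Sum>j<m. L j y * (x $ j - y $ j))) \<le> C * (vnorm (x - y))\<^sup>2)"
    using polyfun_taylor[OF pf] by blast
  from choice[OF this] obtain L where L: "\<And>i j. i < m \<Longrightarrow> j < m \<Longrightarrow> polyfun m (L i j)"
    and T: "\<And>i R. i < m \<Longrightarrow> \<exists>C. \<forall>x\<in>carrier_vec m. \<forall>y\<in>carrier_vec m.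
    vnorm x \<le> R \<longrightarrow> vnorm y \<le> R \<longrightarrow>
    cmod (p x $ i - p y $ i - (\<Sum>j<m. L i j y * (x $ j - y $ j))) \<le> C * (vnorm (x - y))\<^sup>2"
    by blast
  define J where "J z = mat m m (\<lambda>(i, j). L i j z)" for z
  have Jc: "J z \<in> carrier_mat m m" for z by (simp add: J_def)
  have \<delta>: "polyfun m (\<lambda>z. det (J z))" unfolding J_def by (intro polyfun_det L)
  have L0: "L i j (0\<^sub>v m) = (if j = i then 1 else 0)" if ij: "i < m" "j < m" for i j
  proof -
    from T[OF ij(1), of 1] obtain C where C: "\<And>x y. x \<in> carrier_vec m \<Longrightarrow> y \<in> carrier_vec m \<Longrightarrow>
      vnorm x \<le> 1 \<Longrightarrow> vnorm y \<le> 1 \<Longrightarrow>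
      cmod (p x $ i - p y $ i - (\<Sum>j<m. L i j y * (x $ j - y $ j))) \<le> C * (vnorm (x - y))\<^sup>2" by blast
    show ?thesis
    proof (rule taylor_coeff_tangent_to_id[where f = p and R = 1 and L = "\<lambda>j. L i j (0\<^sub>v m)" and C = C])
      show "cmod (p x $ i - p (0\<^sub>v m) $ i - (\<Sum>j<m. L i j (0\<^sub>v m) * (x $ j - 0\<^sub>v m $ j))) \<le> C * (vnorm (x - 0\<^sub>v m))\<^sup>2"
        if "x \<in> carrier_vec m" "vnorm x \<le> 1" for x
        by (rule C[OF that(1) zero_carrier_vec that(2)]) simp
    qed (use t car ij in auto)
  qed
  have "J (0\<^sub>v m) = 1\<^sub>m m" by (rule eq_matI) (auto simp: J_def L0)
  then have \<delta>0: "det (J (0\<^sub>v m)) = 1" by simp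
  have nz: "\<exists>a\<in>carrier_vec m. (\<Sum>\<alpha>\<in>degree_box m E. c \<alpha> * vec_monomial m \<alpha> a) \<noteq> 0"
    if "\<alpha> \<in> degree_box m E" "c \<alpha> \<noteq> 0" for c E \<alpha>
    using vec_monomial_sum_eq_0_imp_coeff_eq_0[OF finite_degree_box degree_box_subset _ that(1), of c] that(2) by blast
  have pfP: "polyfun m (\<lambda>y. \<Sum>\<alpha>\<in>degree_box m E. c \<alpha> * vec_monomial m \<alpha> y)" for c E
    unfolding polyfun_def
    by (rule exI[of _ "degree_box m E"], rule exI[of _ c]) (auto intro: subsetD[OF degree_box_subset])
  \<comment> \<open>In an algebraic relation between \<open>p\<close> and the Jacobian determinant,
    the least occurring power of the determinant is divided out. At a critical point only the lowest
    coefficient, a polynomial in \<open>p z\<close>, survives.\<close>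
  obtain R where R: "polyfun m R" "\<exists>a\<in>carrier_vec m. R a \<noteq> 0"
    and R0: "\<And>z. z \<in> carrier_vec m \<Longrightarrow> det (J z) = 0 \<Longrightarrow> R (p z) = 0"
  proof -
    obtain E B x where ex: "\<exists>\<alpha>\<in>degree_box m E. \<exists>\<beta>\<le>B. x \<alpha> \<beta> \<noteq> 0"
      and rel: "\<And>z. z \<in> carrier_vec m \<Longrightarrow>
        (\<Sum>\<beta>\<le>B. (\<Sum>\<alpha>\<in>degree_box m E. x \<alpha> \<beta> * vec_monomial m \<alpha> (p z)) * det (J z) ^ \<beta>) = 0"
      using algebraic_dependence[OF p \<delta>] by blast
    define P where "P \<beta> y = (\<Sum>\<alpha>\<in>degree_box m E. x \<alpha> \<beta> * vec_monomial m \<alpha> y)" for \<beta> y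
    define s where "s = (LEAST \<beta>. \<beta> \<le> B \<and> (\<exists>\<alpha>\<in>degree_box m E. x \<alpha> \<beta> \<noteq> 0))"
    have "\<exists>\<beta>. \<beta> \<le> B \<and> (\<exists>\<alpha>\<in>degree_box m E. x \<alpha> \<beta> \<noteq> 0)" using ex by blast
    from LeastI_ex[OF this] have s: "s \<le> B" "\<exists>\<alpha>\<in>degree_box m E. x \<alpha> s \<noteq> 0" unfolding s_def by auto
    have below: "P \<beta> y = 0" if "\<beta> < s" for \<beta> y
      using not_less_Least[OF that[unfolded s_def]] that s(1) by (auto simp: P_def)
    define Q where "Q z = (\<Sum>\<beta>\<in>{s..B}. P \<beta> (p z) * det (J z) ^ (\<beta> - s))" for z
    have "polyfun m Q"
      unfolding Q_def P_def
      by (intro polyfun_sum polyfun_mult polyfun_power \<delta> polyfun_compose[OF pfP car pf])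
    moreover have "det (J z) ^ s * Q z = 0" if "z \<in> carrier_vec m" for z
    proof -
      have "det (J z) ^ s * Q z = (\<Sum>\<beta>\<in>{s..B}. P \<beta> (p z) * det (J z) ^ \<beta>)"
        unfolding Q_def sum_distrib_left
        by (intro sum.cong refl) (simp add: mult.left_commute power_add[symmetric])
      also have "\<dots> = (\<Sum>\<beta>\<le>B. P \<beta> (p z) * det (J z) ^ \<beta>)"
        using below by (intro sum.mono_neutral_left) auto
      finally show ?thesis using rel[OF that] by (simp add: P_def)
    qed
    \<comment> \<open>The power of the determinant can be cancelled: it is 1 at the origin, and
      polynomial functions have no zero divisors.\<close>
    ultimately have Q0: "Q z = 0" if "z \<in> carrier_vec m" for z
      using polyfun_no_zero_divisors[OF polyfun_power[OF \<delta>, of s], of Q "0\<^sub>v m" z] \<delta>0 that by simp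
    have "P s (p z) = 0" if z: "z \<in> carrier_vec m" "det (J z) = 0" for z
    proof -
      have "Q z = (\<Sum>\<beta>\<in>{s..B}. if \<beta> = s then P s (p z) else 0)"
        unfolding Q_def by (intro sum.cong) (auto simp: z(2))
      then show ?thesis using Q0[OF z(1)] s(1) by simp
    qed
    moreover have "polyfun m (P s)" unfolding P_def[abs_def] by (rule pfP)
    moreover have "\<exists>a\<in>carrier_vec m. P s a \<noteq> 0"
    proof -
      from s(2) obtain \<alpha> where "\<alpha> \<in> degree_box m E" "x \<alpha> s \<noteq> 0" by blast
      then show ?thesis unfolding P_def by (rule nz[where c = "\<lambda>\<alpha>. x \<alpha> s"])
    qed
    ultimately show thesis by (rule that[rotated 2])
  qed
  have hol: "(\<lambda>t. ?q (a + t \<cdot>\<^sub>v b) $ i) holomorphic_on UNIV"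
    if ab: "a \<in> carrier_vec m" "b \<in> carrier_vec m" "R a \<noteq> 0" and i: "i < m" for a b i
  proof -
    define l where "l t = a + t \<cdot>\<^sub>v b" for t
    have lc: "l t \<in> carrier_vec m" for t using ab by (simp add: l_def)
    have li: "l t $ i = a $ i + t * b $ i" if "i < m" for t i using ab that by (simp add: l_def)
    obtain r where r: "\<And>t. R (l t) = poly r t" using polyfun_line[OF R(1)] ab(1,2) unfolding l_def by blast
    have "l 0 = a" using ab by (intro eq_vecI) (auto simp: l_def)
    then have "r \<noteq> 0" using r[of 0] ab(3) by auto
    then have fin: "finite {t. R (l t) = 0}" unfolding r by (rule poly_roots_finite)
    have cont: "continuous_on UNIV (\<lambda>t. ?q (l t) $ k)" if "k < m" for k
    proof (rule bijective_polynomial_map_inverse_continuous[OF p bij _ _ that])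
      show "continuous_on UNIV (\<lambda>t. l t $ i)" if "i < m" for i
        unfolding li[OF that] by (intro continuous_intros)
    qed (rule lc)
    have diff: "(\<lambda>t. ?q (l t) $ i) field_differentiable at t" if t: "R (l t) \<noteq> 0" for t
    proof -
      define z where "z s = ?q (l s)" for s
      have zc: "z s \<in> carrier_vec m" and pz: "p (z s) = l s" for s using q lc by (auto simp: z_def)
      have det: "det (J (z t)) \<noteq> 0" using R0[OF zc[of t]] t by (auto simp: pz)
      \<comment> \<open>The inverse of the Jacobian matrix at \<open>z t\<close>, through the
        adjugate.\<close>
      define K where "K = (1 / det (J (z t))) \<cdot>\<^sub>m adj_mat (J (z t))"
      have adj: "adj_mat (J (z t)) \<in> carrier_mat m m" by (rule adj_mat(1)[OF Jc])
      have Kc: "K \<in> carrier_mat m m" using adj by (simp add: K_def)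
      have KJ: "K * J (z t) = 1\<^sub>m m"
      proof -
        have "K * J (z t) = (1 / det (J (z t))) \<cdot>\<^sub>m (det (J (z t)) \<cdot>\<^sub>m 1\<^sub>m m)"
          unfolding K_def using adj_mat(3)[OF Jc[of "z t"]] adj Jc[of "z t"]
          by (simp add: mult_smult_assoc_mat[of _ m m _ m])
        also have "\<dots> = 1\<^sub>m m" using det by (intro eq_matI) auto
        finally show ?thesis .
      qed
      obtain \<kappa> where \<kappa>: "\<kappa> \<ge> 0" "\<And>v. v \<in> carrier_vec m \<Longrightarrow> vnorm (K *\<^sub>v v) \<le> \<kappa> * vnorm v"
        using vnorm_mult_mat_vec_le[OF Kc] by blast
      define \<rho> where "\<rho> = vnorm (z t) + 1"
      have "\<forall>i. \<exists>C. i < m \<longrightarrow> (\<forall>x\<in>carrier_vec m. \<forall>y\<in>carrier_vec m. vnorm x \<le> \<rho> \<longrightarrow> vnorm y \<le> \<rho> \<longrightarrow>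
        cmod (p x $ i - p y $ i - (\<Sum>j<m. L i j y * (x $ j - y $ j))) \<le> C * (vnorm (x - y))\<^sup>2)"
        using T[of _ \<rho>] by blast
      from choice[OF this] obtain C where C: "\<And>i x y. i < m \<Longrightarrow> x \<in> carrier_vec m \<Longrightarrow> y \<in> carrier_vec m \<Longrightarrow> vnorm x \<le> \<rho> \<Longrightarrow> vnorm y \<le> \<rho> \<Longrightarrow>
        cmod (p x $ i - p y $ i - (\<Sum>j<m. L i j y * (x $ j - y $ j))) \<le> C i * (vnorm (x - y))\<^sup>2" by blast
      define D where "D = (\<Sum>i<m. \<bar>C i\<bar>)"
      have D0: "D \<ge> 0" unfolding D_def by (intro sum_nonneg) auto
      \<comment> \<open>As \<open>p (z s) = l s\<close>, the increment of \<open>p\<close> along the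
        curve is exactly (s - t) b, so \<open>e s\<close> is its Taylor remainder.\<close>
      define e where "e s = (s - t) \<cdot>\<^sub>v b - J (z t) *\<^sub>v (z s - z t)" for s
      have ec: "e s \<in> carrier_vec m" for s using ab Jc[of "z t"] zc by (simp add: e_def)
      have e_le: "vnorm (e s) \<le> D * (vnorm (z s - z t))\<^sup>2" if s: "vnorm (z s - z t) \<le> 1" for s
      proof (rule vnorm_leI[OF ec])
        show "0 \<le> D * (vnorm (z s - z t))\<^sup>2" using D0 by simp
        fix i assume i: "i < m"
        have "vnorm (z s) \<le> \<rho>" using vnorm_triangle_sub[OF zc zc, of s t] s by (simp add: \<rho>_def)
        moreover have "vnorm (z t) \<le> \<rho>" by (simp add: \<rho>_def)
        ultimately have "cmod (l s $ i - l t $ i - (\<Sum>j<m. L i j (z t) * (z s $ j - z t $ j))) \<le> C i * (vnorm (z s - z t))\<^sup>2"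
          using C[OF i zc zc, of s t] by (simp add: pz)
        also have "\<dots> \<le> D * (vnorm (z s - z t))\<^sup>2"
          unfolding D_def using i member_le_sum[of i "{..<m}" "\<lambda>i. \<bar>C i\<bar>"] by (intro mult_right_mono) auto
        finally have "cmod (l s $ i - l t $ i - (\<Sum>j<m. L i j (z t) * (z s $ j - z t $ j))) \<le> D * (vnorm (z s - z t))\<^sup>2" .
        moreover have "(J (z t) *\<^sub>v (z s - z t)) $ i = (\<Sum>j<m. L i j (z t) * (z s $ j - z t $ j))"
          using i zc[THEN carrier_vecD] by (auto simp: J_def scalar_prod_def atLeast0LessThan intro!: sum.cong)
        moreover have "l s $ i - l t $ i = (s - t) * b $ i" using i by (simp add: li algebra_simps)
        ultimately show "cmod (e s $ i) \<le> D * (vnorm (z s - z t))\<^sup>2"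
          using i ab Jc[of "z t"] by (simp add: e_def)
      qed
      have z_eq: "z s - z t = (s - t) \<cdot>\<^sub>v (K *\<^sub>v b) - K *\<^sub>v e s" for s
      proof -
        have d: "z s - z t \<in> carrier_vec m" using zc by simp
        have "K *\<^sub>v (J (z t) *\<^sub>v (z s - z t)) = z s - z t"
          using assoc_mult_mat_vec[OF Kc Jc[of "z t"] d] d by (simp add: KJ)
        moreover have "K *\<^sub>v e s = (s - t) \<cdot>\<^sub>v (K *\<^sub>v b) - K *\<^sub>v (J (z t) *\<^sub>v (z s - z t))"
          unfolding e_def using ab Kc Jc[of "z t"] d
          by (simp add: mult_minus_distrib_mat_vec[of K m m] mult_mat_vec[of K m m])
        ultimately have *: "K *\<^sub>v e s = (s - t) \<cdot>\<^sub>v (K *\<^sub>v b) - (z s - z t)" by simp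
        show ?thesis unfolding * using Kc ab d
          by (intro eq_vecI) (auto simp: zc[THEN carrier_vecD])
      qed
      \<comment> \<open>Within distance \<eta> the remainder, after applying \<open>K\<close>, is at
        most half of |z s - z t|. This gives |z s - z t| = O(|s - t|), and then a remainder
        quadratic in s - t.\<close>
      define \<eta> where "\<eta> = 1 / (2 * (\<kappa> * D + 1))"
      have \<eta>: "\<eta> > 0" "\<eta> \<le> 1" "\<kappa> * D * \<eta> \<le> 1 / 2"
        using \<kappa>(1) D0 by (auto simp: \<eta>_def field_simps add_pos_nonneg mult_nonneg_nonneg)
      have "\<forall>\<^sub>F s in at t. \<forall>k\<in>{..<m}. cmod (z s $ k - z t $ k) < \<eta>"
      proof (rule eventually_ball_finite)
        show "\<forall>k\<in>{..<m}. \<forall>\<^sub>F s in at t. cmod (z s $ k - z t $ k) < \<eta>"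
        proof
          fix k assume "k \<in> {..<m}"
          then have "isCont (\<lambda>s. z s $ k) t" using cont[of k] by (simp add: z_def continuous_on_eq_continuous_at)
          then have "(\<lambda>s. z s $ k) \<midarrow>t\<rightarrow> z t $ k" by (simp add: isCont_def)
          from tendstoD[OF this \<eta>(1)] show "\<forall>\<^sub>F s in at t. cmod (z s $ k - z t $ k) < \<eta>" by (simp add: dist_norm)
        qed
      qed simp
      then have ev: "\<forall>\<^sub>F s in at t. vnorm (z s - z t) \<le> \<eta>"
      proof eventually_elim
        case (elim s)
        show ?case
          by (rule vnorm_leI[of _ m]) (use elim \<eta>(1) zc in \<open>auto simp: zc[THEN carrier_vecD] intro!: less_imp_le\<close>)
      qed
      define M where "M = 2 * vnorm (K *\<^sub>v b)"
      have "\<forall>\<^sub>F s in at t. cmod (z s $ i - z t $ i - (K *\<^sub>v b) $ i * (s - t)) \<le> (\<kappa> * (D * M\<^sup>2)) * (cmod (s - t))\<^sup>2"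
        using ev
      proof eventually_elim
        case (elim s)
        have c1: "(s - t) \<cdot>\<^sub>v (K *\<^sub>v b) \<in> carrier_vec m" "K *\<^sub>v e s \<in> carrier_vec m" using Kc ab ec by auto
        have Ke: "vnorm (K *\<^sub>v e s) \<le> \<kappa> * (D * (vnorm (z s - z t))\<^sup>2)"
          using \<kappa>(2)[OF ec[of s]] mult_left_mono[OF e_le \<kappa>(1), of s] elim \<eta>(2) by linarith
        have "\<kappa> * (D * (vnorm (z s - z t))\<^sup>2) \<le> 1 / 2 * vnorm (z s - z t)"
        proof -
          have "\<kappa> * D * vnorm (z s - z t) \<le> \<kappa> * D * \<eta>" using elim \<kappa>(1) D0 by (intro mult_left_mono) auto
          then have "\<kappa> * D * vnorm (z s - z t) * vnorm (z s - z t) \<le> 1 / 2 * vnorm (z s - z t)"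
            using \<eta>(3) by (intro mult_right_mono) auto
          then show ?thesis by (simp only: power2_eq_square mult.assoc)
        qed
        moreover have "vnorm (z s - z t) \<le> cmod (s - t) * vnorm (K *\<^sub>v b) + vnorm (K *\<^sub>v e s)"
        proof -
          have "vnorm (z s - z t) \<le> vnorm ((s - t) \<cdot>\<^sub>v (K *\<^sub>v b)) + vnorm (z s - z t - (s - t) \<cdot>\<^sub>v (K *\<^sub>v b))"
            using zc c1 by (intro vnorm_triangle_sub) auto
          also have "z s - z t - (s - t) \<cdot>\<^sub>v (K *\<^sub>v b) = (-1) \<cdot>\<^sub>v (K *\<^sub>v e s)"
            unfolding z_eq using c1 by (intro eq_vecI) auto
          finally show ?thesis using Kc ab ec[of s] by (simp add: vnorm_smult[of _ m])
        qed
        ultimately have "vnorm (z s - z t) \<le> 2 * (cmod (s - t) * vnorm (K *\<^sub>v b))" using Ke by linarith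
        then have "vnorm (z s - z t) \<le> M * cmod (s - t)" by (simp add: M_def mult_ac)
        then have "(vnorm (z s - z t))\<^sup>2 \<le> (M * cmod (s - t))\<^sup>2" by (intro power_mono) auto
        then have "\<kappa> * (D * (vnorm (z s - z t))\<^sup>2) \<le> \<kappa> * (D * (M * cmod (s - t))\<^sup>2)"
          using \<kappa>(1) D0 by (intro mult_left_mono) auto
        with Ke have Ke': "vnorm (K *\<^sub>v e s) \<le> (\<kappa> * (D * M\<^sup>2)) * (cmod (s - t))\<^sup>2"
          by (simp add: power_mult_distrib mult_ac)
        have "z s $ i - z t $ i = (z s - z t) $ i" using i zc[THEN carrier_vecD] by simp
        also have "\<dots> = (s - t) * (K *\<^sub>v b) $ i - (K *\<^sub>v e s) $ i" unfolding z_eq using i c1 Kc by simp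
        finally have "z s $ i - z t $ i - (K *\<^sub>v b) $ i * (s - t) = - (K *\<^sub>v e s) $ i" by simp
        then show ?case using cmod_index_le_vnorm'[OF c1(2) i] Ke' by simp
      qed
      then show ?thesis unfolding z_def by (rule field_differentiable_quadratic)
    qed
    have "(\<lambda>t. ?q (l t) $ i) holomorphic_on UNIV - {t. R (l t) = 0}"
      by (rule holomorphic_onI, rule field_differentiable_at_within, rule diff) simp
    then have "(\<lambda>t. ?q (l t) $ i) holomorphic_on UNIV"
      by (rule no_isolated_singularity[OF cont[OF i] _ open_UNIV fin])
    then show ?thesis unfolding l_def .
  qed
  have "polyfun m (\<lambda>y. ?q y $ k)" if k: "k < m" for k
  proof -
    obtain E B x where ex: "\<exists>\<alpha>\<in>degree_box m E. \<exists>\<beta>\<le>B. x \<alpha> \<beta> \<noteq> 0"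
      and rel: "\<And>z. z \<in> carrier_vec m \<Longrightarrow>
        (\<Sum>\<beta>\<le>B. (\<Sum>\<alpha>\<in>degree_box m E. x \<alpha> \<beta> * vec_monomial m \<alpha> (p z)) * (z $ k) ^ \<beta>) = 0"
      using algebraic_dependence[OF p polyfun_index[OF k]] by blast
    define P where "P \<beta> y = (\<Sum>\<alpha>\<in>degree_box m E. x \<alpha> \<beta> * vec_monomial m \<alpha> y)" for \<beta> y
    have Pp: "polyfun m (P \<beta>)" for \<beta> unfolding P_def[abs_def] by (rule pfP)
    \<comment> \<open>The largest power with a nonzero coefficient;
      \<open>entire_algebraic_imp_poly\<close> asks for a leading coefficient that does not vanish
      identically on the line.\<close>
    define d where "d = (GREATEST \<beta>. \<beta> \<le> B \<and> (\<exists>\<alpha>\<in>degree_box m E. x \<alpha> \<beta> \<noteq> 0))"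
    have "\<exists>\<beta>. \<beta> \<le> B \<and> (\<exists>\<alpha>\<in>degree_box m E. x \<alpha> \<beta> \<noteq> 0)" using ex by blast
    from GreatestI_ex_nat[OF this, of B] have d: "d \<le> B" "\<exists>\<alpha>\<in>degree_box m E. x \<alpha> d \<noteq> 0" unfolding d_def by auto
    have above: "P \<beta> y = 0" if "d < \<beta>" "\<beta> \<le> B" for \<beta> y
    proof -
      have "\<not> (\<exists>\<alpha>\<in>degree_box m E. x \<alpha> \<beta> \<noteq> 0)"
        using Greatest_le_nat[of "\<lambda>\<beta>. \<beta> \<le> B \<and> (\<exists>\<alpha>\<in>degree_box m E. x \<alpha> \<beta> \<noteq> 0)" \<beta> B] that unfolding d_def by fastforce
      then show ?thesis by (simp add: P_def)
    qed
    have rel': "(\<Sum>\<beta>\<le>d. P \<beta> y * (?q y $ k) ^ \<beta>) = 0" if y: "y \<in> carrier_vec m" for y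
    proof -
      have "(\<Sum>\<beta>\<le>d. P \<beta> y * (?q y $ k) ^ \<beta>) = (\<Sum>\<beta>\<le>B. P \<beta> y * (?q y $ k) ^ \<beta>)"
        using above d(1) by (intro sum.mono_neutral_left) auto
      then show ?thesis using rel[OF q(1)[OF y]] by (simp add: P_def q(2)[OF y])
    qed
    obtain a where a: "a \<in> carrier_vec m" "P d a \<noteq> 0"
    proof -
      from d(2) obtain \<alpha> where "\<alpha> \<in> degree_box m E" "x \<alpha> d \<noteq> 0" by blast
      then have "\<exists>a\<in>carrier_vec m. P d a \<noteq> 0" unfolding P_def by (rule nz[where c = "\<lambda>\<alpha>. x \<alpha> d"])
      then show thesis using that by blast
    qed
    \<comment> \<open>For d = 0 the relation at \<open>a\<close> would reduce to
      \<open>P d a = 0\<close>.\<close>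
    have d1: "d \<ge> 1"
    proof (rule ccontr)
      assume "\<not> d \<ge> 1"
      then have "d = 0" by simp
      then show False using rel'[OF a(1)] a(2) by simp
    qed
    have "\<forall>\<beta>. \<exists>D. \<forall>a\<in>carrier_vec m. \<forall>b\<in>carrier_vec m. \<exists>p. degree p \<le> D \<and> (\<forall>t. P \<beta> (a + t \<cdot>\<^sub>v b) = poly p t)"
      using polyfun_line[OF Pp] by blast
    from choice[OF this] obtain D where D: "\<And>\<beta> a b. a \<in> carrier_vec m \<Longrightarrow> b \<in> carrier_vec m \<Longrightarrow>
      \<exists>p. degree p \<le> D \<beta> \<and> (\<forall>t. P \<beta> (a + t \<cdot>\<^sub>v b) = poly p t)" by blast
    define M where "M = (\<Sum>\<beta>\<le>d. D \<beta>)"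
    \<comment> \<open>\<open>M\<close> depends neither on \<open>y\<close> nor on \<open>b\<close>.
      The bound on the degree is expressed by interpolation, an identity whose two sides vary
      continuously with the base point.\<close>
    have generic: "?q (y + t \<cdot>\<^sub>v b) $ k = (\<Sum>i\<le>M. poly (lagrange_basis M i) t * ?q (y + of_nat i \<cdot>\<^sub>v b) $ k)"
      if y: "y \<in> carrier_vec m" "b \<in> carrier_vec m" "R y * P d y \<noteq> 0" for y b t
    proof -
      have "\<forall>\<beta>. \<exists>p. degree p \<le> D \<beta> \<and> (\<forall>t. P \<beta> (y + t \<cdot>\<^sub>v b) = poly p t)" using D[OF y(1,2)] by blast
      from choice[OF this] obtain pp where pp: "\<And>\<beta>. degree (pp \<beta>) \<le> D \<beta>" "\<And>\<beta> t. P \<beta> (y + t \<cdot>\<^sub>v b) = poly (pp \<beta>) t" by blast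
      have y0: "y + 0 \<cdot>\<^sub>v b = y" using y by (intro eq_vecI) auto
      have "\<exists>w. degree w \<le> M \<and> (\<forall>t. ?q (y + t \<cdot>\<^sub>v b) $ k = poly w t)"
      proof (rule entire_algebraic_imp_poly[where P = pp, OF hol _ d1])
        show "degree (pp \<beta>) \<le> M" if "\<beta> \<le> d" for \<beta>
        proof -
          have "D \<beta> \<le> M" unfolding M_def using that by (intro member_le_sum) auto
          then show ?thesis using pp(1)[of \<beta>] by simp
        qed
        show "pp d \<noteq> 0" using pp(2)[of d 0] y y0 by auto
        show "(\<Sum>\<beta>\<le>d. poly (pp \<beta>) t * ?q (y + t \<cdot>\<^sub>v b) $ k ^ \<beta>) = 0" for t
          using rel'[of "y + t \<cdot>\<^sub>v b"] y by (simp add: pp(2))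
      qed (use y k in auto)
      then show ?thesis using lagrange_interpolation[of _ M t] by auto
    qed
    obtain c where c: "c \<in> carrier_vec m" "R c * P d c \<noteq> 0"
    proof -
      have "\<not> (\<forall>c\<in>carrier_vec m. R c * P d c = 0)"
        using polyfun_no_zero_divisors[OF R(1) Pp[of d]] R(2) a by blast
      then show thesis using that by blast
    qed
    show ?thesis
    proof (rule separately_polynomial_imp_polyfun[where M = M])
      fix y :: "complex vec" and i t assume y: "y \<in> carrier_vec m" and i: "i < m"
      \<comment> \<open>The base point is moved from \<open>y\<close> towards the generic point
        \<open>c\<close>. The identity holds at \<open>Y s\<close> for all s \<noteq> 0 near 0, and
        continuity gives it at s = 0.\<close>
      define Y where "Y s = y + s \<cdot>\<^sub>v (c - y)" for s
      have Yc: "Y s \<in> carrier_vec m" for s using y c by (simp add: Y_def)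
      obtain g where g: "\<And>s. R (Y s) * P d (Y s) = poly g s"
        using polyfun_line[OF polyfun_mult[OF R(1) Pp[of d]]] y c unfolding Y_def by (metis minus_carrier_vec)
      have "Y 1 = c" using y c by (intro eq_vecI) (auto simp: Y_def)
      then have "g \<noteq> 0" using g[of 1] c(2) by auto
      then have fin: "finite ({s. poly g s = 0} - {0})" using poly_roots_finite by blast
      define F where "F s = ?q (Y s + t \<cdot>\<^sub>v unit_vec m i) $ k -
        (\<Sum>j\<le>M. poly (lagrange_basis M j) t * ?q (Y s + of_nat j \<cdot>\<^sub>v unit_vec m i) $ k)" for s
      have cont: "continuous_on UNIV (\<lambda>s. ?q (Y s + \<tau> \<cdot>\<^sub>v unit_vec m i) $ k)" for \<tau>
      proof (rule bijective_polynomial_map_inverse_continuous[OF p bij _ _ k])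
        show "Y s + \<tau> \<cdot>\<^sub>v unit_vec m i \<in> carrier_vec m" for s using Yc by simp
        show "continuous_on UNIV (\<lambda>s. (Y s + \<tau> \<cdot>\<^sub>v unit_vec m i) $ j)" if "j < m" for j
        proof -
          have eq: "(\<lambda>s. (Y s + \<tau> \<cdot>\<^sub>v unit_vec m i) $ j) = (\<lambda>s. y $ j + s * (c $ j - y $ j) + \<tau> * unit_vec m i $ j)"
            using y c i that by (auto simp: Y_def fun_eq_iff)
          show ?thesis unfolding eq by (intro continuous_intros)
        qed
      qed
      have "continuous_on UNIV F" unfolding F_def by (intro continuous_intros cont)
      then have "F \<midarrow>0\<rightarrow> F 0" by (simp add: continuous_on_eq_continuous_at isCont_def)
      moreover have "\<forall>\<^sub>F s in at 0. F s = 0"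
      proof -
        have "open (- ({s. poly g s = 0} - {0}))" using fin by (intro open_Compl finite_imp_closed)
        then have "\<forall>\<^sub>F s in at 0. s \<in> - ({s. poly g s = 0} - {0})" by (intro eventually_at_in_open') auto
        then show ?thesis using eventually_neq_at_within[of 0]
        proof eventually_elim
          case (elim s)
          then have ne: "R (Y s) * P d (Y s) \<noteq> 0" by (auto simp: g)
          show ?case unfolding F_def right_minus_eq by (rule generic[OF Yc unit_vec_carrier ne])
        qed
      qed
      then have "F \<midarrow>0\<rightarrow> 0" by (rule tendsto_eventually)
      ultimately have "F 0 = 0" using LIM_unique by blast
      moreover have "Y 0 = y" using y c by (intro eq_vecI) (auto simp: Y_def)
      ultimately show "?q (y + t \<cdot>\<^sub>v unit_vec m i) $ k =
        (\<Sum>j\<le>M. poly (lagrange_basis M j) t * ?q (y + of_nat j \<cdot>\<^sub>v unit_vec m i) $ k)"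
        by (simp add: F_def)
    qed
  qed
  then show ?thesis unfolding polynomial_map_iff_polyfun using q(1) by auto
qed

text \<open>A polynomial inverse is Lipschitz near 0, so for z = k^-1(x) the right-hand side of
  |k(z) - z| \<le> C|z|^2 is O(|x|^2).\<close>

lemma tangent_to_id_inverse:
  assumes bij: "bij_betw k (carrier_vec m) (carrier_vec m)" and t: "tangent_to_id m k"
    and p: "polynomial_map m (inv_into (carrier_vec m) k)"
  shows "tangent_to_id m (inv_into (carrier_vec m) k)"
proof -
  let ?p = "inv_into (carrier_vec m) k"
  have kc: "\<And>x. x \<in> carrier_vec m \<Longrightarrow> k x \<in> carrier_vec m" using bij by (auto simp: bij_betw_def)
  have pc: "?p x \<in> carrier_vec m" "k (?p x) = x" if "x \<in> carrier_vec m" for x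
    using bij that unfolding bij_betw_def by (auto intro: inv_into_into f_inv_into_f)
  have p0: "?p (0\<^sub>v m) = 0\<^sub>v m"
    using inv_into_f_eq[OF bij_betw_imp_inj_on[OF bij] zero_carrier_vec tangent_to_id_zero[OF t kc]] .
  obtain C r where C: "r > 0" "C \<ge> 0" "\<And>y. y \<in> carrier_vec m \<Longrightarrow> vnorm y \<le> r \<Longrightarrow> vnorm (k y - y) \<le> C * (vnorm y)\<^sup>2"
    using tangent_to_idE[OF t] by blast
  obtain D where D: "D \<ge> 0" "\<And>x y. x \<in> carrier_vec m \<Longrightarrow> y \<in> carrier_vec m \<Longrightarrow> vnorm x \<le> 1 \<Longrightarrow> vnorm y \<le> 1 \<Longrightarrow>
    vnorm (?p x - ?p y) \<le> D * vnorm (x - y)" using polynomial_map_lipschitz[OF p, of 1] by blast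
  have le: "vnorm (?p x) \<le> D * vnorm x" if x: "x \<in> carrier_vec m" "vnorm x \<le> 1" for x
    using D(2)[OF x(1) zero_carrier_vec x(2)] x pc by (simp add: p0)
  show ?thesis
    unfolding tangent_to_id_def
  proof (rule exI[of _ "C * D\<^sup>2"], rule exI[of _ "min 1 (r / (D + 1))"], intro conjI ballI impI)
    show "0 < min 1 (r / (D + 1))" using C D by simp
    fix x assume x: "x \<in> carrier_vec m" "vnorm x \<le> min 1 (r / (D + 1))"
    have l: "vnorm (?p x) \<le> D * vnorm x" using x by (intro le) auto
    also have "\<dots> \<le> (D + 1) * (r / (D + 1))" using x D by (intro mult_mono) auto
    also have "\<dots> = r" using D by simp
    finally have "vnorm (k (?p x) - ?p x) \<le> C * (vnorm (?p x))\<^sup>2" using x pc by (intro C) auto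
    also have "\<dots> \<le> C * (D * vnorm x)\<^sup>2" using l C by (intro mult_left_mono power_mono) auto
    finally have "vnorm (x - ?p x) \<le> C * D\<^sup>2 * (vnorm x)\<^sup>2" using pc x by (simp add: power_mult_distrib mult_ac)
    then show "vnorm (?p x - x) \<le> C * D\<^sup>2 * (vnorm x)\<^sup>2"
      using vnorm_minus_commute[of "?p x" m x] pc x by simp
  qed
qed

text \<open>The theorem above is applied to the inverse of \<open>k\<close>, a bijective polynomial
  map whose own inverse is \<open>k\<close>. It serves to make the triangular shift over such a
  \<open>k\<close> polynomial.\<close>

lemma has_polynomial_inverse_imp_polynomial_map:
  assumes k: "has_polynomial_inverse m k" and t: "tangent_to_id m k"
  shows "polynomial_map m k"
proof -
  let ?p = "inv_into (carrier_vec m) k"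
  have bij: "bij_betw k (carrier_vec m) (carrier_vec m)" and p: "polynomial_map m ?p"
    using k unfolding has_polynomial_inverse_def invertible_map_def by auto
  have "polynomial_map m (inv_into (carrier_vec m) ?p)"
    by (rule bijective_polynomial_map_inverse_polynomial[OF p tangent_to_id_inverse[OF bij t p] bij_betw_inv_into[OF bij]])
  then show ?thesis
    using inv_into_inv_into_eq[OF bij] unfolding polynomial_map_def by simp
qed

text \<open>For |\<mu>| < 1 the map f^-1 with multiplier 1/\<mu> is in the expanding case. If k' is
  its pre-conjugation, then k(y) = \<mu> k'(y/\<mu>) equals f^-1(k'(y)), so \<mu> f(k(y)) = \<mu>
  k'(y) = k(\<mu>y).\<close>

lemma global_pre_conjugation_bijective:
  assumes p: "polynomial_map m f" and t: "tangent_to_id m f" and bij: "bij_betw f (carrier_vec m) (carrier_vec m)"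
    and \<mu>: "\<mu> \<noteq> 0" "cmod \<mu> \<noteq> 1"
  shows "\<exists>k. global_pre_conjugation m \<mu> f k"
proof (cases "cmod \<mu> > 1")
  case True
  then show ?thesis by (rule global_pre_conjugation_expanding[OF p t])
next
  case False
  let ?q = "inv_into (carrier_vec m) f"
  have qp: "polynomial_map m ?q" by (rule bijective_polynomial_map_inverse_polynomial[OF p t bij])
  have qt: "tangent_to_id m ?q" by (rule tangent_to_id_inverse[OF bij t qp])
  have q: "?q x \<in> carrier_vec m" "f (?q x) = x" if "x \<in> carrier_vec m" for x
    using bij that unfolding bij_betw_def by (auto intro: inv_into_into f_inv_into_f)
  define \<nu> where "\<nu> = 1 / \<mu>"
  have \<nu>: "cmod \<nu> > 1" using False \<mu> by (simp add: \<nu>_def norm_divide)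
  obtain k' where "global_pre_conjugation m \<nu> ?q k'"
    using global_pre_conjugation_expanding[OF qp qt \<nu>] by blast
  then have k': "\<And>x. x \<in> carrier_vec m \<Longrightarrow> k' x \<in> carrier_vec m" "\<And>i. i < m \<Longrightarrow> entire_fun m (\<lambda>x. k' x $ i)"
    "tangent_to_id m k'" "\<And>y. y \<in> carrier_vec m \<Longrightarrow> \<nu> \<cdot>\<^sub>v ?q (k' y) = k' (\<nu> \<cdot>\<^sub>v y)"
    unfolding global_pre_conjugation_iff by auto
  have \<mu>\<nu>: "\<mu> \<cdot>\<^sub>v (\<nu> \<cdot>\<^sub>v x) = x" "\<nu> \<cdot>\<^sub>v (\<mu> \<cdot>\<^sub>v x) = x" for x
    using \<mu> by (simp_all add: \<nu>_def smult_smult_assoc)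
  define k where "k y = \<mu> \<cdot>\<^sub>v k' (\<nu> \<cdot>\<^sub>v y)" for y
  have kc: "k y \<in> carrier_vec m" if "y \<in> carrier_vec m" for y using that k'(1) by (simp add: k_def)
  have ke: "entire_fun m (\<lambda>y. k y $ i)" if i: "i < m" for i
  proof (rule entire_fun_cong[OF entire_fun_mult[OF entire_fun_const entire_fun_smult_compose[OF k'(2)[OF i]]]])
    fix x :: "complex vec" assume "x \<in> carrier_vec m"
    then show "k x $ i = \<mu> * k' (\<nu> \<cdot>\<^sub>v x) $ i" using k'(1)[of "\<nu> \<cdot>\<^sub>v x", THEN carrier_vecD] i by (simp add: k_def)
  qed
  have kt: "tangent_to_id m k"
  proof -
    obtain C r where C: "r > 0" "C \<ge> 0" "\<And>y. y \<in> carrier_vec m \<Longrightarrow> vnorm y \<le> r \<Longrightarrow> vnorm (k' y - y) \<le> C * (vnorm y)\<^sup>2"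
      using tangent_to_idE[OF k'(3)] by blast
    show ?thesis
      unfolding tangent_to_id_def
    proof (rule exI[of _ "cmod \<mu> * (C * (cmod \<nu>)\<^sup>2)"], rule exI[of _ "r / cmod \<nu>"], intro conjI ballI impI)
      show "0 < r / cmod \<nu>" using C(1) \<nu> by (intro divide_pos_pos) auto
      fix y assume y: "y \<in> carrier_vec m" "vnorm y \<le> r / cmod \<nu>"
      have c: "\<nu> \<cdot>\<^sub>v y \<in> carrier_vec m" using y by simp
      have "cmod \<nu> > 0" using \<nu> by linarith
      with y(2) have "cmod \<nu> * vnorm y \<le> r" by (simp add: field_simps)
      then have "vnorm (k' (\<nu> \<cdot>\<^sub>v y) - \<nu> \<cdot>\<^sub>v y) \<le> C * (vnorm (\<nu> \<cdot>\<^sub>v y))\<^sup>2"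
        using y by (intro C c) (simp add: vnorm_smult[of _ m])
      moreover have "k y - y = \<mu> \<cdot>\<^sub>v (k' (\<nu> \<cdot>\<^sub>v y) - \<nu> \<cdot>\<^sub>v y)"
        using smult_diff_distrib_vec[OF k'(1)[OF c] c, of \<mu>] by (simp add: k_def \<mu>\<nu>)
      moreover have "k' (\<nu> \<cdot>\<^sub>v y) - \<nu> \<cdot>\<^sub>v y \<in> carrier_vec m" using k'(1)[OF c] c by simp
      ultimately have "vnorm (k y - y) \<le> cmod \<mu> * (C * (cmod \<nu> * vnorm y)\<^sup>2)"
        using y(1) by (simp add: vnorm_smult[of _ m] mult_left_mono)
      then show "vnorm (k y - y) \<le> cmod \<mu> * (C * (cmod \<nu>)\<^sup>2) * (vnorm y)\<^sup>2"
        by (simp add: power_mult_distrib mult_ac)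
    qed
  qed
  have "\<mu> \<cdot>\<^sub>v f (k y) = k (\<mu> \<cdot>\<^sub>v y)" if y: "y \<in> carrier_vec m" for y
  proof -
    have "k y = ?q (k' y)" unfolding k_def k'(4)[OF y, symmetric] by (simp add: \<mu>\<nu>)
    then show ?thesis using q(2)[OF k'(1)[OF y]] by (simp add: k_def \<mu>\<nu>)
  qed
  then show ?thesis unfolding global_pre_conjugation_iff using kc ke kt by blast
qed

section \<open>Triangular extensions\<close>

text \<open>In the splitting of \<open>\<complex>\<^sup>N\<close> into the image of \<open>C\<close> and the kernel of \<open>B\<close>, such a map \<open>K\<close> is
  \<open>(y, w) \<mapsto> (k y, w + \<phi> y)\<close>.\<close>

locale triangular_extension =
  fixes n N :: nat and B C :: "complex mat" and k \<phi> K :: "complex vec \<Rightarrow> complex vec"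
  assumes B: "B \<in> carrier_mat n N" and C: "C \<in> carrier_mat N n" and BC: "B * C = 1\<^sub>m n"
    and k: "\<And>y. y \<in> carrier_vec n \<Longrightarrow> k y \<in> carrier_vec n"
    and \<phi>: "\<And>y. y \<in> carrier_vec n \<Longrightarrow> \<phi> y \<in> carrier_vec N"
    and B\<phi>: "\<And>y. y \<in> carrier_vec n \<Longrightarrow> B *\<^sub>v \<phi> y = 0\<^sub>v n"
    and K_eq: "\<And>Y. Y \<in> carrier_vec N \<Longrightarrow> K Y = C *\<^sub>v k (B *\<^sub>v Y) + (Y - C *\<^sub>v (B *\<^sub>v Y)) + \<phi> (B *\<^sub>v Y)"
begin

lemma B_car: "X \<in> carrier_vec N \<Longrightarrow> B *\<^sub>v X \<in> carrier_vec n"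
  and C_car: "x \<in> carrier_vec n \<Longrightarrow> C *\<^sub>v x \<in> carrier_vec N"
  using B C by auto

lemma B_add: "X \<in> carrier_vec N \<Longrightarrow> Y \<in> carrier_vec N \<Longrightarrow> B *\<^sub>v (X + Y) = B *\<^sub>v X + B *\<^sub>v Y"
  and B_diff: "X \<in> carrier_vec N \<Longrightarrow> Y \<in> carrier_vec N \<Longrightarrow> B *\<^sub>v (X - Y) = B *\<^sub>v X - B *\<^sub>v Y"
  using B by (simp_all add: mult_add_distrib_mat_vec[of B n N] mult_minus_distrib_mat_vec[of B n N])

lemma BC_vec: "x \<in> carrier_vec n \<Longrightarrow> B *\<^sub>v (C *\<^sub>v x) = x"
  using assoc_mult_mat_vec[OF B C, of x] by (simp add: BC)

lemma K_car: "Y \<in> carrier_vec N \<Longrightarrow> K Y \<in> carrier_vec N"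
  using C k \<phi> B_car by (simp add: K_eq)

lemma B_K:
  assumes Y: "Y \<in> carrier_vec N" shows "B *\<^sub>v K Y = k (B *\<^sub>v Y)"
proof -
  have "B *\<^sub>v K Y = k (B *\<^sub>v Y) + (B *\<^sub>v Y - B *\<^sub>v Y) + 0\<^sub>v n"
    using Y by (simp add: K_eq B_add B_diff B_car C_car k \<phi> BC_vec B\<phi>)
  also have "\<dots> = k (B *\<^sub>v Y)"
    using k[OF B_car[OF Y]] B_car[OF Y] by simp
  finally show ?thesis .
qed

lemma B_lift:
  assumes "y \<in> carrier_vec n" "w \<in> carrier_vec N" "B *\<^sub>v w = 0\<^sub>v n" shows "B *\<^sub>v (C *\<^sub>v y + w) = y"
  using assms by (simp add: B_add C_car BC_vec)

lemma K_lift: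
  assumes y: "y \<in> carrier_vec n" and w: "w \<in> carrier_vec N" "B *\<^sub>v w = 0\<^sub>v n"
  shows "K (C *\<^sub>v y + w) = C *\<^sub>v k y + w + \<phi> y"
proof -
  have c: "C *\<^sub>v y \<in> carrier_vec N" "C *\<^sub>v k y \<in> carrier_vec N" "\<phi> y \<in> carrier_vec N" using y C k \<phi> by auto
  have "K (C *\<^sub>v y + w) = C *\<^sub>v k y + (C *\<^sub>v y + w - C *\<^sub>v y) + \<phi> y"
    using K_eq[of "C *\<^sub>v y + w"] c w by (simp add: B_lift[OF y w])
  also have "C *\<^sub>v y + w - C *\<^sub>v y = w" using c w C by (intro eq_vecI) auto
  finally show ?thesis .
qed

text \<open>The solution Z of K Z = X once a preimage \<open>y\<close> of BX under \<open>k\<close>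
  is known: \<open>y\<close> is its component in the image of \<open>C\<close>, and the kernel
  component of \<open>X\<close> is corrected by -\<phi>(y).\<close>

definition pre :: "complex vec \<Rightarrow> complex vec \<Rightarrow> complex vec" where
  "pre y X = C *\<^sub>v y + (X - C *\<^sub>v (B *\<^sub>v X) - \<phi> y)"

lemma pre:
  assumes y: "y \<in> carrier_vec n" and X: "X \<in> carrier_vec N" and ky: "k y = B *\<^sub>v X"
  shows "pre y X \<in> carrier_vec N" "K (pre y X) = X" "B *\<^sub>v pre y X = y"
proof -
  let ?w = "X - C *\<^sub>v (B *\<^sub>v X) - \<phi> y"
  have c: "C *\<^sub>v (B *\<^sub>v X) \<in> carrier_vec N" "\<phi> y \<in> carrier_vec N" using y X B_car C_car \<phi> by auto
  have w: "?w \<in> carrier_vec N" using X c by simp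
  have "B *\<^sub>v ?w = B *\<^sub>v X - B *\<^sub>v X - 0\<^sub>v n"
    using X c y by (simp add: B_diff BC_vec B_car B\<phi>)
  then have Bw: "B *\<^sub>v ?w = 0\<^sub>v n" using B_car[OF X] by simp
  show "pre y X \<in> carrier_vec N" using w C_car[OF y] by (simp add: pre_def)
  show "B *\<^sub>v pre y X = y" unfolding pre_def by (rule B_lift[OF y w Bw])
  show "K (pre y X) = X"
    unfolding pre_def K_lift[OF y w Bw] ky using X c C by (intro eq_vecI) auto
qed

lemma one_to_one_iff: "one_to_one n k \<longleftrightarrow> one_to_one N K"
proof
  assume i: "one_to_one n k"
  show "one_to_one N K"
    unfolding one_to_one_def
  proof (rule inj_onI)
    fix X Y assume X: "X \<in> carrier_vec N" and Y: "Y \<in> carrier_vec N" and eq: "K X = K Y"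
    have "k (B *\<^sub>v X) = k (B *\<^sub>v Y)" using B_K[OF X] B_K[OF Y] eq by simp
    then have b: "B *\<^sub>v X = B *\<^sub>v Y" using i B_car[OF X] B_car[OF Y] unfolding one_to_one_def inj_on_def by blast
    define u v where "u = C *\<^sub>v k (B *\<^sub>v Y)" and "v = C *\<^sub>v (B *\<^sub>v Y)"
    define w where "w = \<phi> (B *\<^sub>v Y)"
    have c: "u \<in> carrier_vec N" "v \<in> carrier_vec N" "w \<in> carrier_vec N"
      using Y by (auto simp: u_def v_def w_def intro: C_car k B_car \<phi>)
    have e: "u + (X - v) + w = u + (Y - v) + w"
      using eq K_eq[OF X] K_eq[OF Y] b by (simp add: u_def v_def w_def)
    show "X = Y"
    proof (rule eq_vecI)
      fix j assume "j < dim_vec Y"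
      then have j: "j < N" using Y by simp
      then show "X $ j = Y $ j" using arg_cong[OF e, of "\<lambda>v. v $ j"] c X Y by simp
    qed (use X Y in auto)
  qed
next
  assume i: "one_to_one N K"
  show "one_to_one n k"
    unfolding one_to_one_def
  proof (rule inj_onI)
    fix x y assume x: "x \<in> carrier_vec n" and y: "y \<in> carrier_vec n" and eq: "k x = k y"
    \<comment> \<open>Both \<open>x\<close> and \<open>y\<close> lift to preimages of this one
      vector; injectivity of \<open>K\<close> identifies the lifts, and \<open>B\<close> recovers
      \<open>x\<close> and \<open>y\<close> from them.\<close>
    let ?X = "C *\<^sub>v k y"
    have X: "?X \<in> carrier_vec N" "B *\<^sub>v ?X = k y" using y k C_car BC_vec by auto
    have "pre x ?X = pre y ?X"
      using i pre[OF x X(1)] pre[OF y X(1)] X(2) eq unfolding one_to_one_def inj_on_def by metis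
    then show "x = y" using pre(3)[OF x X(1)] pre(3)[OF y X(1)] X(2) eq by metis
  qed
qed

lemma onto_iff: "onto n k \<longleftrightarrow> onto N K"
proof
  assume o: "onto n k"
  have "X \<in> K ` carrier_vec N" if X: "X \<in> carrier_vec N" for X
  proof -
    have "B *\<^sub>v X \<in> k ` carrier_vec n" using o B_car[OF X] unfolding onto_def by simp
    then obtain y where "y \<in> carrier_vec n" "k y = B *\<^sub>v X" by auto
    from pre[OF this(1) X this(2)] show ?thesis by (metis imageI)
  qed
  then show "onto N K" unfolding onto_def using K_car by blast
next
  assume o: "onto N K"
  have "x \<in> k ` carrier_vec n" if x: "x \<in> carrier_vec n" for x
  proof -
    have "C *\<^sub>v x \<in> K ` carrier_vec N" using o C_car[OF x] unfolding onto_def by simp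
    then obtain Y where Y: "Y \<in> carrier_vec N" "K Y = C *\<^sub>v x" by auto
    then have "k (B *\<^sub>v Y) = x" using B_K[OF Y(1)] BC_vec[OF x] by simp
    then show ?thesis using B_car[OF Y(1)] by blast
  qed
  then show "onto n k" unfolding onto_def using k by blast
qed

lemma invertible_iff: "invertible_map n k \<longleftrightarrow> invertible_map N K"
  using one_to_one_iff onto_iff unfolding invertible_map_def bij_betw_def one_to_one_def onto_def by blast

section \<open>Polynomial and entire triangular extensions\<close>

lemma polyfun_C_B:
  assumes "\<And>y. y \<in> carrier_vec n \<Longrightarrow> h y \<in> carrier_vec n" "\<And>i. i < n \<Longrightarrow> polyfun n (\<lambda>y. h y $ i)" "i < N"
  shows "polyfun N (\<lambda>Y. (C *\<^sub>v h (B *\<^sub>v Y)) $ i)"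
proof (rule polyfun_mult_mat_vec[OF C assms(3)])
  show "h (B *\<^sub>v x) \<in> carrier_vec n" if "x \<in> carrier_vec N" for x using that B_car assms(1) by blast
  show "polyfun N (\<lambda>x. h (B *\<^sub>v x) $ i)" if "i < n" for i
    by (rule polyfun_compose[OF assms(2)[OF that] B_car])
       (auto intro: polyfun_mult_mat_vec[OF B] polyfun_index)
qed

lemma polyfun_B:
  assumes "polyfun n \<psi>" shows "polyfun N (\<lambda>Y. \<psi> (B *\<^sub>v Y))"
  by (rule polyfun_compose[OF assms B_car]) (auto intro: polyfun_mult_mat_vec[OF B] polyfun_index)

lemma polynomial_map_of_polynomial_map_K:
  assumes "polynomial_map N K" shows "polynomial_map n k"
proof -
  have Kp: "\<And>i. i < N \<Longrightarrow> polyfun N (\<lambda>Y. K Y $ i)" using assms unfolding polynomial_map_iff_polyfun by auto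
  have "polyfun n (\<lambda>y. k y $ i)" if i: "i < n" for i
  proof (rule polyfun_cong[OF polyfun_mult_mat_vec[OF B i, of n "\<lambda>y. K (C *\<^sub>v y)"]])
    show "K (C *\<^sub>v y) \<in> carrier_vec N" if "y \<in> carrier_vec n" for y using that K_car C_car by blast
    show "polyfun n (\<lambda>y. K (C *\<^sub>v y) $ j)" if "j < N" for j
      by (rule polyfun_compose[OF Kp[OF that] C_car]) (auto intro: polyfun_mult_mat_vec[OF C] polyfun_index)
    show "k y $ i = (B *\<^sub>v K (C *\<^sub>v y)) $ i" if "y \<in> carrier_vec n" for y
      using B_K[OF C_car[OF that]] BC_vec[OF that] by simp
  qed
  then show ?thesis unfolding polynomial_map_iff_polyfun using k by blast
qed

lemma polynomial_map_K:
  assumes "polynomial_map n k" "\<And>i. i < N \<Longrightarrow> polyfun n (\<lambda>y. \<phi> y $ i)"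
  shows "polynomial_map N K"
proof -
  have kp: "\<And>i. i < n \<Longrightarrow> polyfun n (\<lambda>y. k y $ i)" using assms unfolding polynomial_map_iff_polyfun by auto
  have "polyfun N (\<lambda>Y. K Y $ i)" if i: "i < N" for i
  proof (rule polyfun_cong)
    show "polyfun N (\<lambda>Y. (C *\<^sub>v k (B *\<^sub>v Y)) $ i + (Y $ i - (C *\<^sub>v (B *\<^sub>v Y)) $ i) + \<phi> (B *\<^sub>v Y) $ i)"
      by (intro polyfun_add polyfun_diff polyfun_index i polyfun_C_B[OF k kp i] polyfun_B[OF assms(2)[OF i]]
          polyfun_C_B[of "\<lambda>y. y", OF _ polyfun_index i])
    show "K Y $ i = (C *\<^sub>v k (B *\<^sub>v Y)) $ i + (Y $ i - (C *\<^sub>v (B *\<^sub>v Y)) $ i) + \<phi> (B *\<^sub>v Y) $ i"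
      if Y: "Y \<in> carrier_vec N" for Y
      using i Y C \<phi>[OF B_car[OF Y], THEN carrier_vecD] by (simp add: K_eq[OF Y])
  qed
  then show ?thesis unfolding polynomial_map_iff_polyfun using K_car by blast
qed

text \<open>The inverse of \<open>k\<close> is x -> B K^-1(C x), because B K = k B and BC =
  1.\<close>

lemma has_polynomial_inverse_of_K:
  assumes K: "has_polynomial_inverse N K" shows "has_polynomial_inverse n k"
proof -
  have bK: "bij_betw K (carrier_vec N) (carrier_vec N)" and pK: "polynomial_map N (inv_into (carrier_vec N) K)"
    using K unfolding has_polynomial_inverse_def invertible_map_def by auto
  have inv: "invertible_map n k" using K invertible_iff unfolding has_polynomial_inverse_def by blast
  then have bk: "bij_betw k (carrier_vec n) (carrier_vec n)" unfolding invertible_map_def .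
  let ?G = "inv_into (carrier_vec N) K"
  have G: "?G Y \<in> carrier_vec N" "K (?G Y) = Y" if "Y \<in> carrier_vec N" for Y
    using bK that unfolding bij_betw_def by (auto intro: inv_into_into f_inv_into_f)
  have eq: "inv_into (carrier_vec n) k x = B *\<^sub>v ?G (C *\<^sub>v x)" if x: "x \<in> carrier_vec n" for x
  proof (rule inv_into_f_eq[OF bij_betw_imp_inj_on[OF bk]])
    show "B *\<^sub>v ?G (C *\<^sub>v x) \<in> carrier_vec n" using G C_car[OF x] B_car by blast
    show "k (B *\<^sub>v ?G (C *\<^sub>v x)) = x" using B_K[OF G(1)[OF C_car[OF x]]] G(2)[OF C_car[OF x]] BC_vec[OF x] by simp
  qed
  have pG: "\<And>i. i < N \<Longrightarrow> polyfun N (\<lambda>Y. ?G Y $ i)" using pK unfolding polynomial_map_iff_polyfun by auto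
  have "polyfun n (\<lambda>x. inv_into (carrier_vec n) k x $ i)" if i: "i < n" for i
  proof (rule polyfun_cong[OF polyfun_mult_mat_vec[OF B i, of n "\<lambda>x. ?G (C *\<^sub>v x)"]])
    show "?G (C *\<^sub>v y) \<in> carrier_vec N" if "y \<in> carrier_vec n" for y using that G C_car by blast
    show "polyfun n (\<lambda>y. ?G (C *\<^sub>v y) $ j)" if "j < N" for j
      by (rule polyfun_compose[OF pG[OF that] C_car]) (auto intro: polyfun_mult_mat_vec[OF C] polyfun_index)
  qed (simp add: eq)
  moreover have "inv_into (carrier_vec n) k x \<in> carrier_vec n" if "x \<in> carrier_vec n" for x
    using eq[OF that] G C_car[OF that] B_car by simp
  ultimately show ?thesis
    unfolding has_polynomial_inverse_def polynomial_map_iff_polyfun using inv by blast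
qed

text \<open>By \<open>pre\<close>, the kernel component of K^-1(X) contains \<phi>(k^-1(BX)); hence
  the hypothesis that the shift is polynomial.\<close>

lemma has_polynomial_inverse_K:
  assumes h: "has_polynomial_inverse n k" and \<phi>p: "\<And>i. i < N \<Longrightarrow> polyfun n (\<lambda>y. \<phi> y $ i)"
  shows "has_polynomial_inverse N K"
proof -
  let ?g = "inv_into (carrier_vec n) k"
  have bk: "bij_betw k (carrier_vec n) (carrier_vec n)" and pk: "polynomial_map n ?g"
    using h unfolding has_polynomial_inverse_def invertible_map_def by auto
  have inv: "invertible_map N K" using h invertible_iff unfolding has_polynomial_inverse_def by blast
  then have bK: "bij_betw K (carrier_vec N) (carrier_vec N)" unfolding invertible_map_def .
  have g: "?g y \<in> carrier_vec n" "k (?g y) = y" if "y \<in> carrier_vec n" for y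
    using bk that unfolding bij_betw_def by (auto intro: inv_into_into f_inv_into_f)
  have gp: "\<And>i. i < n \<Longrightarrow> polyfun n (\<lambda>y. ?g y $ i)" using pk unfolding polynomial_map_iff_polyfun by auto
  have eq: "inv_into (carrier_vec N) K X = pre (?g (B *\<^sub>v X)) X" if X: "X \<in> carrier_vec N" for X
    using pre[OF g(1)[OF B_car[OF X]] X g(2)[OF B_car[OF X]]]
    by (intro inv_into_f_eq[OF bij_betw_imp_inj_on[OF bK]])
  have "polyfun N (\<lambda>X. inv_into (carrier_vec N) K X $ i)" if i: "i < N" for i
  proof (rule polyfun_cong)
    have "polyfun N (\<lambda>X. \<phi> (?g (B *\<^sub>v X)) $ i)"
      by (rule polyfun_B[OF polyfun_compose[OF \<phi>p[OF i] g(1) gp]])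
    then show "polyfun N (\<lambda>X. (C *\<^sub>v ?g (B *\<^sub>v X)) $ i + (X $ i - (C *\<^sub>v (B *\<^sub>v X)) $ i - \<phi> (?g (B *\<^sub>v X)) $ i))"
      by (intro polyfun_add polyfun_diff polyfun_index i polyfun_C_B[OF g(1) gp i]
          polyfun_C_B[of "\<lambda>y. y", OF _ polyfun_index i])
    show "inv_into (carrier_vec N) K X $ i = (C *\<^sub>v ?g (B *\<^sub>v X)) $ i + (X $ i - (C *\<^sub>v (B *\<^sub>v X)) $ i - \<phi> (?g (B *\<^sub>v X)) $ i)"
      if X: "X \<in> carrier_vec N" for X
      using i X C \<phi>[OF g(1)[OF B_car[OF X]], THEN carrier_vecD] by (simp add: eq[OF X] pre_def)
  qed
  moreover have "inv_into (carrier_vec N) K X \<in> carrier_vec N" if X: "X \<in> carrier_vec N" for X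
    using eq[OF X] pre(1)[OF g(1)[OF B_car[OF X]] X g(2)[OF B_car[OF X]]] by simp
  ultimately show ?thesis
    unfolding has_polynomial_inverse_def polynomial_map_iff_polyfun using inv by blast
qed

lemma entire_fun_K:
  assumes ke: "\<And>i. i < n \<Longrightarrow> entire_fun n (\<lambda>y. k y $ i)" and \<phi>e: "\<And>i. i < N \<Longrightarrow> entire_fun n (\<lambda>y. \<phi> y $ i)" and i: "i < N"
  shows "entire_fun N (\<lambda>Y. K Y $ i)"
proof (rule entire_fun_cong)
  have "entire_fun n (\<lambda>y. \<Sum>j<n. C $$ (i, j) * k y $ j)"
    by (intro entire_fun_sum entire_fun_mult entire_fun_const ke) auto
  then have "entire_fun n (\<lambda>y. (C *\<^sub>v k y) $ i)"
    by (rule entire_fun_cong) (use i C k[THEN carrier_vecD] in \<open>auto simp: scalar_prod_def atLeast0LessThan intro!: sum.cong\<close>)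
  then show "entire_fun N (\<lambda>Y. (C *\<^sub>v k (B *\<^sub>v Y)) $ i + (Y $ i - (C *\<^sub>v (B *\<^sub>v Y)) $ i) + \<phi> (B *\<^sub>v Y) $ i)"
    by (intro entire_fun_add entire_fun_diff entire_fun_index i entire_fun_linear_compose[OF _ B, of "\<lambda>y. (C *\<^sub>v k y) $ i"]
        entire_fun_linear_compose[OF \<phi>e[OF i] B]
        polyfun_imp_entire_fun[OF polyfun_C_B[of "\<lambda>y. y", OF _ polyfun_index i]])
  show "K Y $ i = (C *\<^sub>v k (B *\<^sub>v Y)) $ i + (Y $ i - (C *\<^sub>v (B *\<^sub>v Y)) $ i) + \<phi> (B *\<^sub>v Y) $ i"
    if Y: "Y \<in> carrier_vec N" for Y
    using i Y C \<phi>[OF B_car[OF Y], THEN carrier_vecD] by (simp add: K_eq[OF Y])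
qed

text \<open>With y = BY, the difference K Y - Y is C(k(y) - y) + \<phi>(y). Both terms are quadratic
  in y, and |y| is at most a multiple of |Y|.\<close>

lemma tangent_to_id_K:
  assumes t: "tangent_to_id n k"
    and q: "r > 0" "\<And>y. y \<in> carrier_vec n \<Longrightarrow> vnorm y \<le> r \<Longrightarrow> vnorm (\<phi> y) \<le> D * (vnorm y)\<^sup>2"
  shows "tangent_to_id N K"
proof -
  obtain E s where E: "s > 0" "E \<ge> 0" "\<And>y. y \<in> carrier_vec n \<Longrightarrow> vnorm y \<le> s \<Longrightarrow> vnorm (k y - y) \<le> E * (vnorm y)\<^sup>2"
    using tangent_to_idE[OF t] by blast
  obtain \<beta> where \<beta>: "\<beta> \<ge> 0" "\<And>z. z \<in> carrier_vec N \<Longrightarrow> vnorm (B *\<^sub>v z) \<le> \<beta> * vnorm z"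
    using vnorm_mult_mat_vec_le[OF B] by blast
  obtain \<gamma> where \<gamma>: "\<gamma> \<ge> 0" "\<And>z. z \<in> carrier_vec n \<Longrightarrow> vnorm (C *\<^sub>v z) \<le> \<gamma> * vnorm z"
    using vnorm_mult_mat_vec_le[OF C] by blast
  show ?thesis
    unfolding tangent_to_id_def
  proof (rule exI[of _ "(\<gamma> * E + \<bar>D\<bar>) * \<beta>\<^sup>2"], rule exI[of _ "min r s / (\<beta> + 1)"], intro conjI ballI impI)
    show "0 < min r s / (\<beta> + 1)" using q(1) E(1) \<beta>(1) by simp
    fix Y assume Y: "Y \<in> carrier_vec N" "vnorm Y \<le> min r s / (\<beta> + 1)"
    let ?y = "B *\<^sub>v Y"
    have y: "?y \<in> carrier_vec n" by (rule B_car[OF Y(1)])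
    have ny: "vnorm ?y \<le> \<beta> * vnorm Y" by (rule \<beta>(2)[OF Y(1)])
    also have "\<dots> \<le> (\<beta> + 1) * (min r s / (\<beta> + 1))" using Y \<beta>(1) q(1) E(1) by (intro mult_mono) auto
    also have "\<dots> = min r s" using \<beta>(1) by simp
    finally have yr: "vnorm ?y \<le> r" "vnorm ?y \<le> s" by auto
    have c: "k ?y - ?y \<in> carrier_vec n" "C *\<^sub>v (k ?y - ?y) \<in> carrier_vec N" "\<phi> ?y \<in> carrier_vec N"
      "C *\<^sub>v k ?y \<in> carrier_vec N" "C *\<^sub>v ?y \<in> carrier_vec N"
      using k[OF y] y C_car \<phi>[OF y] by auto
    have "C *\<^sub>v (k ?y - ?y) = C *\<^sub>v k ?y - C *\<^sub>v ?y"
      using C k[OF y] y by (simp add: mult_minus_distrib_mat_vec[of C N n])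
    then have "K Y - Y = C *\<^sub>v (k ?y - ?y) + \<phi> ?y"
      unfolding K_eq[OF Y(1)] using c Y(1) C by (intro eq_vecI) auto
    then have "vnorm (K Y - Y) \<le> vnorm (C *\<^sub>v (k ?y - ?y)) + vnorm (\<phi> ?y)"
      using vnorm_triangle[OF c(2,3)] by simp
    also have "\<dots> \<le> \<gamma> * (E * (vnorm ?y)\<^sup>2) + \<bar>D\<bar> * (vnorm ?y)\<^sup>2"
    proof (rule add_mono)
      show "vnorm (C *\<^sub>v (k ?y - ?y)) \<le> \<gamma> * (E * (vnorm ?y)\<^sup>2)"
        using \<gamma>(2)[OF c(1)] mult_left_mono[OF E(3)[OF y yr(2)] \<gamma>(1)] by linarith
      show "vnorm (\<phi> ?y) \<le> \<bar>D\<bar> * (vnorm ?y)\<^sup>2"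
        using q(2)[OF y yr(1)] mult_right_mono[OF abs_ge_self, of "(vnorm ?y)\<^sup>2" D] by simp
    qed
    also have "\<dots> = (\<gamma> * E + \<bar>D\<bar>) * (vnorm ?y)\<^sup>2" by (simp add: algebra_simps)
    also have "\<dots> \<le> (\<gamma> * E + \<bar>D\<bar>) * (\<beta> * vnorm Y)\<^sup>2"
      using ny \<gamma>(1) E(2) by (intro mult_left_mono power_mono) auto
    finally show "vnorm (K Y - Y) \<le> (\<gamma> * E + \<bar>D\<bar>) * \<beta>\<^sup>2 * (vnorm Y)\<^sup>2"
      by (simp add: power_mult_distrib mult_ac)
  qed
qed

end

section \<open>Cubic maps and pairings\<close>

lemma linear_expansion:
  fixes \<phi> :: "complex vec \<Rightarrow> complex"
  assumes lin: "\<And>a b x x'. x \<in> carrier_vec n \<Longrightarrow> x' \<in> carrier_vec n \<Longrightarrow> \<phi> (a \<cdot>\<^sub>v x + b \<cdot>\<^sub>v x') = a * \<phi> x + b * \<phi> x'"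
    and x: "x \<in> carrier_vec n"
  shows "\<phi> x = (\<Sum>j<n. x $ j * \<phi> (unit_vec n j))"
proof -
  \<comment> \<open>Linearity is given only on the carrier, so the expansion is built up through
    truncations of \<open>x\<close>, which stay in the carrier.\<close>
  define s where "s r = vec n (\<lambda>i. if i < r then x $ i else 0)" for r
  have "\<phi> (s r) = (\<Sum>j<r. x $ j * \<phi> (unit_vec n j))" if "r \<le> n" for r
    using that
  proof (induction r)
    case 0
    have "s 0 = 0 \<cdot>\<^sub>v x + 0 \<cdot>\<^sub>v x" using x by (intro eq_vecI) (auto simp: s_def)
    then show ?case using lin[OF x x, of 0 0] by simp
  next
    case (Suc r)
    have "s (Suc r) = 1 \<cdot>\<^sub>v s r + (x $ r) \<cdot>\<^sub>v unit_vec n r"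
      using Suc.prems by (intro eq_vecI) (auto simp: s_def less_Suc_eq)
    then have "\<phi> (s (Suc r)) = \<phi> (s r) + x $ r * \<phi> (unit_vec n r)"
      using lin[of "s r" "unit_vec n r" 1 "x $ r"] by (simp add: s_def)
    then show ?case using Suc by simp
  qed
  from this[of n] have "\<phi> (s n) = (\<Sum>j<n. x $ j * \<phi> (unit_vec n j))" by simp
  moreover have "s n = x" using x by (intro eq_vecI) (auto simp: s_def)
  ultimately show ?thesis by simp
qed

lemma symmetric_trilinear_expansion:
  assumes g: "symmetric_trilinear n g" and i: "i < n" and x: "x \<in> carrier_vec n"
  shows "g x x x $ i = (\<Sum>a<n. \<Sum>b<n. \<Sum>c<n. g (unit_vec n a) (unit_vec n b) (unit_vec n c) $ i * (x $ a * x $ b * x $ c))"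
proof -
  have gc: "g x y z \<in> carrier_vec n" if "x \<in> carrier_vec n" "y \<in> carrier_vec n" "z \<in> carrier_vec n" for x y z
    using g that unfolding symmetric_trilinear_def by blast
  have l1: "g (a \<cdot>\<^sub>v x + b \<cdot>\<^sub>v x') y z = a \<cdot>\<^sub>v g x y z + b \<cdot>\<^sub>v g x' y z"
    "g y (a \<cdot>\<^sub>v x + b \<cdot>\<^sub>v x') z = a \<cdot>\<^sub>v g y x z + b \<cdot>\<^sub>v g y x' z"
    "g y z (a \<cdot>\<^sub>v x + b \<cdot>\<^sub>v x') = a \<cdot>\<^sub>v g y z x + b \<cdot>\<^sub>v g y z x'"
    if "x \<in> carrier_vec n" "x' \<in> carrier_vec n" "y \<in> carrier_vec n" "z \<in> carrier_vec n" for a b x x' y z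
    using g that unfolding symmetric_trilinear_def by blast+
  have u: "unit_vec n a \<in> carrier_vec n" for a by simp
  have e1: "g y y z $ i = (\<Sum>a<n. y $ a * g (unit_vec n a) y z $ i)"
    if "y \<in> carrier_vec n" "z \<in> carrier_vec n" for y z
    by (rule linear_expansion[of n "\<lambda>w. g w y z $ i"])
       (use that i gc[THEN carrier_vecD] in \<open>auto simp: l1\<close>)
  have e2: "g w y y $ i = (\<Sum>b<n. y $ b * g w (unit_vec n b) y $ i)"
    if "w \<in> carrier_vec n" "y \<in> carrier_vec n" for w y
    by (rule linear_expansion[of n "\<lambda>v. g w v y $ i"])
       (use that i gc[THEN carrier_vecD] in \<open>auto simp: l1\<close>)
  have e3: "g w v y $ i = (\<Sum>c<n. y $ c * g w v (unit_vec n c) $ i)"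
    if "w \<in> carrier_vec n" "v \<in> carrier_vec n" "y \<in> carrier_vec n" for w v y
    by (rule linear_expansion[of n "\<lambda>y. g w v y $ i"])
       (use that i gc[THEN carrier_vecD] in \<open>auto simp: l1\<close>)
  have "g x x x $ i = (\<Sum>a<n. x $ a * (\<Sum>b<n. x $ b * (\<Sum>c<n. x $ c * g (unit_vec n a) (unit_vec n b) (unit_vec n c) $ i)))"
    unfolding e1[OF x x] e2[OF u x] e3[OF u u x] ..
  then show ?thesis by (simp add: sum_distrib_left mult_ac)
qed

lemma cubic_homogeneous_polynomial_map:
  assumes "cubic_homogeneous n f" shows "polynomial_map n f" "tangent_to_id n f"
proof -
  obtain g where g: "symmetric_trilinear n g" and f: "\<And>x. x \<in> carrier_vec n \<Longrightarrow> f x = x - g x x x"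
    using assms unfolding cubic_homogeneous_def by blast
  have gc: "g x x x \<in> carrier_vec n" if "x \<in> carrier_vec n" for x
    using g that unfolding symmetric_trilinear_def by blast
  have gp: "polyfun n (\<lambda>x. g x x x $ i)" if i: "i < n" for i
    by (rule polyfun_cong[OF _ symmetric_trilinear_expansion[OF g i]])
       (intro polyfun_sum polyfun_mult polyfun_const polyfun_index, auto)
  have "polyfun n (\<lambda>x. f x $ i)" if i: "i < n" for i
    by (rule polyfun_cong[OF polyfun_diff[OF polyfun_index[OF i] gp[OF i]]])
       (use i in \<open>auto simp: f gc[THEN carrier_vecD]\<close>)
  then show "polynomial_map n f"
    unfolding polynomial_map_iff_polyfun using f gc by simp
  define G where "G i = (\<Sum>a<n. \<Sum>b<n. \<Sum>c<n. cmod (g (unit_vec n a) (unit_vec n b) (unit_vec n c) $ i))" for i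
  have G0: "G i \<ge> 0" for i unfolding G_def by (intro sum_nonneg) auto
  have gb: "cmod (g x x x $ i) \<le> G i * vnorm x ^ 3" if x: "x \<in> carrier_vec n" and i: "i < n" for x i
    unfolding symmetric_trilinear_expansion[OF g i x] G_def sum_distrib_right
    using cmod_index_le_vnorm'[OF x]
    by (intro sum_norm_le) (auto simp: norm_mult power3_eq_cube intro!: mult_left_mono mult_mono)
  show "tangent_to_id n f"
    unfolding tangent_to_id_def
  proof (rule exI[of _ "\<Sum>i<n. G i"], rule exI[of _ 1], intro conjI ballI impI)
    fix x assume x: "x \<in> carrier_vec n" "vnorm x \<le> 1"
    show "vnorm (f x - x) \<le> (\<Sum>i<n. G i) * (vnorm x)\<^sup>2"
    proof (rule vnorm_leI[of _ n])
      show "f x - x \<in> carrier_vec n" using f gc x by simp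
      show "0 \<le> (\<Sum>i<n. G i) * (vnorm x)\<^sup>2" using G0 by (intro mult_nonneg_nonneg sum_nonneg) auto
      fix i assume i: "i < n"
      have "cmod ((f x - x) $ i) = cmod (g x x x $ i)" using i x gc[OF x(1)] by (simp add: f)
      also have "\<dots> \<le> G i * vnorm x ^ 3" by (rule gb[OF x(1) i])
      also have "\<dots> \<le> (\<Sum>i<n. G i) * (vnorm x)\<^sup>2"
        using i G0 x by (intro mult_mono member_le_sum power_decreasing sum_nonneg) auto
      finally show "cmod ((f x - x) $ i) \<le> (\<Sum>i<n. G i) * (vnorm x)\<^sup>2" .
    qed
  qed simp
qed

section \<open>Maps built from componentwise cubes\<close>

lemma dim_cwise_cube [simp]: "dim_vec (cwise_cube x) = dim_vec x"
  by (simp add: cwise_cube_def cwise_mult_def)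

lemma index_cwise_cube [simp]: "i < dim_vec x \<Longrightarrow> cwise_cube x $ i = (x $ i) ^ 3"
  by (simp add: cwise_cube_def cwise_mult_def power3_eq_cube)

lemma cwise_cube_carrier: "x \<in> carrier_vec m \<Longrightarrow> cwise_cube x \<in> carrier_vec m"
  by (rule carrier_vecI) auto

text \<open>The polarization of the map sending \<open>x\<close> to
  \<open>B *\<^sub>v cwise_cube (D *\<^sub>v x)\<close>. The nonlinear parts of \<open>f\<close> and
  \<open>F\<close> both have this form, the latter with B = 1 and D = A.\<close>

lemma symmetric_trilinear_cube:
  assumes B: "B \<in> carrier_mat n N" and D: "D \<in> carrier_mat N n"
  shows "symmetric_trilinear n (\<lambda>x y z. B *\<^sub>v vec N (\<lambda>i. (D *\<^sub>v x) $ i * (D *\<^sub>v y) $ i * (D *\<^sub>v z) $ i))"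
proof -
  have lin: "D *\<^sub>v (a \<cdot>\<^sub>v x + b \<cdot>\<^sub>v x') = a \<cdot>\<^sub>v (D *\<^sub>v x) + b \<cdot>\<^sub>v (D *\<^sub>v x')"
    if "x \<in> carrier_vec n" "x' \<in> carrier_vec n" for a b x x'
    using that D by (simp add: mult_add_distrib_mat_vec[of D N n] mult_mat_vec[of D N n])
  have Blin: "B *\<^sub>v (a \<cdot>\<^sub>v X + b \<cdot>\<^sub>v X') = a \<cdot>\<^sub>v (B *\<^sub>v X) + b \<cdot>\<^sub>v (B *\<^sub>v X')"
    if "X \<in> carrier_vec N" "X' \<in> carrier_vec N" for a b X X'
    using that B by (simp add: mult_add_distrib_mat_vec[of B n N] mult_mat_vec[of B n N])
  have T: "vec N (\<lambda>i. (a \<cdot>\<^sub>v u + b \<cdot>\<^sub>v u') $ i * v $ i * w $ i) = a \<cdot>\<^sub>v vec N (\<lambda>i. u $ i * v $ i * w $ i) + b \<cdot>\<^sub>v vec N (\<lambda>i. u' $ i * v $ i * w $ i)"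
    "vec N (\<lambda>i. v $ i * (a \<cdot>\<^sub>v u + b \<cdot>\<^sub>v u') $ i * w $ i) = a \<cdot>\<^sub>v vec N (\<lambda>i. v $ i * u $ i * w $ i) + b \<cdot>\<^sub>v vec N (\<lambda>i. v $ i * u' $ i * w $ i)"
    "vec N (\<lambda>i. v $ i * w $ i * (a \<cdot>\<^sub>v u + b \<cdot>\<^sub>v u') $ i) = a \<cdot>\<^sub>v vec N (\<lambda>i. v $ i * w $ i * u $ i) + b \<cdot>\<^sub>v vec N (\<lambda>i. v $ i * w $ i * u' $ i)"
    if "u \<in> carrier_vec N" "u' \<in> carrier_vec N" for a b and u u' v w :: "complex vec"
    using that by (auto intro!: eq_vecI simp: algebra_simps)
  have Dc: "D *\<^sub>v x \<in> carrier_vec N" if "x \<in> carrier_vec n" for x using that D by simp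
  have Bc: "B *\<^sub>v vec N h \<in> carrier_vec n" for h using B by simp
  show ?thesis
    unfolding symmetric_trilinear_def
  proof (intro conjI ballI allI, goal_cases)
    case 1
    show ?case by (rule Bc)
  next
    case (2 x y z)
    show ?case by (simp only: mult_ac)
  next
    case (3 x y z)
    show ?case by (simp only: mult_ac)
  next
    case (4 a b x x' y z)
    then show ?case by (simp only: lin T[OF Dc Dc] Blin vec_carrier)
  next
    case (5 a b x x' y z)
    then show ?case by (simp only: lin T[OF Dc Dc] Blin vec_carrier)
  next
    case (6 a b x x' y z)
    then show ?case by (simp only: lin T[OF Dc Dc] Blin vec_carrier)
  qed
qed

lemma cubic_homogeneous_cube:
  assumes B: "B \<in> carrier_mat n N" and D: "D \<in> carrier_mat N n"
    and f: "\<And>x. x \<in> carrier_vec n \<Longrightarrow> f x = x - B *\<^sub>v cwise_cube (D *\<^sub>v x)"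
  shows "cubic_homogeneous n f"
  unfolding cubic_homogeneous_def
proof (intro exI conjI ballI)
  show "symmetric_trilinear n (\<lambda>x y z. B *\<^sub>v vec N (\<lambda>i. (D *\<^sub>v x) $ i * (D *\<^sub>v y) $ i * (D *\<^sub>v z) $ i))"
    by (rule symmetric_trilinear_cube[OF B D])
  fix x :: "complex vec" assume x: "x \<in> carrier_vec n"
  have "cwise_cube (D *\<^sub>v x) = vec N (\<lambda>i. (D *\<^sub>v x) $ i * (D *\<^sub>v x) $ i * (D *\<^sub>v x) $ i)"
    using D x by (intro eq_vecI) (auto simp: power3_eq_cube)
  then show "f x = x - B *\<^sub>v vec N (\<lambda>i. (D *\<^sub>v x) $ i * (D *\<^sub>v x) $ i * (D *\<^sub>v x) $ i)" by (simp add: f[OF x])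
qed

lemma cubic_linear_imp_cubic_homogeneous:
  assumes "cubic_linear N A F" shows "cubic_homogeneous N F"
proof (rule cubic_homogeneous_cube[of "1\<^sub>m N" N N A])
  show "F X = X - 1\<^sub>m N *\<^sub>v cwise_cube (A *\<^sub>v X)" if "X \<in> carrier_vec N" for X
  proof -
    have "cwise_cube (A *\<^sub>v X) \<in> carrier_vec N"
      using assms that unfolding cubic_linear_def by (intro cwise_cube_carrier) auto
    then show ?thesis using assms that unfolding cubic_linear_def by simp
  qed
qed (use assms in \<open>auto simp: cubic_linear_def\<close>)

text \<open>Sylvester's identity: the block matrix with unit diagonal blocks and off-diagonal blocks
  \<open>V\<close>, \<open>U\<close> is factored into block triangular matrices in two ways, with
  Schur complement 1 - UV or 1 - VU.\<close>

lemma det_one_minus_mult_commute: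
  fixes U V :: "complex mat"
  assumes U: "U \<in> carrier_mat N n" and V: "V \<in> carrier_mat n N"
  shows "det (1\<^sub>m N - U * V) = det (1\<^sub>m n - V * U)"
proof -
  let ?M = "four_block_mat (1\<^sub>m n) V U (1\<^sub>m N)"
  have W: "1\<^sub>m N - U * V \<in> carrier_mat N N" "1\<^sub>m n - V * U \<in> carrier_mat n n" using U V by auto
  have fb: "det (four_block_mat P Q R S * four_block_mat P' Q' R' S') = det (four_block_mat P Q R S) * det (four_block_mat P' Q' R' S')"
    if "P \<in> carrier_mat n n" "S \<in> carrier_mat N N" "P' \<in> carrier_mat n n" "S' \<in> carrier_mat N N" for P Q R S P' Q' R' S' :: "complex mat"
    by (rule det_mult[OF four_block_carrier_mat[OF that(1,2)] four_block_carrier_mat[OF that(3,4)]])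
  have "?M = four_block_mat (1\<^sub>m n) (0\<^sub>m n N) U (1\<^sub>m N) * four_block_mat (1\<^sub>m n) V (0\<^sub>m N n) (1\<^sub>m N - U * V)"
  proof (subst mult_four_block_mat[of _ n n _ N _ N _ _ n _ N])
    have "U * V + (1\<^sub>m N - U * V) = 1\<^sub>m N" using U V by (intro eq_matI) auto
    then show "?M = four_block_mat (1\<^sub>m n * 1\<^sub>m n + 0\<^sub>m n N * 0\<^sub>m N n) (1\<^sub>m n * V + 0\<^sub>m n N * (1\<^sub>m N - U * V))
      (U * 1\<^sub>m n + 1\<^sub>m N * 0\<^sub>m N n) (U * V + 1\<^sub>m N * (1\<^sub>m N - U * V))"
      using U V by simp
  qed (use U V in auto)
  moreover have "det (four_block_mat (1\<^sub>m n) (0\<^sub>m n N) U (1\<^sub>m N)) = 1"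
    using U by (subst det_four_block_mat_upper_right_zero[of _ n _ N]) auto
  moreover have "det (four_block_mat (1\<^sub>m n) V (0\<^sub>m N n) (1\<^sub>m N - U * V)) = det (1\<^sub>m N - U * V)"
    using U V by (subst det_four_block_mat_lower_left_zero[of _ n _ N]) auto
  ultimately have 1: "det ?M = det (1\<^sub>m N - U * V)"
    by (simp add: fb W)
  have "?M = four_block_mat (1\<^sub>m n - V * U) V (0\<^sub>m N n) (1\<^sub>m N) * four_block_mat (1\<^sub>m n) (0\<^sub>m n N) U (1\<^sub>m N)"
  proof (subst mult_four_block_mat[of _ n n _ N _ N _ _ n _ N])
    have "(1\<^sub>m n - V * U) + V * U = 1\<^sub>m n" using U V by (intro eq_matI) auto
    moreover have "(1\<^sub>m n - V * U) * 0\<^sub>m n N = 0\<^sub>m n N" using U V by (intro right_mult_zero_mat[of _ n]) auto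
    ultimately show "?M = four_block_mat ((1\<^sub>m n - V * U) * 1\<^sub>m n + V * U) ((1\<^sub>m n - V * U) * 0\<^sub>m n N + V * 1\<^sub>m N)
      (0\<^sub>m N n * 1\<^sub>m n + 1\<^sub>m N * U) (0\<^sub>m N n * 0\<^sub>m n N + 1\<^sub>m N * 1\<^sub>m N)"
      using U V by simp
  qed (use U V in auto)
  moreover have "det (four_block_mat (1\<^sub>m n - V * U) V (0\<^sub>m N n) (1\<^sub>m N)) = det (1\<^sub>m n - V * U)"
    using U V by (subst det_four_block_mat_lower_left_zero[of _ n _ N]) auto
  moreover have "det (four_block_mat (1\<^sub>m n) (0\<^sub>m n N) U (1\<^sub>m N)) = 1"
    using U by (subst det_four_block_mat_upper_right_zero[of _ n _ N]) auto
  ultimately have "det ?M = det (1\<^sub>m n - V * U)"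
    by (simp add: fb W)
  with 1 show ?thesis by simp
qed

text \<open>General \<open>B\<close> and \<open>D\<close> allow one computation for \<open>f\<close>
  and \<open>F\<close>, in a form to which the determinant identity applies.\<close>

lemma jacobian_mat_cube:
  assumes B: "B \<in> carrier_mat n N" and D: "D \<in> carrier_mat N n"
    and f: "\<And>x. x \<in> carrier_vec n \<Longrightarrow> f x = x - B *\<^sub>v cwise_cube (D *\<^sub>v x)" and x: "x \<in> carrier_vec n"
  shows "jacobian_mat n f x = 1\<^sub>m n - B * mat N n (\<lambda>(r, j). 3 * ((D *\<^sub>v x) $ r)\<^sup>2 * D $$ (r, j))"
proof (rule eq_matI)
  fix i j assume "i < dim_row (1\<^sub>m n - B * mat N n (\<lambda>(r, j). 3 * ((D *\<^sub>v x) $ r)\<^sup>2 * D $$ (r, j)))"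
    "j < dim_col (1\<^sub>m n - B * mat N n (\<lambda>(r, j). 3 * ((D *\<^sub>v x) $ r)\<^sup>2 * D $$ (r, j)))"
  then have ij: "i < n" "j < n" using B by auto
  let ?e = "unit_vec n j :: complex vec"
  have De: "(D *\<^sub>v (x + t \<cdot>\<^sub>v ?e)) $ r = (D *\<^sub>v x) $ r + t * D $$ (r, j)" if "r < N" for t r
    using mult_mat_vec_line[OF D x, of ?e t] D that ij x by simp
  have "f (x + t \<cdot>\<^sub>v ?e) $ i = (x $ i + t * (if i = j then 1 else 0)) -
    (\<Sum>r<N. B $$ (i, r) * ((D *\<^sub>v x) $ r + t * D $$ (r, j)) ^ 3)" for t
  proof -
    have c: "x + t \<cdot>\<^sub>v ?e \<in> carrier_vec n" using x by simp
    have "(B *\<^sub>v cwise_cube (D *\<^sub>v (x + t \<cdot>\<^sub>v ?e))) $ i = (\<Sum>r<N. B $$ (i, r) * ((D *\<^sub>v (x + t \<cdot>\<^sub>v ?e)) $ r) ^ 3)"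
      using B D ij by (auto simp: scalar_prod_def atLeast0LessThan intro!: sum.cong)
    also have "\<dots> = (\<Sum>r<N. B $$ (i, r) * ((D *\<^sub>v x) $ r + t * D $$ (r, j)) ^ 3)"
      by (intro sum.cong refl) (simp add: De)
    finally show ?thesis using ij x B by (simp add: f[OF c])
  qed
  moreover have "((\<lambda>t. (x $ i + t * (if i = j then 1 else 0)) -
    (\<Sum>r<N. B $$ (i, r) * ((D *\<^sub>v x) $ r + t * D $$ (r, j)) ^ 3)) has_field_derivative
    ((if i = j then 1 else 0) - (\<Sum>r<N. B $$ (i, r) * (3 * ((D *\<^sub>v x) $ r)\<^sup>2 * D $$ (r, j))))) (at 0)"
    by (auto intro!: derivative_eq_intros sum.cong simp: mult_ac)
  ultimately have "deriv (\<lambda>t. f (x + t \<cdot>\<^sub>v ?e) $ i) 0 =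
    (if i = j then 1 else 0) - (\<Sum>r<N. B $$ (i, r) * (3 * ((D *\<^sub>v x) $ r)\<^sup>2 * D $$ (r, j)))"
    by (simp add: DERIV_imp_deriv)
  then show "jacobian_mat n f x $$ (i, j) = (1\<^sub>m n - B * mat N n (\<lambda>(r, j). 3 * ((D *\<^sub>v x) $ r)\<^sup>2 * D $$ (r, j))) $$ (i, j)"
    using ij B by (auto simp: jacobian_mat_def scalar_prod_def atLeast0LessThan intro!: sum.cong)
qed (use B in \<open>auto simp: jacobian_mat_def\<close>)

locale pairing =
  fixes n N :: nat and f F :: "complex vec \<Rightarrow> complex vec" and A B C :: "complex mat"
  assumes paired_through: "paired_through n N f A F B C"
begin

section \<open>A pairing as a triangular extension\<close>

lemma B: "B \<in> carrier_mat n N" and C: "C \<in> carrier_mat N n" and BC: "B * C = 1\<^sub>m n" and A: "A \<in> carrier_mat N N"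
  and f_cubic: "cubic_homogeneous n f" and F_cubic: "cubic_homogeneous N F"
  using paired_through cubic_linear_imp_cubic_homogeneous unfolding paired_through_def cubic_linear_def by auto

definition D :: "complex mat" where "D = A * C"

definition H :: "complex vec \<Rightarrow> complex vec" where "H y = cwise_cube (D *\<^sub>v y)"

text \<open>Minus the projection of \<open>H y\<close> to the kernel of \<open>B\<close> along the
  image of \<open>C\<close>. It is the shift that \<open>F\<close> adds over \<open>y\<close>: F(Cy
  + w) = C f(y) + w + \<psi>(y) for w in the kernel.\<close>

definition \<psi> :: "complex vec \<Rightarrow> complex vec" where "\<psi> y = C *\<^sub>v (B *\<^sub>v H y) - H y"

lemma D: "D \<in> carrier_mat N n" using A C by (simp add: D_def)

lemma H_car: "y \<in> carrier_vec n \<Longrightarrow> H y \<in> carrier_vec N"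
  using D by (simp add: H_def cwise_cube_carrier)

lemma B_car: "X \<in> carrier_vec N \<Longrightarrow> B *\<^sub>v X \<in> carrier_vec n"
  and C_car: "x \<in> carrier_vec n \<Longrightarrow> C *\<^sub>v x \<in> carrier_vec N"
  using B C by auto

lemma BC_vec: "x \<in> carrier_vec n \<Longrightarrow> B *\<^sub>v (C *\<^sub>v x) = x"
  using assoc_mult_mat_vec[OF B C, of x] by (simp add: BC)

lemma B_diff: "X \<in> carrier_vec N \<Longrightarrow> Y \<in> carrier_vec N \<Longrightarrow> B *\<^sub>v (X - Y) = B *\<^sub>v X - B *\<^sub>v Y"
  using B by (simp add: mult_minus_distrib_mat_vec[of B n N])

text \<open>\<open>X - CBX\<close> lies in the kernel of \<open>B\<close>, which is that of \<open>A\<close>.\<close>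

lemma A_vec: assumes X: "X \<in> carrier_vec N" shows "A *\<^sub>v X = D *\<^sub>v (B *\<^sub>v X)"
proof -
  let ?V = "X - C *\<^sub>v (B *\<^sub>v X)"
  have c: "C *\<^sub>v (B *\<^sub>v X) \<in> carrier_vec N" using C_car B_car X by simp
  have V: "?V \<in> carrier_vec N" using X c by simp
  have "B *\<^sub>v ?V = 0\<^sub>v n" using X c B_car[OF X] by (simp add: B_diff BC_vec)
  then have "?V \<in> mat_kernel B" using V B by (auto simp: mat_kernel_def)
  then have "?V \<in> mat_kernel A" using paired_through unfolding paired_through_def by simp
  then have "A *\<^sub>v ?V = 0\<^sub>v N" using A by (auto simp: mat_kernel_def)
  then have z: "A *\<^sub>v X - A *\<^sub>v (C *\<^sub>v (B *\<^sub>v X)) = 0\<^sub>v N"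
    using A X c by (simp add: mult_minus_distrib_mat_vec[of A N N])
  have "A *\<^sub>v X = A *\<^sub>v (C *\<^sub>v (B *\<^sub>v X))"
  proof (rule eq_vecI)
    fix i assume "i < dim_vec (A *\<^sub>v (C *\<^sub>v (B *\<^sub>v X)))"
    then have i: "i < N" using A by simp
    then show "(A *\<^sub>v X) $ i = (A *\<^sub>v (C *\<^sub>v (B *\<^sub>v X))) $ i"
      using arg_cong[OF z, of "\<lambda>v. v $ i"] A by (simp del: index_mult_mat_vec)
  qed (use A in simp)
  then show ?thesis using assoc_mult_mat_vec[OF A C B_car[OF X]] by (simp add: D_def)
qed

lemma A_eq: "A = D * B"
proof (rule eq_matI)
  fix i j assume "i < dim_row (D * B)" "j < dim_col (D * B)"
  then have ij: "i < N" "j < N" using D B by auto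
  have unit: "(M *\<^sub>v unit_vec N j) $ i = M $$ (i, j)" if "M \<in> carrier_mat N N" for M :: "complex mat"
    using that ij by simp
  have "A *\<^sub>v unit_vec N j = (D * B) *\<^sub>v unit_vec N j"
    using A_vec[of "unit_vec N j"] assoc_mult_mat_vec[OF D B, of "unit_vec N j"] by simp
  then show "A $$ (i, j) = (D * B) $$ (i, j)" using unit[OF A] unit[OF mult_carrier_mat[OF D B]] by simp
qed (use A D B in auto)

lemma F_eq: assumes X: "X \<in> carrier_vec N" shows "F X = X - H (B *\<^sub>v X)"
  using paired_through X A_vec[OF X] unfolding paired_through_def cubic_linear_def H_def by simp

lemma f_eq: assumes x: "x \<in> carrier_vec n" shows "f x = x - B *\<^sub>v H x"
proof -
  have "f x = B *\<^sub>v F (C *\<^sub>v x)" using paired_through x unfolding paired_through_def by blast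
  then show ?thesis using F_eq[OF C_car[OF x]] C_car[OF x] H_car[OF x] by (simp add: B_diff BC_vec x)
qed

lemma B_F: assumes X: "X \<in> carrier_vec N" shows "B *\<^sub>v F X = f (B *\<^sub>v X)"
  using X H_car[OF B_car[OF X]] by (simp add: F_eq f_eq B_car B_diff)

lemma F_car: "X \<in> carrier_vec N \<Longrightarrow> F X \<in> carrier_vec N"
  using F_eq H_car B_car by simp

lemma f_car: "x \<in> carrier_vec n \<Longrightarrow> f x \<in> carrier_vec n"
  using f_eq H_car B_car by simp

lemma \<psi>_car: "y \<in> carrier_vec n \<Longrightarrow> \<psi> y \<in> carrier_vec N"
  using H_car B_car C_car by (simp add: \<psi>_def)

lemma B_\<psi>: "y \<in> carrier_vec n \<Longrightarrow> B *\<^sub>v \<psi> y = 0\<^sub>v n"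
  using H_car[of y] B_car[OF H_car[of y]] C_car by (simp add: \<psi>_def B_diff BC_vec)

lemma \<psi>_polyfun: assumes i: "i < N" shows "polyfun n (\<lambda>y. \<psi> y $ i)"
proof -
  have H: "polyfun n (\<lambda>y. H y $ i)" if i: "i < N" for i
    by (rule polyfun_cong[OF polyfun_power[OF polyfun_mult_mat_vec[OF D i, of n "\<lambda>y. y"], of 3]])
       (use i D in \<open>auto simp: H_def intro: polyfun_index simp del: index_mult_mat_vec\<close>)
  have BH: "polyfun n (\<lambda>y. (B *\<^sub>v H y) $ i)" if i: "i < n" for i
    by (rule polyfun_mult_mat_vec[OF B i H_car H])
  have CBH: "polyfun n (\<lambda>y. (C *\<^sub>v (B *\<^sub>v H y)) $ i)"
    by (rule polyfun_mult_mat_vec[OF C i B_car[OF H_car] BH])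
  show ?thesis
    by (rule polyfun_cong[OF polyfun_diff[OF CBH H[OF i]]])
       (use i H_car[THEN carrier_vecD] in \<open>auto simp: \<psi>_def\<close>)
qed

lemma \<psi>_cubic_bound: "\<exists>K\<ge>0. \<forall>y\<in>carrier_vec n. vnorm (\<psi> y) \<le> K * vnorm y ^ 3"
proof -
  obtain \<delta> where \<delta>: "\<delta> \<ge> 0" "\<And>z. z \<in> carrier_vec n \<Longrightarrow> vnorm (D *\<^sub>v z) \<le> \<delta> * vnorm z"
    using vnorm_mult_mat_vec_le[OF D] by blast
  obtain \<beta> where \<beta>: "\<beta> \<ge> 0" "\<And>z. z \<in> carrier_vec N \<Longrightarrow> vnorm (B *\<^sub>v z) \<le> \<beta> * vnorm z"
    using vnorm_mult_mat_vec_le[OF B] by blast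
  obtain \<gamma> where \<gamma>: "\<gamma> \<ge> 0" "\<And>z. z \<in> carrier_vec n \<Longrightarrow> vnorm (C *\<^sub>v z) \<le> \<gamma> * vnorm z"
    using vnorm_mult_mat_vec_le[OF C] by blast
  have Hb: "vnorm (H y) \<le> \<delta> ^ 3 * vnorm y ^ 3" if y: "y \<in> carrier_vec n" for y
  proof (rule vnorm_leI[OF H_car[OF y]])
    fix i assume i: "i < N"
    have "cmod ((D *\<^sub>v y) $ i) \<le> \<delta> * vnorm y"
      using cmod_index_le_vnorm'[of "D *\<^sub>v y" N i] \<delta>(2)[OF y] D y i by (auto intro: order_trans simp del: index_mult_mat_vec)
    then have "cmod ((D *\<^sub>v y) $ i) ^ 3 \<le> (\<delta> * vnorm y) ^ 3" by (rule power_mono) simp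
    moreover have "H y $ i = (D *\<^sub>v y) $ i ^ 3"
      unfolding H_def using D i by (intro index_cwise_cube) simp
    ultimately show "cmod (H y $ i) \<le> \<delta> ^ 3 * vnorm y ^ 3"
      by (simp only: norm_power power_mult_distrib)
  qed (use \<delta> in simp)
  have "vnorm (\<psi> y) \<le> (\<gamma> * \<beta> + 1) * \<delta> ^ 3 * vnorm y ^ 3" if y: "y \<in> carrier_vec n" for y
  proof -
    have c: "C *\<^sub>v (B *\<^sub>v H y) \<in> carrier_vec N" "H y \<in> carrier_vec N" using H_car[OF y] B_car C_car by auto
    have m: "C *\<^sub>v (B *\<^sub>v H y) - H y = C *\<^sub>v (B *\<^sub>v H y) + (-1) \<cdot>\<^sub>v H y" using c by (intro eq_vecI) auto
    have "vnorm (\<psi> y) \<le> vnorm (C *\<^sub>v (B *\<^sub>v H y)) + vnorm ((-1) \<cdot>\<^sub>v H y)"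
      unfolding \<psi>_def m by (rule vnorm_triangle[of _ N]) (use c in auto)
    also have "\<dots> = vnorm (C *\<^sub>v (B *\<^sub>v H y)) + vnorm (H y)" using c by (simp add: vnorm_smult[of _ N])
    also have "\<dots> \<le> \<gamma> * (\<beta> * vnorm (H y)) + vnorm (H y)"
      using \<gamma>(2)[OF B_car[OF c(2)]] mult_left_mono[OF \<beta>(2)[OF c(2)] \<gamma>(1)] by linarith
    also have "\<dots> = (\<gamma> * \<beta> + 1) * vnorm (H y)" by (simp add: algebra_simps)
    also have "\<dots> \<le> (\<gamma> * \<beta> + 1) * (\<delta> ^ 3 * vnorm y ^ 3)"
      using Hb[OF y] \<gamma>(1) \<beta>(1) by (intro mult_left_mono) auto
    finally show ?thesis by (simp only: mult.assoc)
  qed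
  then show ?thesis using \<gamma>(1) \<beta>(1) \<delta>(1) by (intro exI[of _ "(\<gamma> * \<beta> + 1) * \<delta> ^ 3"]) auto
qed

lemma C_f: "y \<in> carrier_vec n \<Longrightarrow> C *\<^sub>v f y = C *\<^sub>v y - C *\<^sub>v (B *\<^sub>v H y)"
  using C H_car B_car by (simp add: f_eq mult_minus_distrib_mat_vec[of C N n])

lemma triangular_F: "triangular_extension n N B C f \<psi> F"
proof
  show "F Y = C *\<^sub>v f (B *\<^sub>v Y) + (Y - C *\<^sub>v (B *\<^sub>v Y)) + \<psi> (B *\<^sub>v Y)" if Y: "Y \<in> carrier_vec N" for Y
  proof -
    have c: "C *\<^sub>v (B *\<^sub>v Y) \<in> carrier_vec N" "C *\<^sub>v (B *\<^sub>v H (B *\<^sub>v Y)) \<in> carrier_vec N" "H (B *\<^sub>v Y) \<in> carrier_vec N"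
      using Y H_car B_car C_car by auto
    show ?thesis
      unfolding F_eq[OF Y] C_f[OF B_car[OF Y]] \<psi>_def
      using c Y C by (intro eq_vecI) auto
  qed
qed (use B C BC f_car \<psi>_car B_\<psi> in auto)

text \<open>Since A = DB, the Jacobian matrices at \<open>X\<close> and BX are 1 - UB and 1 - BU
  with the same U, hence have equal determinants. As BC = 1, every point of the smaller space is of
  the form BX.\<close>

lemma constant_jacobian_det_iff: "constant_jacobian_det n f \<longleftrightarrow> constant_jacobian_det N F"
proof -
  have det: "det (jacobian_mat N F X) = det (jacobian_mat n f (B *\<^sub>v X))" if X: "X \<in> carrier_vec N" for X
  proof -
    let ?U = "mat N n (\<lambda>(r, j). 3 * ((D *\<^sub>v (B *\<^sub>v X)) $ r)\<^sup>2 * D $$ (r, j))"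
    have "jacobian_mat n f (B *\<^sub>v X) = 1\<^sub>m n - B * ?U"
      by (rule jacobian_mat_cube[OF B D _ B_car[OF X]]) (simp add: f_eq H_def)
    moreover have "jacobian_mat N F X = 1\<^sub>m N - 1\<^sub>m N * mat N N (\<lambda>(r, j). 3 * ((A *\<^sub>v X) $ r)\<^sup>2 * A $$ (r, j))"
    proof (rule jacobian_mat_cube[OF one_carrier_mat A _ X])
      fix X :: "complex vec" assume X: "X \<in> carrier_vec N"
      show "F X = X - 1\<^sub>m N *\<^sub>v cwise_cube (A *\<^sub>v X)"
        using F_eq[OF X] H_car[OF B_car[OF X]] by (simp add: A_vec[OF X] H_def)
    qed
    moreover have "mat N N (\<lambda>(r, j). 3 * ((A *\<^sub>v X) $ r)\<^sup>2 * A $$ (r, j)) = ?U * B"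
    proof (rule eq_matI)
      fix r j assume "r < dim_row (?U * B)" "j < dim_col (?U * B)"
      then have rj: "r < N" "j < N" using B by auto
      have "A $$ (r, j) = (D * B) $$ (r, j)" by (rule arg_cong[OF A_eq])
      also have "\<dots> = (\<Sum>k<n. D $$ (r, k) * B $$ (k, j))"
        using rj B D by (auto simp: scalar_prod_def atLeast0LessThan intro!: sum.cong)
      finally have "A $$ (r, j) = (\<Sum>k<n. D $$ (r, k) * B $$ (k, j))" .
      moreover have "(?U * B) $$ (r, j) = (\<Sum>k<n. 3 * ((D *\<^sub>v (B *\<^sub>v X)) $ r)\<^sup>2 * D $$ (r, k) * B $$ (k, j))"
        using rj B by (auto simp: scalar_prod_def atLeast0LessThan intro!: sum.cong simp del: index_mult_mat_vec)
      ultimately show "mat N N (\<lambda>(r, j). 3 * ((A *\<^sub>v X) $ r)\<^sup>2 * A $$ (r, j)) $$ (r, j) = (?U * B) $$ (r, j)"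
        using rj by (simp add: A_vec[OF X] sum_distrib_left mult.assoc del: index_mult_mat_vec index_mult_mat)
    qed (use B in auto)
    moreover have "1\<^sub>m N * (?U * B) = ?U * B" using B by (intro left_mult_one_mat[of _ N N]) auto
    ultimately show ?thesis using det_one_minus_mult_commute[of ?U N n B] B by simp
  qed
  show ?thesis
  proof
    assume "constant_jacobian_det n f"
    then show "constant_jacobian_det N F" unfolding constant_jacobian_det_def using det B_car by metis
  next
    assume "constant_jacobian_det N F"
    then obtain c where c: "\<And>X. X \<in> carrier_vec N \<Longrightarrow> det (jacobian_mat N F X) = c"
      unfolding constant_jacobian_det_def by blast
    have "det (jacobian_mat n f x) = c" if x: "x \<in> carrier_vec n" for x
      using c[OF C_car[OF x]] det[OF C_car[OF x]] BC_vec[OF x] by simp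
    then show "constant_jacobian_det n f" unfolding constant_jacobian_det_def by blast
  qed
qed

text \<open>For a triangular \<open>K\<close> over \<open>k\<close> with shift \<phi>, the kernel
  component of the functional equation reads \<phi>(\<mu>y) = \<mu>(\<phi>(y) + \<psi>(k(y))), that
  is, \<phi>(y) - \<phi>(\<mu>y)/\<mu> = -\<psi>(k(y)). This is solved in each coordinate.\<close>

lemma global_pre_conjugation_extend:
  assumes \<mu>: "\<mu> \<noteq> 0" "cmod \<mu> \<noteq> 1" and k: "global_pre_conjugation n \<mu> f k"
  shows "\<exists>\<phi> K. triangular_extension n N B C k \<phi> K \<and> global_pre_conjugation N \<mu> F K \<and>
    (polynomial_map n k \<longrightarrow> (\<forall>i<N. polyfun n (\<lambda>y. \<phi> y $ i)))"
proof -
  have k: "\<And>x. x \<in> carrier_vec n \<Longrightarrow> k x \<in> carrier_vec n" "\<And>i. i < n \<Longrightarrow> entire_fun n (\<lambda>x. k x $ i)"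
    "tangent_to_id n k" "\<And>y. y \<in> carrier_vec n \<Longrightarrow> \<mu> \<cdot>\<^sub>v f (k y) = k (\<mu> \<cdot>\<^sub>v y)"
    using k unfolding global_pre_conjugation_iff by auto
  obtain E s where E: "s > 0" "E \<ge> 0" "\<And>y. y \<in> carrier_vec n \<Longrightarrow> vnorm y \<le> s \<Longrightarrow> vnorm (k y - y) \<le> E * (vnorm y)\<^sup>2"
    using tangent_to_idE[OF k(3)] by blast
  obtain G where G: "G \<ge> 0" "\<And>y. y \<in> carrier_vec n \<Longrightarrow> vnorm (\<psi> y) \<le> G * vnorm y ^ 3"
    using \<psi>_cubic_bound by blast
  \<comment> \<open>The right-hand side of the linear equation. It has order three at the origin, as
    \<psi> is cubic and k(y) = O(|y|); order two is what the solution lemma uses.\<close>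
  define P where "P i y = - (\<psi> (k y) $ i)" for i y
  define r where "r = min s 1"
  have r: "r > 0" using E(1) by (simp add: r_def)
  have Pe: "entire_fun n (P i)" if i: "i < N" for i
    using entire_fun_mult[OF entire_fun_const[of n "-1"] entire_fun_polyfun_compose[OF \<psi>_polyfun[OF i] k(1) k(2)]]
    by (simp add: P_def[abs_def])
  have Pp: "polyfun n (P i)" if "polynomial_map n k" "i < N" for i
    using polyfun_mult[OF polyfun_const[of n "-1"] polyfun_compose[OF \<psi>_polyfun[OF that(2)] k(1)]] that(1)
    unfolding polynomial_map_iff_polyfun by (simp add: P_def[abs_def])
  have Pb: "cmod (P i y) \<le> G * (E + 1) ^ 3 * (vnorm y)\<^sup>2" if i: "i < N" and y: "y \<in> carrier_vec n" "vnorm y \<le> r" for i y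
  proof -
    have y1: "vnorm y \<le> 1" "vnorm y \<le> s" using y(2) by (auto simp: r_def)
    have "(vnorm y)\<^sup>2 \<le> vnorm y" using y1 by (simp add: power2_eq_square mult_left_le)
    then have "vnorm (k y) \<le> vnorm y + E * vnorm y"
      using vnorm_triangle_sub[OF k(1)[OF y(1)] y(1)] E(3)[OF y(1) y1(2)] mult_left_mono[OF _ E(2), of "(vnorm y)\<^sup>2" "vnorm y"]
      by linarith
    then have ky: "vnorm (k y) \<le> (E + 1) * vnorm y" by (simp add: algebra_simps)
    have "cmod (P i y) \<le> vnorm (\<psi> (k y))"
      using cmod_index_le_vnorm'[OF \<psi>_car[OF k(1)[OF y(1)]] i] by (simp add: P_def)
    also have "\<dots> \<le> G * vnorm (k y) ^ 3" by (rule G(2)[OF k(1)[OF y(1)]])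
    also have "\<dots> \<le> G * ((E + 1) * vnorm y) ^ 3" using ky G(1) by (intro mult_left_mono power_mono) auto
    also have "\<dots> = G * (E + 1) ^ 3 * vnorm y ^ 3" by (simp add: power_mult_distrib)
    also have "\<dots> \<le> G * (E + 1) ^ 3 * (vnorm y)\<^sup>2"
      using y1 G(1) E(2) by (intro mult_left_mono power_decreasing) auto
    finally show ?thesis .
  qed
  have "\<forall>i. \<exists>\<phi>. i < N \<longrightarrow> entire_fun n \<phi> \<and> (\<exists>D s. s > 0 \<and> (\<forall>y\<in>carrier_vec n. vnorm y \<le> s \<longrightarrow> cmod (\<phi> y) \<le> D * (vnorm y)\<^sup>2)) \<and>
    (\<forall>y\<in>carrier_vec n. \<phi> y - \<phi> (\<mu> \<cdot>\<^sub>v y) / \<mu> = P i y) \<and> (polyfun n (P i) \<longrightarrow> polyfun n \<phi>)"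
    using cohomological_equation[OF Pe \<mu> r Pb] by blast
  from choice[OF this] obtain \<theta> where \<theta>: "\<forall>i. i < N \<longrightarrow> entire_fun n (\<theta> i) \<and>
    (\<exists>D s. s > 0 \<and> (\<forall>y\<in>carrier_vec n. vnorm y \<le> s \<longrightarrow> cmod (\<theta> i y) \<le> D * (vnorm y)\<^sup>2)) \<and>
    (\<forall>y\<in>carrier_vec n. \<theta> i y - \<theta> i (\<mu> \<cdot>\<^sub>v y) / \<mu> = P i y) \<and> (polyfun n (P i) \<longrightarrow> polyfun n (\<theta> i))" ..
  define \<chi> where "\<chi> y = vec N (\<lambda>i. \<theta> i y)" for y
  have \<chi>_car: "\<chi> y \<in> carrier_vec N" for y by (simp add: \<chi>_def)
  \<comment> \<open>The coordinatewise solution \<chi> may leave the kernel of \<open>B\<close>. The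
    projection 1 - CB brings it back, and the equation survives because the projection is linear and
    fixes the values of \<psi>.\<close>
  define \<phi> where "\<phi> y = \<chi> y - C *\<^sub>v (B *\<^sub>v \<chi> y)" for y
  have \<phi>_car: "\<phi> y \<in> carrier_vec N" for y using \<chi>_car B_car C_car by (simp add: \<phi>_def)
  have B\<phi>: "B *\<^sub>v \<phi> y = 0\<^sub>v n" for y
    using \<chi>_car[of y] B_car[OF \<chi>_car[of y]] C_car by (simp add: \<phi>_def B_diff BC_vec)
  define M where "M = C * B"
  have M: "M \<in> carrier_mat N N" using B C by (simp add: M_def)
  have M_vec: "C *\<^sub>v (B *\<^sub>v X) = M *\<^sub>v X" if "X \<in> carrier_vec N" for X
    using assoc_mult_mat_vec[OF C B that] by (simp add: M_def)
  have \<phi>_index: "\<phi> y $ i = \<theta> i y - (\<Sum>j<N. M $$ (i, j) * \<theta> j y)" if "i < N" for i y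
    unfolding \<phi>_def M_vec[OF \<chi>_car]
    using that M by (auto simp: \<chi>_def scalar_prod_def atLeast0LessThan intro!: sum.cong)
  have \<phi>e: "entire_fun n (\<lambda>y. \<phi> y $ i)" if i: "i < N" for i
    unfolding \<phi>_index[OF i] using \<theta> i by (intro entire_fun_diff entire_fun_sum entire_fun_mult entire_fun_const) auto
  have \<phi>p: "polyfun n (\<lambda>y. \<phi> y $ i)" if "polynomial_map n k" and i: "i < N" for i
    unfolding \<phi>_index[OF i] using \<theta> i Pp[OF that(1)] by (intro polyfun_diff polyfun_sum polyfun_mult polyfun_const) auto
  define K where "K Y = C *\<^sub>v k (B *\<^sub>v Y) + (Y - C *\<^sub>v (B *\<^sub>v Y)) + \<phi> (B *\<^sub>v Y)" for Y
  interpret T: triangular_extension n N B C k \<phi> K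
    by standard (use B C BC k(1) \<phi>_car B\<phi> in \<open>auto simp: K_def\<close>)
  have "\<exists>\<rho>>0. \<forall>i<N. \<exists>Di. \<forall>y\<in>carrier_vec n. vnorm y \<le> \<rho> \<longrightarrow> cmod (\<theta> i y) \<le> Di * (vnorm y)\<^sup>2"
    by (rule uniform_radius) (use \<theta> in \<open>blast, meson order_trans\<close>)
  then obtain \<rho> where \<rho>: "\<rho> > 0" "\<forall>i. \<exists>Di. i < N \<longrightarrow> (\<forall>y\<in>carrier_vec n. vnorm y \<le> \<rho> \<longrightarrow> cmod (\<theta> i y) \<le> Di * (vnorm y)\<^sup>2)"
    by blast
  from choice[OF \<rho>(2)] obtain Di where Di: "\<And>i y. i < N \<Longrightarrow> y \<in> carrier_vec n \<Longrightarrow> vnorm y \<le> \<rho> \<Longrightarrow> cmod (\<theta> i y) \<le> Di i * (vnorm y)\<^sup>2"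
    by blast
  obtain \<beta> where \<beta>: "\<beta> \<ge> 0" "\<And>z. z \<in> carrier_vec N \<Longrightarrow> vnorm (M *\<^sub>v z) \<le> \<beta> * vnorm z"
    using vnorm_mult_mat_vec_le[OF M] by blast
  have \<phi>b: "vnorm (\<phi> y) \<le> (1 + \<beta>) * (\<Sum>i<N. \<bar>Di i\<bar>) * (vnorm y)\<^sup>2" if y: "y \<in> carrier_vec n" "vnorm y \<le> \<rho>" for y
  proof -
    have "vnorm (\<chi> y) \<le> (\<Sum>i<N. \<bar>Di i\<bar>) * (vnorm y)\<^sup>2"
    proof (rule vnorm_leI[OF \<chi>_car])
      show "0 \<le> (\<Sum>i<N. \<bar>Di i\<bar>) * (vnorm y)\<^sup>2" by (intro mult_nonneg_nonneg sum_nonneg) auto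
      fix i assume i: "i < N"
      have "cmod (\<theta> i y) \<le> Di i * (vnorm y)\<^sup>2" by (rule Di[OF i y])
      also have "\<dots> \<le> (\<Sum>i<N. \<bar>Di i\<bar>) * (vnorm y)\<^sup>2"
        using i member_le_sum[of i "{..<N}" "\<lambda>i. \<bar>Di i\<bar>"] by (intro mult_right_mono) auto
      finally show "cmod (\<chi> y $ i) \<le> (\<Sum>i<N. \<bar>Di i\<bar>) * (vnorm y)\<^sup>2" using i by (simp add: \<chi>_def)
    qed
    moreover have "vnorm (\<phi> y) \<le> (1 + \<beta>) * vnorm (\<chi> y)"
    proof -
      have c: "M *\<^sub>v \<chi> y \<in> carrier_vec N" using M \<chi>_car by simp
      have m: "\<chi> y - M *\<^sub>v \<chi> y = \<chi> y + (-1) \<cdot>\<^sub>v (M *\<^sub>v \<chi> y)" using \<chi>_car[of y] M by (intro eq_vecI) auto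
      have "vnorm (\<phi> y) \<le> vnorm (\<chi> y) + vnorm ((-1) \<cdot>\<^sub>v (M *\<^sub>v \<chi> y))"
        unfolding \<phi>_def M_vec[OF \<chi>_car] m by (rule vnorm_triangle[of _ N]) (use \<chi>_car c in auto)
      also have "\<dots> = vnorm (\<chi> y) + vnorm (M *\<^sub>v \<chi> y)" using c by (simp add: vnorm_smult[of _ N])
      finally show ?thesis using \<beta>(2)[OF \<chi>_car[of y]] by (simp add: distrib_right)
    qed
    ultimately have "vnorm (\<phi> y) \<le> (1 + \<beta>) * ((\<Sum>i<N. \<bar>Di i\<bar>) * (vnorm y)\<^sup>2)"
      using mult_left_mono[of "vnorm (\<chi> y)" _ "1 + \<beta>"] \<beta>(1) by (meson add_nonneg_nonneg order_trans zero_le_one)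
    then show ?thesis by (simp only: mult.assoc)
  qed
  have \<phi>_eq: "\<mu> \<cdot>\<^sub>v (\<phi> y + \<psi> (k y)) = \<phi> (\<mu> \<cdot>\<^sub>v y)" if y: "y \<in> carrier_vec n" for y
  proof -
    have \<chi>_eq: "\<chi> (\<mu> \<cdot>\<^sub>v y) = \<mu> \<cdot>\<^sub>v (\<chi> y + \<psi> (k y))"
    proof (rule eq_vecI)
      fix i assume "i < dim_vec (\<mu> \<cdot>\<^sub>v (\<chi> y + \<psi> (k y)))"
      then have i: "i < N" using \<psi>_car[OF k(1)[OF y]] by simp
      have "\<theta> i y - \<theta> i (\<mu> \<cdot>\<^sub>v y) / \<mu> = - (\<psi> (k y) $ i)" using \<theta> i y by (simp add: P_def)
      then have "\<theta> i (\<mu> \<cdot>\<^sub>v y) = \<mu> * (\<theta> i y + \<psi> (k y) $ i)" using \<mu>(1) by (simp add: field_simps)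
      then show "\<chi> (\<mu> \<cdot>\<^sub>v y) $ i = (\<mu> \<cdot>\<^sub>v (\<chi> y + \<psi> (k y))) $ i"
        using i \<psi>_car[OF k(1)[OF y]] by (simp add: \<chi>_def)
    qed (use \<psi>_car[OF k(1)[OF y]] in \<open>simp add: \<chi>_def\<close>)
    have c: "\<psi> (k y) \<in> carrier_vec N" "\<chi> y \<in> carrier_vec N" "M *\<^sub>v \<chi> y \<in> carrier_vec N"
      using \<psi>_car[OF k(1)[OF y]] \<chi>_car M by auto
    have "M *\<^sub>v \<psi> (k y) = C *\<^sub>v 0\<^sub>v n" using M_vec[OF c(1)] B_\<psi>[OF k(1)[OF y]] by simp
    also have "\<dots> = 0\<^sub>v N" using C by auto
    finally have M\<psi>: "M *\<^sub>v \<psi> (k y) = 0\<^sub>v N" .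
    have M\<mu>: "M *\<^sub>v (\<mu> \<cdot>\<^sub>v (\<chi> y + \<psi> (k y))) = \<mu> \<cdot>\<^sub>v (M *\<^sub>v \<chi> y)"
      using c M by (simp add: mult_mat_vec[of M N N] mult_add_distrib_mat_vec[of M N N] M\<psi>)
    have \<phi>M: "\<phi> x = \<chi> x - M *\<^sub>v \<chi> x" for x by (simp only: \<phi>_def M_vec[OF \<chi>_car])
    have "\<phi> (\<mu> \<cdot>\<^sub>v y) = \<mu> \<cdot>\<^sub>v (\<chi> y + \<psi> (k y)) - \<mu> \<cdot>\<^sub>v (M *\<^sub>v \<chi> y)"
      by (simp only: \<phi>M \<chi>_eq M\<mu>)
    then show ?thesis
      unfolding \<phi>M[of y] using c M by (intro eq_vecI) (auto simp: algebra_simps simp del: index_mult_mat_vec)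
  qed
  have "\<mu> \<cdot>\<^sub>v F (K Y) = K (\<mu> \<cdot>\<^sub>v Y)" if Y: "Y \<in> carrier_vec N" for Y
  proof -
    let ?y = "B *\<^sub>v Y"
    have y: "?y \<in> carrier_vec n" by (rule B_car[OF Y])
    have ky: "k ?y \<in> carrier_vec n" by (rule k(1)[OF y])
    have B\<mu>: "B *\<^sub>v (\<mu> \<cdot>\<^sub>v Y) = \<mu> \<cdot>\<^sub>v ?y" using B Y by (simp add: mult_mat_vec[of B n N])
    have C\<mu>: "C *\<^sub>v (\<mu> \<cdot>\<^sub>v x) = \<mu> \<cdot>\<^sub>v (C *\<^sub>v x)" if "x \<in> carrier_vec n" for x
      using C that by (simp add: mult_mat_vec[of C N n])
    have "k (\<mu> \<cdot>\<^sub>v ?y) = \<mu> \<cdot>\<^sub>v f (k ?y)" using k(4)[OF y] by simp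
    then have Ck: "C *\<^sub>v k (\<mu> \<cdot>\<^sub>v ?y) = \<mu> \<cdot>\<^sub>v (C *\<^sub>v k ?y - C *\<^sub>v (B *\<^sub>v H (k ?y)))"
      using C\<mu>[OF f_car[OF ky]] C_f[OF ky] by simp
    have "F (K Y) = K Y - H (k ?y)" using F_eq[OF T.K_car[OF Y]] T.B_K[OF Y] by simp
    then have l: "\<mu> \<cdot>\<^sub>v F (K Y) = \<mu> \<cdot>\<^sub>v (C *\<^sub>v k ?y + (Y - C *\<^sub>v ?y) + \<phi> ?y - H (k ?y))" by (simp add: K_def)
    have e: "\<phi> (\<mu> \<cdot>\<^sub>v ?y) = \<mu> \<cdot>\<^sub>v (\<phi> ?y + (C *\<^sub>v (B *\<^sub>v H (k ?y)) - H (k ?y)))"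
      using \<phi>_eq[OF y] by (simp add: \<psi>_def)
    define a b h w where "a = C *\<^sub>v k ?y" and "b = C *\<^sub>v ?y" and "h = H (k ?y)" and "w = \<phi> ?y"
    define d where "d = C *\<^sub>v (B *\<^sub>v h)"
    have c: "a \<in> carrier_vec N" "b \<in> carrier_vec N" "d \<in> carrier_vec N" "h \<in> carrier_vec N" "w \<in> carrier_vec N"
      unfolding a_def b_def d_def h_def w_def using y ky C_car B_car H_car \<phi>_car by auto
    show ?thesis
      unfolding l unfolding K_def B\<mu> Ck e C\<mu>[OF y] a_def[symmetric] b_def[symmetric] h_def[symmetric] w_def[symmetric]
        d_def[symmetric]
      using c Y by (intro eq_vecI) (auto simp: algebra_simps)
  qed
  then have "global_pre_conjugation N \<mu> F K"
    unfolding global_pre_conjugation_iff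
    using T.K_car T.entire_fun_K[OF k(2) \<phi>e] T.tangent_to_id_K[OF k(3) \<rho>(1) \<phi>b] by blast
  then show ?thesis using T.triangular_extension_axioms \<phi>p by blast
qed

text \<open>Applying \<open>B\<close> to the functional equation of \<open>K\<close> at Cy gives the
  one for y -> B K(C y), because B F = f B.\<close>

lemma global_pre_conjugation_restrict:
  assumes K: "global_pre_conjugation N \<mu> F K"
  shows "global_pre_conjugation n \<mu> f (\<lambda>y. B *\<^sub>v K (C *\<^sub>v y))"
proof -
  have K: "\<And>x. x \<in> carrier_vec N \<Longrightarrow> K x \<in> carrier_vec N" "\<And>i. i < N \<Longrightarrow> entire_fun N (\<lambda>x. K x $ i)"
    "tangent_to_id N K" "\<And>y. y \<in> carrier_vec N \<Longrightarrow> \<mu> \<cdot>\<^sub>v F (K y) = K (\<mu> \<cdot>\<^sub>v y)"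
    using K unfolding global_pre_conjugation_iff by auto
  have e: "entire_fun n (\<lambda>y. (B *\<^sub>v K (C *\<^sub>v y)) $ i)" if i: "i < n" for i
  proof (rule entire_fun_cong)
    show "entire_fun n (\<lambda>y. \<Sum>j<N. B $$ (i, j) * K (C *\<^sub>v y) $ j)"
      by (intro entire_fun_sum entire_fun_mult entire_fun_const) (auto intro: entire_fun_linear_compose[OF K(2) C])
    show "(B *\<^sub>v K (C *\<^sub>v y)) $ i = (\<Sum>j<N. B $$ (i, j) * K (C *\<^sub>v y) $ j)" if "y \<in> carrier_vec n" for y
      using i B K(1)[OF C_car[OF that]] by (auto simp: scalar_prod_def atLeast0LessThan intro!: sum.cong)
  qed
  obtain E s where E: "s > 0" "E \<ge> 0" "\<And>y. y \<in> carrier_vec N \<Longrightarrow> vnorm y \<le> s \<Longrightarrow> vnorm (K y - y) \<le> E * (vnorm y)\<^sup>2"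
    using tangent_to_idE[OF K(3)] by blast
  obtain \<beta> where \<beta>: "\<beta> \<ge> 0" "\<And>z. z \<in> carrier_vec N \<Longrightarrow> vnorm (B *\<^sub>v z) \<le> \<beta> * vnorm z"
    using vnorm_mult_mat_vec_le[OF B] by blast
  obtain \<gamma> where \<gamma>: "\<gamma> \<ge> 0" "\<And>z. z \<in> carrier_vec n \<Longrightarrow> vnorm (C *\<^sub>v z) \<le> \<gamma> * vnorm z"
    using vnorm_mult_mat_vec_le[OF C] by blast
  have t: "tangent_to_id n (\<lambda>y. B *\<^sub>v K (C *\<^sub>v y))"
    unfolding tangent_to_id_def
  proof (rule exI[of _ "\<beta> * (E * \<gamma>\<^sup>2)"], rule exI[of _ "s / (\<gamma> + 1)"], intro conjI ballI impI)
    show "0 < s / (\<gamma> + 1)" using E(1) \<gamma>(1) by simp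
    fix y assume y: "y \<in> carrier_vec n" "vnorm y \<le> s / (\<gamma> + 1)"
    have Cy: "C *\<^sub>v y \<in> carrier_vec N" by (rule C_car[OF y(1)])
    have l: "vnorm (C *\<^sub>v y) \<le> \<gamma> * vnorm y" by (rule \<gamma>(2)[OF y(1)])
    also have "\<dots> \<le> (\<gamma> + 1) * (s / (\<gamma> + 1))" using y \<gamma>(1) E(1) by (intro mult_mono) auto
    also have "\<dots> = s" using \<gamma>(1) by simp
    finally have "vnorm (K (C *\<^sub>v y) - C *\<^sub>v y) \<le> E * (vnorm (C *\<^sub>v y))\<^sup>2" by (rule E(3)[OF Cy])
    also have "\<dots> \<le> E * (\<gamma> * vnorm y)\<^sup>2" using l E(2) by (intro mult_left_mono power_mono) auto
    finally have "\<beta> * vnorm (K (C *\<^sub>v y) - C *\<^sub>v y) \<le> \<beta> * (E * (\<gamma> * vnorm y)\<^sup>2)"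
      using \<beta>(1) by (rule mult_left_mono)
    moreover have "B *\<^sub>v K (C *\<^sub>v y) - y = B *\<^sub>v (K (C *\<^sub>v y) - C *\<^sub>v y)"
      using B_diff[OF K(1)[OF Cy] Cy] BC_vec[OF y(1)] by simp
    moreover have "vnorm (B *\<^sub>v (K (C *\<^sub>v y) - C *\<^sub>v y)) \<le> \<beta> * vnorm (K (C *\<^sub>v y) - C *\<^sub>v y)"
      using K(1)[OF Cy] Cy by (intro \<beta>(2)) simp
    ultimately show "vnorm (B *\<^sub>v K (C *\<^sub>v y) - y) \<le> \<beta> * (E * \<gamma>\<^sup>2) * (vnorm y)\<^sup>2"
      by (simp add: power_mult_distrib mult_ac)
  qed
  have "\<mu> \<cdot>\<^sub>v f (B *\<^sub>v K (C *\<^sub>v y)) = B *\<^sub>v K (C *\<^sub>v (\<mu> \<cdot>\<^sub>v y))" if y: "y \<in> carrier_vec n" for y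
  proof -
    have Cy: "C *\<^sub>v y \<in> carrier_vec N" by (rule C_car[OF y])
    have "\<mu> \<cdot>\<^sub>v f (B *\<^sub>v K (C *\<^sub>v y)) = \<mu> \<cdot>\<^sub>v (B *\<^sub>v F (K (C *\<^sub>v y)))" by (simp add: B_F[OF K(1)[OF Cy]])
    also have "\<dots> = B *\<^sub>v (\<mu> \<cdot>\<^sub>v F (K (C *\<^sub>v y)))"
      using B F_car[OF K(1)[OF Cy]] by (simp add: mult_mat_vec[of B n N])
    also have "\<dots> = B *\<^sub>v K (\<mu> \<cdot>\<^sub>v (C *\<^sub>v y))" by (simp add: K(4)[OF Cy])
    also have "\<mu> \<cdot>\<^sub>v (C *\<^sub>v y) = C *\<^sub>v (\<mu> \<cdot>\<^sub>v y)" using C y by (simp add: mult_mat_vec[of C N n])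
    finally show ?thesis .
  qed
  then show ?thesis unfolding global_pre_conjugation_iff using e t K(1) C_car B_car by blast
qed

text \<open>The restriction of \<open>K\<close> is extended again; the result is triangular and a
  pre-conjugation of \<open>F\<close>, hence coincides with \<open>K\<close> on the carrier.\<close>

lemma global_pre_conjugation_triangular:
  assumes \<mu>: "\<mu> \<noteq> 0" "cmod \<mu> \<noteq> 1" and K: "global_pre_conjugation N \<mu> F K"
  shows "\<exists>\<phi>. triangular_extension n N B C (\<lambda>y. B *\<^sub>v K (C *\<^sub>v y)) \<phi> K"
proof -
  obtain \<phi> K' where T: "triangular_extension n N B C (\<lambda>y. B *\<^sub>v K (C *\<^sub>v y)) \<phi> K'" and K': "global_pre_conjugation N \<mu> F K'"
    using global_pre_conjugation_extend[OF \<mu> global_pre_conjugation_restrict[OF K]] by blast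
  have "K Y = K' Y" if "Y \<in> carrier_vec N" for Y
    by (rule global_pre_conjugation_unique[OF cubic_homogeneous_polynomial_map[OF F_cubic] \<mu> K K' that])
  then have "triangular_extension n N B C (\<lambda>y. B *\<^sub>v K (C *\<^sub>v y)) \<phi> K"
    using T unfolding triangular_extension_def by simp
  then show ?thesis by blast
qed

end

section \<open>Existence of pairings\<close>

text \<open>Passes from \<open>invertible_mat\<close> to the determinant: if det A \<noteq> 0, the
  scaled adjugate is an inverse.\<close>

lemma singular_imp_kernel_neq_0:
  fixes A :: "complex mat"
  assumes A: "A \<in> carrier_mat N N" and s: "\<not> invertible_mat A"
  shows "\<exists>v\<in>carrier_vec N. v \<noteq> 0\<^sub>v N \<and> A *\<^sub>v v = 0\<^sub>v N"
proof -
  have "det A = 0"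
  proof (rule ccontr)
    assume d: "det A \<noteq> 0"
    define X where "X = (1 / det A) \<cdot>\<^sub>m adj_mat A"
    have adj: "adj_mat A \<in> carrier_mat N N" "A * adj_mat A = det A \<cdot>\<^sub>m 1\<^sub>m N" "adj_mat A * A = det A \<cdot>\<^sub>m 1\<^sub>m N"
      using adj_mat[OF A] by auto
    have s: "(1 / det A) \<cdot>\<^sub>m (det A \<cdot>\<^sub>m 1\<^sub>m N) = 1\<^sub>m N" using d by (intro eq_matI) auto
    have "A * X = 1\<^sub>m N" "X * A = 1\<^sub>m N"
      unfolding X_def using A adj s by (simp_all add: mult_smult_assoc_mat[of _ N N] mult_smult_distrib[of _ N N])
    then have "inverts_mat A X" "inverts_mat X A" using A adj by (auto simp: inverts_mat_def X_def)
    then show False using \<open>\<not> invertible_mat A\<close> A unfolding invertible_mat_def by auto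
  qed
  then show ?thesis using det_0_iff_vec_prod_zero[OF A] by auto
qed

text \<open>A basis of the span of the first \<open>r\<close> rows, together with a right inverse, built row by row.\<close>

lemma row_space_splitting:
  fixes A :: "complex mat"
  assumes A: "A \<in> carrier_mat m N" and "r \<le> m"
  shows "\<exists>n B C. B \<in> carrier_mat n N \<and> C \<in> carrier_mat N n \<and> B * C = 1\<^sub>m n \<and>
    (\<forall>v\<in>carrier_vec N. (\<forall>i<r. row A i \<bullet> v = 0) \<longleftrightarrow> B *\<^sub>v v = 0\<^sub>v n)"
  using assms(2)
proof (induction r)
  case 0
  have "(0\<^sub>m 0 N :: complex mat) * 0\<^sub>m N 0 = 1\<^sub>m 0" by (intro eq_matI) auto
  then show ?case
    by (intro exI[of _ 0] exI[of _ "0\<^sub>m 0 N"] exI[of _ "0\<^sub>m N 0"]) auto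
next
  case (Suc r)
  then obtain n B C where B: "B \<in> carrier_mat n N" and C: "C \<in> carrier_mat N n" and BC: "B * C = 1\<^sub>m n"
    and ker: "\<And>v. v \<in> carrier_vec N \<Longrightarrow> (\<forall>i<r. row A i \<bullet> v = 0) \<longleftrightarrow> B *\<^sub>v v = 0\<^sub>v n" by auto
  define a where "a = row A r"
  have a: "a \<in> carrier_vec N" using A by (auto simp: a_def)
  show ?case
  proof (cases "\<forall>v\<in>carrier_vec N. B *\<^sub>v v = 0\<^sub>v n \<longrightarrow> a \<bullet> v = 0")
    case True
    then have "\<forall>v\<in>carrier_vec N. (\<forall>i<Suc r. row A i \<bullet> v = 0) \<longleftrightarrow> B *\<^sub>v v = 0\<^sub>v n"
      using ker unfolding a_def by (metis less_Suc_eq)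
    then show ?thesis using B C BC by blast
  next
    case False
    then obtain u where u: "u \<in> carrier_vec N" "B *\<^sub>v u = 0\<^sub>v n" "a \<bullet> u \<noteq> 0" by blast
    \<comment> \<open>The new column of the right inverse: a kernel vector of \<open>B\<close>,
      scaled so that the new row takes the value 1 on it.\<close>
    define w where "w = (1 / (a \<bullet> u)) \<cdot>\<^sub>v u"
    have w: "w \<in> carrier_vec N" "B *\<^sub>v w = 0\<^sub>v n" "a \<bullet> w = 1"
      using u a B by (auto simp: w_def mult_mat_vec[of B n N])
    define M where "M = C * B"
    have M: "M \<in> carrier_mat N N" using B C by (simp add: M_def)
    have Mt: "transpose_mat M \<in> carrier_mat N N" using M by simp
    \<comment> \<open>The correction makes the new row vanish on the columns of \<open>C\<close>, as
      B'C' = 1 demands, and does not change it on the kernel of \<open>B\<close>.\<close>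
    define a' where "a' = a - transpose_mat M *\<^sub>v a"
    have a': "a' \<in> carrier_vec N" using a M by (simp add: a'_def)
    have a'_prod: "a' \<bullet> v = a \<bullet> v - a \<bullet> (C *\<^sub>v (B *\<^sub>v v))" if v: "v \<in> carrier_vec N" for v
    proof -
      have "a' \<bullet> v = a \<bullet> v - (transpose_mat M *\<^sub>v a) \<bullet> v"
        unfolding a'_def by (rule minus_scalar_prod_distrib[OF a mult_mat_vec_carrier[OF Mt a] v])
      also have "(transpose_mat M *\<^sub>v a) \<bullet> v = a \<bullet> (M *\<^sub>v v)" by (rule transpose_vec_mult_scalar[OF M v a])
      also have "M *\<^sub>v v = C *\<^sub>v (B *\<^sub>v v)" unfolding M_def by (rule assoc_mult_mat_vec[OF C B v])
      finally show ?thesis .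
    qed
    define B' where "B' = mat (Suc n) N (\<lambda>(i, j). if i < n then B $$ (i, j) else a' $ j)"
    define C' where "C' = mat N (Suc n) (\<lambda>(i, j). if j < n then C $$ (i, j) else w $ i)"
    have rowB: "row B' i = (if i < n then row B i else a')" if "i < Suc n" for i
      using that B a' by (auto intro!: eq_vecI simp: B'_def)
    have colC: "col C' j = (if j < n then col C j else w)" if "j < Suc n" for j
      using that C w by (auto intro!: eq_vecI simp: C'_def)
    have "C *\<^sub>v 0\<^sub>v n = 0\<^sub>v N" using C by auto
    then have z: "a \<bullet> (C *\<^sub>v 0\<^sub>v n) = 0" using a by simp
    have "B' * C' = 1\<^sub>m (Suc n)"
    proof (rule eq_matI)
      fix i j assume "i < dim_row (1\<^sub>m (Suc n))" "j < dim_col (1\<^sub>m (Suc n))"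
      then have ij: "i < Suc n" "j < Suc n" by auto
      have e: "(B' * C') $$ (i, j) = row B' i \<bullet> col C' j" using ij by (simp add: B'_def C'_def)
      have Bw: "row B i \<bullet> w = 0" if "i < n"
      proof -
        have "(B *\<^sub>v w) $ i = row B i \<bullet> w" using that B by simp
        then show ?thesis using that w by simp
      qed
      have BCij: "row B i \<bullet> col C j = (if i = j then 1 else 0)" if "i < n" "j < n"
      proof -
        have "(B * C) $$ (i, j) = row B i \<bullet> col C j" using that B C by simp
        then show ?thesis using that by (simp add: BC)
      qed
      have aC: "a' \<bullet> col C j = 0" if j: "j < n"
      proof -
        have cc: "col C j \<in> carrier_vec N" using C by auto
        have "B *\<^sub>v col C j = unit_vec n j"
        proof (rule eq_vecI)
          fix l assume "l < dim_vec (unit_vec n j)"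
          then have l: "l < n" by simp
          have "(B * C) $$ (l, j) = (B *\<^sub>v col C j) $ l" using l j B C by simp
          then show "(B *\<^sub>v col C j) $ l = unit_vec n j $ l" using l j by (simp add: BC)
        qed (use B in simp)
        moreover have "C *\<^sub>v unit_vec n j = col C j"
          using C j by (intro eq_vecI) auto
        ultimately show ?thesis using a'_prod[OF cc] by simp
      qed
      have aw: "a' \<bullet> w = 1" using a'_prod[OF w(1)] w z by simp
      show "(B' * C') $$ (i, j) = 1\<^sub>m (Suc n) $$ (i, j)"
        unfolding e rowB[OF ij(1)] colC[OF ij(2)] using ij Bw BCij aC aw by (auto simp: less_Suc_eq)
    qed (auto simp: B'_def C'_def)
    moreover have "(\<forall>i<Suc r. row A i \<bullet> v = 0) \<longleftrightarrow> B' *\<^sub>v v = 0\<^sub>v (Suc n)" if v: "v \<in> carrier_vec N" for v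
    proof -
      have idx: "(B' *\<^sub>v v) $ i = (if i < n then (B *\<^sub>v v) $ i else a' \<bullet> v)" if "i < Suc n" for i
      proof -
        have "(B' *\<^sub>v v) $ i = row B' i \<bullet> v" using that by (simp add: B'_def)
        then show ?thesis using rowB[OF that] that B by simp
      qed
      have "B' *\<^sub>v v = 0\<^sub>v (Suc n) \<longleftrightarrow> (\<forall>i<Suc n. (B' *\<^sub>v v) $ i = 0)"
        by (auto simp: B'_def vec_eq_iff simp del: index_mult_mat_vec)
      also have "\<dots> \<longleftrightarrow> (\<forall>i<n. (B *\<^sub>v v) $ i = 0) \<and> a' \<bullet> v = 0"
        using idx by (auto simp: less_Suc_eq simp del: index_mult_mat_vec)
      also have "(\<forall>i<n. (B *\<^sub>v v) $ i = 0) \<longleftrightarrow> B *\<^sub>v v = 0\<^sub>v n"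
        using B by (auto simp: vec_eq_iff simp del: index_mult_mat_vec)
      also have "(B *\<^sub>v v = 0\<^sub>v n \<and> a' \<bullet> v = 0) \<longleftrightarrow> (B *\<^sub>v v = 0\<^sub>v n \<and> a \<bullet> v = 0)"
        using a'_prod[OF v] z by auto
      also have "\<dots> \<longleftrightarrow> (\<forall>i<Suc r. row A i \<bullet> v = 0)"
        using ker[OF v] unfolding a_def by (metis less_Suc_eq)
      finally show ?thesis by simp
    qed
    ultimately show ?thesis
      by (intro exI[of _ "Suc n"] exI[of _ B'] exI[of _ C']) (auto simp: B'_def C'_def)
  qed
qed

text \<open>Padding with zeros to square matrices of size n keeps the product. The right inverse is
  then a left inverse, but the product in the other order has a zero on the diagonal at position
  \<open>N\<close>.\<close>

lemma right_inverse_imp_le: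
  fixes B C :: "complex mat"
  assumes B: "B \<in> carrier_mat n N" and C: "C \<in> carrier_mat N n" and BC: "B * C = 1\<^sub>m n"
  shows "n \<le> N"
proof (rule ccontr)
  assume "\<not> n \<le> N"
  then have nN: "N < n" by simp
  define B' where "B' = mat n n (\<lambda>(i, j). if j < N then B $$ (i, j) else 0)"
  define C' where "C' = mat n n (\<lambda>(i, j). if i < N then C $$ (i, j) else 0)"
  have c: "B' \<in> carrier_mat n n" "C' \<in> carrier_mat n n" by (auto simp: B'_def C'_def)
  have "B' * C' = B * C"
  proof (rule eq_matI)
    fix i j assume "i < dim_row (B * C)" "j < dim_col (B * C)"
    then have ij: "i < n" "j < n" using B C by auto
    have "(B' * C') $$ (i, j) = (\<Sum>k<n. if k < N then B $$ (i, k) * C $$ (k, j) else 0)"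
      using ij by (auto simp: B'_def C'_def scalar_prod_def atLeast0LessThan intro!: sum.cong)
    also have "\<dots> = (\<Sum>k<N. B $$ (i, k) * C $$ (k, j))"
      using nN by (intro sum.mono_neutral_cong_right) auto
    also have "\<dots> = (B * C) $$ (i, j)"
      using ij B C by (auto simp: scalar_prod_def atLeast0LessThan intro!: sum.cong)
    finally show "(B' * C') $$ (i, j) = (B * C) $$ (i, j)" .
  qed (use B C in \<open>auto simp: B'_def C'_def\<close>)
  then have "C' * B' = 1\<^sub>m n" using mat_mult_left_right_inverse[OF c] BC by simp
  moreover have "(C' * B') $$ (N, N) = 0"
    using nN by (simp add: B'_def C'_def scalar_prod_def)
  ultimately show False using nN by simp
qed

text \<open>A basis of the row space of \<open>A\<close> gives \<open>B\<close> with the kernel of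
  \<open>A\<close>, together with a right inverse \<open>C\<close>; the map \<open>f\<close> is then
  dictated by the definition of a pairing.\<close>

lemma cubic_linear_can_be_paired:
  assumes F: "cubic_linear N A F" and s: "\<not> invertible_mat A"
  shows "\<exists>n f. paired n N f A F"
proof -
  have A: "A \<in> carrier_mat N N" and Fc: "\<And>X. X \<in> carrier_vec N \<Longrightarrow> F X = X - cwise_cube (A *\<^sub>v X)"
    using F unfolding cubic_linear_def by auto
  obtain n B C where B: "B \<in> carrier_mat n N" and C: "C \<in> carrier_mat N n" and BC: "B * C = 1\<^sub>m n"
    and ker: "\<And>v. v \<in> carrier_vec N \<Longrightarrow> (\<forall>i<N. row A i \<bullet> v = 0) \<longleftrightarrow> B *\<^sub>v v = 0\<^sub>v n"
    using row_space_splitting[OF A order_refl] by blast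
  have kerA: "A *\<^sub>v v = 0\<^sub>v N \<longleftrightarrow> B *\<^sub>v v = 0\<^sub>v n" if v: "v \<in> carrier_vec N" for v
  proof -
    have "A *\<^sub>v v = 0\<^sub>v N \<longleftrightarrow> (\<forall>i<N. row A i \<bullet> v = 0)" using A by (auto simp: vec_eq_iff)
    then show ?thesis using ker[OF v] by simp
  qed
  \<comment> \<open>For n = N the matrix \<open>B\<close> would be invertible, so the common kernel
    would be trivial, against the singularity of \<open>A\<close>.\<close>
  have "n \<noteq> N"
  proof
    assume n: "n = N"
    obtain v where v: "v \<in> carrier_vec N" "v \<noteq> 0\<^sub>v N" "A *\<^sub>v v = 0\<^sub>v N"
      using singular_imp_kernel_neq_0[OF A s] by blast
    have "C * B = 1\<^sub>m N" using mat_mult_left_right_inverse[of B N C] B C BC n by simp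
    then have "v = C *\<^sub>v (B *\<^sub>v v)" using assoc_mult_mat_vec[OF C B v(1)] v(1) by simp
    also have "\<dots> = C *\<^sub>v 0\<^sub>v n" using kerA[OF v(1)] v(3) by simp
    also have "\<dots> = 0\<^sub>v N" using C by auto
    finally show False using v(2) by simp
  qed
  then have nN: "n < N" using right_inverse_imp_le[OF B C BC] by simp
  define f where "f x = B *\<^sub>v F (C *\<^sub>v x)" for x
  have "cubic_homogeneous n f"
  proof (rule cubic_homogeneous_cube[OF B mult_carrier_mat[OF A C]])
    fix x :: "complex vec" assume x: "x \<in> carrier_vec n"
    have Cx: "C *\<^sub>v x \<in> carrier_vec N" using C x by simp
    have "cwise_cube (A *\<^sub>v (C *\<^sub>v x)) \<in> carrier_vec N"
      by (rule cwise_cube_carrier[OF mult_mat_vec_carrier[OF A Cx]])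
    then have "f x = B *\<^sub>v (C *\<^sub>v x) - B *\<^sub>v cwise_cube (A *\<^sub>v (C *\<^sub>v x))"
      using B Cx by (simp add: f_def Fc mult_minus_distrib_mat_vec[of B n N])
    also have "B *\<^sub>v (C *\<^sub>v x) = x" using assoc_mult_mat_vec[OF B C x] x by (simp add: BC)
    also have "A *\<^sub>v (C *\<^sub>v x) = (A * C) *\<^sub>v x" using assoc_mult_mat_vec[OF A C x] by simp
    finally show "f x = x - B *\<^sub>v cwise_cube ((A * C) *\<^sub>v x)" .
  qed
  moreover have "mat_kernel A = mat_kernel B"
    using kerA A B unfolding mat_kernel_def by auto
  ultimately have "paired_through n N f A F B C"
    unfolding paired_through_def using F nN B C BC by (simp add: f_def)
  then show ?thesis unfolding paired_def by blast
qed

text \<open>The linear forms \<open>l r\<close> are shared by all components and only the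
  coefficients \<open>b r i\<close> depend on \<open>i\<close>, because the forms become rows of a
  single matrix. The condition \<open>M > 0\<close> makes the dimension M + n of the pairing larger
  than n.\<close>

definition cube_sum :: "nat \<Rightarrow> (complex vec \<Rightarrow> nat \<Rightarrow> complex) \<Rightarrow> bool" where
  "cube_sum n \<phi> \<longleftrightarrow> (\<exists>(M::nat) b l. M > 0 \<and> (\<forall>x\<in>carrier_vec n. \<forall>i<n.
     \<phi> x i = (\<Sum>r<M. b r i * (\<Sum>j<n. l r j * x $ j) ^ 3)))"

lemma cube_sumI: "cube_sum n (\<lambda>x i. b i * (\<Sum>j<n. l j * x $ j) ^ 3)"
  unfolding cube_sum_def
  by (rule exI[of _ 1], rule exI[of _ "\<lambda>_. b"], rule exI[of _ "\<lambda>_. l"]) simp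

lemma sum_lessThan_add: "(\<Sum>r<M + K. h r) = (\<Sum>r<M. h r) + (\<Sum>r<K. h (M + r))" for h :: "nat \<Rightarrow> complex"
  by (induction K) (simp_all add: add.assoc)

lemma cube_sum_add:
  assumes "cube_sum n \<phi>" "cube_sum n \<psi>" shows "cube_sum n (\<lambda>x i. \<phi> x i + \<psi> x i)"
proof -
  obtain M :: nat and b l where M: "M > 0 \<and> (\<forall>x\<in>carrier_vec n. \<forall>i<n. \<phi> x i = (\<Sum>r<M. b r i * (\<Sum>j<n. l r j * x $ j) ^ 3))"
    using assms(1) unfolding cube_sum_def by (elim exE)
  obtain K :: nat and c k where K: "K > 0 \<and> (\<forall>x\<in>carrier_vec n. \<forall>i<n. \<psi> x i = (\<Sum>r<K. c r i * (\<Sum>j<n. k r j * x $ j) ^ 3))"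
    using assms(2) unfolding cube_sum_def by (elim exE)
  show ?thesis
    unfolding cube_sum_def
    by (rule exI[of _ "M + K"], rule exI[of _ "\<lambda>r. if r < M then b r else c (r - M)"],
        rule exI[of _ "\<lambda>r. if r < M then l r else k (r - M)"])
       (use M K in \<open>simp add: sum_lessThan_add\<close>)
qed

lemma cube_sum_sum:
  assumes "\<And>s. s \<in> S \<Longrightarrow> cube_sum n (\<phi> s)" shows "cube_sum n (\<lambda>x i. \<Sum>s\<in>S. \<phi> s x i)"
  using assms
proof (induction S rule: infinite_finite_induct)
  case (insert s S)
  then show ?case by (simp add: cube_sum_add)
qed (use cube_sumI[of n "\<lambda>_. 0" "\<lambda>_. 0"] in simp_all)

text \<open>Polarization:
  \<open>24 x y z = (x + y + z)\<^sup>3 + (x - y - z)\<^sup>3 + (-x + y - z)\<^sup>3 + (-x - y + z)\<^sup>3\<close>.\<close>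

lemma cube_sum_monomial:
  assumes "a < n" "b < n" "c < n"
  shows "cube_sum n (\<lambda>x i. t i * (x $ a * x $ b * x $ c))"
proof -
  define l where "l p q r j = p * (if j = a then 1 else 0) + q * (if j = b then 1 else 0) + r * (if j = c then 1 else (0::complex))"
    for p q r j
  have l: "(\<Sum>j<n. l p q r j * x $ j) = p * x $ a + q * x $ b + r * x $ c" for p q r and x :: "complex vec"
  proof -
    have "(\<Sum>j<n. l p q r j * x $ j) =
      (\<Sum>j<n. if j = a then p * x $ a else 0) + (\<Sum>j<n. if j = b then q * x $ b else 0) + (\<Sum>j<n. if j = c then r * x $ c else 0)"
      unfolding sum.distrib[symmetric] by (intro sum.cong) (auto simp: l_def algebra_simps)
    then show ?thesis using assms by simp
  qed
  have "cube_sum n (\<lambda>x i. t i / 24 * (\<Sum>j<n. l 1 1 1 j * x $ j) ^ 3 + t i / 24 * (\<Sum>j<n. l 1 (-1) (-1) j * x $ j) ^ 3 +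
    t i / 24 * (\<Sum>j<n. l (-1) 1 (-1) j * x $ j) ^ 3 + t i / 24 * (\<Sum>j<n. l (-1) (-1) 1 j * x $ j) ^ 3)"
    by (intro cube_sum_add cube_sumI)
  moreover have "t i / 24 * (1 * u + 1 * v + 1 * w) ^ 3 + t i / 24 * (1 * u + (-1) * v + (-1) * w) ^ 3 +
    t i / 24 * ((-1) * u + 1 * v + (-1) * w) ^ 3 + t i / 24 * ((-1) * u + (-1) * v + 1 * w) ^ 3 = t i * (u * v * w)"
    for i and u v w :: complex
    by (simp add: power3_eq_cube field_simps)
  ultimately show ?thesis unfolding l by simp
qed

text \<open>With \<open>B = (b | I)\<close>, the matrix \<open>D\<close> of linear forms extended by the coordinate forms is
  injective, so that \<open>A = DB\<close> has the kernel of \<open>B\<close>. The coordinate forms contribute the cubes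
  \<open>x\<^sub>i\<^sup>3\<close>, which are subtracted beforehand.\<close>

lemma cubic_homogeneous_can_be_paired:
  assumes f: "cubic_homogeneous n f"
  shows "\<exists>N A F. paired n N f A F"
proof -
  obtain g where g: "symmetric_trilinear n g" and fg: "\<And>x. x \<in> carrier_vec n \<Longrightarrow> f x = x - g x x x"
    using f unfolding cubic_homogeneous_def by blast
  have gc: "g x x x \<in> carrier_vec n" if "x \<in> carrier_vec n" for x
    using g that unfolding symmetric_trilinear_def by blast
  have cs: "cube_sum n (\<lambda>x i. (\<Sum>a<n. \<Sum>b<n. \<Sum>c<n. g (unit_vec n a) (unit_vec n b) (unit_vec n c) $ i * (x $ a * x $ b * x $ c)) +
    (\<Sum>a<n. (if i = a then -1 else 0) * (x $ a * x $ a * x $ a)))"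
    by (intro cube_sum_add cube_sum_sum cube_sum_monomial) auto
  obtain M :: nat and b l where M: "M > 0 \<and> (\<forall>x\<in>carrier_vec n. \<forall>i<n.
    (\<Sum>a<n. \<Sum>b<n. \<Sum>c<n. g (unit_vec n a) (unit_vec n b) (unit_vec n c) $ i * (x $ a * x $ b * x $ c)) +
    (\<Sum>a<n. (if i = a then -1 else 0) * (x $ a * x $ a * x $ a)) = (\<Sum>r<M. b r i * (\<Sum>j<n. l r j * x $ j) ^ 3))"
    using cs unfolding cube_sum_def by (elim exE)
  have gl: "g x x x $ i = (\<Sum>r<M. b r i * (\<Sum>j<n. l r j * x $ j) ^ 3) + (x $ i) ^ 3"
    if x: "x \<in> carrier_vec n" and i: "i < n" for x i
  proof -
    have "(\<Sum>a<n. (if i = a then -1 else 0) * (x $ a * x $ a * x $ a)) = (\<Sum>a<n. if a = i then - ((x $ i) ^ 3) else 0)"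
      by (intro sum.cong) (auto simp: power3_eq_cube)
    also have "\<dots> = - ((x $ i) ^ 3)" using i by simp
    finally have cubes: "(\<Sum>a<n. (if i = a then -1 else 0) * (x $ a * x $ a * x $ a)) = - ((x $ i) ^ 3)" .
    have "(\<Sum>a<n. \<Sum>b<n. \<Sum>c<n. g (unit_vec n a) (unit_vec n b) (unit_vec n c) $ i * (x $ a * x $ b * x $ c)) +
      (\<Sum>a<n. (if i = a then -1 else 0) * (x $ a * x $ a * x $ a)) = (\<Sum>r<M. b r i * (\<Sum>j<n. l r j * x $ j) ^ 3)"
      using M x i by blast
    then have "g x x x $ i - (x $ i) ^ 3 = (\<Sum>r<M. b r i * (\<Sum>j<n. l r j * x $ j) ^ 3)"
      unfolding cubes symmetric_trilinear_expansion[OF g i x] by simp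
    then show ?thesis unfolding diff_eq_eq .
  qed
  define N where "N = M + n"
  define B where "B = mat n N (\<lambda>(i, r). if r < M then b r i else if r - M = i then 1 else 0)"
  \<comment> \<open>\<open>C\<close> places a vector into the last \<open>n\<close> coordinates,
    where \<open>B\<close> is the identity block; hence BC = 1 and AC = D.\<close>
  define C where "C = mat N n (\<lambda>(r, j). if r < M then 0 else if r - M = j then 1 else (0::complex))"
  define D where "D = mat N n (\<lambda>(r, j). if r < M then l r j else if r - M = j then 1 else 0)"
  define A where "A = D * B"
  have c: "B \<in> carrier_mat n N" "C \<in> carrier_mat N n" "D \<in> carrier_mat N n" "A \<in> carrier_mat N N"
    by (auto simp: B_def C_def D_def A_def)
  define F where "F X = X - cwise_cube (A *\<^sub>v X)" for X
  have F: "cubic_linear N A F" using c by (simp add: cubic_linear_def F_def)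
  have BC: "B * C = 1\<^sub>m n"
  proof (rule eq_matI)
    fix i j assume "i < dim_row (1\<^sub>m n)" "j < dim_col (1\<^sub>m n)"
    then have ij: "i < n" "j < n" by auto
    have "(B * C) $$ (i, j) = (\<Sum>r<M + n. B $$ (i, r) * C $$ (r, j))"
      using ij c by (auto simp: scalar_prod_def atLeast0LessThan N_def intro!: sum.cong)
    also have "\<dots> = (\<Sum>r<n. if r = i then if i = j then 1 else 0 else 0)"
      unfolding sum_lessThan_add using ij
      by (auto simp: B_def C_def N_def if_distrib[where f = "\<lambda>z. z * _"] cong: if_cong)
    finally show "(B * C) $$ (i, j) = 1\<^sub>m n $$ (i, j)" using ij by simp
  qed (use c in auto)
  have D_low: "(D *\<^sub>v x) $ r = (\<Sum>j<n. l r j * x $ j)" if "x \<in> carrier_vec n" "r < M" for x r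
    using that by (auto simp: D_def N_def scalar_prod_def atLeast0LessThan intro!: sum.cong)
  have D_high: "(D *\<^sub>v x) $ (M + i) = x $ i" if "x \<in> carrier_vec n" "i < n" for x i
  proof -
    have "(D *\<^sub>v x) $ (M + i) = (\<Sum>j<n. (if i = j then 1 else 0) * x $ j)"
      using that by (simp add: D_def N_def scalar_prod_def atLeast0LessThan)
    also have "\<dots> = (\<Sum>j<n. if j = i then x $ i else 0)" by (intro sum.cong) auto
    finally show ?thesis using that by simp
  qed
  have ker: "A *\<^sub>v v = 0\<^sub>v N \<longleftrightarrow> B *\<^sub>v v = 0\<^sub>v n" if v: "v \<in> carrier_vec N" for v
  proof -
    have Bv: "B *\<^sub>v v \<in> carrier_vec n" using c v by simp
    have Av: "A *\<^sub>v v = D *\<^sub>v (B *\<^sub>v v)" unfolding A_def by (rule assoc_mult_mat_vec[OF c(3,1) v])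
    show ?thesis
    proof
      assume "A *\<^sub>v v = 0\<^sub>v N"
      then have "(D *\<^sub>v (B *\<^sub>v v)) $ (M + i) = 0" if "i < n" for i using that Av by (simp add: N_def)
      then have "(B *\<^sub>v v) $ i = 0" if "i < n" for i using D_high[OF Bv that] that by metis
      then show "B *\<^sub>v v = 0\<^sub>v n" using c by (intro eq_vecI) (auto simp del: index_mult_mat_vec)
    next
      assume "B *\<^sub>v v = 0\<^sub>v n"
      then show "A *\<^sub>v v = 0\<^sub>v N" using Av c(3) by auto
    qed
  qed
  have "f x = B *\<^sub>v F (C *\<^sub>v x)" if x: "x \<in> carrier_vec n" for x
  proof -
    have Cx: "C *\<^sub>v x \<in> carrier_vec N" using c x by simp
    have BCx: "B *\<^sub>v (C *\<^sub>v x) = x" using assoc_mult_mat_vec[OF c(1,2) x] x by (simp add: BC)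
    have ACx: "A *\<^sub>v (C *\<^sub>v x) = D *\<^sub>v x"
      using assoc_mult_mat_vec[OF c(3,1) Cx] by (simp add: A_def BCx)
    have Dx: "cwise_cube (D *\<^sub>v x) \<in> carrier_vec N" using c x by (intro cwise_cube_carrier) simp
    have "B *\<^sub>v cwise_cube (D *\<^sub>v x) = g x x x"
    proof (rule eq_vecI)
      fix i assume "i < dim_vec (g x x x)"
      then have i: "i < n" using gc[OF x] by simp
      have "(B *\<^sub>v cwise_cube (D *\<^sub>v x)) $ i = (\<Sum>r<M + n. B $$ (i, r) * ((D *\<^sub>v x) $ r) ^ 3)"
        using i c by (auto simp: scalar_prod_def atLeast0LessThan N_def intro!: sum.cong simp del: index_mult_mat_vec)
          (simp add: scalar_prod_def atLeast0LessThan N_def)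
      also have "\<dots> = (\<Sum>r<M. b r i * (\<Sum>j<n. l r j * x $ j) ^ 3) + (\<Sum>r<n. if r = i then (x $ i) ^ 3 else 0)"
        unfolding sum_lessThan_add
        using i D_low[OF x] D_high[OF x] by (intro arg_cong2[of _ _ _ _ "(+)"] sum.cong refl) (auto simp: B_def N_def simp del: index_mult_mat_vec)
      finally show "(B *\<^sub>v cwise_cube (D *\<^sub>v x)) $ i = g x x x $ i" using i by (simp add: gl[OF x i])
    qed (use gc[OF x] c in auto)
    then show ?thesis
      using c Cx Dx BCx by (simp add: F_def ACx fg[OF x] mult_minus_distrib_mat_vec[of B n N])
  qed
  moreover have "mat_kernel A = mat_kernel B" using ker c unfolding mat_kernel_def by auto
  ultimately have "paired_through n N f A F B C"
    unfolding paired_through_def using f F M c BC by (simp add: N_def)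
  then show ?thesis unfolding paired_def by blast
qed

section \<open>Transfer of the properties\<close>

context pairing
begin

text \<open>Each property passes from \<open>k\<close> to its extension, and from \<open>K\<close>
  to its restriction, over which \<open>K\<close> is triangular by uniqueness.\<close>

lemma transfer:
  assumes \<mu>: "\<mu> \<noteq> 0" "cmod \<mu> \<noteq> 1"
  shows "(\<exists>k. global_pre_conjugation n \<mu> f k) \<longleftrightarrow> (\<exists>K. global_pre_conjugation N \<mu> F K)"
    and "(\<exists>k. global_pre_conjugation n \<mu> f k \<and> onto n k) \<longleftrightarrow> (\<exists>K. global_pre_conjugation N \<mu> F K \<and> onto N K)"
    and "(\<exists>k. global_pre_conjugation n \<mu> f k \<and> one_to_one n k) \<longleftrightarrow> (\<exists>K. global_pre_conjugation N \<mu> F K \<and> one_to_one N K)"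
    and "(\<exists>k. global_pre_conjugation n \<mu> f k \<and> polynomial_map n k) \<longleftrightarrow> (\<exists>K. global_pre_conjugation N \<mu> F K \<and> polynomial_map N K)"
    and "(\<exists>k. conjugation n \<mu> f k \<and> has_polynomial_inverse n k) \<longleftrightarrow> (\<exists>K. conjugation N \<mu> F K \<and> has_polynomial_inverse N K)"
proof -
  note down = global_pre_conjugation_restrict global_pre_conjugation_triangular[OF \<mu>]
  note up = global_pre_conjugation_extend[OF \<mu>]
  show "(\<exists>k. global_pre_conjugation n \<mu> f k) \<longleftrightarrow> (\<exists>K. global_pre_conjugation N \<mu> F K)"
    using up down(1) by blast
  show "(\<exists>k. global_pre_conjugation n \<mu> f k \<and> onto n k) \<longleftrightarrow> (\<exists>K. global_pre_conjugation N \<mu> F K \<and> onto N K)"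
    using up down triangular_extension.onto_iff by meson
  show "(\<exists>k. global_pre_conjugation n \<mu> f k \<and> one_to_one n k) \<longleftrightarrow> (\<exists>K. global_pre_conjugation N \<mu> F K \<and> one_to_one N K)"
    using up down triangular_extension.one_to_one_iff by meson
  show "(\<exists>k. global_pre_conjugation n \<mu> f k \<and> polynomial_map n k) \<longleftrightarrow> (\<exists>K. global_pre_conjugation N \<mu> F K \<and> polynomial_map N K)"
    using up down triangular_extension.polynomial_map_K triangular_extension.polynomial_map_of_polynomial_map_K by meson
  have conj: "conjugation m \<mu> h k \<and> has_polynomial_inverse m k \<longleftrightarrow> global_pre_conjugation m \<mu> h k \<and> has_polynomial_inverse m k"
    for m h k unfolding conjugation_def has_polynomial_inverse_def by blast
  \<comment> \<open>Polynomiality of \<open>k\<close> makes the shift of the extension polynomial,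
    as \<open>has_polynomial_inverse_K\<close> requires.\<close>
  have poly: "polynomial_map n k" if "global_pre_conjugation n \<mu> f k" "has_polynomial_inverse n k" for k
    using has_polynomial_inverse_imp_polynomial_map[OF that(2)] that(1) unfolding global_pre_conjugation_iff by blast
  show "(\<exists>k. conjugation n \<mu> f k \<and> has_polynomial_inverse n k) \<longleftrightarrow> (\<exists>K. conjugation N \<mu> F K \<and> has_polynomial_inverse N K)"
    unfolding conj
    using up down poly triangular_extension.has_polynomial_inverse_K triangular_extension.has_polynomial_inverse_of_K by meson
qed

lemma global_pre_conjugation_exists:
  assumes "cmod \<mu> > 1"
  shows "\<exists>k. global_pre_conjugation n \<mu> f k" "\<exists>K. global_pre_conjugation N \<mu> F K"
  using global_pre_conjugation_expanding cubic_homogeneous_polynomial_map f_cubic F_cubic assms by blast+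

lemma global_pre_conjugation_exists_invertible:
  assumes "\<mu> \<noteq> 0" "cmod \<mu> \<noteq> 1" "invertible_map n f" "invertible_map N F"
  shows "\<exists>k. global_pre_conjugation n \<mu> f k" "\<exists>K. global_pre_conjugation N \<mu> F K"
  using global_pre_conjugation_bijective cubic_homogeneous_polynomial_map f_cubic F_cubic assms
  unfolding invertible_map_def by blast+

lemma has_polynomial_inverse_iff: "has_polynomial_inverse n f \<longleftrightarrow> has_polynomial_inverse N F"
  using triangular_extension.has_polynomial_inverse_K[OF triangular_F _ \<psi>_polyfun]
    triangular_extension.has_polynomial_inverse_of_K[OF triangular_F] by blast

end

theorem theorem1p3:
  shows
    "(\<forall>n f. cubic_homogeneous n f \<longrightarrow> (\<exists>N A F. paired n N f A F)) \<and>
     (\<forall>N A F. cubic_linear N A F \<and> \<not> invertible_mat A \<longrightarrow> (\<exists>n f. paired n N f A F)) \<and>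
     (\<forall>n N f A F. paired n N f A F \<longrightarrow>
        (one_to_one n f \<longleftrightarrow> one_to_one N F) \<and>
        (onto n f \<longleftrightarrow> onto N F) \<and>
        (has_polynomial_inverse n f \<longleftrightarrow> has_polynomial_inverse N F) \<and>
        (constant_jacobian_det n f \<longleftrightarrow> constant_jacobian_det N F) \<and>
        (\<forall>\<mu>::complex. \<mu> \<noteq> 0 \<and> cmod \<mu> \<noteq> 1 \<longrightarrow>
           ((\<exists>k. global_pre_conjugation n \<mu> f k) \<longleftrightarrow>
            (\<exists>K. global_pre_conjugation N \<mu> F K)) \<and>
           ((\<exists>k. global_pre_conjugation n \<mu> f k \<and> onto n k) \<longleftrightarrow>
            (\<exists>K. global_pre_conjugation N \<mu> F K \<and> onto N K)) \<and>
           ((\<exists>k. global_pre_conjugation n \<mu> f k \<and> one_to_one n k) \<longleftrightarrow>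
            (\<exists>K. global_pre_conjugation N \<mu> F K \<and> one_to_one N K)) \<and>
           ((\<exists>k. global_pre_conjugation n \<mu> f k \<and> polynomial_map n k) \<longleftrightarrow>
            (\<exists>K. global_pre_conjugation N \<mu> F K \<and> polynomial_map N K)) \<and>
           ((\<exists>k. conjugation n \<mu> f k \<and> has_polynomial_inverse n k) \<longleftrightarrow>
            (\<exists>K. conjugation N \<mu> F K \<and> has_polynomial_inverse N K)) \<and>
           (cmod \<mu> > 1 \<longrightarrow>
              (\<exists>k. global_pre_conjugation n \<mu> f k) \<and>
              (\<exists>K. global_pre_conjugation N \<mu> F K)) \<and>
           (invertible_map n f \<and> invertible_map N F \<longrightarrow>
              (\<exists>k. global_pre_conjugation n \<mu> f k) \<and>
              (\<exists>K. global_pre_conjugation N \<mu> F K))))"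
proof (rule conjI[OF _ conjI], goal_cases)
  case 1
  show ?case using cubic_homogeneous_can_be_paired by blast
next
  case 2
  show ?case using cubic_linear_can_be_paired by blast
next
  case 3
  show ?case
  proof (intro allI impI, goal_cases)
    case (1 n N f A F)
    then obtain B C where "paired_through n N f A F B C" unfolding paired_def by blast
    then interpret pairing n N f F A B C by unfold_locales
    show ?case
      by (intro conjI allI impI; (elim conjE)?;
          (rule triangular_extension.one_to_one_iff[OF triangular_F] triangular_extension.onto_iff[OF triangular_F]
            has_polynomial_inverse_iff constant_jacobian_det_iff transfer
            global_pre_conjugation_exists global_pre_conjugation_exists_invertible; assumption))
  qed
qed

end
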